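(* Let $\nu>0$, let $A_\nu^\pm:=r^{-1}(h_\nu-(1\pm i0))^{-1}r^{-1}$ be the boundary values at energy $1$ of the weighted resolvent of the Bessel operator $h_\nu$ in $L^2:=L^2((0,\infty))$, and let $e_{\nu,0}(r):=(2\nu)^{1/2}r^{-1/2}J_\nu(r)$, where $J_\nu$ is the Bessel function of the first kind. Then $$\|A_\nu^\pm\|_{L^2\to L^2}^2\ge\|A_\nu^\pm e_{\nu,0}\|_{L^2}^2=\frac{\pi^2}{12\nu^2}+\frac{1}{8\nu^4}.$$
   Context: For $\nu>0$, $h_\nu$ is the Friedrichs extension in $L^2=L^2((0,\infty))$ of the operator $-\frac{d^2}{dr^2}+\frac{\nu^2-1/4}{r^2}$ initially defined on $C_0^\infty((0,\infty))$. $A_\nu^\pm$ is the bounded operator on $L^2$ which is the (weak) limit as $\varepsilon\to0^+$ of (the bounded extension of) $r^{-1}(h_\nu-(1\pm i\varepsilon))^{-1}r^{-1}$, where $r^{-1}$ is multiplication by $1/r$; explicitly, $A_\nu^+$ is the integral operator with kernel $\frac{i\pi}{2}(rR)^{-1/2}J_\nu(\min(r,R))\,H^{(1)}_\nu(\max(r,R))$ and $A_\nu^-$ is the integral operator with the complex conjugate kernel, where $H^{(1)}_\nu=J_\nu+iY_\nu$ and $Y_\nu$ is the Bessel function of the second kind. The function $e_{\nu,0}$ has norm $1$ in $L^2$. *)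

theory Defs
  imports "HOL-Analysis.Analysis"
begin

text \<open>The space \<open>L\<^sup>2((0,\<infinity>))\<close>, handled through representatives: an element is a square-integrable
  function, and two functions represent the same element iff they agree almost everywhere. Values
  of representatives outside \<open>(0,\<infinity>)\<close> are irrelevant.\<close>

abbreviation half_line :: "real measure" where
  "half_line \<equiv> lebesgue_on {0<..}"

definition L2 :: "(real \<Rightarrow> complex) set" where
  "L2 = {f. f \<in> borel_measurable half_line \<and> integrable half_line (\<lambda>r. (norm (f r))\<^sup>2)}"

definition L2_inner :: "(real \<Rightarrow> complex) \<Rightarrow> (real \<Rightarrow> complex) \<Rightarrow> complex" where
  "L2_inner f g = (LINT r|half_line. f r * cnj (g r))"

definition L2_norm :: "(real \<Rightarrow> complex) \<Rightarrow> real" where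
  "L2_norm f = sqrt (LINT r|half_line. (norm (f r))\<^sup>2)"

text \<open>Bounded linear operators on \<open>L\<^sup>2\<close>. Linearity and boundedness together imply that the operator
  respects almost-everywhere equality.\<close>

definition bounded_L2_operator :: "((real \<Rightarrow> complex) \<Rightarrow> (real \<Rightarrow> complex)) \<Rightarrow> bool" where
  "bounded_L2_operator T \<longleftrightarrow>
     (\<forall>f\<in>L2. T f \<in> L2) \<and>
     (\<forall>f\<in>L2. \<forall>g\<in>L2. AE r in half_line. T (\<lambda>s. f s + g s) r = T f r + T g r) \<and>
     (\<forall>c. \<forall>f\<in>L2. AE r in half_line. T (\<lambda>s. c * f s) r = c * T f r) \<and>
     (\<exists>C. \<forall>f\<in>L2. L2_norm (T f) \<le> C * L2_norm f)"

definition L2_operator_norm :: "((real \<Rightarrow> complex) \<Rightarrow> (real \<Rightarrow> complex)) \<Rightarrow> real" where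
  "L2_operator_norm T = (SUP f\<in>{f \<in> L2. L2_norm f \<le> 1}. L2_norm (T f))"

definition deriv_c :: "(real \<Rightarrow> complex) \<Rightarrow> real \<Rightarrow> complex" where
  "deriv_c f x = vector_derivative f (at x)"

text \<open>\<open>C\<^sub>0\<^sup>\<infinity>((0,\<infinity>))\<close>, each function being extended by zero to the whole line.\<close>

definition test_functions :: "(real \<Rightarrow> complex) set" where
  "test_functions =
     {\<phi>. (\<forall>n x. ((deriv_c ^^ n) \<phi>) differentiable (at x)) \<and>
         (\<exists>a b. 0 < a \<and> a \<le> b \<and> (\<forall>x. x \<notin> {a..b} \<longrightarrow> \<phi> x = 0))}"

definition bessel_expr :: "real \<Rightarrow> (real \<Rightarrow> complex) \<Rightarrow> real \<Rightarrow> complex" where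
  "bessel_expr \<nu> \<phi> r = - deriv_c (deriv_c \<phi>) r + of_real ((\<nu>\<^sup>2 - 1/4) / r\<^sup>2) * \<phi> r"

text \<open>Unbounded operators are given by their graphs, as sets of pairs \<open>(u, T u)\<close> of representatives.

  For a nonnegative symmetric operator \<open>T\<close> with dense domain \<open>D\<close>, the form domain is the domain of
  the closure of the quadratic form \<open>\<langle>T v, v\<rangle>\<close>: the limits in \<open>L\<^sup>2\<close> of sequences in \<open>D\<close> that are
  Cauchy for the form. The Friedrichs extension is the restriction of the adjoint of \<open>T\<close> to the form
  domain; since the closed form takes the value \<open>\<langle>u, T v\<rangle>\<close> at \<open>(u, v)\<close> for \<open>v\<close> in \<open>D\<close>, it is also
  the operator associated with the closed form.\<close>

definition form_domain ::
  "(real \<Rightarrow> complex) set \<Rightarrow> ((real \<Rightarrow> complex) \<Rightarrow> real \<Rightarrow> complex) \<Rightarrow> (real \<Rightarrow> complex) set" where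
  "form_domain D T =
     {u \<in> L2. \<exists>\<phi> :: nat \<Rightarrow> real \<Rightarrow> complex.
        (\<forall>n. \<phi> n \<in> D) \<and>
        (\<lambda>n. L2_norm (\<lambda>r. \<phi> n r - u r)) \<longlonglongrightarrow> 0 \<and>
        (\<forall>e>0. \<exists>N. \<forall>m\<ge>N. \<forall>n\<ge>N.
           Re (L2_inner (T (\<lambda>r. \<phi> m r - \<phi> n r)) (\<lambda>r. \<phi> m r - \<phi> n r)) < e)}"

definition friedrichs_extension ::
  "(real \<Rightarrow> complex) set \<Rightarrow> ((real \<Rightarrow> complex) \<Rightarrow> real \<Rightarrow> complex)
     \<Rightarrow> ((real \<Rightarrow> complex) \<times> (real \<Rightarrow> complex)) set" where
  "friedrichs_extension D T =
     {(u, f). u \<in> form_domain D T \<and> f \<in> L2 \<and> (\<forall>v\<in>D. L2_inner u (T v) = L2_inner f v)}"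

definition bessel_operator :: "real \<Rightarrow> ((real \<Rightarrow> complex) \<times> (real \<Rightarrow> complex)) set" where
  "bessel_operator \<nu> = friedrichs_extension test_functions (bessel_expr \<nu>)"

text \<open>The graph of \<open>(H - z)\<^sup>-\<^sup>1\<close>: pairs \<open>(g, u)\<close> with \<open>(H - z) u = g\<close>.\<close>

definition resolvent_graph ::
  "((real \<Rightarrow> complex) \<times> (real \<Rightarrow> complex)) set \<Rightarrow> complex
     \<Rightarrow> ((real \<Rightarrow> complex) \<times> (real \<Rightarrow> complex)) set" where
  "resolvent_graph H z =
     {(g, u). g \<in> L2 \<and> (\<exists>f. (u, f) \<in> H \<and> (AE r in half_line. f r - z * u r = g r))}"

definition inv_r :: "(real \<Rightarrow> complex) \<Rightarrow> real \<Rightarrow> complex" where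
  "inv_r f r = f r / of_real r"

text \<open>\<open>B\<close> is the bounded extension to \<open>L\<^sup>2\<close> of \<open>r\<^sup>-\<^sup>1 (h\<^sub>\<nu> - z)\<^sup>-\<^sup>1 r\<^sup>-\<^sup>1\<close>, the latter being defined on
  the dense set of those \<open>g\<close> for which \<open>r\<^sup>-\<^sup>1 g\<close> lies in \<open>L\<^sup>2\<close>.\<close>

definition is_weighted_resolvent ::
  "real \<Rightarrow> complex \<Rightarrow> ((real \<Rightarrow> complex) \<Rightarrow> (real \<Rightarrow> complex)) \<Rightarrow> bool" where
  "is_weighted_resolvent \<nu> z B \<longleftrightarrow>
     bounded_L2_operator B \<and>
     (\<forall>g\<in>L2. inv_r g \<in> L2 \<longrightarrow>
        (\<exists>u. (inv_r g, u) \<in> resolvent_graph (bessel_operator \<nu>) z \<and>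
             (AE r in half_line. B g r = inv_r u r)))"

text \<open>\<open>A = r\<^sup>-\<^sup>1 (h\<^sub>\<nu> - (1 \<plusminus> i0))\<^sup>-\<^sup>1 r\<^sup>-\<^sup>1\<close>, as a weak operator limit; the sign is that of \<open>\<sigma> = \<plusminus>1\<close>.\<close>

definition is_boundary_value ::
  "real \<Rightarrow> real \<Rightarrow> ((real \<Rightarrow> complex) \<Rightarrow> (real \<Rightarrow> complex)) \<Rightarrow> bool" where
  "is_boundary_value \<nu> \<sigma> A \<longleftrightarrow>
     bounded_L2_operator A \<and>
     (\<exists>B. (\<forall>\<epsilon>>0. is_weighted_resolvent \<nu> (Complex 1 (\<sigma> * \<epsilon>)) (B \<epsilon>)) \<and>
          (\<forall>f\<in>L2. \<forall>g\<in>L2.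
             ((\<lambda>\<epsilon>. L2_inner (B \<epsilon> f) g) \<longlongrightarrow> L2_inner (A f) g) (at_right 0)))"

text \<open>The Bessel function of the first kind, for \<open>x > 0\<close>.\<close>

definition bessel_J :: "real \<Rightarrow> real \<Rightarrow> real" where
  "bessel_J \<nu> x =
     (\<Sum>k. (-1) ^ k / (fact k * Gamma (\<nu> + real k + 1)) * (x / 2) powr (2 * real k + \<nu>))"

definition e0 :: "real \<Rightarrow> real \<Rightarrow> complex" where
  "e0 \<nu> r = of_real ((2 * \<nu>) powr (1/2) * r powr (-1/2) * bessel_J \<nu> r)"

end

theory Submission
  imports Defs "HOL-Real_Asymp.Real_Asymp"
begin

text \<open>
  Put \<open>\<phi>\<^sub>\<mu>(r) = r\<^sup>1\<^sup>/\<^sup>2 J\<^sub>\<mu>(r)\<close>. For \<open>\<mu> \<noteq> \<nu>\<close> the function \<open>\<phi>\<^sub>\<mu> / (\<nu>\<^sup>2 - \<mu>\<^sup>2)\<close> solves \<open>-u'' + (\<nu>\<^sup>2 - 1/4) r\<^sup>-\<^sup>2 u - u = r\<^sup>-\<^sup>2 \<phi>\<^sub>\<mu>\<close>,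
  and it becomes outgoing (or incoming) after subtracting the right multiple of \<open>\<phi>\<^sub>\<nu>\<close>; this identifies \<open>A (\<phi>\<^sub>\<mu> / r)\<close>.
  Its norm is a combination of the integrals \<open>\<integral> \<phi>\<^sub>\<mu> \<phi>\<^sub>\<nu> r\<^sup>-\<^sup>2 dr\<close>, which are Wronskians at infinity, and
  the claim follows by letting \<open>\<mu> \<rightarrow> \<nu>\<close>, so that no derivative with respect to the order is needed.

  The boundary condition of the Friedrichs extension at \<open>0\<close> enters only through \<open>B g = r\<^sup>-\<^sup>1 u\<close> being
  square-integrable, which excludes the singular solution. The radiation condition is obtained by
  testing the resolvent equation with \<open>v exp(i \<sigma> \<kappa> r)\<close>, where \<open>v\<close> is the outgoing solution for a
  compactly supported right-hand side and \<open>(1 + \<kappa>)\<^sup>2 = 1 + i \<sigma> \<epsilon>\<close>, and letting \<open>\<epsilon> \<rightarrow> 0\<close>; the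
  family \<open>B\<^sub>\<epsilon> g\<close> stays bounded by the uniform boundedness principle. The asymptotics of \<open>J\<^sub>\<mu>\<close> come from the
  Wronskian with the Hankel function, which is given by a Laplace integral.
\<close>

section \<open>The space of square-integrable functions on the half-line\<close>

text \<open>The hypothesis on \<open>A\<close> is abstract: bounded operators agree with the
  weighted resolvent and converge weakly, and about \<open>B g\<close> nothing is given beyond
  square-integrability and a weak equation. All regularity therefore sits in the test functions,
  which are explicit solutions, and \<open>A g\<close> is identified by duality rather than through
  a kernel.

  For \<mu> = \<nu> + d the squared norm is a quotient whose numerator and denominator both vanish
  to second order in d, and the two terms of the result have different origins. The term pi^2 / (12
  \<nu>^2) comes from the phase difference of the two waves at infinity, through 1 - sin (pi d) /
  (pi d), which is pi^2 d^2 / 6 to leading order. The term 1 / (8 \<nu>^4) comes from the excess of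
  1 / (2 \<mu>) + 1 / (2 \<nu>), the two diagonal overlaps, over 2 / (\<mu> + \<nu>).\<close>

lemma L2I:
  assumes "f \<in> borel_measurable half_line" "integrable half_line (\<lambda>r. (norm (f r))\<^sup>2)"
  shows "f \<in> L2"
  using assms by (simp add: L2_def)

lemma L2_measurable [measurable_dest]: "f \<in> L2 \<Longrightarrow> f \<in> borel_measurable half_line"
  by (simp add: L2_def)

lemma L2_integrable: "f \<in> L2 \<Longrightarrow> integrable half_line (\<lambda>r. (norm (f r))\<^sup>2)"
  by (simp add: L2_def)

lemma L2_bound:
  fixes f :: "real \<Rightarrow> complex" and g :: "real \<Rightarrow> real"
  assumes "f \<in> borel_measurable half_line" "integrable half_line (\<lambda>r. (g r)\<^sup>2)"
    and "\<And>r. r > 0 \<Longrightarrow> norm (f r) \<le> g r"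
  shows "f \<in> L2"
proof (rule L2I[OF assms(1)], rule Bochner_Integration.integrable_bound[OF assms(2)])
  show "(\<lambda>r. (norm (f r))\<^sup>2) \<in> borel_measurable half_line" using assms(1) by measurable
  show "AE r in half_line. norm ((norm (f r))\<^sup>2) \<le> norm ((g r)\<^sup>2)"
    by (intro AE_I2) (use assms(3) in \<open>auto intro!: power_mono\<close>)
qed

lemma L2_mult_integrable:
  assumes "f \<in> L2" "g \<in> L2"
  shows "integrable half_line (\<lambda>r. f r * g r)"
proof (rule Bochner_Integration.integrable_bound[of _ "\<lambda>r. (norm (f r))\<^sup>2 + (norm (g r))\<^sup>2"])
  show "integrable half_line (\<lambda>r. (norm (f r))\<^sup>2 + (norm (g r))\<^sup>2)"
    using assms by (auto dest: L2_integrable)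
  show "(\<lambda>r. f r * g r) \<in> borel_measurable half_line"
    using assms by measurable
  have "a * b \<le> a\<^sup>2 + b\<^sup>2" if "a \<ge> 0" "b \<ge> 0" for a b :: real
  proof -
    have "0 \<le> a * b" using that by simp
    then show ?thesis using sum_squares_bound[of a b] by linarith
  qed
  then show "AE r in half_line. norm (f r * g r) \<le> norm ((norm (f r))\<^sup>2 + (norm (g r))\<^sup>2)"
    by (auto simp: norm_mult)
qed

lemma L2_cnj: "f \<in> L2 \<Longrightarrow> (\<lambda>r. cnj (f r)) \<in> L2"
  using measurable_compose[of f half_line borel cnj borel]
  by (auto simp: L2_def borel_measurable_continuous_onI continuous_on_cnj)

lemma L2_scale: "f \<in> L2 \<Longrightarrow> (\<lambda>r. c * f r) \<in> L2"
  by (auto simp: L2_def norm_mult power_mult_distrib)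

lemma L2_add:
  assumes "f \<in> L2" "g \<in> L2"
  shows "(\<lambda>r. f r + g r) \<in> L2"
proof (rule L2I)
  show "(\<lambda>r. f r + g r) \<in> borel_measurable half_line" using assms by measurable
  show "integrable half_line (\<lambda>r. (norm (f r + g r))\<^sup>2)"
  proof (rule Bochner_Integration.integrable_bound[of _ "\<lambda>r. 2 * (norm (f r))\<^sup>2 + 2 * (norm (g r))\<^sup>2"])
    show "integrable half_line (\<lambda>r. 2 * (norm (f r))\<^sup>2 + 2 * (norm (g r))\<^sup>2)"
      by (intro Bochner_Integration.integrable_add integrable_mult_right L2_integrable assms)
    show "(\<lambda>r. (norm (f r + g r))\<^sup>2) \<in> borel_measurable half_line" using assms by measurable
    have "(norm (x + y))\<^sup>2 \<le> 2 * (norm x)\<^sup>2 + 2 * (norm y)\<^sup>2" for x y :: complex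
    proof -
      have "(norm (x + y))\<^sup>2 \<le> (norm x + norm y)\<^sup>2"
        by (intro power_mono norm_triangle_ineq) auto
      also have "\<dots> \<le> 2 * (norm x)\<^sup>2 + 2 * (norm y)\<^sup>2"
        using sum_squares_bound[of "norm x" "norm y"] by (simp add: power2_sum)
      finally show ?thesis .
    qed
    then show "AE r in half_line. norm ((norm (f r + g r))\<^sup>2) \<le> norm (2 * (norm (f r))\<^sup>2 + 2 * (norm (g r))\<^sup>2)"
      by (auto intro!: AE_I2)
  qed
qed

lemma L2_minus:
  assumes "f \<in> L2" "g \<in> L2"
  shows "(\<lambda>r. f r - g r) \<in> L2"
  using L2_add[OF assms(1) L2_scale[OF assms(2), of "-1"]] by simp

lemma L2_zero: "(\<lambda>r. 0) \<in> L2"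
  by (simp add: L2_def)

lemma L2_sum: "(\<And>i. i \<in> I \<Longrightarrow> f i \<in> L2) \<Longrightarrow> (\<lambda>r. \<Sum>i\<in>I. f i r) \<in> L2"
  by (induction I rule: infinite_finite_induct) (auto intro: L2_zero L2_add)

section \<open>The norm: Cauchy-Schwarz and the triangle inequality\<close>

lemma L2_norm_nonneg [simp]: "L2_norm f \<ge> 0"
  by (simp add: L2_norm_def)

lemma L2_norm_sq: "(L2_norm f)\<^sup>2 = (LINT r|half_line. (norm (f r))\<^sup>2)"
  by (simp add: L2_norm_def)

lemma L2_norm_zero: "L2_norm (\<lambda>r. 0) = 0"
  by (simp add: L2_norm_def)

lemma L2_norm_cnj: "L2_norm (\<lambda>r. cnj (f r)) = L2_norm f"
  by (simp add: L2_norm_def)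

lemma L2_norm_scale: "L2_norm (\<lambda>r. c * f r) = norm c * L2_norm f"
  by (simp add: L2_norm_def norm_mult power_mult_distrib real_sqrt_mult)

lemma L2_norm_minus_commute: "L2_norm (\<lambda>r. f r - g r) = L2_norm (\<lambda>r. g r - f r)"
  by (simp add: L2_norm_def norm_minus_commute)

lemma L2_norm_cong_AE:
  assumes "f \<in> L2" "g \<in> L2" "AE r in half_line. f r = g r"
  shows "L2_norm f = L2_norm g"
proof -
  have "(LINT r|half_line. (norm (f r))\<^sup>2) = (LINT r|half_line. (norm (g r))\<^sup>2)"
    by (rule integral_cong_AE) (use assms in \<open>auto dest: L2_measurable\<close>)
  then show ?thesis by (simp add: L2_norm_def)
qed

text \<open>The integral of the square of norm f - t norm g is a nonnegative quadratic in t; its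
  value at the minimiser gives the bound.\<close>

lemma L2_Cauchy_Schwarz_norm:
  assumes "f \<in> L2" "g \<in> L2"
  shows "(LINT r|half_line. norm (f r) * norm (g r)) \<le> L2_norm f * L2_norm g"
proof -
  define I where "I = (LINT r|half_line. norm (f r) * norm (g r))"
  have int: "integrable half_line (\<lambda>r. norm (f r) * norm (g r))"
    using integrable_norm[OF L2_mult_integrable[OF assms]] by (simp add: norm_mult)
  have *: "0 \<le> (L2_norm f)\<^sup>2 - 2 * t * I + t\<^sup>2 * (L2_norm g)\<^sup>2" for t
  proof -
    have "0 \<le> (LINT r|half_line. (norm (f r) - t * norm (g r))\<^sup>2)" by simp
    also have "\<dots> = (LINT r|half_line. (norm (f r))\<^sup>2 - 2 * t * (norm (f r) * norm (g r)) + t\<^sup>2 * (norm (g r))\<^sup>2)"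
      by (intro Bochner_Integration.integral_cong) (auto simp: power2_diff algebra_simps)
    also have "\<dots> = (L2_norm f)\<^sup>2 - 2 * t * I + t\<^sup>2 * (L2_norm g)\<^sup>2"
      using int L2_integrable[OF assms(1)] L2_integrable[OF assms(2)] by (simp add: L2_norm_sq I_def)
    finally show ?thesis .
  qed
  have "I \<le> L2_norm f * L2_norm g"
  proof (cases "L2_norm g = 0")
    case True
    show ?thesis
    proof (rule ccontr)
      assume "\<not> ?thesis"
      then have "I > 0" using True by simp
      \<comment> \<open>With \<open>L2_norm g = 0\<close> the quadratic degenerates to a linear
        function of t, and this t makes it equal to -1.\<close>
      with *[of "((L2_norm f)\<^sup>2 + 1) / (2 * I)"] True show False by simp
    qed
  next
    case False
    then have p: "L2_norm g > 0" by (simp add: order_less_le)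
    have "0 \<le> (L2_norm f)\<^sup>2 - I\<^sup>2 / (L2_norm g)\<^sup>2"
      using *[of "I / (L2_norm g)\<^sup>2"] p by (simp add: field_simps power2_eq_square)
    then have "I\<^sup>2 \<le> (L2_norm f * L2_norm g)\<^sup>2"
      using p by (simp add: field_simps power_mult_distrib)
    then show ?thesis by (rule power2_le_imp_le) simp
  qed
  then show ?thesis by (simp add: I_def)
qed

lemma L2_Cauchy_Schwarz:
  assumes "f \<in> L2" "g \<in> L2"
  shows "norm (LINT r|half_line. f r * g r) \<le> L2_norm f * L2_norm g"
proof -
  have "norm (LINT r|half_line. f r * g r) \<le> (LINT r|half_line. norm (f r * g r))"
    by (rule integral_norm_bound)
  then show ?thesis using L2_Cauchy_Schwarz_norm[OF assms] by (simp add: norm_mult)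
qed

lemma L2_norm_triangle:
  assumes "f \<in> L2" "g \<in> L2"
  shows "L2_norm (\<lambda>r. f r + g r) \<le> L2_norm f + L2_norm g"
proof (rule power2_le_imp_le)
  have int: "integrable half_line (\<lambda>r. norm (f r) * norm (g r))"
    using integrable_norm[OF L2_mult_integrable[OF assms]] by (simp add: norm_mult)
  have "(L2_norm (\<lambda>r. f r + g r))\<^sup>2 \<le> (LINT r|half_line. (norm (f r))\<^sup>2 + 2 * (norm (f r) * norm (g r)) + (norm (g r))\<^sup>2)"
    unfolding L2_norm_sq
  proof (rule integral_mono)
    show "(norm (f r + g r))\<^sup>2 \<le> (norm (f r))\<^sup>2 + 2 * (norm (f r) * norm (g r)) + (norm (g r))\<^sup>2" for r
    proof -
      have "(norm (f r + g r))\<^sup>2 \<le> (norm (f r) + norm (g r))\<^sup>2"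
        by (intro power_mono norm_triangle_ineq) auto
      then show ?thesis by (simp add: power2_sum)
    qed
    show "integrable half_line (\<lambda>r. (norm (f r))\<^sup>2 + 2 * (norm (f r) * norm (g r)) + (norm (g r))\<^sup>2)"
      by (intro Bochner_Integration.integrable_add integrable_mult_right L2_integrable assms int)
  qed (rule L2_integrable[OF L2_add[OF assms]])
  also have "\<dots> = (L2_norm f)\<^sup>2 + 2 * (LINT r|half_line. norm (f r) * norm (g r)) + (L2_norm g)\<^sup>2"
    using int L2_integrable[OF assms(1)] L2_integrable[OF assms(2)] by (simp add: L2_norm_sq)
  also have "\<dots> \<le> (L2_norm f + L2_norm g)\<^sup>2"
    using L2_Cauchy_Schwarz_norm[OF assms] by (simp add: power2_sum)
  finally show "(L2_norm (\<lambda>r. f r + g r))\<^sup>2 \<le> (L2_norm f + L2_norm g)\<^sup>2" .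
qed auto

lemma L2_norm_triangle_minus:
  assumes "f \<in> L2" "g \<in> L2"
  shows "\<bar>L2_norm f - L2_norm g\<bar> \<le> L2_norm (\<lambda>r. f r - g r)"
  using L2_norm_triangle[OF L2_minus[OF assms] assms(2)]
    L2_norm_triangle[OF L2_minus[OF assms(2,1)] assms(1)]
  by (simp add: L2_norm_minus_commute[of g f])

lemma L2_norm_sum:
  "(\<And>i. i \<in> I \<Longrightarrow> f i \<in> L2) \<Longrightarrow> L2_norm (\<lambda>r. \<Sum>i\<in>I. f i r) \<le> (\<Sum>i\<in>I. L2_norm (f i))"
proof (induction I rule: infinite_finite_induct)
  case (insert i I)
  have "L2_norm (\<lambda>r. f i r + (\<Sum>i\<in>I. f i r)) \<le> L2_norm (f i) + L2_norm (\<lambda>r. \<Sum>i\<in>I. f i r)"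
    by (rule L2_norm_triangle) (use insert in \<open>auto intro!: L2_sum\<close>)
  also have "\<dots> \<le> L2_norm (f i) + (\<Sum>i\<in>I. L2_norm (f i))"
    using insert by (intro add_left_mono) auto
  finally show ?case using insert by simp
qed (auto simp: L2_norm_zero)

section \<open>Completeness and uniform boundedness\<close>

lemma nn_integral_L2_norm:
  assumes "f \<in> L2"
  shows "(\<integral>\<^sup>+ r. ennreal ((norm (f r))\<^sup>2) \<partial>half_line) = ennreal ((L2_norm f)\<^sup>2)"
  unfolding L2_norm_sq by (rule nn_integral_eq_integral) (use L2_integrable[OF assms] in auto)

lemma L2_norm_le_nn_integral:
  assumes "f \<in> borel_measurable half_line" "c \<ge> 0"
    and "(\<integral>\<^sup>+ r. ennreal ((norm (f r))\<^sup>2) \<partial>half_line) \<le> ennreal (c\<^sup>2)"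
  shows "f \<in> L2" "L2_norm f \<le> c"
proof -
  have "integrable half_line (\<lambda>r. (norm (f r))\<^sup>2)"
    by (rule integrableI_bounded) (use assms in \<open>auto simp: order_le_less_trans\<close>)
  then show f: "f \<in> L2" using assms(1) by (intro L2I)
  have "(L2_norm f)\<^sup>2 \<le> c\<^sup>2"
    using assms(3) nn_integral_L2_norm[OF f] by simp
  then show "L2_norm f \<le> c" using assms(2) by (rule power2_le_imp_le)
qed

text \<open>Completeness in the form required by the uniform boundedness principle. Monotone
  convergence for the squared partial sums of \<open>norm (f i r)\<close> gives absolute convergence
  almost everywhere; Fatou's lemma then carries the tail bounds over to the pointwise sum.\<close>

lemma L2_series:
  fixes f :: "nat \<Rightarrow> real \<Rightarrow> complex"
  assumes f: "\<And>i. f i \<in> L2" and le: "\<And>i. L2_norm (f i) \<le> c i" and c: "summable c"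
  shows "\<exists>x\<in>L2. \<forall>j. L2_norm (\<lambda>r. x r - (\<Sum>i<j. f i r)) \<le> (\<Sum>i. c (i + j))"
proof -
  have c0: "c i \<ge> 0" for i using le[of i] L2_norm_nonneg[of "f i"] by linarith
  have fm [measurable]: "f i \<in> borel_measurable half_line" for i using f by (rule L2_measurable)
  \<comment> \<open>The absolute values are read as complex functions so that the triangle
    inequality for finite sums applies to them.\<close>
  define nf where "nf i r = complex_of_real (norm (f i r))" for i r
  have nf: "nf i \<in> L2" "L2_norm (nf i) = L2_norm (f i)" for i
    using f[of i] fm[of i] unfolding nf_def[abs_def] L2_def L2_norm_def by auto
  define u where "u n r = ennreal ((\<Sum>i<n. norm (f i r))\<^sup>2)" for n r
  have um: "u n \<in> borel_measurable half_line" for n unfolding u_def by measurable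
  have un: "(\<integral>\<^sup>+ r. u n r \<partial>half_line) \<le> ennreal ((suminf c)\<^sup>2)" for n
  proof -
    have eq: "(norm (\<Sum>i<n. nf i r))\<^sup>2 = (\<Sum>i<n. norm (f i r))\<^sup>2" for r
    proof -
      have "(\<Sum>i<n. nf i r) = of_real (\<Sum>i<n. norm (f i r))" by (simp add: nf_def)
      then show ?thesis by (metis norm_of_real power2_abs)
    qed
    have "(\<integral>\<^sup>+ r. u n r \<partial>half_line) = ennreal ((L2_norm (\<lambda>r. \<Sum>i<n. nf i r))\<^sup>2)"
      unfolding u_def eq[symmetric] by (rule nn_integral_L2_norm) (intro L2_sum nf)
    also have "\<dots> \<le> ennreal ((suminf c)\<^sup>2)"
    proof (intro ennreal_leI power_mono L2_norm_nonneg)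
      have "L2_norm (\<lambda>r. \<Sum>i<n. nf i r) \<le> (\<Sum>i<n. L2_norm (nf i))"
        by (intro L2_norm_sum nf)
      also have "\<dots> \<le> (\<Sum>i<n. c i)" by (intro sum_mono) (simp add: nf le)
      also have "\<dots> \<le> suminf c" using c c0 by (intro sum_le_suminf) auto
      finally show "L2_norm (\<lambda>r. \<Sum>i<n. nf i r) \<le> suminf c" .
    qed
    finally show ?thesis .
  qed
  have inc: "incseq u"
    unfolding u_def incseq_def le_fun_def
    by (auto intro!: ennreal_leI power_mono sum_mono2 sum_nonneg)
  have "(\<integral>\<^sup>+ r. (SUP n. u n r) \<partial>half_line) = (SUP n. \<integral>\<^sup>+ r. u n r \<partial>half_line)"
    by (rule nn_integral_monotone_convergence_SUP[OF inc um])
  also have "\<dots> \<le> ennreal ((suminf c)\<^sup>2)" by (intro SUP_least un)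
  finally have "(\<integral>\<^sup>+ r. (SUP n. u n r) \<partial>half_line) \<noteq> \<infinity>"
    by (auto simp: top_unique)
  then have "AE r in half_line. (SUP n. u n r) \<noteq> \<infinity>"
    by (intro nn_integral_PInf_AE) (use um in measurable)
  then have ae: "AE r in half_line. summable (\<lambda>i. norm (f i r))"
  proof eventually_elim
    case (elim r)
    then obtain K where K: "(SUP n. u n r) = ennreal K" "K \<ge> 0" by (cases "SUP n. u n r") auto
    have "(\<Sum>i<n. norm (f i r)) \<le> sqrt K" for n
    proof -
      have "u n r \<le> ennreal K" unfolding K(1)[symmetric] by (rule SUP_upper) simp
      then have "(\<Sum>i<n. norm (f i r))\<^sup>2 \<le> K" using K(2) by (simp add: u_def)
      then show ?thesis by (rule real_le_rsqrt)
    qed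
    then show ?case by (intro summableI_nonneg_bounded[of _ "sqrt K"]) auto
  qed
  define x where "x r = (\<Sum>i. f i r)" for r
  have xm [measurable]: "x \<in> borel_measurable half_line" unfolding x_def by measurable
  have tail: "(\<Sum>i=j..<n. c i) \<le> (\<Sum>i. c (i + j))" if "j \<le> n" for j n
  proof -
    have "(\<Sum>i=j..<n. c i) = (\<Sum>i<n - j. c (i + j))"
      using sum.shift_bounds_nat_ivl[of c 0 j "n - j"] that by (simp add: atLeast0LessThan)
    also have "\<dots> \<le> (\<Sum>i. c (i + j))"
      using c c0 by (intro sum_le_suminf) (auto simp: summable_iff_shift)
    finally show ?thesis .
  qed
  have main: "(\<lambda>r. x r - (\<Sum>i<j. f i r)) \<in> L2 \<and>
      L2_norm (\<lambda>r. x r - (\<Sum>i<j. f i r)) \<le> (\<Sum>i. c (i + j))" for j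
  proof -
    have pos: "0 \<le> (\<Sum>i. c (i + j))" using c c0 by (intro suminf_nonneg) (auto simp: summable_iff_shift)
    have m: "(\<lambda>r. x r - (\<Sum>i<j. f i r)) \<in> borel_measurable half_line" by measurable
    define v where "v n r = ennreal ((norm ((\<Sum>i<n. f i r) - (\<Sum>i<j. f i r)))\<^sup>2)" for n r
    have vm [measurable]: "v n \<in> borel_measurable half_line" for n unfolding v_def by measurable
    have "(\<integral>\<^sup>+ r. ennreal ((norm (x r - (\<Sum>i<j. f i r)))\<^sup>2) \<partial>half_line)
        \<le> (\<integral>\<^sup>+ r. liminf (\<lambda>n. v n r) \<partial>half_line)"
    proof (rule nn_integral_mono_AE)
      show "AE r in half_line. ennreal ((norm (x r - (\<Sum>i<j. f i r)))\<^sup>2) \<le> liminf (\<lambda>n. v n r)"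
        using ae
      proof eventually_elim
        case (elim r)
        then have "(\<lambda>n. \<Sum>i<n. f i r) \<longlonglongrightarrow> x r"
          unfolding x_def by (rule summable_LIMSEQ[OF summable_norm_cancel])
        then have "(\<lambda>n. v n r) \<longlonglongrightarrow> ennreal ((norm (x r - (\<Sum>i<j. f i r)))\<^sup>2)"
          unfolding v_def by (intro tendsto_ennrealI tendsto_power tendsto_norm tendsto_diff tendsto_const)
        then have "liminf (\<lambda>n. v n r) = ennreal ((norm (x r - (\<Sum>i<j. f i r)))\<^sup>2)"
          by (intro lim_imp_Liminf) auto
        then show ?case by simp
      qed
    qed
    also have "\<dots> \<le> liminf (\<lambda>n. \<integral>\<^sup>+ r. v n r \<partial>half_line)"
      by (rule nn_integral_liminf) measurable
    also have "\<dots> \<le> ennreal ((\<Sum>i. c (i + j))\<^sup>2)"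
    proof (rule Liminf_le)
      have "\<forall>n\<ge>j. (\<integral>\<^sup>+ r. v n r \<partial>half_line) \<le> ennreal ((\<Sum>i. c (i + j))\<^sup>2)"
      proof (intro allI impI)
        fix n assume n: "j \<le> n"
        have eq: "(\<Sum>i<n. f i r) - (\<Sum>i<j. f i r) = (\<Sum>i=j..<n. f i r)" for r
        proof -
          have "(\<Sum>i<n. f i r) = (\<Sum>i<j. f i r) + (\<Sum>i=j..<n. f i r)"
            using sum.atLeastLessThan_concat[of 0 j n "\<lambda>i. f i r"] n by (simp add: atLeast0LessThan)
          then show ?thesis by simp
        qed
        have "(\<integral>\<^sup>+ r. v n r \<partial>half_line) = ennreal ((L2_norm (\<lambda>r. \<Sum>i=j..<n. f i r))\<^sup>2)"
          unfolding v_def eq by (rule nn_integral_L2_norm) (intro L2_sum f)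
        also have "\<dots> \<le> ennreal ((\<Sum>i. c (i + j))\<^sup>2)"
        proof (intro ennreal_leI power_mono L2_norm_nonneg)
          have "L2_norm (\<lambda>r. \<Sum>i=j..<n. f i r) \<le> (\<Sum>i=j..<n. L2_norm (f i))"
            by (intro L2_norm_sum f)
          also have "\<dots> \<le> (\<Sum>i=j..<n. c i)" by (intro sum_mono le)
          also have "\<dots> \<le> (\<Sum>i. c (i + j))" by (rule tail[OF n])
          finally show "L2_norm (\<lambda>r. \<Sum>i=j..<n. f i r) \<le> (\<Sum>i. c (i + j))" .
        qed
        finally show "(\<integral>\<^sup>+ r. v n r \<partial>half_line) \<le> ennreal ((\<Sum>i. c (i + j))\<^sup>2)" .
      qed
      then show "\<forall>\<^sub>F n in sequentially. (\<integral>\<^sup>+ r. v n r \<partial>half_line) \<le> ennreal ((\<Sum>i. c (i + j))\<^sup>2)"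
        unfolding eventually_sequentially by blast
    qed auto
    finally show ?thesis using L2_norm_le_nn_integral[OF m pos] by blast
  qed
  show ?thesis using main main[of 0] by (intro bexI[of _ x]) auto
qed

text \<open>Uniform boundedness principle, after Sokal: if \<open>\<parallel>y\<^sub>j\<parallel> \<ge> 4\<^sup>j\<close>, add to the \<open>j\<close>-th partial sum
  \<open>\<plusminus>3\<^sup>-\<^sup>j\<close> times the unit vector of \<open>y\<^sub>j\<close>, with the sign that makes the pairing with \<open>y\<^sub>j\<close> large;
  the remaining terms cannot cancel it.\<close>

lemma L2_uniform_boundedness:
  fixes w :: "'i \<Rightarrow> real \<Rightarrow> complex"
  assumes w: "\<And>i. w i \<in> L2"
    and bdd: "\<And>g. g \<in> L2 \<Longrightarrow> \<exists>K. \<forall>i. norm (LINT r|half_line. w i r * g r) \<le> K"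
  shows "\<exists>K. \<forall>i. L2_norm (w i) \<le> K"
proof (rule ccontr)
  assume "\<not> ?thesis"
  then have "\<forall>j::nat. \<exists>i. L2_norm (w i) \<ge> 4 ^ j" by (meson linear)
  then obtain \<iota> where \<iota>: "\<And>j::nat. L2_norm (w (\<iota> j)) \<ge> 4 ^ j" by metis
  define y where "y j = w (\<iota> j)" for j
  have y: "y j \<in> L2" "L2_norm (y j) \<ge> 4 ^ j" "L2_norm (y j) > 0" for j
    using w \<iota>[of j] by (auto simp: y_def intro: less_le_trans[of _ "4 ^ j"])
  define pair where "pair f g = (LINT r|half_line. f r * g r)" for f g :: "real \<Rightarrow> complex"
  define e where "e j r = of_real (1 / L2_norm (y j)) * cnj (y j r)" for j r
  have e: "e j \<in> L2" "L2_norm (e j) = 1" for j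
  proof -
    show "e j \<in> L2" unfolding e_def by (intro L2_scale L2_cnj y)
    show "L2_norm (e j) = 1"
      using y(3)[of j] unfolding e_def L2_norm_scale L2_norm_cnj by (simp add: norm_divide)
  qed
  have pe: "pair (y j) (e j) = of_real (L2_norm (y j))" for j
  proof -
    have "pair (y j) (e j) = of_real (1 / L2_norm (y j)) * (LINT r|half_line. y j r * cnj (y j r))"
      unfolding pair_def e_def by (subst integral_mult_right_zero[symmetric]) (simp add: mult_ac)
    also have "(LINT r|half_line. y j r * cnj (y j r)) = of_real ((L2_norm (y j))\<^sup>2)"
      unfolding L2_norm_sq by (subst integral_complex_of_real[symmetric], rule Bochner_Integration.integral_cong) (use complex_norm_square in simp_all)
    finally show ?thesis using y(3)[of j] by (simp add: power2_eq_square)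
  qed
  have pair_add: "pair f (\<lambda>r. g r + c * h r) = pair f g + c * pair f h" if "f \<in> L2" "g \<in> L2" "h \<in> L2" for f g h c
  proof -
    have "pair f (\<lambda>r. g r + c * h r) = (LINT r|half_line. f r * g r + c * (f r * h r))"
      unfolding pair_def by (simp add: algebra_simps)
    also have "\<dots> = pair f g + c * pair f h"
      unfolding pair_def using L2_mult_integrable[OF that(1,2)] L2_mult_integrable[OF that(1,3)] by simp
    finally show ?thesis .
  qed
  define S where "S = rec_nat (\<lambda>r. 0) (\<lambda>j x r.
     x r + (if norm (pair (y j) (\<lambda>r. x r + (1/3)^j * e j r)) \<ge> (1/3)^j * L2_norm (y j) then (1/3)^j else - ((1/3)^j)) * e j r)"
  define s :: "nat \<Rightarrow> complex" where "s j = (if norm (pair (y j) (\<lambda>r. S j r + (1/3)^j * e j r)) \<ge> (1/3)^j * L2_norm (y j) then (1/3)^j else - ((1/3)^j))" for j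
  have S_Suc: "S (Suc j) = (\<lambda>r. S j r + s j * e j r)" for j
    by (simp add: S_def s_def)
  have S_eq: "S j r = (\<Sum>i<j. s i * e i r)" for j r
    by (induction j) (auto simp: S_Suc, simp add: S_def)
  have ns: "norm (s j) = (1/3)^j" for j by (simp add: s_def norm_power norm_divide)
  have SL2: "S j \<in> L2" for j
    unfolding S_eq[abs_def] by (intro L2_sum L2_scale e)
  have pe2: "pair (y j) (\<lambda>r. S j r + c * e j r) = pair (y j) (S j) + c * of_real (L2_norm (y j))" for j c
    using pair_add[OF y(1)[of j] SL2[of j] e(1)[of j], of c] by (simp add: pe)
  have big: "norm (pair (y j) (S (Suc j))) \<ge> (1/3)^j * L2_norm (y j)" for j
  proof (cases "norm (pair (y j) (\<lambda>r. S j r + (1/3)^j * e j r)) \<ge> (1/3)^j * L2_norm (y j)")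
    case True
    then show ?thesis by (simp add: S_Suc s_def)
  next
    case False
    define b where "b = complex_of_real ((1/3)^j * L2_norm (y j))"
    have nb: "norm b = (1/3)^j * L2_norm (y j)" by (simp add: b_def norm_mult norm_power norm_divide)
    have "(1/3)^j * of_real (L2_norm (y j)) = b" by (simp add: b_def)
    then have 1: "norm (pair (y j) (S j) + b) < (1/3)^j * L2_norm (y j)"
      using False pe2[of j "(1/3)^j"] by simp
    have 2: "pair (y j) (S (Suc j)) = pair (y j) (S j) - b"
      using False unfolding S_Suc s_def pe2 by (simp add: b_def)
    \<comment> \<open>The shifts by b and by -b differ by 2 b, so if one of them has norm below that
      of b, the other has norm above it.\<close>
    have "norm (2 * b) \<le> norm (pair (y j) (S j) + b) + norm (pair (y j) (S j) - b)"
      using norm_triangle_ineq4[of "pair (y j) (S j) + b" "pair (y j) (S j) - b"] by simp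
    moreover have "norm (2 * b) = 2 * norm b" by (simp add: norm_mult)
    ultimately show ?thesis using 1 nb unfolding 2 by linarith
  qed
  have sm: "summable (\<lambda>i. (1/3 :: real) ^ i)" by (simp add: summable_geometric)
  obtain x where x: "x \<in> L2" "\<And>j. L2_norm (\<lambda>r. x r - (\<Sum>i<j. s i * e i r)) \<le> (\<Sum>i. (1/3) ^ (i + j))"
    using L2_series[of "\<lambda>i r. s i * e i r" "\<lambda>i. (1/3)^i"] sm
    by (auto simp: L2_norm_scale L2_scale e ns)
  \<comment> \<open>After index j the remaining steps add up to at most (3/2) 3^(-j-1) = 3^(-j) / 2,
    half of what step j has secured.\<close>
  have tail: "(\<Sum>i. (1/3 :: real) ^ (i + j)) = (3/2) * (1/3) ^ j" for j
    using suminf_mult2[OF sm, of "(1/3) ^ j"] suminf_geometric[of "1/3 :: real"] by (simp add: power_add)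
  obtain K where K: "\<And>i. norm (LINT r|half_line. w i r * x r) \<le> K" using bdd[OF x(1)] by blast
  have "(1/2) * (4/3) ^ j \<le> K" for j
  proof -
    have d: "(\<lambda>r. x r - S (Suc j) r) \<in> L2" by (intro L2_minus x SL2)
    have "norm (pair (y j) (\<lambda>r. x r - S (Suc j) r)) \<le> L2_norm (y j) * L2_norm (\<lambda>r. x r - S (Suc j) r)"
      unfolding pair_def by (rule L2_Cauchy_Schwarz[OF y(1) d])
    also have "\<dots> \<le> L2_norm (y j) * ((3/2) * (1/3) ^ Suc j)"
      using x(2)[of "Suc j"] unfolding tail S_eq by (intro mult_left_mono) auto
    finally have 1: "norm (pair (y j) (\<lambda>r. x r - S (Suc j) r)) \<le> (1/2) * ((1/3) ^ j * L2_norm (y j))"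
      by (simp add: field_simps)
    have "pair (y j) x = pair (y j) (S (Suc j)) + pair (y j) (\<lambda>r. x r - S (Suc j) r)"
      using pair_add[OF y(1) SL2 d, of j "Suc j" 1] by simp
    then have "norm (pair (y j) x) \<ge> (1/2) * ((1/3) ^ j * L2_norm (y j))"
      using 1 big[of j] norm_triangle_ineq2[of "pair (y j) (S (Suc j))" "- pair (y j) (\<lambda>r. x r - S (Suc j) r)"] by simp
    also have "(1/3) ^ j * L2_norm (y j) \<ge> (1/3) ^ j * 4 ^ j" using y(2) by (intro mult_left_mono) auto
    then have "(1/2) * ((1/3) ^ j * L2_norm (y j)) \<ge> (1/2) * (4/3)^j"
      by (simp add: power_mult_distrib[symmetric])
    finally show ?thesis using K[of "\<iota> j"] by (simp add: pair_def y_def)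
  qed
  then have le: "(4/3) ^ j \<le> 2 * K" for j by (simp add: field_simps)
  obtain j where "(4/3 :: real) ^ j > 2 * K" using real_arch_pow[of "4/3" "2 * K"] by auto
  with le[of j] show False by linarith
qed

lemma measurable_half_line_id [measurable]: "(\<lambda>r. r) \<in> borel_measurable half_line"
  using continuous_imp_measurable_on_sets_lebesgue[of "{0<..}" "\<lambda>r::real. r"] by simp

text \<open>\<open>is_weighted_resolvent\<close> describes \<open>B g\<close> only when
  \<open>inv_r g\<close> is in \<open>L2\<close>. Cutting off near 0 produces such functions, and
  they approximate every element of \<open>L2\<close>.\<close>

lemma L2_cutoff:
  assumes "g \<in> L2"
  defines "G n \<equiv> (\<lambda>r. if r \<ge> 1 / real (Suc n) then g r else 0)"
  shows "G n \<in> L2" "inv_r (G n) \<in> L2" "(\<lambda>n. L2_norm (\<lambda>r. G n r - g r)) \<longlonglongrightarrow> 0"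
proof -
  have gm [measurable]: "g \<in> borel_measurable half_line" by (rule L2_measurable[OF assms(1)])
  have Gm [measurable]: "G n \<in> borel_measurable half_line" for n unfolding G_def by measurable
  show "G n \<in> L2" for n
  proof (rule L2_bound[of _ "\<lambda>r. norm (g r)"])
    show "norm (G n r) \<le> norm (g r)" for r by (simp add: G_def)
  qed (use L2_integrable[OF assms(1)] in simp_all)
  show "inv_r (G n) \<in> L2" for n
  proof (rule L2_bound[of _ "\<lambda>r. real (Suc n) * norm (g r)"])
    show "inv_r (G n) \<in> borel_measurable half_line" unfolding inv_r_def by measurable
    show "integrable half_line (\<lambda>r. (real (Suc n) * norm (g r))\<^sup>2)"
      unfolding power_mult_distrib by (intro integrable_mult_right L2_integrable assms)
    show "norm (inv_r (G n) r) \<le> real (Suc n) * norm (g r)" if "r > 0" for r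
    proof (cases "r \<ge> 1 / real (Suc n)")
      case True
      then have "1 / r \<le> real (Suc n)" using that by (simp add: field_simps)
      then have "norm (g r) * (1 / r) \<le> norm (g r) * real (Suc n)" by (intro mult_left_mono) auto
      then show ?thesis using True that by (simp add: inv_r_def G_def norm_divide mult.commute)
    qed (simp add: inv_r_def G_def)
  qed
  have "(\<lambda>n. LINT r|half_line. (norm (G n r - g r))\<^sup>2) \<longlonglongrightarrow> (LINT r|half_line. 0)"
  proof (rule integral_dominated_convergence[where w = "\<lambda>r. (norm (g r))\<^sup>2"])
    show "AE r in half_line. (\<lambda>n. (norm (G n r - g r))\<^sup>2) \<longlonglongrightarrow> 0"
    proof (rule AE_I2)
      fix r assume "r \<in> space half_line"
      then have "r > 0" by simp
      then obtain N where N: "1 / real (Suc N) < r" using nat_approx_posE by blast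
      have "(norm (G n r - g r))\<^sup>2 = 0" if "n \<ge> N" for n
      proof -
        have "1 / real (Suc n) \<le> 1 / real (Suc N)" using that by (simp add: field_simps)
        then show ?thesis using N by (simp add: G_def)
      qed
      then show "(\<lambda>n. (norm (G n r - g r))\<^sup>2) \<longlonglongrightarrow> 0"
        by (intro tendsto_eventually) (auto simp: eventually_sequentially)
    qed
    show "AE r in half_line. norm ((norm (G n r - g r))\<^sup>2) \<le> (norm (g r))\<^sup>2" for n
      by (auto simp: G_def)
  qed (use L2_integrable[OF assms(1)] in simp_all)
  then have "(\<lambda>n. sqrt (LINT r|half_line. (norm (G n r - g r))\<^sup>2)) \<longlonglongrightarrow> sqrt 0"
    by (intro tendsto_intros) simp
  then show "(\<lambda>n. L2_norm (\<lambda>r. G n r - g r)) \<longlonglongrightarrow> 0"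
    by (simp add: L2_norm_def)
qed

section \<open>Mollification and the weak form of the Bessel operator\<close>

definition flat_exp :: "real poly \<Rightarrow> real \<Rightarrow> real" where
  "flat_exp p x = (if x > 0 then poly p (1 / x) * exp (- (1 / x)) else 0)"

text \<open>The functions p(1/x) exp(-1/x), extended by 0, are closed under differentiation: the
  chain rule contributes y^2 with y = 1/x, the product rule p - p'. Smoothness thus becomes
  bookkeeping with polynomials.\<close>

definition flat_exp_deriv :: "real poly \<Rightarrow> real poly" where
  "flat_exp_deriv p = [:0, 0, 1:] * (p - pderiv p)"

lemma poly_times_exp_tendsto_0: "((\<lambda>y. poly p y * exp (- y)) \<longlongrightarrow> (0::real)) at_top"
proof -
  have "((\<lambda>y. \<Sum>i\<le>degree p. coeff p i * (y ^ i / exp y)) \<longlongrightarrow> (\<Sum>i\<le>degree p. coeff p i * 0)) at_top"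
    by (intro tendsto_sum tendsto_mult tendsto_const tendsto_power_div_exp_0)
  moreover have "(\<lambda>y. \<Sum>i\<le>degree p. coeff p i * (y ^ i / exp y)) = (\<lambda>y. poly p y * exp (- y))"
    by (simp add: poly_altdef sum_distrib_right exp_minus divide_inverse mult.assoc)
  ultimately show ?thesis by simp
qed

lemma flat_exp_has_derivative: "(flat_exp p has_real_derivative flat_exp (flat_exp_deriv p) x) (at x)"
proof -
  consider "x > 0" | "x < 0" | "x = 0" by linarith
  then show ?thesis
  proof cases
    case 1
    have "((\<lambda>x. poly p (1 / x) * exp (- (1 / x))) has_real_derivative flat_exp (flat_exp_deriv p) x) (at x)"
      using 1 by (auto intro!: derivative_eq_intros DERIV_chain2[OF poly_DERIV]
          simp: flat_exp_def flat_exp_deriv_def field_simps power2_eq_square)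
    then show ?thesis
      by (rule has_field_derivative_transform_within_open[of _ _ _ "{0<..}"]) (use 1 in \<open>auto simp: flat_exp_def\<close>)
  next
    case 2
    have "((\<lambda>x. 0) has_real_derivative flat_exp (flat_exp_deriv p) x) (at x)"
      using 2 by (simp add: flat_exp_def)
    then show ?thesis
      by (rule has_field_derivative_transform_within_open[of _ _ _ "{..<0}"]) (use 2 in \<open>auto simp: flat_exp_def\<close>)
  next
    case 3
    \<comment> \<open>At the origin the difference quotient is y p(y) exp(-y) with y = 1/h, and
      \<open>pCons 0 p\<close> is the polynomial y p(y).\<close>
    have "((\<lambda>y. poly (pCons 0 p) y * exp (- y)) \<longlongrightarrow> 0) at_top" by (rule poly_times_exp_tendsto_0)
    then have "((\<lambda>h. poly (pCons 0 p) (inverse h) * exp (- inverse h)) \<longlongrightarrow> 0) (at_right (0::real))"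
      by (rule filterlim_compose) (rule filterlim_inverse_at_top_right)
    then have r: "((\<lambda>h. flat_exp p h / h) \<longlongrightarrow> 0) (at_right 0)"
      by (rule Lim_transform_eventually)
        (auto simp: eventually_at_right_less flat_exp_def field_simps eventually_at_filter)
    have l: "((\<lambda>h. flat_exp p h / h) \<longlongrightarrow> 0) (at_left 0)"
      by (rule tendsto_eventually) (auto simp: flat_exp_def eventually_at_filter)
    have "((\<lambda>h. flat_exp p h / h) \<longlongrightarrow> 0) (at 0)"
      using l r by (rule filterlim_split_at)
    then show ?thesis using 3 by (simp add: DERIV_def flat_exp_def)
  qed
qed

lemma flat_exp_minus: "flat_exp (- p) x = - flat_exp p x"
  by (simp add: flat_exp_def)

text \<open>Differentiating one product yields two, so lists of pairs represent all derivatives of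
  the bump exp(-1/x) exp(-1/(1-x)). The sign of \<open>- p\<close> in \<open>bump_comb_deriv\<close>
  comes from the inner derivative of 1 - x.\<close>

definition bump_comb :: "(real poly \<times> real poly) list \<Rightarrow> real \<Rightarrow> real" where
  "bump_comb l x = (\<Sum>(p, q)\<leftarrow>l. flat_exp p x * flat_exp q (1 - x))"

fun bump_comb_deriv :: "(real poly \<times> real poly) list \<Rightarrow> (real poly \<times> real poly) list" where
  "bump_comb_deriv [] = []"
| "bump_comb_deriv ((p, q) # l) = (flat_exp_deriv p, q) # (- p, flat_exp_deriv q) # bump_comb_deriv l"

lemma bump_comb_has_derivative:
  "(bump_comb l has_real_derivative bump_comb (bump_comb_deriv l) x) (at x)"
proof (induction l)
  case (Cons a l)
  obtain p q where a: "a = (p, q)" by (cases a)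
  have 1: "(flat_exp p has_real_derivative flat_exp (flat_exp_deriv p) x) (at x)"
    by (rule flat_exp_has_derivative)
  have 2: "((\<lambda>x. flat_exp q (1 - x)) has_real_derivative flat_exp (flat_exp_deriv q) (1 - x) * (- 1)) (at x)"
    by (rule DERIV_chain2[OF flat_exp_has_derivative]) (auto intro!: derivative_eq_intros)
  have "((\<lambda>x. flat_exp p x * flat_exp q (1 - x) + bump_comb l x) has_real_derivative
      flat_exp (flat_exp_deriv p) x * flat_exp q (1 - x) + flat_exp (flat_exp_deriv q) (1 - x) * (- 1) * flat_exp p x
      + bump_comb (bump_comb_deriv l) x) (at x)"
    by (intro DERIV_add DERIV_mult 1 2 Cons.IH)
  then show ?case by (simp add: a bump_comb_def[abs_def] flat_exp_minus algebra_simps)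
qed (simp add: bump_comb_def[abs_def])

lemma smooth_bump_exists:
  "\<exists>\<rho> :: nat \<Rightarrow> real \<Rightarrow> real. (\<forall>k x. (\<rho> k has_real_derivative \<rho> (Suc k) x) (at x)) \<and> (\<forall>x. 0 \<le> \<rho> 0 x) \<and>
     (\<forall>k x. x \<notin> {0<..<1} \<longrightarrow> \<rho> k x = 0) \<and> (\<rho> 0 has_integral 1) {0..1}"
proof -
  define g where "g k = bump_comb ((bump_comb_deriv ^^ k) [([:1:], [:1:])])" for k
  have g: "(g k has_real_derivative g (Suc k) x) (at x)" for k x
    unfolding g_def by (simp add: bump_comb_has_derivative)
  have g0: "g 0 x = flat_exp [:1:] x * flat_exp [:1:] (1 - x)" for x
    by (simp add: g_def bump_comb_def)
  have out: "g k x = 0" if "x \<notin> {0<..<1}" for k x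
  proof -
    have *: "flat_exp p x * flat_exp q (1 - x) = 0" for p q
      using that by (auto simp: flat_exp_def)
    have "bump_comb l x = 0" for l
      unfolding bump_comb_def * by (simp add: case_prod_unfold)
    then show ?thesis by (simp add: g_def)
  qed
  have cont: "continuous_on {0..1} (g 0)"
    using g by (intro continuous_at_imp_continuous_on ballI) (blast intro: DERIV_isCont)
  have nn: "0 \<le> g 0 x" for x by (simp add: g0 flat_exp_def)
  define c where "c = integral {0..1} (g 0)"
  have "c \<noteq> 0"
  proof
    assume "c = 0"
    then have "(g 0 has_integral 0) (cbox 0 1)"
      using integrable_continuous_interval[OF cont] by (simp add: c_def has_integral_iff)
    \<comment> \<open>A continuous nonnegative function with integral 0 vanishes throughout, but at
      1/2 both exponential factors are positive.\<close>
    then have "g 0 (1/2) = 0"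
      using cont nn by (intro has_integral_0_cbox_imp_0[of 0 1 "g 0" "1/2"]) auto
    then show False by (simp add: g0 flat_exp_def)
  qed
  moreover have "c \<ge> 0" unfolding c_def using nn by (intro integral_nonneg integrable_continuous_interval cont)
  ultimately have c: "c > 0" by simp
  show ?thesis
  proof (intro exI[of _ "\<lambda>k x. g k x / c"] conjI allI impI)
    show "((\<lambda>x. g k x / c) has_real_derivative g (Suc k) x / c) (at x)" for k x
      by (intro DERIV_cdivide g)
    show "((\<lambda>x. g 0 x / c) has_integral 1) {0..1}"
      using has_integral_divide[OF integrable_integral[OF integrable_continuous_interval[OF cont]], of c] c
      by (simp add: c_def)
  qed (use out nn c in auto)
qed

section \<open>Mollification\<close>

locale bump =
  fixes \<rho> :: "nat \<Rightarrow> real \<Rightarrow> real"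
  assumes deriv: "(\<rho> k has_real_derivative \<rho> (Suc k) x) (at x)"
    and nonneg: "0 \<le> \<rho> 0 x"
    and support: "x \<notin> {0<..<1} \<Longrightarrow> \<rho> k x = 0"
    and integral_1: "(\<rho> 0 has_integral 1) {0..1}"
begin

lemma continuous: "continuous_on S (\<rho> k)"
  using deriv by (intro continuous_at_imp_continuous_on ballI) (blast intro: DERIV_isCont)

lemmas continuous_compose [continuous_intros] = continuous_on_compose2[OF continuous[of UNIV] _ subset_UNIV]

text \<open>The average runs over [x - 1/(n+1), x] only: supports grow to the right and keep their
  distance from 0, where the potential is singular.\<close>

definition mollify :: "nat \<Rightarrow> (real \<Rightarrow> complex) \<Rightarrow> real \<Rightarrow> complex" where
  "mollify n w x = integral {0..1} (\<lambda>t. \<rho> 0 t *\<^sub>R w (x - t / real (Suc n)))"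

context
  fixes w :: "real \<Rightarrow> complex"
  assumes w: "continuous_on UNIV w"
begin

lemmas continuous_w [continuous_intros] = continuous_on_compose2[OF w _ subset_UNIV]

lemma mollify_integrable: "(\<lambda>t. \<rho> 0 t *\<^sub>R w (x - t / real (Suc n))) integrable_on {0..1}"
  by (intro integrable_continuous_interval continuous_intros) auto

text \<open>The bump is a probability density, so a mollification is a mean of nearby values.
  Convergence, boundedness (with c = 0) and the support property (with c = 0 and e = 0) all follow
  from this estimate.\<close>

lemma mollify_diff_bound:
  assumes "\<And>y. y \<in> {x - 1 / real (Suc n)..x} \<Longrightarrow> norm (w y - c) \<le> e"
  shows "norm (mollify n w x - c) \<le> e"
proof -
  have c: "((\<lambda>t. \<rho> 0 t *\<^sub>R c) has_integral c) {0..1}"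
    using has_integral_scaleR_left[OF integral_1, of c] by simp
  have "mollify n w x - c = integral {0..1} (\<lambda>t. \<rho> 0 t *\<^sub>R (w (x - t / real (Suc n)) - c))"
    unfolding mollify_def using Henstock_Kurzweil_Integration.integral_diff[OF mollify_integrable[of x n] has_integral_integrable[OF c]] integral_unique[OF c]
    by (simp add: scaleR_diff_right)
  also have "norm \<dots> \<le> integral {0..1} (\<lambda>t. \<rho> 0 t * e)"
  proof (rule integral_norm_bound_integral)
    show "(\<lambda>t. \<rho> 0 t *\<^sub>R (w (x - t / real (Suc n)) - c)) integrable_on {0..1}"
      by (intro integrable_continuous_interval continuous_intros) auto
    show "(\<lambda>t. \<rho> 0 t * e) integrable_on {0..1}"
      by (intro integrable_continuous_interval continuous_intros continuous)
    show "norm (\<rho> 0 t *\<^sub>R (w (x - t / real (Suc n)) - c)) \<le> \<rho> 0 t * e" if "t \<in> {0..1}" for t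
    proof -
      have "t / real (Suc n) \<le> 1 / real (Suc n)" "0 \<le> t / real (Suc n)"
        using that by (auto intro!: divide_right_mono)
      then have "norm (w (x - t / real (Suc n)) - c) \<le> e"
        by (intro assms) simp
      then show ?thesis using nonneg[of t] by (simp add: mult_left_mono)
    qed
  qed
  also have "\<dots> = e"
    using integral_unique[OF has_integral_mult_left[OF integral_1, of e]] by simp
  finally show ?thesis .
qed

lemma mollify_tendsto: "(\<lambda>n. mollify n w x) \<longlonglongrightarrow> w x"
proof (rule LIMSEQ_I)
  fix e :: real assume e: "e > 0"
  have "isCont w x" using w by (simp add: continuous_on_eq_continuous_at)
  then obtain d where d: "d > 0" "\<And>y. dist y x < d \<Longrightarrow> dist (w y) (w x) < e / 2"
    using e unfolding continuous_at_eps_delta by (meson half_gt_zero)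
  obtain N where N: "1 / real (Suc N) < d" using d(1) nat_approx_posE by blast
  have "norm (mollify n w x - w x) < e" if "n \<ge> N" for n
  proof -
    have "1 / real (Suc n) \<le> 1 / real (Suc N)" using that by (simp add: field_simps)
    then have "norm (mollify n w x - w x) \<le> e / 2"
      using N d(2) by (intro mollify_diff_bound) (force simp: dist_norm abs_if intro: less_imp_le)
    then show ?thesis using e by simp
  qed
  then show "\<exists>N. \<forall>n\<ge>N. norm (mollify n w x - w x) < e" by blast
qed

lemma mollify_bound: "(\<And>y. norm (w y) \<le> K) \<Longrightarrow> norm (mollify n w x) \<le> K"
  using mollify_diff_bound[of x n 0 K] by simp

lemma mollify_support:
  assumes "\<And>y. y \<notin> {a..b} \<Longrightarrow> w y = 0" and x: "x \<notin> {a..b + 1}"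
  shows "mollify n w x = 0"
proof -
  have "norm (mollify n w x - 0) \<le> 0"
  proof (rule mollify_diff_bound)
    fix y assume y: "y \<in> {x - 1 / real (Suc n)..x}"
    have "1 / real (Suc n) \<le> 1" by simp
    moreover have "x - 1 / real (Suc n) \<le> y" "y \<le> x" using y by auto
    ultimately have "x - 1 \<le> y" "y \<le> x" by linarith+
    then have "y \<notin> {a..b}" using x by auto
    then show "norm (w y - 0) \<le> 0" using assms(1) by simp
  qed
  then show ?thesis by simp
qed

text \<open>Here the derivative falls on \<open>w\<close>, so that derivatives of mollifications
  converge to those of \<open>w\<close>; in \<open>mollify_deriv_c\<close> it falls on the bump,
  which gives smoothness.\<close>

lemma mollify_has_derivative:
  assumes "\<And>x. (w has_vector_derivative w' x) (at x)" "continuous_on UNIV w'"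
  shows "(mollify n w has_vector_derivative mollify n w' x) (at x)"
proof -
  have "((\<lambda>x. integral (cbox 0 1) (\<lambda>t. \<rho> 0 t *\<^sub>R w (x - t / real (Suc n)))) has_vector_derivative
      integral (cbox 0 1) (\<lambda>t. \<rho> 0 t *\<^sub>R w' (x - t / real (Suc n)))) (at x within UNIV)"
  proof (rule leibniz_rule_vector_derivative)
    fix x t :: real
    have "((\<lambda>x. w (x - t / real (Suc n))) has_vector_derivative 1 *\<^sub>R w' (x - t / real (Suc n))) (at x)"
      by (rule vector_diff_chain_at[unfolded o_def, OF _ assms(1)]) (auto intro!: derivative_eq_intros)
    then show "((\<lambda>x. \<rho> 0 t *\<^sub>R w (x - t / real (Suc n))) has_vector_derivative
        \<rho> 0 t *\<^sub>R w' (x - t / real (Suc n))) (at x)"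
      by (auto intro!: derivative_eq_intros)
    show "(\<lambda>t. \<rho> 0 t *\<^sub>R w (x - t / real (Suc n))) integrable_on cbox 0 1"
      using mollify_integrable by simp
    show "continuous_on (UNIV \<times> cbox 0 1) (\<lambda>(x, t). \<rho> 0 t *\<^sub>R w' (x - t / real (Suc n)))"
      unfolding split_beta
      by (intro continuous_intros continuous_on_compose2[OF assms(2) _ subset_UNIV]) auto
  qed auto
  then show ?thesis by (simp add: mollify_def[abs_def])
qed

text \<open>Substituting \<open>y = x - t / (n + 1)\<close> moves the dependence on \<open>x\<close> to the bump, which makes
  the mollification smooth.\<close>

lemma mollify_alt:
  assumes "\<And>y. y \<notin> {a..b} \<Longrightarrow> w y = 0"
  shows "mollify n w x = real (Suc n) *\<^sub>R integral {a..b} (\<lambda>y. \<rho> 0 (real (Suc n) * (x - y)) *\<^sub>R w y)"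
proof -
  define N where "N = real (Suc n)"
  have N: "N > 0" by (simp add: N_def)
  define F where "F y = \<rho> 0 (N * (x - y)) *\<^sub>R w y" for y
  have Fc: "continuous_on S F" for S
    unfolding F_def by (intro continuous_intros)
  have "F y = indicator {a..b} y *\<^sub>R F y" for y
    by (cases "y \<in> {a..b}") (simp_all add: F_def assms)
  then have "(\<integral>y. F y \<partial>lborel) = (LINT y:{a..b}|lborel. F y)"
    unfolding set_lebesgue_integral_def by (intro Bochner_Integration.integral_cong) auto
  also have "\<dots> = integral {a..b} F"
    by (rule set_borel_integral_eq_integral(2)[OF borel_integrable_atLeastAtMost'[OF Fc]])
  finally have 1: "(\<integral>y. F y \<partial>lborel) = integral {a..b} F" .
  have 2: "F (x + (- 1 / N) * t) = indicator {0..1} t *\<^sub>R (\<rho> 0 t *\<^sub>R w (x - t / N))" for t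
    using N support[of t 0] by (cases "t \<in> {0..1}") (auto simp: F_def)
  have "(\<integral>y. F y \<partial>lborel) = \<bar>- 1 / N\<bar> *\<^sub>R (\<integral>t. F (x + (- 1 / N) * t) \<partial>lborel)"
    by (rule lborel_integral_real_affine) (use N in simp)
  also have "(\<integral>t. F (x + (- 1 / N) * t) \<partial>lborel) = (LINT t:{0..1}|lborel. \<rho> 0 t *\<^sub>R w (x - t / N))"
    unfolding set_lebesgue_integral_def 2 ..
  also have "\<dots> = integral {0..1} (\<lambda>t. \<rho> 0 t *\<^sub>R w (x - t / N))"
    using N by (intro set_borel_integral_eq_integral(2) borel_integrable_atLeastAtMost' continuous_intros) auto
  finally have "integral {a..b} F = (1 / N) *\<^sub>R mollify n w x"
    using N by (simp add: 1 mollify_def N_def)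
  then have "mollify n w x = N *\<^sub>R integral {a..b} F" using N by simp
  then show ?thesis by (simp add: F_def[abs_def] N_def)
qed

lemma mollify_deriv_c:
  assumes out: "\<And>y. y \<notin> {a..b} \<Longrightarrow> w y = 0"
  shows "(deriv_c ^^ k) (mollify n w) =
    (\<lambda>x. real (Suc n) ^ Suc k *\<^sub>R integral {a..b} (\<lambda>y. \<rho> k (real (Suc n) * (x - y)) *\<^sub>R w y))"
    and "(deriv_c ^^ k) (mollify n w) differentiable (at x)"
proof -
  define N where "N = real (Suc n)"
  define F where "F k x = N ^ Suc k *\<^sub>R integral {a..b} (\<lambda>y. \<rho> k (N * (x - y)) *\<^sub>R w y)" for k x
  have F: "(F k has_vector_derivative F (Suc k) x) (at x)" for k x
  proof -
    have "((\<lambda>x. integral (cbox a b) (\<lambda>y. \<rho> k (N * (x - y)) *\<^sub>R w y)) has_vector_derivative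
      integral (cbox a b) (\<lambda>y. (N * \<rho> (Suc k) (N * (x - y))) *\<^sub>R w y)) (at x within UNIV)"
    proof (rule leibniz_rule_vector_derivative)
      fix x y :: real
      have "((\<lambda>x. \<rho> k (N * (x - y))) has_real_derivative \<rho> (Suc k) (N * (x - y)) * N) (at x)"
        by (rule DERIV_chain2[OF deriv]) (auto intro!: derivative_eq_intros)
      then show "((\<lambda>x. \<rho> k (N * (x - y)) *\<^sub>R w y) has_vector_derivative
          (N * \<rho> (Suc k) (N * (x - y))) *\<^sub>R w y) (at x)"
        by (auto intro!: derivative_eq_intros simp: mult.commute)
      show "(\<lambda>y. \<rho> k (N * (x - y)) *\<^sub>R w y) integrable_on cbox a b"
        by (intro integrable_continuous continuous_intros)
      show "continuous_on (UNIV \<times> cbox a b) (\<lambda>(x, y). (N * \<rho> (Suc k) (N * (x - y))) *\<^sub>R w y)"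
        unfolding split_beta by (intro continuous_intros)
    qed auto
    also have "integral (cbox a b) (\<lambda>y. (N * \<rho> (Suc k) (N * (x - y))) *\<^sub>R w y) =
        N *\<^sub>R integral {a..b} (\<lambda>y. \<rho> (Suc k) (N * (x - y)) *\<^sub>R w y)"
      by (simp flip: scaleR_scaleR)
    finally have *: "((\<lambda>x. integral {a..b} (\<lambda>y. \<rho> k (N * (x - y)) *\<^sub>R w y)) has_vector_derivative
      N *\<^sub>R integral {a..b} (\<lambda>y. \<rho> (Suc k) (N * (x - y)) *\<^sub>R w y)) (at x)" by simp
    show ?thesis
      unfolding F_def[abs_def] using has_vector_derivative_scaleR[OF DERIV_const *, of "N ^ Suc k"]
      by (simp add: mult.commute)
  qed
  have eq: "(deriv_c ^^ k) (mollify n w) = F k" for k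
  proof (induction k)
    case 0
    show ?case using mollify_alt[OF out] by (simp add: F_def N_def fun_eq_iff)
  next
    case (Suc k)
    have "deriv_c (F k) = F (Suc k)" using vector_derivative_at[OF F] by (simp add: deriv_c_def fun_eq_iff)
    then show ?case using Suc by simp
  qed
  show "(deriv_c ^^ k) (mollify n w) =
    (\<lambda>x. real (Suc n) ^ Suc k *\<^sub>R integral {a..b} (\<lambda>y. \<rho> k (real (Suc n) * (x - y)) *\<^sub>R w y))"
    unfolding eq by (simp add: F_def[abs_def] N_def)
  show "(deriv_c ^^ k) (mollify n w) differentiable (at x)"
    unfolding eq using F by (rule differentiableI_vector)
qed

end

end

text \<open>The operator is defined by testing with smooth functions, whereas the solutions used
  later have only two continuous derivatives. Mollifications of \<open>cnj v\<close> are admissible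
  and converge together with their second derivatives inside a fixed interval away from 0, where the
  potential is bounded. The conjugate undoes the one in \<open>L2_inner\<close>.\<close>

lemma bessel_operator_weak:
  fixes v v1 v2 :: "real \<Rightarrow> complex"
  assumes uf: "(u, f) \<in> bessel_operator \<nu>"
    and v: "\<And>x. (v has_vector_derivative v1 x) (at x)" "\<And>x. (v1 has_vector_derivative v2 x) (at x)"
    and v2: "continuous_on UNIV v2"
    and ab: "0 < a" and out: "\<And>x. x \<notin> {a..b} \<Longrightarrow> v x = 0 \<and> v1 x = 0 \<and> v2 x = 0"
  shows "(LINT r|half_line. u r * (- v2 r + of_real ((\<nu>\<^sup>2 - 1/4) / r\<^sup>2) * v r)) = (LINT r|half_line. f r * v r)"
proof -
  obtain \<rho> where "bump \<rho>" using smooth_bump_exists unfolding bump_def by blast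
  then interpret bump \<rho> .
  have uL: "u \<in> L2" and fL: "f \<in> L2"
    and eq: "\<And>\<phi>. \<phi> \<in> test_functions \<Longrightarrow> L2_inner u (bessel_expr \<nu> \<phi>) = L2_inner f \<phi>"
    using uf by (auto simp: bessel_operator_def friedrichs_extension_def form_domain_def)
  have [measurable]: "u \<in> borel_measurable half_line" "f \<in> borel_measurable half_line"
    using uL fL by (auto dest: L2_measurable)
  define c c1 c2 where "c = (\<lambda>x. cnj (v x))" and "c1 = (\<lambda>x. cnj (v1 x))" and "c2 = (\<lambda>x. cnj (v2 x))"
  have c: "(c has_vector_derivative c1 x) (at x)" "(c1 has_vector_derivative c2 x) (at x)" for x
    using v by (auto simp: c_def c1_def c2_def intro: has_vector_derivative_cnj)
  have cc: "continuous_on UNIV c" "continuous_on UNIV c1" "continuous_on UNIV c2"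
    using c v2 by (auto intro!: continuous_at_imp_continuous_on has_vector_derivative_continuous
        continuous_intros simp: c2_def)
  have cout: "c x = 0" "c1 x = 0" "c2 x = 0" if "x \<notin> {a..b}" for x
    using out[OF that] by (auto simp: c_def c1_def c2_def)
  have bounded: "\<exists>K. \<forall>x. norm (w x) \<le> K" if "continuous_on UNIV w" "\<And>x. x \<notin> {a..b} \<Longrightarrow> w x = 0" for w :: "real \<Rightarrow> complex"
  proof -
    have "compact (w ` {a..b})"
      using that(1) by (intro compact_continuous_image compact_Icc) (blast intro: continuous_on_subset)
    then obtain K where "\<forall>z\<in>w ` {a..b}. norm z \<le> K" using compact_imp_bounded bounded_iff by blast
    then have "norm (w x) \<le> max K 0" for x by (cases "x \<in> {a..b}") (auto simp: that(2) intro: max.coboundedI1)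
    then show ?thesis by blast
  qed
  obtain K K2 where K: "\<And>x. norm (c x) \<le> K" and K2: "\<And>x. norm (c2 x) \<le> K2"
    using bounded[OF cc(1) cout(1)] bounded[OF cc(3) cout(3)] by blast
  define \<phi> where "\<phi> n = mollify n c" for n
  have d1: "deriv_c (\<phi> n) = mollify n c1" for n
    using vector_derivative_at[OF mollify_has_derivative[OF cc(1) c(1) cc(2)]] by (simp add: \<phi>_def deriv_c_def fun_eq_iff)
  have d2: "deriv_c (deriv_c (\<phi> n)) = mollify n c2" for n
    using vector_derivative_at[OF mollify_has_derivative[OF cc(2) c(2) cc(3)]] unfolding d1 by (simp add: deriv_c_def fun_eq_iff)
  have supp: "\<phi> n x = 0" "mollify n c2 x = 0" if "x \<notin> {a..b+1}" for n x
    using mollify_support[OF cc(1) cout(1) that] mollify_support[OF cc(3) cout(3) that] by (auto simp: \<phi>_def)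
  have test: "\<phi> n \<in> test_functions" for n
  proof -
    have "(deriv_c ^^ k) (\<phi> n) differentiable (at x)" for k x
      unfolding \<phi>_def by (rule mollify_deriv_c(2)[OF cc(1) cout(1)])
    \<comment> \<open>The interval \<open>{a..b}\<close> may be empty, and then b + 1 need not reach
      a; hence the maximum.\<close>
    moreover have "\<exists>a b. 0 < a \<and> a \<le> b \<and> (\<forall>x. x \<notin> {a..b} \<longrightarrow> \<phi> n x = 0)"
      by (rule exI[of _ a], rule exI[of _ "max a (b + 1)"]) (use supp(1) ab in \<open>auto simp: not_le\<close>)
    ultimately show ?thesis by (simp add: test_functions_def)
  qed
  define V where "V r = (\<nu>\<^sup>2 - 1/4) / r\<^sup>2" for r :: real
  define V0 where "V0 = \<bar>\<nu>\<^sup>2 - 1/4\<bar> / a\<^sup>2"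
  have Vb: "\<bar>V r\<bar> \<le> V0" if "r \<ge> a" for r
    using that ab unfolding V_def V0_def abs_divide by (intro divide_left_mono) (auto intro: power_mono)
  have Vm [measurable]: "V \<in> borel_measurable half_line" unfolding V_def[abs_def] by measurable
  have meas: "w \<in> borel_measurable half_line" if "continuous_on UNIV w" for w :: "real \<Rightarrow> complex"
    using continuous_imp_measurable_on_sets_lebesgue[OF continuous_on_subset[OF that subset_UNIV], of "{0<..}"] by simp
  have pc: "continuous_on UNIV (mollify n w)" if "continuous_on UNIV w" "\<And>x. x \<notin> {a..b} \<Longrightarrow> w x = 0" for n w
    using mollify_deriv_c(2)[OF that(1,2), of a b 0 n] by (auto intro!: continuous_at_imp_continuous_on differentiable_imp_continuous_within)
  have vm [measurable]: "v \<in> borel_measurable half_line" "v2 \<in> borel_measurable half_line"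
    using v v2 by (auto intro!: meas continuous_at_imp_continuous_on has_vector_derivative_continuous)
  have pm [measurable]: "\<phi> n \<in> borel_measurable half_line" "mollify n c2 \<in> borel_measurable half_line" for n
    unfolding \<phi>_def by (auto intro!: meas pc cc cout)
  have cnjm: "(\<lambda>r. cnj (w r)) \<in> borel_measurable half_line" if "w \<in> borel_measurable half_line" for w :: "real \<Rightarrow> complex"
    using measurable_compose[OF that, of cnj borel] by (simp add: borel_measurable_continuous_onI continuous_on_cnj)
  have dom: "integrable half_line (\<lambda>r. norm (h r) * (indicator {a..b+1} r * C))" if "h \<in> L2" for h and C :: real
  proof -
    have "(\<lambda>r. of_real (indicator {a..b+1} r * C)) \<in> L2"
    proof (rule L2I)
      have 1: "integrable half_line (indicator {a..b+1} :: real \<Rightarrow> real)"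
      proof -
        have "{0<..} \<inter> {a..b+1} = {a..b+1}" using ab by auto
        moreover have "integrable lebesgue (indicator {a..b+1} :: real \<Rightarrow> real)"
          by (rule integrable_real_indicator) (simp_all add: emeasure_lborel_Icc_eq)
        ultimately show ?thesis by (simp add: integrable_restrict_space indicator_inter_arith[symmetric])
      qed
      have "integrable half_line (\<lambda>r. C\<^sup>2 * indicator {a..b+1} r)" by (intro integrable_mult_right 1)
      moreover have "(\<lambda>r. (norm (complex_of_real (indicator {a..b+1} r * C)))\<^sup>2) = (\<lambda>r. C\<^sup>2 * indicator {a..b+1} r)"
        by (auto simp: indicator_def)
      ultimately show "integrable half_line (\<lambda>r. (norm (complex_of_real (indicator {a..b+1} r * C)))\<^sup>2)" by simp
    qed measurable
    from integrable_norm[OF L2_mult_integrable[OF that this]]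
    have "integrable half_line (\<lambda>r. norm (h r) * (indicator {a..b+1} r * \<bar>C\<bar>))"
      by (simp add: norm_mult abs_mult)
    \<comment> \<open>The sign of \<open>C\<close> is arbitrary; it is restored through C = sgn C *
      \<bar>C\<bar>.\<close>
    then have "integrable half_line (\<lambda>r. sgn C * (norm (h r) * (indicator {a..b+1} r * \<bar>C\<bar>)))"
      by (rule integrable_mult_right)
    then show ?thesis by (simp add: mult.left_commute[of "sgn C"] sgn_mult_abs)
  qed
  have be: "bessel_expr \<nu> (\<phi> n) r = - mollify n c2 r + of_real (V r) * mollify n c r" for n r
    by (simp only: bessel_expr_def d2 V_def) (simp only: \<phi>_def)
  have "(\<lambda>n. LINT r|half_line. u r * cnj (bessel_expr \<nu> (\<phi> n) r)) \<longlonglongrightarrow>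
      (LINT r|half_line. u r * (- v2 r + of_real (V r) * v r))"
  proof (rule integral_dominated_convergence[where w = "\<lambda>r. norm (u r) * (indicator {a..b+1} r * (K2 + V0 * K))"])
    show "(\<lambda>r. u r * (- v2 r + of_real (V r) * v r)) \<in> borel_measurable half_line" by measurable
    show "(\<lambda>r. u r * cnj (bessel_expr \<nu> (\<phi> n) r)) \<in> borel_measurable half_line" for n
    proof -
      have "bessel_expr \<nu> (\<phi> n) \<in> borel_measurable half_line"
        unfolding bessel_expr_def[abs_def] d2 by measurable
      from cnjm[OF this] show ?thesis by measurable
    qed
    show "integrable half_line (\<lambda>r. norm (u r) * (indicator {a..b+1} r * (K2 + V0 * K)))" by (rule dom[OF uL])
    show "AE r in half_line. (\<lambda>n. u r * cnj (bessel_expr \<nu> (\<phi> n) r)) \<longlonglongrightarrow> u r * (- v2 r + of_real (V r) * v r)"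
    proof (rule AE_I2)
      fix r :: real
      have "(\<lambda>n. u r * cnj (- mollify n c2 r + of_real (V r) * mollify n c r)) \<longlonglongrightarrow> u r * cnj (- c2 r + of_real (V r) * c r)"
        by (intro tendsto_intros mollify_tendsto cc)
      then show "(\<lambda>n. u r * cnj (bessel_expr \<nu> (\<phi> n) r)) \<longlonglongrightarrow> u r * (- v2 r + of_real (V r) * v r)"
        unfolding be by (simp add: c2_def c_def)
    qed
    show "AE r in half_line. norm (u r * cnj (bessel_expr \<nu> (\<phi> n) r)) \<le> norm (u r) * (indicator {a..b+1} r * (K2 + V0 * K))" for n
    proof (rule AE_I2)
      fix r :: real
      show "norm (u r * cnj (bessel_expr \<nu> (\<phi> n) r)) \<le> norm (u r) * (indicator {a..b+1} r * (K2 + V0 * K))"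
      proof (cases "r \<in> {a..b+1}")
        case True
        have "norm (- mollify n c2 r + of_real (V r) * mollify n c r) \<le> norm (mollify n c2 r) + \<bar>V r\<bar> * norm (mollify n c r)"
          using norm_triangle_ineq[of "- mollify n c2 r" "of_real (V r) * mollify n c r"] by (simp add: norm_mult)
        also have "\<dots> \<le> K2 + V0 * K"
          using Vb[of r] True by (intro add_mono mult_mono mollify_bound cc K K2) (auto simp: V0_def)
        finally show ?thesis
          using True unfolding be norm_mult complex_mod_cnj by (auto intro!: mult_left_mono)
      qed (use supp in \<open>simp add: bessel_expr_def d2\<close>)
    qed
  qed
  moreover have "(\<lambda>n. LINT r|half_line. f r * cnj (\<phi> n r)) \<longlonglongrightarrow> (LINT r|half_line. f r * v r)"
  proof (rule integral_dominated_convergence[where w = "\<lambda>r. norm (f r) * (indicator {a..b+1} r * K)"])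
    show "(\<lambda>r. f r * v r) \<in> borel_measurable half_line" by measurable
    show "(\<lambda>r. f r * cnj (\<phi> n r)) \<in> borel_measurable half_line" for n
      using cnjm[OF pm(1)[of n]] by measurable
    show "integrable half_line (\<lambda>r. norm (f r) * (indicator {a..b+1} r * K))" by (rule dom[OF fL])
    show "AE r in half_line. (\<lambda>n. f r * cnj (\<phi> n r)) \<longlonglongrightarrow> f r * v r"
    proof (rule AE_I2)
      fix r :: real
      have "(\<lambda>n. f r * cnj (mollify n c r)) \<longlonglongrightarrow> f r * cnj (c r)"
        by (intro tendsto_intros mollify_tendsto cc)
      then show "(\<lambda>n. f r * cnj (\<phi> n r)) \<longlonglongrightarrow> f r * v r" by (simp add: \<phi>_def c_def)
    qed
    show "AE r in half_line. norm (f r * cnj (\<phi> n r)) \<le> norm (f r) * (indicator {a..b+1} r * K)" for n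
    proof (rule AE_I2)
      fix r :: real
      show "norm (f r * cnj (\<phi> n r)) \<le> norm (f r) * (indicator {a..b+1} r * K)"
        using mollify_bound[OF cc(1) K, of n r] supp(1)[of r n]
        by (cases "r \<in> {a..b+1}") (auto simp: norm_mult \<phi>_def intro!: mult_left_mono)
    qed
  qed
  moreover have "(LINT r|half_line. u r * cnj (bessel_expr \<nu> (\<phi> n) r)) = (LINT r|half_line. f r * cnj (\<phi> n r))" for n
    using eq[OF test[of n]] by (simp add: L2_inner_def)
  ultimately show ?thesis
    unfolding V_def using LIMSEQ_unique by simp
qed

section \<open>The weighted resolvent tested against twice differentiable functions\<close>

lemma tendsto_L2_pair:
  assumes "\<And>n. f n \<in> L2" "g \<in> L2" "h \<in> L2" "(\<lambda>n. L2_norm (\<lambda>r. f n r - g r)) \<longlonglongrightarrow> 0"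
  shows "(\<lambda>n. LINT r|half_line. f n r * h r) \<longlonglongrightarrow> (LINT r|half_line. g r * h r)"
proof -
  have "(\<lambda>n. (LINT r|half_line. f n r * h r) - (LINT r|half_line. g r * h r)) \<longlonglongrightarrow> 0"
  proof (rule Lim_null_comparison)
    show "\<forall>\<^sub>F n in sequentially. norm ((LINT r|half_line. f n r * h r) - (LINT r|half_line. g r * h r))
        \<le> L2_norm (\<lambda>r. f n r - g r) * L2_norm h"
    proof (intro always_eventually allI)
      fix n
      have "(LINT r|half_line. f n r * h r) - (LINT r|half_line. g r * h r) = (LINT r|half_line. (f n r - g r) * h r)"
        using L2_mult_integrable[OF assms(1,3)] L2_mult_integrable[OF assms(2,3)] by (simp add: left_diff_distrib)
      then show "norm ((LINT r|half_line. f n r * h r) - (LINT r|half_line. g r * h r))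
        \<le> L2_norm (\<lambda>r. f n r - g r) * L2_norm h"
        using L2_Cauchy_Schwarz[OF L2_minus[OF assms(1)[of n] assms(2)] assms(3)] by simp
    qed
    show "(\<lambda>n. L2_norm (\<lambda>r. f n r - g r) * L2_norm h) \<longlonglongrightarrow> 0"
      using tendsto_mult_right[OF assms(4), of "L2_norm h"] by simp
  qed
  then show ?thesis by (simp add: LIM_zero_iff)
qed

lemma bounded_L2_operator_L2: "bounded_L2_operator T \<Longrightarrow> f \<in> L2 \<Longrightarrow> T f \<in> L2"
  by (simp add: bounded_L2_operator_def)

lemma bounded_L2_operator_add:
  "bounded_L2_operator T \<Longrightarrow> f \<in> L2 \<Longrightarrow> g \<in> L2 \<Longrightarrow> AE r in half_line. T (\<lambda>s. f s + g s) r = T f r + T g r"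
  by (simp add: bounded_L2_operator_def)

lemma bounded_L2_operator_scale:
  "bounded_L2_operator T \<Longrightarrow> f \<in> L2 \<Longrightarrow> AE r in half_line. T (\<lambda>s. c * f s) r = c * T f r"
  by (simp add: bounded_L2_operator_def)

lemma bounded_L2_operator_tendsto:
  assumes T: "bounded_L2_operator T" and f: "\<And>n. f n \<in> L2" "g \<in> L2"
    and lim: "(\<lambda>n. L2_norm (\<lambda>r. f n r - g r)) \<longlonglongrightarrow> 0"
  shows "(\<lambda>n. L2_norm (\<lambda>r. T (f n) r - T g r)) \<longlonglongrightarrow> 0"
proof -
  obtain C where C: "\<And>f. f \<in> L2 \<Longrightarrow> L2_norm (T f) \<le> C * L2_norm f"
    using T unfolding bounded_L2_operator_def by blast
  have eq: "L2_norm (\<lambda>r. T (f n) r - T g r) = L2_norm (T (\<lambda>r. f n r - g r))" for n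
  proof -
    have m: "(\<lambda>r. -1 * g r) \<in> L2" by (intro L2_scale f)
    have "AE r in half_line. T (\<lambda>s. f n s + -1 * g s) r = T (f n) r + T (\<lambda>s. -1 * g s) r"
      by (rule bounded_L2_operator_add[OF T f(1) m])
    moreover have "AE r in half_line. T (\<lambda>s. -1 * g s) r = -1 * T g r"
      by (rule bounded_L2_operator_scale[OF T f(2)])
    ultimately have "AE r in half_line. T (f n) r - T g r = T (\<lambda>r. f n r - g r) r"
      by eventually_elim simp
    then show ?thesis
      by (intro L2_norm_cong_AE L2_minus bounded_L2_operator_L2[OF T] f)
  qed
  have "(\<lambda>n. C * L2_norm (\<lambda>r. f n r - g r)) \<longlonglongrightarrow> 0"
    using tendsto_mult_left[OF lim, of C] by simp
  then show ?thesis
    by (rule Lim_null_comparison[rotated])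
      (use C L2_minus[OF f(1) f(2)] in \<open>auto simp: eq\<close>)
qed

lemma continuous_measurable_half_line:
  fixes f :: "real \<Rightarrow> 'a::euclidean_space"
  shows "continuous_on {0<..} f \<Longrightarrow> f \<in> borel_measurable half_line"
  by (rule continuous_imp_measurable_on_sets_lebesgue) auto

lemma L2_compact_support:
  fixes f :: "real \<Rightarrow> complex"
  assumes f: "continuous_on {0<..} f" and "0 < a" and out: "\<And>r. r > 0 \<Longrightarrow> r \<notin> {a..b} \<Longrightarrow> f r = 0"
  shows "f \<in> L2"
proof -
  have "continuous_on {a..b} f"
    using \<open>0 < a\<close> by (intro continuous_on_subset[OF f]) auto
  then have "bounded (f ` {a..b})" by (intro compact_imp_bounded compact_continuous_image compact_Icc)
  then obtain K where K: "\<And>r. r \<in> {a..b} \<Longrightarrow> norm (f r) \<le> K" unfolding bounded_iff by blast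
  have 1: "integrable half_line (indicator {a..b} :: real \<Rightarrow> real)"
  proof -
    have "{0<..} \<inter> {a..b} = {a..b}" using \<open>0 < a\<close> by auto
    moreover have "integrable lebesgue (indicator {a..b} :: real \<Rightarrow> real)"
      by (rule integrable_real_indicator) (simp_all add: emeasure_lborel_Icc_eq)
    ultimately show ?thesis by (simp add: integrable_restrict_space indicator_inter_arith[symmetric])
  qed
  show ?thesis
  proof (rule L2_bound[of _ "\<lambda>r. K * indicator {a..b} r"])
    show "f \<in> borel_measurable half_line" by (rule continuous_measurable_half_line[OF f])
    have "integrable half_line (\<lambda>r. K\<^sup>2 * indicator {a..b} r)" by (intro integrable_mult_right 1)
    moreover have "(\<lambda>r. (K * indicator {a..b} r)\<^sup>2) = (\<lambda>r. K\<^sup>2 * indicator {a..b} r)"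
      by (auto simp: indicator_def)
    ultimately show "integrable half_line (\<lambda>r. (K * indicator {a..b} r)\<^sup>2)" by simp
    show "norm (f r) \<le> K * indicator {a..b} r" if "r > 0" for r
      using K[of r] out[OF that] by (cases "r \<in> {a..b}") auto
  qed
qed

text \<open>If \<open>inv_r g\<close> is in \<open>L2\<close>, then \<open>B g\<close> is u / r
  where u solves the resolvent equation with source g / r, and the factor r in the test function
  turns \<open>B g\<close> back into u. Every other g is reached by \<open>L2_cutoff\<close>, since
  both sides are continuous in g.\<close>

lemma weighted_resolvent_weak_compact:
  fixes v v1 v2 :: "real \<Rightarrow> complex"
  assumes B: "is_weighted_resolvent \<nu> z B" and g: "g \<in> L2"
    and v: "\<And>x. (v has_vector_derivative v1 x) (at x)" "\<And>x. (v1 has_vector_derivative v2 x) (at x)"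
    and v2: "continuous_on UNIV v2"
    and ab: "0 < a" and out: "\<And>x. x \<notin> {a..b} \<Longrightarrow> v x = 0 \<and> v1 x = 0 \<and> v2 x = 0"
  shows "(LINT r|half_line. B g r * (of_real r * (- v2 r + of_real ((\<nu>\<^sup>2 - 1/4) / r\<^sup>2) * v r - z * v r)))
    = (LINT r|half_line. g r * (v r / of_real r))"
proof -
  have bB: "bounded_L2_operator B" using B by (simp add: is_weighted_resolvent_def)
  have vc: "continuous_on S v" for S
    using v(1) by (auto intro!: continuous_at_imp_continuous_on has_vector_derivative_continuous)
  have v2c: "continuous_on S v2" for S by (rule continuous_on_subset[OF v2]) simp
  define V where "V r = complex_of_real ((\<nu>\<^sup>2 - 1/4) / r\<^sup>2)" for r
  have L: "v \<in> L2" "(\<lambda>r. v r / of_real r) \<in> L2" "(\<lambda>r. - v2 r + V r * v r) \<in> L2"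
    "(\<lambda>r. of_real r * (- v2 r + V r * v r - z * v r)) \<in> L2"
    unfolding V_def by (rule L2_compact_support[OF _ ab, of _ b], (intro continuous_intros vc v2c; simp), use out in simp)+
  have main: "(LINT r|half_line. B g r * (of_real r * (- v2 r + V r * v r - z * v r)))
    = (LINT r|half_line. g r * (v r / of_real r))" if g: "g \<in> L2" "inv_r g \<in> L2" for g
  proof -
    obtain u f where uf: "(u, f) \<in> bessel_operator \<nu>"
      and f: "AE r in half_line. f r - z * u r = inv_r g r" and Bg: "AE r in half_line. B g r = inv_r u r"
      using B g unfolding is_weighted_resolvent_def resolvent_graph_def by blast
    have uL: "u \<in> L2" and fL: "f \<in> L2"
      using uf by (auto simp: bessel_operator_def friedrichs_extension_def form_domain_def)
    have "(LINT r|half_line. B g r * (of_real r * (- v2 r + V r * v r - z * v r))) =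
        (LINT r|half_line. u r * (- v2 r + V r * v r) - z * (u r * v r))"
    proof (rule integral_cong_AE)
      show "(\<lambda>r. B g r * (of_real r * (- v2 r + V r * v r - z * v r))) \<in> borel_measurable half_line"
        by (rule borel_measurable_integrable[OF L2_mult_integrable[OF bounded_L2_operator_L2[OF bB g(1)] L(4)]])
      show "(\<lambda>r. u r * (- v2 r + V r * v r) - z * (u r * v r)) \<in> borel_measurable half_line"
        by (intro borel_measurable_integrable Bochner_Integration.integrable_diff integrable_mult_right
            L2_mult_integrable uL L)
      have "AE r in half_line. r \<noteq> 0" by (rule AE_I2) auto
      with Bg show "AE r in half_line. B g r * (of_real r * (- v2 r + V r * v r - z * v r)) =
          u r * (- v2 r + V r * v r) - z * (u r * v r)"
      proof eventually_elim
        case (elim r)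
        then have "B g r * of_real r = u r" by (simp add: inv_r_def)
        then have "B g r * (of_real r * (- v2 r + V r * v r - z * v r)) = u r * (- v2 r + V r * v r - z * v r)"
          by (metis mult.assoc)
        then show ?case by (simp add: algebra_simps)
      qed
    qed
    also have "\<dots> = (LINT r|half_line. u r * (- v2 r + V r * v r)) - z * (LINT r|half_line. u r * v r)"
      using L2_mult_integrable[OF uL L(3)] L2_mult_integrable[OF uL L(1)] by simp
    also have "(LINT r|half_line. u r * (- v2 r + V r * v r)) = (LINT r|half_line. f r * v r)"
      unfolding V_def by (rule bessel_operator_weak[OF uf v v2 ab out])
    also have "(LINT r|half_line. f r * v r) - z * (LINT r|half_line. u r * v r) =
        (LINT r|half_line. f r * v r - z * (u r * v r))"
      using L2_mult_integrable[OF fL L(1)] L2_mult_integrable[OF uL L(1)] by simp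
    also have "\<dots> = (LINT r|half_line. g r * (v r / of_real r))"
    proof (rule integral_cong_AE)
      show "(\<lambda>r. f r * v r - z * (u r * v r)) \<in> borel_measurable half_line"
        by (intro borel_measurable_integrable Bochner_Integration.integrable_diff integrable_mult_right
            L2_mult_integrable uL fL L)
      show "(\<lambda>r. g r * (v r / of_real r)) \<in> borel_measurable half_line"
        by (rule borel_measurable_integrable[OF L2_mult_integrable[OF g(1) L(2)]])
      show "AE r in half_line. f r * v r - z * (u r * v r) = g r * (v r / of_real r)"
        using f by eventually_elim (simp add: inv_r_def flip: mult.assoc left_diff_distrib)
    qed
    finally show ?thesis .
  qed
  define G where "G n = (\<lambda>r. if r \<ge> 1 / real (Suc n) then g r else 0)" for n
  have G: "G n \<in> L2" "inv_r (G n) \<in> L2" "(\<lambda>n. L2_norm (\<lambda>r. G n r - g r)) \<longlonglongrightarrow> 0" for n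
    using L2_cutoff[OF g] by (auto simp: G_def)
  have "(\<lambda>n. LINT r|half_line. B (G n) r * (of_real r * (- v2 r + V r * v r - z * v r))) \<longlonglongrightarrow>
      (LINT r|half_line. B g r * (of_real r * (- v2 r + V r * v r - z * v r)))"
    by (rule tendsto_L2_pair[OF _ _ L(4)]) (rule bounded_L2_operator_L2[OF bB] bounded_L2_operator_tendsto[OF bB] G g)+
  moreover have "(\<lambda>n. LINT r|half_line. G n r * (v r / of_real r)) \<longlonglongrightarrow> (LINT r|half_line. g r * (v r / of_real r))"
    by (rule tendsto_L2_pair[OF G(1) g L(2) G(3)])
  ultimately show ?thesis
    unfolding main[OF G(1,2)] V_def[symmetric] by (rule LIMSEQ_unique)
qed

lemma (in bump) smooth_step:
  "\<exists>\<eta>. (\<forall>x. (\<eta> has_real_derivative \<rho> 0 x) (at x)) \<and> (\<forall>x\<le>0. \<eta> x = 0) \<and> (\<forall>x\<ge>1. \<eta> x = 1)"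
proof -
  define \<eta> where "\<eta> x = integral {-2..x} (\<rho> 0)" for x
  have 0: "\<eta> x = 0" if "x \<le> 0" for x
  proof -
    have "\<eta> x = integral {-2..x} (\<lambda>x. 0)"
      unfolding \<eta>_def by (rule integral_cong) (use that support[of _ 0] in auto)
    then show ?thesis by simp
  qed
  have 1: "\<eta> x = 1" if "x \<ge> 1" for x
  proof -
    have "(\<rho> 0 has_integral 1) {-2..x}"
      by (rule has_integral_on_superset[OF integral_1]) (use that support[of _ 0] in auto)
    then show ?thesis by (simp add: \<eta>_def integral_unique)
  qed
  have "(\<eta> has_real_derivative \<rho> 0 x) (at x)" for x
  proof (cases "x < 0")
    case True
    have "((\<lambda>x. 0) has_real_derivative \<rho> 0 x) (at x)" using True support[of x 0] by simp
    then show ?thesis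
      by (rule has_field_derivative_transform_within_open[of _ _ _ "{..<0}"]) (use True 0 in auto)
  next
    case False
    have "(\<eta> has_real_derivative \<rho> 0 x) (at x within {-2..x+1})"
      unfolding \<eta>_def[abs_def] by (rule integral_has_real_derivative[OF continuous]) (use False in auto)
    then show ?thesis
      using False at_within_interior[of x "{-2..x+1}"] by auto
  qed
  with 0 1 show ?thesis by blast
qed

text \<open>Removes the compact support. Cutting \<open>v\<close> off near 0 and near infinity
  leaves commutator terms r X'' v and 2 r X' v', where X' is of order 1/r and X'' of order 1/r^2
  near 0, and both are bounded far out. The weights (1 + r^2)/r and 1 + r^2 in the hypotheses
  dominate them, so dominated convergence disposes of them without a rate. At the origin this works
  because the pairing is with \<open>B g\<close> itself, which is square-integrable.\<close>

lemma weighted_resolvent_weak: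
  fixes v v1 v2 :: "real \<Rightarrow> complex"
  assumes B: "is_weighted_resolvent \<nu> z B" and g: "g \<in> L2"
    and v: "\<And>x. x > 0 \<Longrightarrow> (v has_vector_derivative v1 x) (at x)"
      "\<And>x. x > 0 \<Longrightarrow> (v1 has_vector_derivative v2 x) (at x)"
    and v2: "continuous_on {0<..} v2"
    and L: "(\<lambda>r. of_real ((1 + r\<^sup>2) / r) * v r) \<in> L2" "(\<lambda>r. of_real (1 + r\<^sup>2) * v1 r) \<in> L2"
      "(\<lambda>r. of_real r * (- v2 r + of_real ((\<nu>\<^sup>2 - 1/4) / r\<^sup>2) * v r - z * v r)) \<in> L2"
  shows "(LINT r|half_line. B g r * (of_real r * (- v2 r + of_real ((\<nu>\<^sup>2 - 1/4) / r\<^sup>2) * v r - z * v r)))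
    = (LINT r|half_line. g r * (v r / of_real r))"
proof -
  obtain \<rho> where "bump \<rho>" using smooth_bump_exists unfolding bump_def by blast
  then interpret bump \<rho> .
  obtain \<eta> where \<eta>: "\<And>x. (\<eta> has_real_derivative \<rho> 0 x) (at x)" "\<And>x. x \<le> 0 \<Longrightarrow> \<eta> x = 0" "\<And>x. x \<ge> 1 \<Longrightarrow> \<eta> x = 1"
    using smooth_step by blast
  have bounded: "\<exists>K\<ge>0. \<forall>x. \<bar>w x\<bar> \<le> K" if "continuous_on UNIV w" "\<And>x. x \<notin> {0..1} \<Longrightarrow> \<bar>w x\<bar> \<le> 1" for w :: "real \<Rightarrow> real"
  proof -
    have "compact (w ` {0..1})"
      using that(1) by (intro compact_continuous_image compact_Icc) (blast intro: continuous_on_subset)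
    then obtain K where K: "\<forall>z\<in>w ` {0..1}. norm z \<le> K" using compact_imp_bounded bounded_iff by blast
    have "\<bar>w x\<bar> \<le> max K 1" for x
      using K that(2)[of x] by (cases "x \<in> {0..1}") (auto intro: max.coboundedI1)
    then show ?thesis by (intro exI[of _ "max K 1"]) auto
  qed
  have \<eta>c: "continuous_on UNIV \<eta>"
    using \<eta>(1) by (intro continuous_at_imp_continuous_on ballI) (blast intro: DERIV_isCont)
  have "\<bar>\<eta> x\<bar> \<le> 1" if "x \<notin> {0..1}" for x using \<eta>(2,3)[of x] that by (cases "x \<le> 0") auto
  then obtain K where K: "K \<ge> 0" "\<And>x. \<bar>\<eta> x\<bar> \<le> K" using bounded[OF \<eta>c] by blast
  have "\<bar>\<rho> k x\<bar> \<le> 1" if "x \<notin> {0..1}" for x k using support[of x k] that by auto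
  then have "\<exists>K\<ge>0. \<forall>x. \<bar>\<rho> k x\<bar> \<le> K" for k by (intro bounded continuous)
  then obtain K0 K1 where K0: "K0 \<ge> 0" "\<And>x. \<bar>\<rho> 0 x\<bar> \<le> K0" and K1: "K1 \<ge> 0" "\<And>x. \<bar>\<rho> 1 x\<bar> \<le> K1" by meson
  define N where "N n = real (Suc n)" for n
  have N: "N n \<ge> 1" for n by (simp add: N_def)
  \<comment> \<open>For N at least 2 this rises from 0 to 1 on [1/N, 2/N] and falls back to 0 on
    [N, N + 1].\<close>
  define X where "X n r = \<eta> (N n * r - 1) - \<eta> (r - N n)" for n r
  define X1 where "X1 n r = N n * \<rho> 0 (N n * r - 1) - \<rho> 0 (r - N n)" for n r
  define X2 where "X2 n r = (N n)\<^sup>2 * \<rho> 1 (N n * r - 1) - \<rho> 1 (r - N n)" for n r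
  have X: "(X n has_real_derivative X1 n r) (at r)" for n r
    unfolding X_def[abs_def] X1_def
    by (auto intro!: derivative_eq_intros DERIV_chain2[OF \<eta>(1)])
  have X1: "(X1 n has_real_derivative X2 n r) (at r)" for n r
    unfolding X1_def[abs_def] X2_def
    by (auto intro!: derivative_eq_intros DERIV_chain2[OF deriv] simp: power2_eq_square)
  have Xc: "continuous_on S (X n)" "continuous_on S (X1 n)" "continuous_on S (X2 n)" for S n
  proof -
    show "continuous_on S (X n)" "continuous_on S (X1 n)"
      using DERIV_isCont[OF X] DERIV_isCont[OF X1] by (auto intro!: continuous_at_imp_continuous_on)
    show "continuous_on S (X2 n)" unfolding X2_def[abs_def] by (intro continuous_intros)
  qed
  have Xout: "X n r = 0 \<and> X1 n r = 0 \<and> X2 n r = 0" if "r \<notin> {1 / N n<..<N n + 1}" for n r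
  proof (cases "r \<le> 1 / N n")
    case True
    then have "N n * r - 1 \<le> 0" using N[of n] by (simp add: field_simps)
    moreover have "1 / N n \<le> N n" by (rule order_trans[of _ 1]) (use N[of n] in auto)
    then have "r - N n \<le> 0" using True by linarith
    ultimately show ?thesis using \<eta>(2) support by (simp add: X_def X1_def X2_def)
  next
    case False
    then have r: "r \<ge> N n + 1" using that by auto
    then have "N n * r \<ge> 1 * 2" using N[of n] by (intro mult_mono) auto
    then show ?thesis using r \<eta>(3) support by (simp add: X_def X1_def X2_def)
  qed
  define V where "V r = complex_of_real ((\<nu>\<^sup>2 - 1/4) / r\<^sup>2)" for r
  define P where "P r = of_real r * (- v2 r + V r * v r - z * v r)" for r
  have PL: "P \<in> L2" using L(3) by (simp add: P_def[abs_def] V_def)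
  define w w1 w2 where "w n r = of_real (X n r) * v r"
    and "w1 n r = of_real (X1 n r) * v r + of_real (X n r) * v1 r"
    and "w2 n r = of_real (X2 n r) * v r + 2 * of_real (X1 n r) * v1 r + of_real (X n r) * v2 r" for n r
  have wout: "w n r = 0 \<and> w1 n r = 0 \<and> w2 n r = 0" if "r \<notin> {1 / N n<..<N n + 1}" for n r
    using Xout[OF that] by (simp add: w_def w1_def w2_def)
  have Nlt: "{..<1 / N n} \<inter> {1 / N n<..<N n + 1} = {}" for n by auto
  have Xr: "((\<lambda>r. complex_of_real (X n r)) has_vector_derivative of_real (X1 n r)) (at r)"
    "((\<lambda>r. complex_of_real (X1 n r)) has_vector_derivative of_real (X2 n r)) (at r)" for n r
    using X X1 by (auto intro!: has_vector_derivative_of_real simp: has_real_derivative_iff_has_vector_derivative)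
  have w: "(w n has_vector_derivative w1 n r) (at r)" for n r
  \<comment> \<open>\<open>v\<close> is controlled only on the positive axis; for r \<le> 0 the
    cutoff vanishes in a whole neighbourhood of r.\<close>
  proof (cases "r > 0")
    case True
    show ?thesis unfolding w_def[abs_def] w1_def
      using has_vector_derivative_mult[OF Xr(1) v(1)[OF True], of n] by (simp add: add.commute)
  next
    case False
    then have r: "r < 1 / N n" using N[of n] by (intro le_less_trans[of r 0]) auto
    have "((\<lambda>x. 0) has_vector_derivative w1 n r) (at r)" using wout[of r n] r by auto
    then show ?thesis
      by (rule has_vector_derivative_transform_within_open[of _ _ _ "{..<1 / N n}"]) (use r wout[of _ n] in auto)
  qed
  have w1: "(w1 n has_vector_derivative w2 n r) (at r)" for n r
  proof (cases "r > 0")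
    case True
    show ?thesis unfolding w1_def[abs_def] w2_def
      using has_vector_derivative_add[OF has_vector_derivative_mult[OF Xr(2) v(1)[OF True], of n]
        has_vector_derivative_mult[OF Xr(1) v(2)[OF True], of n]] by (simp add: algebra_simps)
  next
    case False
    then have r: "r < 1 / N n" using N[of n] by (intro le_less_trans[of r 0]) auto
    have "((\<lambda>x. 0) has_vector_derivative w2 n r) (at r)" using wout[of r n] r by auto
    then show ?thesis
      by (rule has_vector_derivative_transform_within_open[of _ _ _ "{..<1 / N n}"]) (use r wout[of _ n] in auto)
  qed
  have vc: "continuous_on {0<..} v" "continuous_on {0<..} v1"
    using v by (auto intro!: continuous_at_imp_continuous_on has_vector_derivative_continuous)
  have w2: "continuous_on UNIV (w2 n)" for n
  proof -
    have 1: "continuous_on {0<..} (w2 n)"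
      unfolding w2_def[abs_def]
      by (intro continuous_on_add continuous_on_mult continuous_on_of_real continuous_on_const vc v2 Xc)
    have "0 = w2 n r" if "r \<in> {..<1 / N n}" for r using wout[of r n] that by auto
    then have 2: "continuous_on {..<1 / N n} (w2 n)"
      by (rule continuous_on_eq[OF continuous_on_const])
    have "continuous_on ({0<..} \<union> {..<1 / N n}) (w2 n)"
      by (rule continuous_on_open_Un[OF _ _ 1 2]) auto
    moreover have "{0<..} \<union> {..<1 / N n} = UNIV"
    proof -
      have "0 < 1 / N n" using N[of n] by simp
      then have "r > 0 \<or> r < 1 / N n" for r by linarith
      then show ?thesis by auto
    qed
    ultimately show ?thesis by simp
  qed
  have BL: "B g \<in> L2" using B g by (simp add: is_weighted_resolvent_def bounded_L2_operator_L2)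
  have id: "(LINT r|half_line. B g r * (of_real r * (- w2 n r + V r * w n r - z * w n r)))
    = (LINT r|half_line. g r * (w n r / of_real r))" for n
    unfolding V_def
    by (rule weighted_resolvent_weak_compact[OF B g w w1 w2, of "1 / N n" "N n + 1"]) (use N[of n] wout[of _ n] in auto)
  have expand: "of_real r * (- w2 n r + V r * w n r - z * w n r) =
      of_real (X n r) * P r - (of_real (r * X2 n r) * v r + of_real (2 * (r * X1 n r)) * v1 r)" for n r
    by (simp add: w2_def w_def P_def algebra_simps)
  have ev: "\<forall>\<^sub>F n in sequentially. X n r = 1 \<and> X1 n r = 0 \<and> X2 n r = 0" if "r > 0" for r
  proof -
    obtain n0 :: nat where n0: "real n0 > max r (2 / r)" using reals_Archimedean2 by blast
    show ?thesis unfolding eventually_sequentially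
    proof (intro exI[of _ n0] allI impI)
      fix n assume "n \<ge> n0"
      then have n: "N n > r" "N n > 2 / r" using n0 by (auto simp: N_def)
      then have "N n * r - 1 \<ge> 1" using that by (simp add: field_simps)
      then show "X n r = 1 \<and> X1 n r = 0 \<and> X2 n r = 0"
        using n(1) \<eta>(2,3) support by (simp add: X_def X1_def X2_def)
    qed
  qed
  have b0: "\<bar>X n r\<bar> \<le> 2 * K" for n r
    using K(2)[of "N n * r - 1"] K(2)[of "r - N n"] unfolding X_def by linarith
  \<comment> \<open>Where the derivative of the inner step is nonzero, N r < 2, so each factor N
    costs at most 2/r.\<close>
  have nb: "N n * \<bar>\<rho> k (N n * r - 1)\<bar> \<le> 2 / r * Q" if "r > 0" "\<And>x. \<bar>\<rho> k x\<bar> \<le> Q" "Q \<ge> 0" for n r k Q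
  proof (cases "N n * r - 1 < 1")
    case True
    then have "N n \<le> 2 / r" using that by (simp add: field_simps)
    then show ?thesis using N[of n] that by (intro mult_mono) auto
  next
    case False
    then have "\<rho> k (N n * r - 1) = 0" by (intro support) auto
    then show ?thesis using that by simp
  qed
  have b1: "\<bar>r * X1 n r\<bar> \<le> 3 * K0 * (1 + r\<^sup>2)" if r: "r > 0" for n r
  proof -
    have "\<bar>r * X1 n r\<bar> \<le> r * (N n * \<bar>\<rho> 0 (N n * r - 1)\<bar>) + r * \<bar>\<rho> 0 (r - N n)\<bar>"
      using r N[of n] abs_triangle_ineq4[of "N n * \<rho> 0 (N n * r - 1)" "\<rho> 0 (r - N n)"]
      by (simp add: X1_def abs_mult flip: distrib_left)
    also have "\<dots> \<le> r * (2 / r * K0) + r * K0"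
      using r by (intro add_mono mult_left_mono nb K0) auto
    also have "\<dots> = K0 * (2 + r)" using r by (simp add: field_simps)
    also have "\<dots> \<le> K0 * (3 * (1 + r\<^sup>2))"
    proof (intro mult_left_mono K0)
      have "2 * r \<le> r\<^sup>2 + 1" using sum_squares_bound[of r 1] by simp
      moreover have "r\<^sup>2 \<ge> 0" by simp
      ultimately show "2 + r \<le> 3 * (1 + r\<^sup>2)" unfolding distrib_left by linarith
    qed
    finally show ?thesis by (simp add: mult_ac)
  qed
  have b2: "\<bar>r * X2 n r\<bar> \<le> 4 * K1 * ((1 + r\<^sup>2) / r)" if r: "r > 0" for n r
  proof -
    have N2: "(N n)\<^sup>2 * \<bar>\<rho> 1 (N n * r - 1)\<bar> \<le> 2 / r * (2 / r * K1)"
    proof (cases "N n * r - 1 < 1")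
      case True
      then have "N n \<le> 2 / r" using r by (simp add: field_simps)
      then show ?thesis
        using N[of n] nb[OF r K1(2,1), of n] r K1(1) unfolding power2_eq_square mult.assoc[of "N n" "N n"] by (intro mult_mono[of "N n" "2 / r" "N n * _"]) auto
    next
      case False
      then have "\<rho> 1 (N n * r - 1) = 0" by (intro support) auto
      then show ?thesis using r K1 by simp
    qed
    have "\<bar>r * X2 n r\<bar> \<le> r * ((N n)\<^sup>2 * \<bar>\<rho> 1 (N n * r - 1)\<bar>) + r * \<bar>\<rho> 1 (r - N n)\<bar>"
      using r N[of n] abs_triangle_ineq4[of "(N n)\<^sup>2 * \<rho> 1 (N n * r - 1)" "\<rho> 1 (r - N n)"]
      by (simp add: X2_def abs_mult flip: distrib_left)
    also have "\<dots> \<le> r * (2 / r * (2 / r * K1)) + r * K1"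
      using r by (intro add_mono mult_left_mono N2 K1) auto
    also have "\<dots> = K1 * (4 + r\<^sup>2) / r" using r by (simp add: field_simps power2_eq_square)
    also have "\<dots> \<le> K1 * (4 * (1 + r\<^sup>2)) / r"
      using r K1 by (intro divide_right_mono mult_left_mono) auto
    finally show ?thesis by (simp add: mult_ac)
  qed
  have "(\<lambda>n. LINT r|half_line. B g r * (of_real r * (- w2 n r + V r * w n r - z * w n r))) \<longlonglongrightarrow>
      (LINT r|half_line. B g r * P r)"
  proof (rule integral_dominated_convergence[where w = "\<lambda>r. 2 * K * norm (B g r * P r) +
        (4 * K1 * norm (B g r * (of_real ((1 + r\<^sup>2) / r) * v r)) + 6 * K0 * norm (B g r * (of_real (1 + r\<^sup>2) * v1 r)))"])
    show "(\<lambda>r. B g r * P r) \<in> borel_measurable half_line"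
      by (rule borel_measurable_integrable[OF L2_mult_integrable[OF BL PL]])
    show "(\<lambda>r. B g r * (of_real r * (- w2 n r + V r * w n r - z * w n r))) \<in> borel_measurable half_line" for n
    proof (rule borel_measurable_integrable[OF L2_mult_integrable[OF BL]], rule L2_compact_support[of _ "1 / N n" "N n + 1"])
      show "continuous_on {0<..} (\<lambda>r. of_real r * (- w2 n r + V r * w n r - z * w n r))"
        unfolding V_def w_def
        by (intro continuous_on_add continuous_on_diff continuous_on_minus continuous_on_mult continuous_on_of_real
            continuous_on_const continuous_on_divide continuous_on_power continuous_on_id continuous_on_subset[OF w2] vc Xc) auto
    qed (use N[of n] wout[of _ n] in auto)
    show "integrable half_line (\<lambda>r. 2 * K * norm (B g r * P r) +
        (4 * K1 * norm (B g r * (of_real ((1 + r\<^sup>2) / r) * v r)) + 6 * K0 * norm (B g r * (of_real (1 + r\<^sup>2) * v1 r))))"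
      by (intro Bochner_Integration.integrable_add integrable_mult_right integrable_norm L2_mult_integrable BL PL L)
    show "AE r in half_line. (\<lambda>n. B g r * (of_real r * (- w2 n r + V r * w n r - z * w n r))) \<longlonglongrightarrow> B g r * P r"
    proof (rule AE_I2)
      fix r assume "r \<in> space half_line"
      then have "r > 0" by simp
      show "(\<lambda>n. B g r * (of_real r * (- w2 n r + V r * w n r - z * w n r))) \<longlonglongrightarrow> B g r * P r"
        unfolding expand by (rule tendsto_eventually[OF eventually_mono[OF ev[OF \<open>r > 0\<close>]]]) simp
    qed
    show "AE r in half_line. norm (B g r * (of_real r * (- w2 n r + V r * w n r - z * w n r))) \<le>
        2 * K * norm (B g r * P r) +
        (4 * K1 * norm (B g r * (of_real ((1 + r\<^sup>2) / r) * v r)) + 6 * K0 * norm (B g r * (of_real (1 + r\<^sup>2) * v1 r)))" for n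
    proof (rule AE_I2)
      fix r assume "r \<in> space half_line"
      then have r: "r > 0" by simp
      have "norm (of_real (X n r) * P r - (of_real (r * X2 n r) * v r + of_real (2 * (r * X1 n r)) * v1 r))
        \<le> norm (of_real (X n r) * P r) + (norm (of_real (r * X2 n r) * v r) + norm (of_real (2 * (r * X1 n r)) * v1 r))"
        by (rule order_trans[OF norm_triangle_ineq4 add_left_mono[OF norm_triangle_ineq]])
      also have "\<dots> = \<bar>X n r\<bar> * norm (P r) + (\<bar>r * X2 n r\<bar> * norm (v r) + 2 * \<bar>r * X1 n r\<bar> * norm (v1 r))"
        by (simp add: norm_mult abs_mult)
      also have "\<dots> \<le> 2 * K * norm (P r) + (4 * K1 * ((1 + r\<^sup>2) / r) * norm (v r) + 2 * (3 * K0 * (1 + r\<^sup>2)) * norm (v1 r))"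
        by (intro add_mono mult_right_mono mult_left_mono b0 b1[OF r] b2[OF r]) auto
      finally have "norm (B g r) * norm (of_real (X n r) * P r - (of_real (r * X2 n r) * v r + of_real (2 * (r * X1 n r)) * v1 r))
        \<le> norm (B g r) * (2 * K * norm (P r) + (4 * K1 * ((1 + r\<^sup>2) / r) * norm (v r) + 2 * (3 * K0 * (1 + r\<^sup>2)) * norm (v1 r)))"
        by (rule mult_left_mono) simp
      moreover have "norm (complex_of_real ((1 + r\<^sup>2) / r)) = (1 + r\<^sup>2) / r" "norm (complex_of_real (1 + r\<^sup>2)) = 1 + r\<^sup>2"
        using r unfolding norm_of_real by (auto simp: abs_of_pos add_pos_nonneg)
      ultimately show "norm (B g r * (of_real r * (- w2 n r + V r * w n r - z * w n r))) \<le>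
        2 * K * norm (B g r * P r) +
        (4 * K1 * norm (B g r * (of_real ((1 + r\<^sup>2) / r) * v r)) + 6 * K0 * norm (B g r * (of_real (1 + r\<^sup>2) * v1 r)))"
        unfolding expand norm_mult by (simp only: distrib_left mult_ac)
    qed
  qed
  moreover have "(\<lambda>n. LINT r|half_line. g r * (w n r / of_real r)) \<longlonglongrightarrow> (LINT r|half_line. g r * (v r / of_real r))"
  proof (rule integral_dominated_convergence[where w = "\<lambda>r. 2 * K * norm (g r * (of_real ((1 + r\<^sup>2) / r) * v r))"])
    show "integrable half_line (\<lambda>r. 2 * K * norm (g r * (of_real ((1 + r\<^sup>2) / r) * v r)))"
      by (intro integrable_mult_right integrable_norm L2_mult_integrable g L)
    have [measurable]: "g \<in> borel_measurable half_line" "v \<in> borel_measurable half_line" "X n \<in> borel_measurable half_line" for n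
      using L2_measurable[OF g] continuous_measurable_half_line vc Xc by auto
    show "(\<lambda>r. g r * (v r / of_real r)) \<in> borel_measurable half_line" by measurable
    show "(\<lambda>r. g r * (w n r / of_real r)) \<in> borel_measurable half_line" for n unfolding w_def by measurable
    show "AE r in half_line. (\<lambda>n. g r * (w n r / of_real r)) \<longlonglongrightarrow> g r * (v r / of_real r)"
    proof (rule AE_I2)
      fix r assume "r \<in> space half_line"
      then have "r > 0" by simp
      show "(\<lambda>n. g r * (w n r / of_real r)) \<longlonglongrightarrow> g r * (v r / of_real r)"
        unfolding w_def by (rule tendsto_eventually[OF eventually_mono[OF ev[OF \<open>r > 0\<close>]]]) simp
    qed
    show "AE r in half_line. norm (g r * (w n r / of_real r)) \<le> 2 * K * norm (g r * (of_real ((1 + r\<^sup>2) / r) * v r))" for n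
    proof (rule AE_I2)
      fix r assume "r \<in> space half_line"
      then have r: "r > 0" by simp
      have "\<bar>X n r\<bar> / r \<le> 2 * K / r" using b0 r by (intro divide_right_mono) auto
      also have "\<dots> \<le> 2 * K * ((1 + r\<^sup>2) / r)" using r K(1) by (simp add: field_simps mult_nonneg_nonneg)
      finally have "(norm (g r) * norm (v r)) * (\<bar>X n r\<bar> / r) \<le> (norm (g r) * norm (v r)) * (2 * K * ((1 + r\<^sup>2) / r))"
        by (rule mult_left_mono) simp
      moreover have "norm (complex_of_real ((1 + r\<^sup>2) / r)) = (1 + r\<^sup>2) / r"
        using r unfolding norm_of_real by (auto simp: abs_of_pos add_pos_nonneg)
      ultimately show "norm (g r * (w n r / of_real r)) \<le> 2 * K * norm (g r * (of_real ((1 + r\<^sup>2) / r) * v r))"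
        using r unfolding norm_mult w_def norm_divide by (simp add: mult_ac)
    qed
  qed
  ultimately have "(LINT r|half_line. B g r * P r) = (LINT r|half_line. g r * (v r / of_real r))"
    unfolding id by (rule LIMSEQ_unique)
  then show ?thesis by (simp add: P_def V_def)
qed

section \<open>The limiting absorption principle in weak form\<close>

lemma L2_cong:
  assumes "\<And>r. r > 0 \<Longrightarrow> f r = g r"
  shows "f \<in> L2 \<longleftrightarrow> g \<in> L2"
proof -
  have "f \<in> borel_measurable half_line \<longleftrightarrow> g \<in> borel_measurable half_line"
    by (rule measurable_cong) (simp add: assms)
  moreover have "integrable half_line (\<lambda>r. (norm (f r))\<^sup>2) \<longleftrightarrow> integrable half_line (\<lambda>r. (norm (g r))\<^sup>2)"
    by (rule Bochner_Integration.integrable_cong) (simp_all add: assms)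
  ultimately show ?thesis by (simp add: L2_def)
qed

lemma integrable_half_line_indicator:
  fixes h :: "real \<Rightarrow> real"
  assumes "h integrable_on S" "\<And>x. x \<in> S \<Longrightarrow> 0 \<le> h x"
  shows "integrable half_line (\<lambda>r. indicator S r * h r)"
proof -
  have "h absolutely_integrable_on S"
    by (rule nonnegative_absolutely_integrable_1[OF assms])
  then have "integrable lebesgue (\<lambda>r. indicator S r * h r)"
    by (simp add: set_integrable_def)
  then have "integrable lebesgue (\<lambda>r. indicator {0<..} r * (indicator S r * h r))"
    using integrable_mult_indicator[of "{0<..}" lebesgue "\<lambda>r. indicator S r * h r"] by simp
  then show ?thesis by (simp add: integrable_restrict_space)
qed

text \<open>Its square is r^(2a-1) up to 1 and r^(-2) beyond, which is integrable for a > 0. With a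
  = \<nu> it covers v / r whenever v is of order r^(\<nu>+1/2) at 0 and bounded at infinity.\<close>

definition L2_majorant :: "real \<Rightarrow> real \<Rightarrow> real" where
  "L2_majorant a r = (if r \<le> 1 then r powr (a - 1/2) else 1 / r)"

lemma L2_majorant_integrable:
  assumes "a > 0"
  shows "integrable half_line (\<lambda>r. (L2_majorant a r)\<^sup>2)"
proof (rule Bochner_Integration.integrable_bound)
  have "(\<lambda>r. r powr (2 * a - 1)) integrable_on {0..1::real}"
    using integrable_on_powr_from_0[of "2 * a - 1" 1] assms by simp
  then have 1: "integrable half_line (\<lambda>r. indicator {0..1} r * r powr (2 * a - 1))"
    by (rule integrable_half_line_indicator) auto
  have "(\<lambda>r. r powr (-2)) integrable_on {1::real..}"
    using has_integral_powr_to_inf[of "-2" 1] by (auto intro: has_integral_integrable)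
  then have 2: "integrable half_line (\<lambda>r. indicator {1..} r * r powr (-2))"
    by (rule integrable_half_line_indicator) auto
  show "integrable half_line (\<lambda>r. indicator {0..1} r * r powr (2 * a - 1) + indicator {1..} r * r powr (-2))"
    using 1 2 by (rule Bochner_Integration.integrable_add)
  show "(\<lambda>r. (L2_majorant a r)\<^sup>2) \<in> borel_measurable half_line"
    unfolding L2_majorant_def by measurable
  show "AE r in half_line. norm ((L2_majorant a r)\<^sup>2)
      \<le> norm (indicator {0..1} r * r powr (2 * a - 1) + indicator {1..} r * r powr (-2))"
  proof (rule AE_I2)
    fix r assume "r \<in> space half_line"
    then have r: "r > 0" by simp
    show "norm ((L2_majorant a r)\<^sup>2)
      \<le> norm (indicator {0..1} r * r powr (2 * a - 1) + indicator {1..} r * r powr (-2))"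
    proof (cases "r \<le> 1")
      case True
      have "(r powr (a - 1/2))\<^sup>2 = r powr (2 * a - 1)"
        by (simp add: power2_eq_square powr_add[symmetric] algebra_simps)
      then show ?thesis using True r by (simp add: L2_majorant_def indicator_def)
    next
      case False
      then have "(1 / r)\<^sup>2 = r powr (-2)" using r
        by (simp add: powr_minus power_one_over field_simps powr_realpow[of r 2, simplified])
      then show ?thesis using False r by (simp add: L2_majorant_def indicator_def)
    qed
  qed
qed

lemma L2_majorant_nonneg: "r > 0 \<Longrightarrow> 0 \<le> L2_majorant a r"
  by (simp add: L2_majorant_def)

lemma L2_if_le_majorant:
  fixes f :: "real \<Rightarrow> complex"
  assumes "a > 0" "f \<in> borel_measurable half_line" "\<And>r. r > 0 \<Longrightarrow> norm (f r) \<le> C * L2_majorant a r"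
  shows "f \<in> L2"
proof (rule L2_bound[OF assms(2) _ assms(3)])
  show "integrable half_line (\<lambda>r. (C * L2_majorant a r)\<^sup>2)"
    unfolding power_mult_distrib by (intro integrable_mult_right L2_majorant_integrable assms)
qed

lemma mult_exp_neg_le: "x * exp (- x) \<le> (1::real)"
proof -
  have "x \<le> exp x" using exp_ge_add_one_self[of x] by linarith
  then show ?thesis by (simp add: exp_minus field_simps)
qed

text \<open>Let k = 1 + \<kappa> be the principal root. From 2 Re k Im k = \<sigma> \<epsilon> and
  norm k \<le> 2 comes the lower bound for the decay rate \<sigma> Im \<kappa>; from (k - 1)(k + 1)
  = i \<sigma> \<epsilon> and norm (k + 1) \<ge> 1 comes the upper bound for norm \<kappa>. Size and
  decay rate being comparable makes \<kappa> exp(i \<sigma> \<kappa> r) of order 1/r uniformly in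
  \<epsilon>.\<close>

lemma sqrt_one_plus_imaginary:
  assumes \<sigma>: "\<sigma> = 1 \<or> \<sigma> = -1" and \<epsilon>: "0 < \<epsilon>" "\<epsilon> \<le> 1"
  obtains \<kappa> where "(1 + \<kappa>)\<^sup>2 = Complex 1 (\<sigma> * \<epsilon>)" "norm \<kappa> \<le> \<epsilon>" "\<epsilon> / 4 \<le> \<sigma> * Im \<kappa>"
proof -
  define z where "z = Complex 1 (\<sigma> * \<epsilon>)"
  define k where "k = csqrt z"
  have kk: "k\<^sup>2 = z" by (simp add: k_def)
  have Re0: "Re k \<ge> 0" unfolding k_def by (rule Re_csqrt)
  have im: "2 * Re k * Im k = \<sigma> * \<epsilon>"
    using arg_cong[OF kk, of Im] by (simp add: power2_eq_square z_def mult_ac)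
  have re: "(Re k)\<^sup>2 - (Im k)\<^sup>2 = 1"
    using arg_cong[OF kk, of Re] by (simp add: power2_eq_square z_def)
  have nz: "Re k \<noteq> 0" using im \<sigma> \<epsilon> by auto
  then have pos: "Re k > 0" using Re0 by simp
  have "norm z \<le> \<bar>Re z\<bar> + \<bar>Im z\<bar>" by (rule cmod_le)
  also have "\<dots> \<le> 2" using \<sigma> \<epsilon> by (auto simp: z_def)
  finally have "norm k ^ 2 \<le> 2 ^ 2" unfolding norm_power[symmetric] kk by simp
  then have "norm k \<le> 2" by (rule power2_le_imp_le) simp
  then have Re2: "Re k \<le> 2" using complex_Re_le_cmod[of k] by linarith
  have "\<sigma> * Im k * (2 * Re k) = \<epsilon>" using im \<sigma> by (auto simp: mult_ac)
  then have s: "\<sigma> * Im k = \<epsilon> / (2 * Re k)" using pos by (simp add: field_simps)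
  have 3: "\<epsilon> / 4 \<le> \<sigma> * Im k" unfolding s using pos Re2 \<epsilon> by (intro divide_left_mono) auto
  have "(k - 1) * (k + 1) = z - 1" using kk by (simp add: power2_eq_square algebra_simps)
  then have "norm (k - 1) * norm (k + 1) = norm (z - 1)" by (metis norm_mult)
  also have "norm (z - 1) = \<epsilon>"
    using \<sigma> \<epsilon> by (auto simp: z_def norm_complex_def)
  finally have e: "norm (k - 1) * norm (k + 1) = \<epsilon>" .
  have "1 \<le> Re (k + 1)" using Re0 by simp
  then have "1 \<le> norm (k + 1)" using complex_Re_le_cmod[of "k + 1"] by linarith
  then have "norm (k - 1) * 1 \<le> norm (k - 1) * norm (k + 1)" by (intro mult_left_mono) auto
  then have "norm (k - 1) \<le> \<epsilon>" using e by simp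
  with 3 kk that[of "k - 1"] show ?thesis by (simp add: z_def)
qed

text \<open>In effect the symmetry of \<open>A\<close> for the bilinear pairing: it moves from g to
  r \<psi>, where it yields v / r for the radiating solution v with source \<psi>. Since v does not
  decay, it cannot be inserted into the resolvent equation directly. Multiplied by m = exp(i
  \<sigma> \<kappa> r) it decays exponentially, and with (1 + \<kappa>)^2 as spectral parameter the
  error is 2 i \<sigma> \<kappa> m (v' - i \<sigma> v), so that the radiation condition is exactly
  what controls it.\<close>

lemma boundary_value_weak:
  fixes v v1 v2 \<psi> :: "real \<Rightarrow> complex" and \<sigma> \<nu> :: real
  assumes A: "is_boundary_value \<nu> \<sigma> A" and \<sigma>: "\<sigma> = 1 \<or> \<sigma> = -1" and \<nu>: "\<nu> > 0" and g: "g \<in> L2"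
    and v: "\<And>x. x > 0 \<Longrightarrow> (v has_vector_derivative v1 x) (at x)"
      "\<And>x. x > 0 \<Longrightarrow> (v1 has_vector_derivative v2 x) (at x)"
    and ode: "\<And>r. r > 0 \<Longrightarrow> v2 r = (of_real ((\<nu>\<^sup>2 - 1/4) / r\<^sup>2) - 1) * v r - \<psi> r"
    and \<psi>: "continuous_on {0<..} \<psi>" "0 < a" "\<And>r. r > 0 \<Longrightarrow> r \<notin> {a..b} \<Longrightarrow> \<psi> r = 0"
    and v0: "\<And>r. 0 < r \<Longrightarrow> r \<le> 1 \<Longrightarrow> norm (v r) \<le> C * r powr (\<nu> + 1/2) \<and> norm (v1 r) \<le> C * r powr (\<nu> - 1/2)"
    and vinf: "\<And>r. 1 \<le> r \<Longrightarrow> norm (v r) \<le> C \<and> norm (v1 r) \<le> C \<and> r * norm (v1 r - \<i> * of_real \<sigma> * v r) \<le> C"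
  shows "(\<lambda>r. v r / of_real r) \<in> L2"
    and "(LINT r|half_line. A g r * (of_real r * \<psi> r)) = (LINT r|half_line. g r * (v r / of_real r))"
proof -
  have C: "C \<ge> 0" using vinf[of 1] norm_ge_zero[of "v 1"] by linarith
  have vc: "continuous_on {0<..} v" "continuous_on {0<..} v1"
    using v by (auto intro!: continuous_at_imp_continuous_on has_vector_derivative_continuous)
  have [measurable]: "v \<in> borel_measurable half_line" "v1 \<in> borel_measurable half_line" "\<psi> \<in> borel_measurable half_line"
    using continuous_measurable_half_line vc \<psi>(1) by auto
  have vle: "norm (v r / of_real r) \<le> C * L2_majorant \<nu> r" if r: "r > 0" for r
  proof (cases "r \<le> 1")
    case True
    have "norm (v r) / r \<le> C * r powr (\<nu> + 1/2) / r" using v0[OF r True] r by (intro divide_right_mono) auto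
    also have "\<dots> = C * r powr (\<nu> - 1/2)" using r powr_diff[of r "\<nu> + 1/2" 1] by simp
    finally show ?thesis using r True by (simp add: L2_majorant_def norm_divide)
  next
    case False
    then show ?thesis using vinf[of r] r by (simp add: L2_majorant_def norm_divide divide_right_mono)
  qed
  show vL: "(\<lambda>r. v r / of_real r) \<in> L2"
    by (rule L2_if_le_majorant[OF \<nu> _ vle]) measurable
  define q where "q r = of_real r * (v1 r - \<i> * of_real \<sigma> * v r)" for r
  have qm [measurable]: "q \<in> borel_measurable half_line" unfolding q_def[abs_def] by measurable
  have ns: "norm (\<i> * of_real \<sigma> * x) = norm x" for x using \<sigma> by (auto simp: norm_mult)
  have v0': "norm (v r) \<le> C * r powr (\<nu> - 1/2)" if "0 < r" "r \<le> 1" for r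
  proof -
    have "r powr (\<nu> + 1/2) \<le> r powr (\<nu> - 1/2)" using that by (intro powr_mono') auto
    then have "C * r powr (\<nu> + 1/2) \<le> C * r powr (\<nu> - 1/2)" using C by (rule mult_left_mono)
    then show ?thesis using v0[OF that] by linarith
  qed
  have q0: "norm (q r) \<le> 2 * C * r powr (\<nu> - 1/2)" if "0 < r" "r \<le> 1" for r
  proof -
    have "norm (q r) \<le> 1 * norm (v1 r - \<i> * of_real \<sigma> * v r)"
      unfolding q_def norm_mult using that by (intro mult_right_mono) auto
    also have "\<dots> \<le> norm (v1 r) + norm (v r)"
      using norm_triangle_ineq4[of "v1 r" "\<i> * of_real \<sigma> * v r"] by (simp only: ns mult_1)
    finally show ?thesis using v0'[OF that] v0[OF that] by linarith
  qed
  have q1: "norm (q r) \<le> C" if "1 \<le> r" for r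
    using vinf[OF that] that by (simp add: q_def norm_mult)
  have \<psi>L: "(\<lambda>r. of_real r * \<psi> r) \<in> L2"
    by (rule L2_compact_support[OF _ \<psi>(2), of _ b]) (use \<psi>(3) in \<open>auto intro!: continuous_intros \<psi>(1)\<close>)
  define \<epsilon> where "\<epsilon> n = 1 / real (Suc n)" for n
  have \<epsilon>: "0 < \<epsilon> n" "\<epsilon> n \<le> 1" for n by (auto simp: \<epsilon>_def)
  have \<epsilon>0: "\<epsilon> \<longlonglongrightarrow> 0" unfolding \<epsilon>_def[abs_def] by (rule LIMSEQ_Suc[OF lim_1_over_n])
  have \<epsilon>lim: "filterlim \<epsilon> (at_right 0) sequentially"
    unfolding filterlim_at using \<epsilon>0 \<epsilon>(1) by (auto intro!: always_eventually simp: less_imp_neq[THEN not_sym])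
  have "\<exists>\<kappa>. (1 + \<kappa>)\<^sup>2 = Complex 1 (\<sigma> * \<epsilon> n) \<and> norm \<kappa> \<le> \<epsilon> n \<and> \<epsilon> n / 4 \<le> \<sigma> * Im \<kappa>" for n
    using sqrt_one_plus_imaginary[OF \<sigma> \<epsilon>, of n] by metis
  then obtain \<kappa> where \<kappa>: "\<And>n. (1 + \<kappa> n)\<^sup>2 = Complex 1 (\<sigma> * \<epsilon> n)" "\<And>n. norm (\<kappa> n) \<le> \<epsilon> n" "\<And>n. \<epsilon> n / 4 \<le> \<sigma> * Im (\<kappa> n)"
    by metis
  define m where "m n r = exp (\<i> * of_real \<sigma> * \<kappa> n * of_real r)" for n r
  have m_norm: "norm (m n r) \<le> exp (- (\<epsilon> n / 4 * r))" if "r > 0" for n r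
  proof -
    have "norm (m n r) = exp (- (\<sigma> * Im (\<kappa> n) * r))" by (simp add: m_def)
    also have "\<dots> \<le> exp (- (\<epsilon> n / 4 * r))" using \<kappa>(3)[of n] that by (simp add: mult_right_mono)
    finally show ?thesis .
  qed
  have m1: "norm (m n r) \<le> 1" if "r > 0" for n r
    using m_norm[OF that, of n] \<epsilon>(1)[of n] that by (rule_tac order_trans) auto
  have mc: "continuous_on S (m n)" for n S unfolding m_def[abs_def] by (intro continuous_intros)
  have [measurable]: "m n \<in> borel_measurable half_line" for n by (rule continuous_measurable_half_line[OF mc])
  have md: "(m n has_vector_derivative \<i> * of_real \<sigma> * \<kappa> n * m n r) (at r)" for n r
    unfolding m_def[abs_def] by (rule has_vector_derivative_real_field) (auto intro!: derivative_eq_intros)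
  define w w1 w2 where "w n r = v r * m n r"
    and "w1 n r = (v1 r + \<i> * of_real \<sigma> * \<kappa> n * v r) * m n r"
    and "w2 n r = (v2 r + 2 * \<i> * of_real \<sigma> * \<kappa> n * v1 r - (\<kappa> n)\<^sup>2 * v r) * m n r" for n r
  have wd: "(w n has_vector_derivative w1 n r) (at r)" if "r > 0" for n r
    unfolding w_def[abs_def] w1_def
    using has_vector_derivative_mult[OF v(1)[OF that] md[of n r]] by (simp add: algebra_simps)
  have \<sigma>2: "(\<i> * of_real \<sigma>) * (\<i> * of_real \<sigma>) = -1" using \<sigma> by auto
  have w1d: "(w1 n has_vector_derivative w2 n r) (at r)" if "r > 0" for n r
  proof -
    have "(w1 n has_vector_derivative (v1 r + \<i> * of_real \<sigma> * \<kappa> n * v r) * (\<i> * of_real \<sigma> * \<kappa> n * m n r)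
        + (v2 r + \<i> * of_real \<sigma> * \<kappa> n * v1 r) * m n r) (at r)"
      unfolding w1_def[abs_def]
      by (intro has_vector_derivative_mult has_vector_derivative_add has_vector_derivative_mult_right v that md)
    moreover have "(v1 r + \<i> * of_real \<sigma> * \<kappa> n * v r) * (\<i> * of_real \<sigma> * \<kappa> n * m n r)
        + (v2 r + \<i> * of_real \<sigma> * \<kappa> n * v1 r) * m n r
        = (v2 r + 2 * \<i> * of_real \<sigma> * \<kappa> n * v1 r + ((\<i> * of_real \<sigma>) * (\<i> * of_real \<sigma>)) * (\<kappa> n)\<^sup>2 * v r) * m n r"
      by (simp add: algebra_simps power2_eq_square)
    ultimately show ?thesis unfolding \<sigma>2 w2_def by simp
  qed
  have v2c: "continuous_on {0<..} v2"
    by (rule continuous_on_eq[of _ "\<lambda>r. (of_real ((\<nu>\<^sup>2 - 1/4) / r\<^sup>2) - 1) * v r - \<psi> r"])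
      (auto intro!: continuous_intros vc \<psi>(1) simp: ode)
  have w2c: "continuous_on {0<..} (w2 n)" for n
    unfolding w2_def[abs_def]
    by (intro continuous_on_add continuous_on_diff continuous_on_mult continuous_on_const v2c vc mc)
  \<comment> \<open>The terms with \<kappa>^2 v cancel, and since (i \<sigma>)^2 = -1 the terms -2 i
    \<sigma> \<kappa> v' and -2 \<kappa> v combine to a multiple of v' - i \<sigma> v.\<close>
  have op: "of_real r * (- w2 n r + of_real ((\<nu>\<^sup>2 - 1/4) / r\<^sup>2) * w n r - Complex 1 (\<sigma> * \<epsilon> n) * w n r)
      = m n r * (of_real r * \<psi> r) - 2 * \<i> * of_real \<sigma> * \<kappa> n * (m n r * q r)" if "r > 0" for n r
  proof -
    define Q where "Q = complex_of_real ((\<nu>\<^sup>2 - 1/4) / r\<^sup>2)"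
    have "of_real r * (- w2 n r + Q * w n r - (1 + \<kappa> n)\<^sup>2 * w n r)
      = m n r * (of_real r * \<psi> r) - 2 * \<i> * of_real \<sigma> * \<kappa> n * m n r * (of_real r * v1 r)
        - 2 * \<kappa> n * (m n r * (of_real r * v r))"
      unfolding w2_def w_def ode[OF that] Q_def[symmetric] by (simp add: algebra_simps power2_eq_square)
    also have "\<dots> = m n r * (of_real r * \<psi> r) - 2 * \<i> * of_real \<sigma> * \<kappa> n * m n r * (of_real r * v1 r)
        + 2 * ((\<i> * of_real \<sigma>) * (\<i> * of_real \<sigma>)) * \<kappa> n * (m n r * (of_real r * v r))"
      unfolding \<sigma>2 by simp
    finally show ?thesis unfolding \<kappa>(1) Q_def[symmetric] q_def by (simp add: algebra_simps)
  qed
  obtain B where AB: "bounded_L2_operator A" and B: "\<And>\<epsilon>. \<epsilon> > 0 \<Longrightarrow> is_weighted_resolvent \<nu> (Complex 1 (\<sigma> * \<epsilon>)) (B \<epsilon>)"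
    and lim: "\<And>f g. f \<in> L2 \<Longrightarrow> g \<in> L2 \<Longrightarrow> ((\<lambda>\<epsilon>. L2_inner (B \<epsilon> f) g) \<longlongrightarrow> L2_inner (A f) g) (at_right 0)"
    using A unfolding is_boundary_value_def by blast
  have BL: "B (\<epsilon> n) g \<in> L2" for n
    using B[OF \<epsilon>(1)[of n]] g by (simp add: is_weighted_resolvent_def bounded_L2_operator_L2)
  have Blim: "(\<lambda>n. LINT r|half_line. B (\<epsilon> n) g r * h r) \<longlonglongrightarrow> (LINT r|half_line. A g r * h r)" if "h \<in> L2" for h
    using filterlim_compose[OF lim[OF g L2_cnj[OF that]] \<epsilon>lim] by (simp add: L2_inner_def)
  \<comment> \<open>In the pairings both \<open>B (\<epsilon> n) g\<close> and the test function
    \<open>P n\<close> vary with n, so weak convergence of the former has to be supplemented by a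
    bound on its norms.\<close>
  have "\<exists>K. \<forall>n. L2_norm (B (\<epsilon> n) g) \<le> K"
  proof (rule L2_uniform_boundedness[OF BL])
    fix h assume "h \<in> L2"
    from Blim[OF this] have "Bseq (\<lambda>n. LINT r|half_line. B (\<epsilon> n) g r * h r)"
      by (intro convergent_imp_Bseq) (auto simp: convergent_def)
    then show "\<exists>K. \<forall>n. norm (LINT r|half_line. B (\<epsilon> n) g r * h r) \<le> K" by (auto simp: Bseq_def)
  qed
  then obtain K where K: "\<And>n. L2_norm (B (\<epsilon> n) g) \<le> K" by blast
  define P where "P n r = m n r * (of_real r * \<psi> r) - 2 * \<i> * of_real \<sigma> * \<kappa> n * (m n r * q r)" for n r
  have Pm [measurable]: "P n \<in> borel_measurable half_line" for n unfolding P_def[abs_def] by measurable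
  \<comment> \<open>By y exp(-y) \<le> 1 with y = \<epsilon> r / 4, the factor \<epsilon>
    exp(-\<epsilon> r / 4) is at most 4/r, a majorant independent of n.\<close>
  have emq: "\<epsilon> n * norm (m n r * q r) \<le> 4 * C * L2_majorant \<nu> r" if r: "r > 0" for n r
  proof (cases "r \<le> 1")
    case True
    have "\<epsilon> n * norm (m n r * q r) \<le> 1 * (1 * norm (q r))"
      unfolding norm_mult using \<epsilon>[of n] m1[OF r] by (intro mult_mono) auto
    also have "\<dots> \<le> 2 * C * r powr (\<nu> - 1/2)" using q0[OF r True] by simp
    also have "\<dots> \<le> 4 * C * r powr (\<nu> - 1/2)" using C by (intro mult_right_mono) auto
    finally show ?thesis using True by (simp add: L2_majorant_def)
  next
    case False
    have "\<epsilon> n * norm (m n r * q r) \<le> \<epsilon> n * (exp (- (\<epsilon> n / 4 * r)) * C)"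
      unfolding norm_mult using \<epsilon>(1)[of n] m_norm[OF r] q1 False C by (intro mult_left_mono mult_mono) auto
    also have "\<dots> = (\<epsilon> n / 4 * r) * exp (- (\<epsilon> n / 4 * r)) * (4 * C / r)" using r by (simp add: field_simps)
    also have "\<dots> \<le> 1 * (4 * C / r)" using C r by (intro mult_right_mono mult_exp_neg_le) auto
    finally show ?thesis using False by (simp add: L2_majorant_def)
  qed
  have kmq: "norm (2 * \<i> * of_real \<sigma> * \<kappa> n * (m n r * q r)) \<le> 8 * C * L2_majorant \<nu> r" if r: "r > 0" for n r
  proof -
    have "norm (2 * \<i> * of_real \<sigma> * \<kappa> n * (m n r * q r)) = 2 * (norm (\<kappa> n) * norm (m n r * q r))"
      using \<sigma> by (auto simp: norm_mult)
    also have "\<dots> \<le> 2 * (\<epsilon> n * norm (m n r * q r))"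
      using \<kappa>(2) by (intro mult_left_mono mult_right_mono) auto
    finally show ?thesis using emq[OF r, of n] by linarith
  qed
  have PL: "P n \<in> L2" for n
    unfolding P_def[abs_def]
  proof (rule L2_minus)
    show "(\<lambda>r. m n r * (of_real r * \<psi> r)) \<in> L2"
      by (rule L2_compact_support[OF _ \<psi>(2), of _ b]) (use \<psi>(3) in \<open>auto intro!: continuous_intros mc \<psi>(1)\<close>)
    show "(\<lambda>r. 2 * \<i> * of_real \<sigma> * \<kappa> n * (m n r * q r)) \<in> L2"
      by (rule L2_if_le_majorant[OF \<nu> _ kmq]) measurable
  qed
  \<comment> \<open>This bound may depend on n, because it only serves the integrability hypotheses
    of \<open>weighted_resolvent_weak\<close>. The cube arises from splitting the exponential into
    three equal factors, one for each power in r^3.\<close>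
  have rexp: "(1 + r\<^sup>2) * norm (m n r) \<le> (4 / \<epsilon> n + (12 / \<epsilon> n) ^ 3) / r" if r: "r > 0" for n r
  proof -
    define c where "c = \<epsilon> n / 4"
    have c: "c > 0" using \<epsilon>(1)[of n] by (simp add: c_def)
    have e1: "r * exp (- (c * r)) \<le> 1 / c"
      using mult_exp_neg_le[of "c * r"] c by (simp add: field_simps)
    have "((c / 3) * r * exp (- ((c / 3) * r))) ^ 3 \<le> 1 ^ 3"
      using c r by (intro power_mono mult_exp_neg_le) auto
    moreover have "exp (- ((c / 3) * r)) ^ 3 = exp (- (c * r))"
      using exp_of_nat_mult[of 3 "- ((c / 3) * r)"] by simp
    ultimately have "(c / 3) ^ 3 * (r ^ 3 * exp (- (c * r))) \<le> 1"
      unfolding power_mult_distrib by (simp only: power_one mult.assoc)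
    then have e3: "r ^ 3 * exp (- (c * r)) \<le> (3 / c) ^ 3"
      using c by (simp add: power_divide field_simps)
    have "(1 + r\<^sup>2) * norm (m n r) \<le> (1 + r\<^sup>2) * exp (- (c * r))"
      using m_norm[OF r, of n] by (intro mult_left_mono) (auto simp: c_def)
    also have "\<dots> = (r * exp (- (c * r)) + r ^ 3 * exp (- (c * r))) / r"
      using r by (simp add: field_simps power2_eq_square power3_eq_cube)
    also have "\<dots> \<le> (1 / c + (3 / c) ^ 3) / r"
      using r e1 e3 by (intro divide_right_mono add_mono) auto
    also have "\<dots> \<le> (4 / \<epsilon> n + (12 / \<epsilon> n) ^ 3) / r"
      using r \<epsilon>(1)[of n] by (intro divide_right_mono add_mono) (auto simp: c_def field_simps)
    finally show ?thesis .
  qed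
  have id: "(LINT r|half_line. B (\<epsilon> n) g r * P n r) = (LINT r|half_line. g r * (w n r / of_real r))" for n
  proof -
    define D where "D = 2 + (4 / \<epsilon> n + (12 / \<epsilon> n) ^ 3)"
    have D: "(1 + r\<^sup>2) * norm (m n r) \<le> D" if "0 < r" "r \<le> 1" for r
    proof -
      have "(1 + r\<^sup>2) * norm (m n r) \<le> 2 * 1"
        using m1[OF that(1)] power_le_one[of r 2] that by (intro mult_mono) auto
      also have "\<dots> \<le> D" using \<epsilon>(1)[of n] by (simp add: D_def)
      finally show ?thesis .
    qed
    have D': "(1 + r\<^sup>2) * norm (m n r) \<le> D / r" if "0 < r" for r
      using rexp[OF that, of n] that by (rule_tac order_trans) (auto simp: D_def intro!: divide_right_mono)
    have maj: "(1 + r\<^sup>2) * norm (m n r) * y \<le> D * Y * L2_majorant \<nu> r"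
      if "r > 0" "r \<le> 1 \<Longrightarrow> y \<le> Y * r powr (\<nu> - 1/2)" "r \<ge> 1 \<Longrightarrow> y \<le> Y" "y \<ge> 0" for r y Y
    proof (cases "r \<le> 1")
      case True
      have "(1 + r\<^sup>2) * norm (m n r) * y \<le> D * (Y * r powr (\<nu> - 1/2))"
        using that True D[OF that(1) True] by (intro mult_mono) (auto simp: D_def \<epsilon>_def)
      then show ?thesis using True by (simp add: L2_majorant_def mult_ac)
    next
      case False
      have "(1 + r\<^sup>2) * norm (m n r) * y \<le> D / r * Y"
        using that False D'[OF that(1)] by (intro mult_mono) (auto simp: D_def \<epsilon>_def)
      then show ?thesis using False by (simp add: L2_majorant_def mult_ac)
    qed
    have "(LINT r|half_line. B (\<epsilon> n) g r * (of_real r * (- w2 n r + of_real ((\<nu>\<^sup>2 - 1/4) / r\<^sup>2) * w n r - Complex 1 (\<sigma> * \<epsilon> n) * w n r)))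
      = (LINT r|half_line. g r * (w n r / of_real r))"
    proof (rule weighted_resolvent_weak[OF B[OF \<epsilon>(1)] g wd w1d w2c])
      show "(\<lambda>r. of_real ((1 + r\<^sup>2) / r) * w n r) \<in> L2"
      proof (rule L2_if_le_majorant[OF \<nu>, of _ "D * C"])
        show "(\<lambda>r. of_real ((1 + r\<^sup>2) / r) * w n r) \<in> borel_measurable half_line"
          unfolding w_def by measurable
        fix r :: real assume r: "r > 0"
        have "norm (of_real ((1 + r\<^sup>2) / r) * w n r) = (1 + r\<^sup>2) * norm (m n r) * (norm (v r / of_real r))"
          unfolding w_def norm_mult norm_of_real norm_divide using r by (simp add: abs_of_pos add_pos_nonneg mult_ac)
        also have "\<dots> \<le> D * C * L2_majorant \<nu> r"
        proof (rule maj[OF r])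
          show "norm (v r / of_real r) \<le> C * r powr (\<nu> - 1/2)" if "r \<le> 1"
            using vle[OF r] that by (simp add: L2_majorant_def)
          show "norm (v r / of_real r) \<le> C" if "r \<ge> 1"
            using vinf[OF that] that C by (simp add: norm_divide divide_le_eq) (meson mult_left_le mult_le_cancel_left1 order_trans linorder_not_less)
        qed simp
        finally show "norm (of_real ((1 + r\<^sup>2) / r) * w n r) \<le> D * C * L2_majorant \<nu> r" .
      qed
      show "(\<lambda>r. of_real (1 + r\<^sup>2) * w1 n r) \<in> L2"
      proof (rule L2_if_le_majorant[OF \<nu>, of _ "D * (2 * C)"])
        show "(\<lambda>r. of_real (1 + r\<^sup>2) * w1 n r) \<in> borel_measurable half_line"
          unfolding w1_def by measurable
        fix r :: real assume r: "r > 0"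
        have le: "norm (v1 r + \<i> * of_real \<sigma> * \<kappa> n * v r) \<le> norm (v1 r) + norm (v r)"
        proof -
          have "norm (\<i> * of_real \<sigma> * (\<kappa> n * v r)) \<le> 1 * norm (v r)"
            unfolding ns norm_mult[of "\<kappa> n"] using order_trans[OF \<kappa>(2) \<epsilon>(2), of n] by (intro mult_right_mono) auto
          then show ?thesis using norm_triangle_ineq[of "v1 r" "\<i> * of_real \<sigma> * \<kappa> n * v r"] by (simp add: mult.assoc)
        qed
        have "norm (of_real (1 + r\<^sup>2) * w1 n r) = (1 + r\<^sup>2) * norm (m n r) * norm (v1 r + \<i> * of_real \<sigma> * \<kappa> n * v r)"
          unfolding w1_def norm_mult norm_of_real by (simp add: abs_of_pos add_pos_nonneg mult_ac)
        also have "\<dots> \<le> D * (2 * C) * L2_majorant \<nu> r"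
        proof (rule maj[OF r])
          show "norm (v1 r + \<i> * of_real \<sigma> * \<kappa> n * v r) \<le> 2 * C * r powr (\<nu> - 1/2)" if "r \<le> 1"
            using le v0[OF r that] v0'[OF r that] by linarith
          show "norm (v1 r + \<i> * of_real \<sigma> * \<kappa> n * v r) \<le> 2 * C" if "r \<ge> 1"
            using le vinf[OF that] by linarith
        qed simp
        finally show "norm (of_real (1 + r\<^sup>2) * w1 n r) \<le> D * (2 * C) * L2_majorant \<nu> r" .
      qed
      show "(\<lambda>r. of_real r * (- w2 n r + of_real ((\<nu>\<^sup>2 - 1/4) / r\<^sup>2) * w n r - Complex 1 (\<sigma> * \<epsilon> n) * w n r)) \<in> L2"
        using PL[of n] op[of _ n] by (subst L2_cong[of _ "P n"]) (auto simp: P_def)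
    qed
    moreover have "(LINT r|half_line. B (\<epsilon> n) g r * (of_real r * (- w2 n r + of_real ((\<nu>\<^sup>2 - 1/4) / r\<^sup>2) * w n r - Complex 1 (\<sigma> * \<epsilon> n) * w n r)))
      = (LINT r|half_line. B (\<epsilon> n) g r * P n r)"
      by (rule Bochner_Integration.integral_cong) (use op[of _ n] in \<open>auto simp: P_def\<close>)
    ultimately show ?thesis by simp
  qed
  have \<kappa>0: "\<kappa> \<longlonglongrightarrow> 0"
    by (rule Lim_null_comparison[OF _ \<epsilon>0]) (use \<kappa>(2) in auto)
  have mlim: "(\<lambda>n. m n r) \<longlonglongrightarrow> 1" for r
  proof -
    have "(\<lambda>n. exp (\<i> * of_real \<sigma> * \<kappa> n * of_real r)) \<longlonglongrightarrow> exp (\<i> * of_real \<sigma> * 0 * of_real r)"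
      by (intro tendsto_intros \<kappa>0)
    then show ?thesis by (simp add: m_def)
  qed
  \<comment> \<open>The error term tends to 0 pointwise because \<kappa> does, and the majorant in
    \<open>kmq\<close> is square-integrable and independent of n.\<close>
  have Plim: "(\<lambda>n. L2_norm (\<lambda>r. P n r - of_real r * \<psi> r)) \<longlonglongrightarrow> 0"
  proof -
    have "(\<lambda>n. LINT r|half_line. (norm (P n r - of_real r * \<psi> r))\<^sup>2) \<longlonglongrightarrow> (LINT r|half_line. 0)"
    proof (rule integral_dominated_convergence[where w = "\<lambda>r. (norm (of_real (2 * norm (of_real r * \<psi> r)) + complex_of_real (8 * C * L2_majorant \<nu> r)))\<^sup>2"])
      show "integrable half_line (\<lambda>r. (norm (of_real (2 * norm (of_real r * \<psi> r)) + complex_of_real (8 * C * L2_majorant \<nu> r)))\<^sup>2)"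
      proof (rule L2_integrable[OF L2_add])
        show "(\<lambda>r. complex_of_real (2 * norm (of_real r * \<psi> r))) \<in> L2"
          using L2_scale[OF \<psi>L, of 2] by (simp add: L2_def norm_mult)
        show "(\<lambda>r. complex_of_real (8 * C * L2_majorant \<nu> r)) \<in> L2"
          by (rule L2_if_le_majorant[OF \<nu>, of _ "8 * C"])
            (use C L2_majorant_nonneg in \<open>auto simp: L2_majorant_def[abs_def] norm_mult\<close>)
      qed
      show "AE r in half_line. (\<lambda>n. (norm (P n r - of_real r * \<psi> r))\<^sup>2) \<longlonglongrightarrow> 0"
      proof (rule AE_I2)
        fix r :: real
        have "(\<lambda>n. (norm (P n r - of_real r * \<psi> r))\<^sup>2) \<longlonglongrightarrow>
           (norm (1 * (of_real r * \<psi> r) - 2 * \<i> * of_real \<sigma> * 0 * (1 * q r) - of_real r * \<psi> r))\<^sup>2"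
          unfolding P_def by (intro tendsto_intros mlim \<kappa>0)
        then show "(\<lambda>n. (norm (P n r - of_real r * \<psi> r))\<^sup>2) \<longlonglongrightarrow> 0" by simp
      qed
      show "AE r in half_line. norm ((norm (P n r - of_real r * \<psi> r))\<^sup>2) \<le>
          (norm (of_real (2 * norm (of_real r * \<psi> r)) + complex_of_real (8 * C * L2_majorant \<nu> r)))\<^sup>2" for n
      proof (rule AE_I2)
        fix r assume "r \<in> space half_line"
        then have r: "r > 0" by simp
        have "norm (P n r - of_real r * \<psi> r) = norm ((m n r - 1) * (of_real r * \<psi> r) - 2 * \<i> * of_real \<sigma> * \<kappa> n * (m n r * q r))"
          by (simp add: P_def algebra_simps)
        also have "\<dots> \<le> norm ((m n r - 1) * (of_real r * \<psi> r)) + norm (2 * \<i> * of_real \<sigma> * \<kappa> n * (m n r * q r))"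
          by (rule norm_triangle_ineq4)
        also have "\<dots> \<le> 2 * norm (of_real r * \<psi> r) + 8 * C * L2_majorant \<nu> r"
        proof (intro add_mono kmq r)
          have "norm (m n r - 1) \<le> 2" using norm_triangle_ineq4[of "m n r" 1] m1[OF r, of n] by simp
          then show "norm ((m n r - 1) * (of_real r * \<psi> r)) \<le> 2 * norm (of_real r * \<psi> r)"
            unfolding norm_mult[of "m n r - 1"] by (intro mult_right_mono) auto
        qed
        also have "\<dots> = norm (of_real (2 * norm (of_real r * \<psi> r)) + complex_of_real (8 * C * L2_majorant \<nu> r))"
          unfolding of_real_add[symmetric] norm_of_real using C L2_majorant_nonneg[OF r, of \<nu>] by simp
        finally show "norm ((norm (P n r - of_real r * \<psi> r))\<^sup>2) \<le>
          (norm (of_real (2 * norm (of_real r * \<psi> r)) + complex_of_real (8 * C * L2_majorant \<nu> r)))\<^sup>2"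
          by (simp add: power_mono)
      qed
    qed measurable
    then have "(\<lambda>n. sqrt (LINT r|half_line. (norm (P n r - of_real r * \<psi> r))\<^sup>2)) \<longlonglongrightarrow> sqrt 0"
      by (intro tendsto_real_sqrt) simp
    then show ?thesis by (simp add: L2_norm_def)
  qed
  have "(\<lambda>n. (LINT r|half_line. B (\<epsilon> n) g r * P n r) - (LINT r|half_line. B (\<epsilon> n) g r * (of_real r * \<psi> r))) \<longlonglongrightarrow> 0"
  proof (rule Lim_null_comparison)
    show "\<forall>\<^sub>F n in sequentially. norm ((LINT r|half_line. B (\<epsilon> n) g r * P n r) - (LINT r|half_line. B (\<epsilon> n) g r * (of_real r * \<psi> r)))
        \<le> K * L2_norm (\<lambda>r. P n r - of_real r * \<psi> r)"
    proof (intro always_eventually allI)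
      fix n
      have "(LINT r|half_line. B (\<epsilon> n) g r * P n r) - (LINT r|half_line. B (\<epsilon> n) g r * (of_real r * \<psi> r))
        = (LINT r|half_line. B (\<epsilon> n) g r * (P n r - of_real r * \<psi> r))"
        using L2_mult_integrable[OF BL[of n] PL[of n]] L2_mult_integrable[OF BL[of n] \<psi>L] by (simp add: right_diff_distrib)
      also have "norm \<dots> \<le> L2_norm (B (\<epsilon> n) g) * L2_norm (\<lambda>r. P n r - of_real r * \<psi> r)"
        by (rule L2_Cauchy_Schwarz[OF BL L2_minus[OF PL \<psi>L]])
      also have "\<dots> \<le> K * L2_norm (\<lambda>r. P n r - of_real r * \<psi> r)" by (intro mult_right_mono K) simp
      finally show "norm ((LINT r|half_line. B (\<epsilon> n) g r * P n r) - (LINT r|half_line. B (\<epsilon> n) g r * (of_real r * \<psi> r)))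
        \<le> K * L2_norm (\<lambda>r. P n r - of_real r * \<psi> r)" .
    qed
    show "(\<lambda>n. K * L2_norm (\<lambda>r. P n r - of_real r * \<psi> r)) \<longlonglongrightarrow> 0"
      using tendsto_mult_left[OF Plim, of K] by simp
  qed
  from tendsto_add[OF this Blim[OF \<psi>L]]
  have 1: "(\<lambda>n. LINT r|half_line. B (\<epsilon> n) g r * P n r) \<longlonglongrightarrow> (LINT r|half_line. A g r * (of_real r * \<psi> r))" by simp
  have "(\<lambda>n. LINT r|half_line. g r * (w n r / of_real r)) \<longlonglongrightarrow> (LINT r|half_line. g r * (v r / of_real r))"
  proof (rule integral_dominated_convergence[where w = "\<lambda>r. norm (g r * (v r / of_real r))"])
    have [measurable]: "g \<in> borel_measurable half_line" by (rule L2_measurable[OF g])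
    show "integrable half_line (\<lambda>r. norm (g r * (v r / of_real r)))"
      by (intro integrable_norm L2_mult_integrable g vL)
    show "(\<lambda>r. g r * (v r / of_real r)) \<in> borel_measurable half_line" by measurable
    show "(\<lambda>r. g r * (w n r / of_real r)) \<in> borel_measurable half_line" for n unfolding w_def by measurable
    show "AE r in half_line. (\<lambda>n. g r * (w n r / of_real r)) \<longlonglongrightarrow> g r * (v r / of_real r)"
    proof (rule AE_I2)
      fix r :: real
      have "(\<lambda>n. (g r * (v r / of_real r)) * m n r) \<longlonglongrightarrow> (g r * (v r / of_real r)) * 1"
        by (intro tendsto_intros mlim)
      then show "(\<lambda>n. g r * (w n r / of_real r)) \<longlonglongrightarrow> g r * (v r / of_real r)" by (simp add: w_def mult.assoc)
    qed
    show "AE r in half_line. norm (g r * (w n r / of_real r)) \<le> norm (g r * (v r / of_real r))" for n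
    proof (rule AE_I2)
      fix r assume "r \<in> space half_line"
      then have r: "r > 0" by simp
      have "norm (g r * (v r / of_real r)) * norm (m n r) \<le> norm (g r * (v r / of_real r)) * 1"
        by (intro mult_left_mono m1 r) simp
      then show "norm (g r * (w n r / of_real r)) \<le> norm (g r * (v r / of_real r))" by (simp add: w_def norm_mult norm_divide)
    qed
  qed
  with 1 show "(LINT r|half_line. A g r * (of_real r * \<psi> r)) = (LINT r|half_line. g r * (v r / of_real r))"
    unfolding id by (rule LIMSEQ_unique)
qed

section \<open>The regular solution\<close>

text \<open>Coefficients of the entire function S with J(r) = 2^(-\<nu>) r^\<nu> S(r^2): the
  noninteger power is split off, and what remains can be differentiated termwise.\<close>

definition bessel_coeff :: "real \<Rightarrow> nat \<Rightarrow> real" where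
  "bessel_coeff \<nu> k = (-1) ^ k / (fact k * Gamma (\<nu> + real k + 1) * 4 ^ k)"

lemma bessel_coeff_Suc:
  assumes "\<nu> \<ge> 0"
  shows "(real k + 1) * (real k + \<nu> + 1) * bessel_coeff \<nu> (Suc k) = - bessel_coeff \<nu> k / 4"
proof -
  have "Gamma (\<nu> + real (Suc k) + 1) = (\<nu> + real k + 1) * Gamma (\<nu> + real k + 1)"
    using assms by (subst Gamma_plus1[symmetric]) (auto simp: add_ac nonpos_Ints_def)
  then have "bessel_coeff \<nu> (Suc k) = - ((-1) ^ k) / (((real k + 1) * fact k) * ((\<nu> + real k + 1) * Gamma (\<nu> + real k + 1)) * (4 * 4 ^ k))"
    unfolding bessel_coeff_def by (simp add: add.commute)
  also have "\<dots> = - bessel_coeff \<nu> k / (4 * (real k + 1) * (real k + \<nu> + 1))"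
    by (simp add: bessel_coeff_def add_ac mult_ac)
  finally have *: "bessel_coeff \<nu> (Suc k) = - bessel_coeff \<nu> k / (4 * (real k + 1) * (real k + \<nu> + 1))" .
  have "c * d * (- b / (4 * c * d)) = - b / 4" if "c > 0" "d > 0" for b c d :: real
    using that by simp
  from this[of "real k + 1" "real k + \<nu> + 1"] show ?thesis unfolding * using assms by simp
qed

lemma Gamma_add_nat_ge:
  assumes "\<nu> \<ge> 0"
  shows "Gamma (\<nu> + 1) \<le> Gamma (\<nu> + real k + 1)"
proof (induction k)
  case (Suc k)
  have "Gamma (\<nu> + real (Suc k) + 1) = (\<nu> + real k + 1) * Gamma (\<nu> + real k + 1)"
    using assms by (subst Gamma_plus1[symmetric]) (auto simp: add_ac nonpos_Ints_def)
  moreover have "1 * Gamma (\<nu> + real k + 1) \<le> (\<nu> + real k + 1) * Gamma (\<nu> + real k + 1)"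
    using assms by (intro mult_right_mono) (auto intro!: less_imp_le Gamma_real_pos)
  ultimately show ?case using Suc by simp
qed simp

text \<open>The order enters only through Gamma (\<nu> + 1), which makes the bound locally uniform
  in \<nu>; continuity in the order rests on this.\<close>

lemma bessel_coeff_bound:
  assumes "\<nu> \<ge> 0"
  shows "\<bar>bessel_coeff \<nu> k\<bar> \<le> 1 / Gamma (\<nu> + 1) * ((1/4) ^ k / fact k)"
proof -
  have p: "Gamma (\<nu> + 1) > 0" using assms by (intro Gamma_real_pos) auto
  have g: "Gamma (\<nu> + 1) \<le> Gamma (\<nu> + real k + 1)" by (rule Gamma_add_nat_ge[OF assms])
  have "\<bar>bessel_coeff \<nu> k\<bar> = 1 / Gamma (\<nu> + real k + 1) * ((1/4) ^ k / fact k)"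
    using p g by (simp add: bessel_coeff_def abs_mult power_one_over field_simps)
  also have "\<dots> \<le> 1 / Gamma (\<nu> + 1) * ((1/4) ^ k / fact k)"
    using p g by (intro mult_right_mono divide_left_mono) auto
  finally show ?thesis .
qed

lemma exp_series_quarter: "(\<lambda>k. (1/4) ^ k / fact k * x ^ k) sums exp (x / 4 :: real)"
proof -
  have "(1/4) ^ k / fact k * x ^ k = (x / 4) ^ k /\<^sub>R fact k" for k
  proof -
    have "(x / 4) ^ k = (1/4) ^ k * x ^ k" by (simp flip: power_mult_distrib)
    then show ?thesis by (simp add: inverse_eq_divide)
  qed
  then show ?thesis using exp_converges[of "x / 4"] by simp
qed

lemma bessel_coeff_term_bound:
  assumes "\<nu> \<ge> 0"
  shows "norm (bessel_coeff \<nu> k * x ^ k) \<le> 1 / Gamma (\<nu> + 1) * ((1/4) ^ k / fact k * \<bar>x\<bar> ^ k)"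
  using mult_right_mono[OF bessel_coeff_bound[OF assms, of k], of "\<bar>x\<bar> ^ k"]
  by (simp add: abs_mult power_abs mult_ac)

lemma bessel_coeff_summable:
  assumes "\<nu> \<ge> 0"
  shows "summable (\<lambda>k. bessel_coeff \<nu> k * x ^ k)"
proof (rule summable_comparison_test'[of "\<lambda>k. 1 / Gamma (\<nu> + 1) * ((1/4) ^ k / fact k * \<bar>x\<bar> ^ k)" 0])
  show "summable (\<lambda>k. 1 / Gamma (\<nu> + 1) * ((1/4) ^ k / fact k * \<bar>x\<bar> ^ k))"
    by (intro summable_mult sums_summable[OF exp_series_quarter])
qed (rule bessel_coeff_term_bound[OF assms])

definition bessel_S :: "real \<Rightarrow> real \<Rightarrow> real" where
  "bessel_S \<nu> x = (\<Sum>k. bessel_coeff \<nu> k * x ^ k)"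

definition bessel_S1 :: "real \<Rightarrow> real \<Rightarrow> real" where
  "bessel_S1 \<nu> x = (\<Sum>k. diffs (bessel_coeff \<nu>) k * x ^ k)"

definition bessel_S2 :: "real \<Rightarrow> real \<Rightarrow> real" where
  "bessel_S2 \<nu> x = (\<Sum>k. diffs (diffs (bessel_coeff \<nu>)) k * x ^ k)"

lemma bessel_S_bound:
  assumes "\<nu> \<ge> 0"
  shows "\<bar>bessel_S \<nu> x\<bar> \<le> exp (\<bar>x\<bar> / 4) / Gamma (\<nu> + 1)"
proof -
  have "norm (bessel_S \<nu> x) \<le> (\<Sum>k. 1 / Gamma (\<nu> + 1) * ((1/4) ^ k / fact k * \<bar>x\<bar> ^ k))"
    unfolding bessel_S_def
    by (rule norm_suminf_le[OF bessel_coeff_term_bound[OF assms]])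
      (intro summable_mult sums_summable[OF exp_series_quarter])
  also have "\<dots> = 1 / Gamma (\<nu> + 1) * exp (\<bar>x\<bar> / 4)"
    by (intro sums_unique[symmetric] sums_mult exp_series_quarter)
  finally show ?thesis by simp
qed

context
  fixes \<nu> :: real
  assumes \<nu>: "\<nu> \<ge> 0"
begin

lemma bessel_S1_summable: "summable (\<lambda>k. diffs (bessel_coeff \<nu>) k * x ^ k)"
  by (rule termdiff_converges_all[OF bessel_coeff_summable[OF \<nu>]])

lemma bessel_S2_summable: "summable (\<lambda>k. diffs (diffs (bessel_coeff \<nu>)) k * x ^ k)"
  by (rule termdiff_converges_all[OF bessel_S1_summable])

lemma bessel_S_deriv: "(bessel_S \<nu> has_real_derivative bessel_S1 \<nu> x) (at x)"
  unfolding bessel_S_def[abs_def] bessel_S1_def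
  by (rule termdiffs_strong_converges_everywhere[OF bessel_coeff_summable[OF \<nu>]])

lemma bessel_S1_deriv: "(bessel_S1 \<nu> has_real_derivative bessel_S2 \<nu> x) (at x)"
  unfolding bessel_S1_def[abs_def] bessel_S2_def
  by (rule termdiffs_strong_converges_everywhere[OF bessel_S1_summable])

text \<open>Bessel's equation in the variable x = r^2. At x^k the first two terms contribute (k +
  1)(k + \<nu> + 1) times the coefficient of index k + 1, which \<open>bessel_coeff_Suc\<close>
  cancels against the third.\<close>

lemma bessel_S_ode: "x * bessel_S2 \<nu> x + (\<nu> + 1) * bessel_S1 \<nu> x + bessel_S \<nu> x / 4 = 0"
proof -
  have "(\<lambda>k. x * (diffs (diffs (bessel_coeff \<nu>)) k * x ^ k)) sums (x * bessel_S2 \<nu> x)"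
    unfolding bessel_S2_def by (intro sums_mult summable_sums bessel_S2_summable)
  then have "(\<lambda>k. real (Suc k) * diffs (bessel_coeff \<nu>) (Suc k) * x ^ Suc k) sums (x * bessel_S2 \<nu> x)"
    by (simp add: diffs_def mult_ac)
  \<comment> \<open>The term of index 0 carries the factor k = 0, so the index shift leaves the sum
    unchanged.\<close>
  then have a: "(\<lambda>k. real k * diffs (bessel_coeff \<nu>) k * x ^ k) sums (x * bessel_S2 \<nu> x)"
    using sums_Suc_iff[of "\<lambda>k. real k * diffs (bessel_coeff \<nu>) k * x ^ k" "x * bessel_S2 \<nu> x"] by simp
  have b: "(\<lambda>k. (\<nu> + 1) * (diffs (bessel_coeff \<nu>) k * x ^ k)) sums ((\<nu> + 1) * bessel_S1 \<nu> x)"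
    unfolding bessel_S1_def by (intro sums_mult summable_sums bessel_S1_summable)
  have c: "(\<lambda>k. bessel_coeff \<nu> k * x ^ k / 4) sums (bessel_S \<nu> x / 4)"
    unfolding bessel_S_def by (intro sums_divide summable_sums bessel_coeff_summable \<nu>)
  have "(\<lambda>k. real k * diffs (bessel_coeff \<nu>) k * x ^ k + (\<nu> + 1) * (diffs (bessel_coeff \<nu>) k * x ^ k)
      + bessel_coeff \<nu> k * x ^ k / 4) sums (x * bessel_S2 \<nu> x + (\<nu> + 1) * bessel_S1 \<nu> x + bessel_S \<nu> x / 4)"
    by (intro sums_add a b c)
  moreover have "real k * diffs (bessel_coeff \<nu>) k * x ^ k + (\<nu> + 1) * (diffs (bessel_coeff \<nu>) k * x ^ k)
      + bessel_coeff \<nu> k * x ^ k / 4 = 0" for k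
  proof -
    have "real k * diffs (bessel_coeff \<nu>) k * x ^ k + (\<nu> + 1) * (diffs (bessel_coeff \<nu>) k * x ^ k)
      + bessel_coeff \<nu> k * x ^ k / 4 =
      ((real k + 1) * (real k + \<nu> + 1) * bessel_coeff \<nu> (Suc k) + bessel_coeff \<nu> k / 4) * x ^ k"
      by (simp add: diffs_def algebra_simps)
    then show ?thesis using bessel_coeff_Suc[OF \<nu>, of k] by simp
  qed
  ultimately have "(\<lambda>k. 0) sums (x * bessel_S2 \<nu> x + (\<nu> + 1) * bessel_S1 \<nu> x + bessel_S \<nu> x / 4)" by simp
  from sums_unique2[OF this sums_zero] show ?thesis .
qed

end

text \<open>\<open>bessel_phi \<nu> r = r\<^sup>1\<^sup>/\<^sup>2 J\<^sub>\<nu>(r)\<close> is the solution of \<open>\<phi>'' = ((\<nu>\<^sup>2 - 1/4) / r\<^sup>2 - 1) \<phi>\<close> that is regular at \<open>0\<close>.\<close>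

definition bessel_phi :: "real \<Rightarrow> real \<Rightarrow> real" where
  "bessel_phi \<nu> r = 2 powr (- \<nu>) * (r powr (\<nu> + 1/2) * bessel_S \<nu> (r\<^sup>2))"

definition bessel_phi' :: "real \<Rightarrow> real \<Rightarrow> real" where
  "bessel_phi' \<nu> r = 2 powr (- \<nu>) * ((\<nu> + 1/2) * r powr (\<nu> - 1/2) * bessel_S \<nu> (r\<^sup>2)
     + 2 * r powr (\<nu> + 3/2) * bessel_S1 \<nu> (r\<^sup>2))"

lemma bessel_phi_deriv:
  assumes "\<nu> \<ge> 0" "r > 0"
  shows "(bessel_phi \<nu> has_real_derivative bessel_phi' \<nu> r) (at r)"
proof -
  have p: "r powr (\<nu> + 1/2) * r = r powr (\<nu> + 3/2)" "r powr (\<nu> + 1/2 - 1) = r powr (\<nu> - 1/2)"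
    using assms(2) powr_add[of r "\<nu> + 1/2" 1] by (auto simp: algebra_simps)
  have "((\<lambda>r. bessel_S \<nu> (r\<^sup>2)) has_real_derivative bessel_S1 \<nu> (r\<^sup>2) * (2 * r)) (at r)"
    by (rule DERIV_chain2[OF bessel_S_deriv[OF assms(1)]]) (auto intro!: derivative_eq_intros)
  note d = DERIV_cmult[OF DERIV_mult[OF has_real_derivative_powr[OF assms(2), of "\<nu> + 1/2"] this], of "2 powr (- \<nu>)"]
  have "bessel_phi' \<nu> r = 2 powr - \<nu> * ((\<nu> + 1 / 2) * r powr (\<nu> + 1 / 2 - 1) * bessel_S \<nu> (r\<^sup>2) +
      bessel_S1 \<nu> (r\<^sup>2) * (2 * r) * r powr (\<nu> + 1 / 2))"
    unfolding bessel_phi'_def p[symmetric] by (simp add: algebra_simps)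
  with d show ?thesis unfolding bessel_phi_def[abs_def] by simp
qed

lemma bessel_phi'_deriv:
  assumes "\<nu> \<ge> 0" "r > 0"
  shows "(bessel_phi' \<nu> has_real_derivative ((\<nu>\<^sup>2 - 1/4) / r\<^sup>2 - 1) * bessel_phi \<nu> r) (at r)"
proof -
  define q where "q = \<nu> + 1/2"
  have d0: "((\<lambda>r. bessel_S \<nu> (r\<^sup>2)) has_real_derivative bessel_S1 \<nu> (r\<^sup>2) * (2 * r)) (at r)"
    by (rule DERIV_chain2[OF bessel_S_deriv[OF assms(1)]]) (auto intro!: derivative_eq_intros)
  have d1: "((\<lambda>r. bessel_S1 \<nu> (r\<^sup>2)) has_real_derivative bessel_S2 \<nu> (r\<^sup>2) * (2 * r)) (at r)"
    by (rule DERIV_chain2[OF bessel_S1_deriv[OF assms(1)]]) (auto intro!: derivative_eq_intros)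
  note d = DERIV_cmult[OF DERIV_add[OF
      DERIV_cmult[OF DERIV_mult[OF has_real_derivative_powr[OF assms(2), of "q - 1"] d0], of q]
      DERIV_cmult[OF DERIV_mult[OF has_real_derivative_powr[OF assms(2), of "q + 1"] d1], of 2]], of "2 powr (- \<nu>)"]
  \<comment> \<open>All powers of r that occur are this factor times nonnegative integer powers,
    which reduces the claim to polynomial algebra and \<open>bessel_S_ode\<close>.\<close>
  define P where "P = r powr q / r\<^sup>2"
  have r: "r \<noteq> 0" using assms(2) by simp
  have p: "r powr q = P * r\<^sup>2" "r powr (q - 1) = P * r" "r powr (q - 1 - 1) = P" "r powr (q + 1) = P * r ^ 3" "r powr (q + 1 - 1) = P * r\<^sup>2"
    using r assms(2) by (simp_all add: P_def powr_diff powr_add power2_eq_square power3_eq_cube)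
  have S2: "r\<^sup>2 * bessel_S2 \<nu> (r\<^sup>2) = - (\<nu> + 1) * bessel_S1 \<nu> (r\<^sup>2) - bessel_S \<nu> (r\<^sup>2) / 4"
    using bessel_S_ode[OF assms(1), of "r\<^sup>2"] by (simp add: algebra_simps)
  have q2: "\<nu>\<^sup>2 - 1/4 = q * (q - 1)" by (simp add: q_def power2_eq_square algebra_simps)
  have "2 powr - \<nu> *
     (q * ((q - 1) * r powr (q - 1 - 1) * bessel_S \<nu> (r\<^sup>2) + bessel_S1 \<nu> (r\<^sup>2) * (2 * r) * r powr (q - 1)) +
      2 * ((q + 1) * r powr (q + 1 - 1) * bessel_S1 \<nu> (r\<^sup>2) + bessel_S2 \<nu> (r\<^sup>2) * (2 * r) * r powr (q + 1)))
    = 2 powr - \<nu> * P * (q * (q - 1) * bessel_S \<nu> (r\<^sup>2) + (4 * q + 2) * r\<^sup>2 * bessel_S1 \<nu> (r\<^sup>2)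
        + 4 * r\<^sup>2 * (r\<^sup>2 * bessel_S2 \<nu> (r\<^sup>2)))"
    unfolding p by (simp add: algebra_simps power2_eq_square power3_eq_cube)
  also have "\<dots> = 2 powr - \<nu> * P * ((q * (q - 1) - r\<^sup>2) * bessel_S \<nu> (r\<^sup>2))"
    unfolding S2 by (simp add: q_def algebra_simps)
  also have "\<dots> = (q * (q - 1) / r\<^sup>2 - 1) * (2 powr - \<nu> * (r powr q * bessel_S \<nu> (r\<^sup>2)))"
    unfolding p(1) using r by (simp add: field_simps)
  finally have eq: "2 powr - \<nu> *
     (q * ((q - 1) * r powr (q - 1 - 1) * bessel_S \<nu> (r\<^sup>2) + bessel_S1 \<nu> (r\<^sup>2) * (2 * r) * r powr (q - 1)) +
      2 * ((q + 1) * r powr (q + 1 - 1) * bessel_S1 \<nu> (r\<^sup>2) + bessel_S2 \<nu> (r\<^sup>2) * (2 * r) * r powr (q + 1)))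
    = ((\<nu>\<^sup>2 - 1/4) / r\<^sup>2 - 1) * bessel_phi \<nu> r"
    unfolding q2 bessel_phi_def q_def .
  have "bessel_phi' \<nu> = (\<lambda>r. 2 powr - \<nu> * (q * (r powr (q - 1) * bessel_S \<nu> (r\<^sup>2)) + 2 * (r powr (q + 1) * bessel_S1 \<nu> (r\<^sup>2))))"
    by (simp add: bessel_phi'_def fun_eq_iff q_def mult_ac add_ac)
  then show ?thesis using d unfolding eq by simp
qed

section \<open>Link with J, behaviour at the origin and dependence on the order\<close>

lemma bessel_J_eq:
  assumes "\<nu> \<ge> 0" "r > 0"
  shows "bessel_J \<nu> r = r powr (-1/2) * bessel_phi \<nu> r" "e0 \<nu> r = of_real ((2 * \<nu>) powr (1/2) * (bessel_phi \<nu> r / r))"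
proof -
  have t: "(-1) ^ k / (fact k * Gamma (\<nu> + real k + 1)) * (r / 2) powr (2 * real k + \<nu>)
      = 2 powr (- \<nu>) * r powr \<nu> * (bessel_coeff \<nu> k * (r\<^sup>2) ^ k)" for k
  proof -
    have "(r / 2) powr (2 * real k + \<nu>) = (r / 2) powr (real (2 * k)) * (r / 2) powr \<nu>"
      by (simp add: powr_add)
    also have "(r / 2) powr (real (2 * k)) = (r\<^sup>2) ^ k / 4 ^ k"
      using assms by (subst powr_realpow) (auto simp: power_mult power_divide)
    also have "(r / 2) powr \<nu> = r powr \<nu> * 2 powr (- \<nu>)"
      using assms by (simp add: powr_divide powr_minus_divide)
    finally show ?thesis by (simp add: bessel_coeff_def)
  qed
  have J: "bessel_J \<nu> r = 2 powr (- \<nu>) * r powr \<nu> * bessel_S \<nu> (r\<^sup>2)"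
    unfolding bessel_J_def t bessel_S_def by (rule suminf_mult[OF bessel_coeff_summable[OF assms(1)]])
  have "r powr (-1/2) * r powr (\<nu> + 1/2) = r powr \<nu>" by (simp add: powr_add[symmetric])
  then show *: "bessel_J \<nu> r = r powr (-1/2) * bessel_phi \<nu> r"
    unfolding J bessel_phi_def by (simp add: mult.left_commute mult.assoc[symmetric])
  have "r powr (-1/2) * r powr (-1/2) = 1 / r"
    using assms(2) by (simp add: powr_add[symmetric] powr_minus_divide)
  then have "(2 * \<nu>) powr (1/2) * r powr (-1/2) * (r powr (-1/2) * bessel_phi \<nu> r) = (2 * \<nu>) powr (1/2) * (1 / r * bessel_phi \<nu> r)"
    by (metis mult.assoc)
  then show "e0 \<nu> r = of_real ((2 * \<nu>) powr (1/2) * (bessel_phi \<nu> r / r))"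
    unfolding e0_def * by (simp only: times_divide_eq_left mult_1)
qed

text \<open>The constant is explicit in the order and hence stays bounded along convergent sequences
  of orders; \<open>bessel_phi_near_0\<close> treats a fixed order together with the
  derivative.\<close>

lemma bessel_phi_bound_near_0:
  assumes "\<nu> \<ge> 0" "0 < r" "r \<le> 1"
  shows "\<bar>bessel_phi \<nu> r\<bar> \<le> exp 1 / Gamma (\<nu> + 1) * r powr (\<nu> + 1/2)"
proof -
  have G: "Gamma (\<nu> + 1) > 0" using assms by (intro Gamma_real_pos) auto
  have "r\<^sup>2 \<le> 1" using assms by (simp add: power_le_one)
  then have "exp (\<bar>r\<^sup>2\<bar> / 4) \<le> exp (1::real)" by simp
  then have S: "\<bar>bessel_S \<nu> (r\<^sup>2)\<bar> \<le> exp 1 / Gamma (\<nu> + 1)"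
    using bessel_S_bound[OF assms(1), of "r\<^sup>2"] G by (meson divide_right_mono less_imp_le order_trans)
  have "2 powr (- \<nu>) \<le> 1" using assms by (simp add: powr_minus_divide ge_one_powr_ge_zero)
  then have "2 powr (- \<nu>) * (r powr (\<nu> + 1/2) * \<bar>bessel_S \<nu> (r\<^sup>2)\<bar>) \<le> 1 * (r powr (\<nu> + 1/2) * (exp 1 / Gamma (\<nu> + 1)))"
    using S by (intro mult_mono) auto
  then show ?thesis by (simp add: bessel_phi_def abs_mult mult.commute)
qed

lemma bessel_phi_near_0:
  assumes "\<nu> \<ge> 0"
  obtains C where "\<And>r. 0 < r \<Longrightarrow> r \<le> 1 \<Longrightarrow> \<bar>bessel_phi \<nu> r\<bar> \<le> C * r powr (\<nu> + 1/2)"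
    "\<And>r. 0 < r \<Longrightarrow> r \<le> 1 \<Longrightarrow> \<bar>bessel_phi' \<nu> r\<bar> \<le> C * r powr (\<nu> - 1/2)"
proof -
  have c: "continuous_on {0..1} (bessel_S \<nu>)" "continuous_on {0..1} (bessel_S1 \<nu>)"
    using DERIV_isCont[OF bessel_S_deriv[OF assms]] DERIV_isCont[OF bessel_S1_deriv[OF assms]]
    by (auto intro!: continuous_at_imp_continuous_on)
  have ex: "\<exists>K. \<forall>x\<in>{0..1}. \<bar>f x\<bar> \<le> K" if "continuous_on {0..1} f" for f :: "real \<Rightarrow> real"
  proof -
    have "bounded (f ` {0..1})" by (intro compact_imp_bounded compact_continuous_image that compact_Icc)
    then show ?thesis unfolding bounded_iff by auto
  qed
  obtain K K1 where K: "\<And>x. x \<in> {0..1} \<Longrightarrow> \<bar>bessel_S \<nu> x\<bar> \<le> K" "\<And>x. x \<in> {0..1} \<Longrightarrow> \<bar>bessel_S1 \<nu> x\<bar> \<le> K1"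
    using ex[OF c(1)] ex[OF c(2)] by blast
  have K0: "K \<ge> 0" "K1 \<ge> 0" using K(1,2)[of 0] by auto
  have t: "2 powr (- \<nu>) \<le> 1" using assms by (simp add: powr_minus_divide ge_one_powr_ge_zero)
  define C where "C = (\<nu> + 1) * K + 2 * K1"
  show ?thesis
  proof (rule that[of C])
    fix r :: real assume r: "0 < r" "r \<le> 1"
    have r2: "r\<^sup>2 \<in> {0..1}" using r by (simp add: power_le_one)
    have "2 powr (- \<nu>) * (r powr (\<nu> + 1/2) * \<bar>bessel_S \<nu> (r\<^sup>2)\<bar>) \<le> 1 * (r powr (\<nu> + 1/2) * K)"
      using K r2 t K0 by (intro mult_mono) auto
    also have "\<dots> \<le> r powr (\<nu> + 1/2) * C"
      unfolding mult_1 using K0 assms by (intro mult_left_mono) (auto simp: C_def algebra_simps)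
    finally show "\<bar>bessel_phi \<nu> r\<bar> \<le> C * r powr (\<nu> + 1/2)" by (simp add: bessel_phi_def abs_mult mult.commute)
    have le: "r powr (\<nu> + 3/2) \<le> r powr (\<nu> - 1/2)" using r by (intro powr_mono') auto
    have "\<bar>bessel_phi' \<nu> r\<bar> \<le> 2 powr (- \<nu>) * ((\<nu> + 1/2) * r powr (\<nu> - 1/2) * \<bar>bessel_S \<nu> (r\<^sup>2)\<bar> + 2 * r powr (\<nu> + 3/2) * \<bar>bessel_S1 \<nu> (r\<^sup>2)\<bar>)"
    proof -
      have "\<bar>(\<nu> + 1/2) * r powr (\<nu> - 1/2) * bessel_S \<nu> (r\<^sup>2) + 2 * r powr (\<nu> + 3/2) * bessel_S1 \<nu> (r\<^sup>2)\<bar>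
        \<le> (\<nu> + 1/2) * r powr (\<nu> - 1/2) * \<bar>bessel_S \<nu> (r\<^sup>2)\<bar> + 2 * r powr (\<nu> + 3/2) * \<bar>bessel_S1 \<nu> (r\<^sup>2)\<bar>"
        by (rule order_trans[OF abs_triangle_ineq]) (use assms in \<open>simp add: abs_mult\<close>)
      then show ?thesis unfolding bessel_phi'_def abs_mult by (simp add: mult_left_mono)
    qed
    also have "\<dots> \<le> 1 * ((\<nu> + 1/2) * r powr (\<nu> - 1/2) * K + 2 * r powr (\<nu> - 1/2) * K1)"
      using K r2 t K0 assms le by (intro mult_mono add_mono) auto
    also have "\<dots> = r powr (\<nu> - 1/2) * ((\<nu> + 1/2) * K + 2 * K1)" by (simp add: algebra_simps)
    also have "\<dots> \<le> r powr (\<nu> - 1/2) * C"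
      using K0 by (intro mult_left_mono) (auto simp: C_def algebra_simps)
    finally show "\<bar>bessel_phi' \<nu> r\<bar> \<le> C * r powr (\<nu> - 1/2)" by (simp add: mult.commute)
  qed
qed

lemma bessel_phi_continuous: "\<nu> \<ge> 0 \<Longrightarrow> continuous_on {0<..} (bessel_phi \<nu>)"
  using DERIV_isCont[OF bessel_phi_deriv] by (auto intro!: continuous_at_imp_continuous_on)

text \<open>Tannery's theorem for the power series: a summable majorant independent of n is
  available once Gamma (\<mu> n + 1) exceeds half of its limit.\<close>

lemma bessel_phi_continuous_in_order:
  assumes \<mu>: "\<mu> \<longlonglongrightarrow> \<nu>" and "\<And>n. \<mu> n \<ge> 0" "\<nu> \<ge> 0" "r > 0"
  shows "(\<lambda>n. bessel_phi (\<mu> n) r) \<longlonglongrightarrow> bessel_phi \<nu> r"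
proof -
  have G: "Gamma (\<nu> + 1) > 0" using assms by (intro Gamma_real_pos) auto
  have nz: "\<nu> + real k + 1 \<notin> \<int>\<^sub>\<le>\<^sub>0" for k using assms by (auto simp: nonpos_Ints_def)
  have Gl: "(\<lambda>n. Gamma (\<mu> n + real k + 1)) \<longlonglongrightarrow> Gamma (\<nu> + real k + 1)" for k
    by (intro tendsto_Gamma tendsto_intros \<mu> nz)
  have "\<forall>\<^sub>F n in sequentially. Gamma (\<mu> n + real 0 + 1) > Gamma (\<nu> + 1) / 2"
    by (rule order_tendstoD(1)[OF Gl[of 0]]) (use G in simp)
  then have ev: "\<forall>\<^sub>F n in sequentially. 1 / Gamma (\<mu> n + 1) \<le> 2 / Gamma (\<nu> + 1)"
    by eventually_elim (use G in \<open>simp add: field_simps\<close>)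
  have "(\<lambda>n. bessel_S (\<mu> n) x) \<longlonglongrightarrow> bessel_S \<nu> x" for x
    unfolding bessel_S_def
  proof (rule tannerys_theorem[THEN conjunct2, THEN conjunct2])
    show "(\<lambda>n. bessel_coeff (\<mu> n) k * x ^ k) \<longlonglongrightarrow> bessel_coeff \<nu> k * x ^ k" for k
    proof -
      have "Gamma (\<nu> + real k + 1) > 0" using assms by (intro Gamma_real_pos) auto
      then show ?thesis unfolding bessel_coeff_def by (intro tendsto_intros Gl) auto
    qed
    have "eventually (\<lambda>(k, n). 1 / Gamma (\<mu> n + 1) \<le> 2 / Gamma (\<nu> + 1)) (sequentially \<times>\<^sub>F sequentially)"
      using eventually_prodI[OF eventually_True[of sequentially] ev] by (simp add: case_prod_unfold)
    then show "\<forall>\<^sub>F (k, n) in sequentially \<times>\<^sub>F sequentially.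
        norm (bessel_coeff (\<mu> n) k * x ^ k) \<le> 2 / Gamma (\<nu> + 1) * ((1/4) ^ k / fact k * \<bar>x\<bar> ^ k)"
    proof (rule eventually_mono, safe)
      fix k n assume "1 / Gamma (\<mu> n + 1) \<le> 2 / Gamma (\<nu> + 1)"
      then show "norm (bessel_coeff (\<mu> n) k * x ^ k) \<le> 2 / Gamma (\<nu> + 1) * ((1/4) ^ k / fact k * \<bar>x\<bar> ^ k)"
        by (intro order_trans[OF bessel_coeff_term_bound[OF assms(2)] mult_right_mono]) auto
    qed
    show "summable (\<lambda>k. 2 / Gamma (\<nu> + 1) * ((1/4) ^ k / fact k * \<bar>x\<bar> ^ k))"
      by (intro summable_mult sums_summable[OF exp_series_quarter])
  qed simp
  then show ?thesis
    unfolding bessel_phi_def using assms(4) by (intro tendsto_intros \<mu>) auto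
qed

section \<open>The Hankel function as a Laplace integral\<close>

text \<open>Integrability of \<open>f\<close> is assumed, so the boundary values have to be known
  only along 1/(n+1) and n+1. The integrations by parts over the whole half-line go through this
  form.\<close>

lemma half_line_FTC:
  fixes F f :: "real \<Rightarrow> 'a::euclidean_space"
  assumes F: "\<And>x. x > 0 \<Longrightarrow> (F has_vector_derivative f x) (at x)"
    and f: "integrable half_line f"
    and A: "(\<lambda>n. F (1 / real (Suc n))) \<longlonglongrightarrow> A" and B: "(\<lambda>n. F (real (Suc n))) \<longlonglongrightarrow> B"
  shows "(LINT r|half_line. f r) = B - A"
proof -
  define I where "I n = {1 / real (Suc n)..real (Suc n)}" for n
  have fL: "integrable lebesgue (\<lambda>x. indicator {0<..} x *\<^sub>R f x)"
    using f by (simp add: integrable_restrict_space)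
  have sub: "I n \<subseteq> {0<..}" for n by (auto simp: I_def intro: less_le_trans[rotated])
  have int: "(LINT r|half_line. indicator (I n) r *\<^sub>R f r) = F (real (Suc n)) - F (1 / real (Suc n))" for n
  proof -
    have "1 / real (Suc n) \<le> real (Suc n)" by (rule order_trans[of _ 1]) auto
    then have h: "(f has_integral (F (real (Suc n)) - F (1 / real (Suc n)))) (I n)"
      unfolding I_def using sub[of n, unfolded I_def]
      by (intro fundamental_theorem_of_calculus has_vector_derivative_at_within[OF F]) auto
    have "set_integrable lebesgue (I n) f"
      using set_integrable_subset[of lebesgue "{0<..}" f "I n"] fL sub by (auto simp: set_integrable_def I_def)
    from set_lebesgue_integral_eq_integral(2)[OF this]
    have 1: "(LINT x:I n|lebesgue. f x) = F (real (Suc n)) - F (1 / real (Suc n))"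
      using integral_unique[OF h] by simp
    have eq: "indicator {0<..} x *\<^sub>R (indicator (I n) x *\<^sub>R f x) = indicator (I n) x *\<^sub>R f x" for x
      using sub[of n] by (auto simp: indicator_def)
    have "(LINT r|half_line. indicator (I n) r *\<^sub>R f r) = (LINT x|lebesgue. indicator {0<..} x *\<^sub>R (indicator (I n) x *\<^sub>R f x))"
      by (rule integral_restrict_space) simp
    also have "\<dots> = (LINT x:I n|lebesgue. f x)" unfolding eq set_lebesgue_integral_def ..
    finally show ?thesis using 1 by simp
  qed
  have "(\<lambda>n. LINT r|half_line. indicator (I n) r *\<^sub>R f r) \<longlonglongrightarrow> (LINT r|half_line. f r)"
  proof (rule integral_dominated_convergence[where w = "\<lambda>r. norm (f r)"])
    have [measurable]: "f \<in> borel_measurable half_line" using f by auto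
    have [measurable]: "I n \<in> sets half_line" for n
      using sub[of n] by (simp add: I_def sets_restrict_space_iff)
    show "f \<in> borel_measurable half_line" by measurable
    show "(\<lambda>r. indicator (I n) r *\<^sub>R f r) \<in> borel_measurable half_line" for n by measurable
    show "integrable half_line (\<lambda>r. norm (f r))" using f by auto
    show "AE r in half_line. (\<lambda>n. indicator (I n) r *\<^sub>R f r) \<longlonglongrightarrow> f r"
    proof (rule AE_I2)
      fix r assume "r \<in> space half_line"
      then have r: "r > 0" by simp
      obtain n0 :: nat where n0: "real n0 > max r (1 / r)" using reals_Archimedean2 by blast
      have "indicator (I n) r *\<^sub>R f r = f r" if "n \<ge> n0" for n
      proof -
        have "real (Suc n) > r" "real (Suc n) > 1 / r" using n0 that by auto
        then have "r \<in> I n" using r by (auto simp: I_def field_simps)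
        then show ?thesis by simp
      qed
      then show "(\<lambda>n. indicator (I n) r *\<^sub>R f r) \<longlonglongrightarrow> f r"
        by (intro tendsto_eventually) (auto simp: eventually_sequentially)
    qed
    show "AE r in half_line. norm (indicator (I n) r *\<^sub>R f r) \<le> norm (f r)" for n
      by (intro AE_I2) (auto simp: indicator_def)
  qed
  moreover have "(\<lambda>n. LINT r|half_line. indicator (I n) r *\<^sub>R f r) \<longlonglongrightarrow> B - A"
    unfolding int by (intro tendsto_diff A B)
  ultimately show ?thesis by (rule LIMSEQ_unique)
qed

text \<open>The n-th power of y exp(-y) \<le> 1 with y = c t / n bounds t^n exp(-c t), and n exceeds
  the growth exponents by enough to leave 1/t^2 over.\<close>

lemma exp_powr_decay:
  fixes c p :: real
  assumes "c > 0"
  shows "\<exists>C\<ge>0. \<forall>t\<ge>1. exp (- (c * t)) * t powr p * (1 + t) ^ N \<le> C * (1 / t)\<^sup>2"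
proof -
  obtain k :: nat where k: "p \<le> real k" using real_arch_simple by blast
  define n where "n = Suc (k + N + 2)"
  define C where "C = 2 ^ N * (real n / c) ^ n"
  have n: "real n > 0" by (simp add: n_def)
  show ?thesis
  proof (intro exI[of _ C] conjI allI impI)
    show "C \<ge> 0" using assms by (simp add: C_def)
    fix t :: real assume t: "t \<ge> 1"
    have "((c * t / real n) * exp (- (c * t / real n))) ^ n \<le> 1 ^ n"
      using assms t n by (intro power_mono mult_exp_neg_le) auto
    moreover have "exp (- (c * t / real n)) ^ n = exp (- (c * t))"
      using exp_of_nat_mult[of n "- (c * t / real n)"] n by simp
    ultimately have "(c * t / real n) ^ n * exp (- (c * t)) \<le> 1"
      unfolding power_mult_distrib[of "c * t / real n"] by simp
    moreover have "(c * t / real n) ^ n = (c / real n) ^ n * t ^ n" by (simp flip: power_mult_distrib)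
    ultimately have "(c / real n) ^ n * (t ^ n * exp (- (c * t))) \<le> 1" by (simp add: mult_ac)
    then have 1: "t ^ n * exp (- (c * t)) \<le> (real n / c) ^ n"
      using assms n by (simp add: power_divide field_simps)
    have "t powr p \<le> t powr real k" using t k by (intro powr_mono) auto
    also have "\<dots> = t ^ k" using t by (simp add: powr_realpow)
    finally have p: "t powr p \<le> t ^ k" .
    have "(1 + t) ^ N \<le> (2 * t) ^ N" using t by (intro power_mono) auto
    then have "exp (- (c * t)) * t powr p * (1 + t) ^ N \<le> exp (- (c * t)) * t ^ k * (2 * t) ^ N"
      using t p by (intro mult_mono) auto
    also have "\<dots> = 2 ^ N * (exp (- (c * t)) * t ^ (k + N + 2)) / t\<^sup>2"
      using t by (simp add: power_mult_distrib power_add field_simps power2_eq_square)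
    also have "\<dots> \<le> 2 ^ N * (exp (- (c * t)) * t ^ n) / t\<^sup>2"
      using t unfolding n_def by (intro divide_right_mono mult_left_mono power_increasing) auto
    also have "\<dots> \<le> 2 ^ N * (real n / c) ^ n / t\<^sup>2"
      using t 1 by (intro divide_right_mono mult_left_mono) (auto simp: mult.commute)
    finally show "exp (- (c * t)) * t powr p * (1 + t) ^ N \<le> C * (1 / t)\<^sup>2"
      by (simp add: C_def power_divide)
  qed
qed

lemma exp_powr_integrable:
  fixes c p :: real
  assumes "c > 0" "p > -1"
  shows "integrable half_line (\<lambda>t. exp (- (c * t)) * t powr p * (1 + t) ^ N)"
proof -
  obtain C where C: "C \<ge> 0" "\<And>t. t \<ge> 1 \<Longrightarrow> exp (- (c * t)) * t powr p * (1 + t) ^ N \<le> C * (1 / t)\<^sup>2"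
    using exp_powr_decay[OF assms(1)] by blast
  show ?thesis
  proof (rule Bochner_Integration.integrable_bound)
    show "integrable half_line (\<lambda>t. (2 ^ N + C) * (L2_majorant ((p + 1) / 2) t)\<^sup>2)"
      using assms by (intro integrable_mult_right L2_majorant_integrable) simp
    show "(\<lambda>t. exp (- (c * t)) * t powr p * (1 + t) ^ N) \<in> borel_measurable half_line" by measurable
    show "AE t in half_line. norm (exp (- (c * t)) * t powr p * (1 + t) ^ N) \<le> norm ((2 ^ N + C) * (L2_majorant ((p + 1) / 2) t)\<^sup>2)"
    proof (rule AE_I2)
      fix t assume "t \<in> space half_line"
      then have t: "t > 0" by simp
      have "exp (- (c * t)) * t powr p * (1 + t) ^ N \<le> (2 ^ N + C) * (L2_majorant ((p + 1) / 2) t)\<^sup>2"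
      proof (cases "t \<le> 1")
        case True
        have "(t powr ((p + 1) / 2 - 1/2))\<^sup>2 = t powr p"
          by (simp add: power2_eq_square powr_add[symmetric] field_simps)
        then have M: "(L2_majorant ((p + 1) / 2) t)\<^sup>2 = t powr p" using True by (simp add: L2_majorant_def)
        have "exp (- (c * t)) * t powr p * (1 + t) ^ N \<le> 1 * t powr p * 2 ^ N"
          using True t assms by (intro mult_mono power_mono) auto
        also have "\<dots> \<le> (2 ^ N + C) * t powr p" using C(1) by (simp add: algebra_simps)
        finally show ?thesis by (simp add: M)
      next
        case False
        have "exp (- (c * t)) * t powr p * (1 + t) ^ N \<le> C * (1 / t)\<^sup>2" using C(2) False by simp
        also have "\<dots> \<le> (2 ^ N + C) * (1 / t)\<^sup>2" by (intro mult_right_mono) auto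
        finally show ?thesis using False by (simp add: L2_majorant_def)
      qed
      then show "norm (exp (- (c * t)) * t powr p * (1 + t) ^ N) \<le> norm ((2 ^ N + C) * (L2_majorant ((p + 1) / 2) t)\<^sup>2)"
        using t C(1) by simp
    qed
  qed
qed

lemma Gamma_half_line:
  assumes "x > (0::real)"
  shows "(LINT t|half_line. exp (- t) * t powr (x - 1)) = Gamma x"
proof -
  have i: "integrable half_line (\<lambda>t. exp (- t) * t powr (x - 1))"
    using exp_powr_integrable[of 1 "x - 1" 0] assms by simp
  have "((\<lambda>t. exp (- t) * t powr (x - 1)) has_integral Gamma x) {0..}"
    using Gamma_integral_real[OF assms] by (simp add: exp_minus field_simps)
  then have "((\<lambda>t. exp (- t) * t powr (x - 1)) has_integral Gamma x) {0<..}"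
    by (rule has_integral_spike_set_eq[THEN iffD1, rotated 2]) (auto intro: negligible_subset[of "{0}"])
  moreover have "set_integrable lebesgue {0<..} (\<lambda>t. exp (- t) * t powr (x - 1))"
    using i by (simp add: integrable_restrict_space set_integrable_def)
  ultimately have "(LINT t:{0<..}|lebesgue. exp (- t) * t powr (x - 1)) = Gamma x"
    using set_lebesgue_integral_eq_integral(2) integral_unique by metis
  then show ?thesis by (simp add: integral_restrict_space set_lebesgue_integral_def)
qed

lemma half_line_scale:
  fixes f :: "real \<Rightarrow> 'a::euclidean_space"
  assumes "r > 0"
  shows "(LINT s|half_line. f s) = (1 / r) *\<^sub>R (LINT t|half_line. f (t / r))"
proof -
  have "(LINT s|half_line. f s) = (LINT s|lebesgue. indicator {0<..} s *\<^sub>R f s)"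
    by (simp add: integral_restrict_space)
  also have "\<dots> = \<bar>1 / r\<bar> *\<^sub>R (LINT t|lebesgue. indicator {0<..} (0 + 1 / r * t) *\<^sub>R f (0 + 1 / r * t))"
    using assms by (intro lebesgue_integral_real_affine) simp
  also have "(\<lambda>t. indicator {0<..} (0 + 1 / r * t) *\<^sub>R f (0 + 1 / r * t)) = (\<lambda>t. indicator {0<..} t *\<^sub>R f (t / r))"
    using assms by (auto simp: indicator_def zero_less_divide_iff)
  finally show ?thesis using assms by (simp add: integral_restrict_space)
qed

text \<open>The weight in Hankel's integral: up to constants, the Hankel function of the first kind
  is r^\<nu> exp(i r) times the Laplace transform of (s (1 + i s / 2))^(\<nu> - 1/2).\<close>

definition hankel_m :: "real \<Rightarrow> real \<Rightarrow> complex" where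
  "hankel_m \<nu> s = of_real (s powr (\<nu> - 1/2)) * (1 + \<i> * of_real s / 2) powr of_real (\<nu> - 1/2)"

lemma one_plus_imag_norm: "1 \<le> norm (1 + \<i> * of_real t)" "t \<ge> 0 \<Longrightarrow> norm (1 + \<i> * of_real t) \<le> 1 + t"
  using complex_Re_le_cmod[of "1 + \<i> * of_real t"] norm_triangle_ineq[of 1 "\<i> * of_real t"]
  by (auto simp: norm_mult)

lemma one_plus_imag_powr_le:
  assumes "t \<ge> 0" "\<bar>\<gamma>\<bar> \<le> real N" "u \<ge> 0" "u \<le> t"
  shows "norm ((1 + \<i> * of_real u) powr of_real \<gamma>) \<le> (1 + t) ^ N"
proof -
  let ?w = "norm (1 + \<i> * of_real u)"
  have w: "1 \<le> ?w" "?w \<le> 1 + t" using one_plus_imag_norm[of u] assms by auto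
  have "norm ((1 + \<i> * of_real u) powr of_real \<gamma>) = ?w powr \<gamma>" by (simp add: norm_powr_real_powr')
  also have "\<dots> \<le> ?w powr real N" using w assms by (intro powr_mono) auto
  also have "\<dots> = ?w ^ N" using w by (intro powr_realpow) linarith
  also have "\<dots> \<le> (1 + t) ^ N" using w by (intro power_mono) auto
  finally show ?thesis .
qed

lemma one_plus_imag_notin_nonpos: "1 + \<i> * of_real s / 2 \<notin> \<real>\<^sub>\<le>\<^sub>0"
  by (auto simp: complex_nonpos_Reals_iff)

lemma one_plus_imag_nonzero: "1 + \<i> * of_real s / 2 \<noteq> 0"
  by (simp add: complex_eq_iff)

text \<open>With u = s (1 + i s / 2) the function being differentiated is u^(\<nu>+1/2), and du/ds =
  1 + i s.\<close>

lemma hankel_m_deriv: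
  assumes "s > 0"
  shows "((\<lambda>s. of_real s * (1 + \<i> * of_real s / 2) * hankel_m \<nu> s) has_vector_derivative
    of_real (\<nu> + 1/2) * (1 + \<i> * of_real s) * hankel_m \<nu> s) (at s)"
proof -
  define \<gamma> where "\<gamma> = \<nu> - 1/2"
  define w where "w = 1 + \<i> * of_real s / 2"
  have w0: "w \<noteq> 0" using one_plus_imag_notin_nonpos[of s] by (auto simp: w_def)
  have a: "((\<lambda>s. complex_of_real (s powr \<gamma>)) has_vector_derivative of_real (\<gamma> * s powr (\<gamma> - 1))) (at s)"
    using assms by (intro has_vector_derivative_of_real has_real_derivative_powr)
  have b: "((\<lambda>s. (1 + \<i> * of_real s / 2) powr of_real \<gamma>) has_vector_derivative of_real \<gamma> * w powr (of_real \<gamma> - 1) * (\<i> / 2)) (at s)"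
    unfolding w_def
    by (rule has_vector_derivative_real_field)
      (rule DERIV_chain2[where f = "\<lambda>z. z powr of_real \<gamma>" and g = "\<lambda>z. 1 + \<i> * z / 2", OF has_field_derivative_powr[OF one_plus_imag_notin_nonpos]],
        auto intro!: derivative_eq_intros)
  have c: "((\<lambda>s. complex_of_real s * (1 + \<i> * of_real s / 2)) has_vector_derivative 1 + \<i> * of_real s) (at s)"
    by (rule has_vector_derivative_real_field) (auto intro!: derivative_eq_intros)
  have "((\<lambda>s. of_real s * (1 + \<i> * of_real s / 2) * (of_real (s powr \<gamma>) * (1 + \<i> * of_real s / 2) powr of_real \<gamma>))
     has_vector_derivative
       of_real s * (1 + \<i> * of_real s / 2) * (of_real (s powr \<gamma>) * (of_real \<gamma> * w powr (of_real \<gamma> - 1) * (\<i> / 2))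
         + of_real (\<gamma> * s powr (\<gamma> - 1)) * (1 + \<i> * of_real s / 2) powr of_real \<gamma>)
       + (1 + \<i> * of_real s) * (of_real (s powr \<gamma>) * (1 + \<i> * of_real s / 2) powr of_real \<gamma>)) (at s)"
    by (intro has_vector_derivative_mult a b c)
  moreover have "w powr (of_real \<gamma> - 1) = w powr of_real \<gamma> / w" using w0 by (simp add: powr_diff)
  moreover have "s powr (\<gamma> - 1) = s powr \<gamma> / s" using assms by (simp add: powr_diff)
  moreover have "of_real s * w * (of_real (s powr \<gamma>) * (of_real \<gamma> * (w powr of_real \<gamma> / w) * (\<i> / 2))
         + of_real (\<gamma> * (s powr \<gamma> / s)) * w powr of_real \<gamma>) + (1 + \<i> * of_real s) * (of_real (s powr \<gamma>) * w powr of_real \<gamma>)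
      = of_real (\<gamma> + 1) * (1 + \<i> * of_real s) * (of_real (s powr \<gamma>) * w powr of_real \<gamma>)"
  proof -
    have gen: "S * W * (P * (G * (Z / W) * (\<i> / 2)) + G * (P / S) * Z) = G * (S * \<i> / 2 + W) * (P * Z)"
      if "S \<noteq> 0" "W \<noteq> 0" for S W P G Z :: complex
      using that by (simp add: field_simps)
    have "complex_of_real s \<noteq> 0" using assms by simp
    from gen[OF this w0, of "of_real (s powr \<gamma>)" "of_real \<gamma>" "w powr of_real \<gamma>"]
    have "of_real s * w * (of_real (s powr \<gamma>) * (of_real \<gamma> * (w powr of_real \<gamma> / w) * (\<i> / 2))
         + of_real (\<gamma> * (s powr \<gamma> / s)) * w powr of_real \<gamma>)
      = of_real \<gamma> * (of_real s * \<i> / 2 + w) * (of_real (s powr \<gamma>) * w powr of_real \<gamma>)"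
      by simp
    also have "of_real s * \<i> / 2 + w = 1 + \<i> * of_real s" by (simp add: w_def)
    finally show ?thesis by (simp add: algebra_simps)
  qed
  ultimately show ?thesis
    unfolding hankel_m_def \<gamma>_def[symmetric] w_def[symmetric] by (simp add: \<gamma>_def add.commute)
qed

lemma hankel_m_continuous: "continuous_on {0<..} (hankel_m \<nu>)"
  unfolding hankel_m_def[abs_def]
  by (intro continuous_intros) (use one_plus_imag_notin_nonpos one_plus_imag_nonzero in auto)

lemma hankel_m_le:
  assumes "\<bar>\<nu> - 1/2\<bar> \<le> real N" "s > 0"
  shows "norm (hankel_m \<nu> s) \<le> s powr (\<nu> - 1/2) * (1 + s) ^ N"
  using one_plus_imag_powr_le[OF _ assms(1), of s "s / 2"] assms
  by (auto simp: hankel_m_def norm_mult intro!: mult_left_mono)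

definition hankel_L :: "real \<Rightarrow> nat \<Rightarrow> real \<Rightarrow> complex" where
  "hankel_L \<nu> j r = (LINT s|half_line. of_real (exp (- (r * s)) * s ^ j) * hankel_m \<nu> s)"

lemma hankel_m_measurable [measurable]: "hankel_m \<nu> \<in> borel_measurable half_line"
  by (rule continuous_measurable_half_line[OF hankel_m_continuous])

lemma hankel_L_bound:
  assumes "\<bar>\<nu> - 1/2\<bar> \<le> real N" "s > 0"
  shows "norm (of_real (exp (- (r * s)) * s ^ j) * hankel_m \<nu> s) \<le> exp (- (r * s)) * s powr (\<nu> - 1/2 + real j) * (1 + s) ^ N"
proof -
  have "norm (of_real (exp (- (r * s)) * s ^ j) * hankel_m \<nu> s) = exp (- (r * s)) * s ^ j * norm (hankel_m \<nu> s)"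
    using assms by (simp add: norm_mult norm_power)
  also have "\<dots> \<le> exp (- (r * s)) * s ^ j * (s powr (\<nu> - 1/2) * (1 + s) ^ N)"
    using assms by (intro mult_left_mono hankel_m_le) auto
  also have "\<dots> = exp (- (r * s)) * s powr (\<nu> - 1/2 + real j) * (1 + s) ^ N"
    using assms by (simp add: powr_add powr_realpow)
  finally show ?thesis .
qed

lemma abs_le_nat_exists: "\<exists>N::nat. \<bar>x::real\<bar> \<le> real N"
  using real_arch_simple by blast

lemma hankel_L_integrable:
  assumes "\<nu> > 0" "r > 0"
  shows "integrable half_line (\<lambda>s. of_real (exp (- (r * s)) * s ^ j) * hankel_m \<nu> s)"
proof -
  obtain N :: nat where N: "\<bar>\<nu> - 1/2\<bar> \<le> real N" using abs_le_nat_exists by blast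
  show ?thesis
  proof (rule Bochner_Integration.integrable_bound[OF exp_powr_integrable[OF assms(2), of "\<nu> - 1/2 + real j" N]])
    show "\<nu> - 1/2 + real j > -1" using assms by simp
    show "(\<lambda>s. of_real (exp (- (r * s)) * s ^ j) * hankel_m \<nu> s) \<in> borel_measurable half_line" by measurable
    show "AE s in half_line. norm (of_real (exp (- (r * s)) * s ^ j) * hankel_m \<nu> s) \<le>
        norm (exp (- (r * s)) * s powr (\<nu> - 1/2 + real j) * (1 + s) ^ N)"
      by (intro AE_I2) (use hankel_L_bound[OF N] in \<open>auto intro: order_trans\<close>)
  qed
qed

text \<open>Differentiation under the integral by a Taylor estimate: exp(-u) - 1 + u is at most u^2
  exp \<bar>u\<bar> for u = (y - r) s. For y within r/2 of r half of the exponential decay survives,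
  so the remainder is quadratic in y - r with a convergent integral as constant.\<close>

lemma hankel_L_deriv:
  assumes "\<nu> > 0" "r > 0"
  shows "(hankel_L \<nu> j has_vector_derivative - hankel_L \<nu> (Suc j) r) (at r)"
proof -
  define K where "K = (LINT s|half_line. norm (of_real (exp (- (r / 2 * s)) * s ^ (j + 2)) * hankel_m \<nu> s))"
  have Ki: "integrable half_line (\<lambda>s. norm (of_real (exp (- (r / 2 * s)) * s ^ (j + 2)) * hankel_m \<nu> s))"
    using hankel_L_integrable[OF assms(1), of "r / 2" "j + 2"] assms(2) by auto
  have est: "norm (hankel_L \<nu> j y - hankel_L \<nu> j r - (y - r) *\<^sub>R (- hankel_L \<nu> (Suc j) r)) \<le> (y - r)\<^sup>2 * K"
    if y: "\<bar>y - r\<bar> \<le> r / 2" for y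
  proof -
    have y0: "y > 0" using y assms(2) by (auto simp: abs_if split: if_splits)
    have eq: "hankel_L \<nu> j y - hankel_L \<nu> j r - (y - r) *\<^sub>R (- hankel_L \<nu> (Suc j) r)
      = (LINT s|half_line. (of_real (exp (- (y * s)) * s ^ j) * hankel_m \<nu> s - of_real (exp (- (r * s)) * s ^ j) * hankel_m \<nu> s)
          - (y - r) *\<^sub>R (- (of_real (exp (- (r * s)) * s ^ Suc j) * hankel_m \<nu> s)))"
      unfolding hankel_L_def
      using hankel_L_integrable[OF assms(1) y0, of j] hankel_L_integrable[OF assms(1,2), of j]
        hankel_L_integrable[OF assms(1,2), of "Suc j"] by simp
    have "norm (hankel_L \<nu> j y - hankel_L \<nu> j r - (y - r) *\<^sub>R (- hankel_L \<nu> (Suc j) r)) \<le> (LINT s|half_line. (y - r)\<^sup>2 * norm (of_real (exp (- (r / 2 * s)) * s ^ (j + 2)) * hankel_m \<nu> s))"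
      unfolding eq
    proof (rule order_trans[OF integral_norm_bound integral_mono], rule integrable_norm)
      show "integrable half_line (\<lambda>s. (of_real (exp (- (y * s)) * s ^ j) * hankel_m \<nu> s - of_real (exp (- (r * s)) * s ^ j) * hankel_m \<nu> s)
          - (y - r) *\<^sub>R (- (of_real (exp (- (r * s)) * s ^ Suc j) * hankel_m \<nu> s)))"
        by (intro Bochner_Integration.integrable_diff integrable_scaleR_right integrable_minus hankel_L_integrable assms y0)
      show "integrable half_line (\<lambda>s. (y - r)\<^sup>2 * norm (of_real (exp (- (r / 2 * s)) * s ^ (j + 2)) * hankel_m \<nu> s))"
        by (intro integrable_mult_right Ki)
      fix s :: real assume "s \<in> space half_line"
      then have s: "s > 0" by simp
      define u where "u = (y - r) * s"
      have t: "\<bar>exp (- u) - 1 + u\<bar> \<le> exp \<bar>u\<bar> * u\<^sup>2"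
        using Taylor_exp_field[of "- u" 1] by (simp add: power2_eq_square)
      have "\<bar>u\<bar> \<le> r / 2 * s" using y s by (simp add: u_def abs_mult mult_right_mono)
      then have "exp (- (r * s)) * exp \<bar>u\<bar> \<le> exp (- (r * s)) * exp (r / 2 * s)" by simp
      also have "\<dots> = exp (- (r / 2 * s))" by (simp add: exp_add[symmetric] algebra_simps)
      finally have e: "exp (- (r * s)) * exp \<bar>u\<bar> \<le> exp (- (r / 2 * s))" .
      have "exp (- (y * s)) = exp (- (r * s)) * exp (- u)"
        by (simp add: exp_add[symmetric] u_def algebra_simps)
      then have "exp (- (y * s)) * s ^ j - exp (- (r * s)) * s ^ j + (y - r) * (exp (- (r * s)) * s ^ Suc j)
          = exp (- (r * s)) * s ^ j * (exp (- u) - 1 + u)"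
        by (simp add: u_def algebra_simps)
      then have "\<bar>exp (- (y * s)) * s ^ j - exp (- (r * s)) * s ^ j + (y - r) * (exp (- (r * s)) * s ^ Suc j)\<bar>
          = exp (- (r * s)) * s ^ j * \<bar>exp (- u) - 1 + u\<bar>"
        using s by (simp add: abs_mult)
      also have "\<dots> \<le> exp (- (r * s)) * s ^ j * (exp \<bar>u\<bar> * u\<^sup>2)"
        using s t by (intro mult_left_mono) auto
      also have "\<dots> = (exp (- (r * s)) * exp \<bar>u\<bar>) * (s ^ j * u\<^sup>2)" by (simp add: mult_ac)
      also have "\<dots> \<le> exp (- (r / 2 * s)) * (s ^ j * u\<^sup>2)"
        using s e by (intro mult_right_mono) auto
      also have "\<dots> = (y - r)\<^sup>2 * (exp (- (r / 2 * s)) * s ^ (j + 2))"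
        by (simp add: u_def power_add power2_eq_square mult_ac)
      finally have main: "\<bar>exp (- (y * s)) * s ^ j - exp (- (r * s)) * s ^ j + (y - r) * (exp (- (r * s)) * s ^ Suc j)\<bar>
        \<le> (y - r)\<^sup>2 * (exp (- (r / 2 * s)) * s ^ (j + 2))" .
      have "(of_real (exp (- (y * s)) * s ^ j) * hankel_m \<nu> s - of_real (exp (- (r * s)) * s ^ j) * hankel_m \<nu> s)
          - (y - r) *\<^sub>R (- (of_real (exp (- (r * s)) * s ^ Suc j) * hankel_m \<nu> s))
        = of_real (exp (- (y * s)) * s ^ j - exp (- (r * s)) * s ^ j + (y - r) * (exp (- (r * s)) * s ^ Suc j)) * hankel_m \<nu> s"
        by (simp add: scaleR_conv_of_real algebra_simps)
      also have "norm \<dots> \<le> (y - r)\<^sup>2 * (exp (- (r / 2 * s)) * s ^ (j + 2)) * norm (hankel_m \<nu> s)"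
        unfolding norm_mult norm_of_real using main by (rule mult_right_mono) simp
      also have "\<dots> = (y - r)\<^sup>2 * norm (of_real (exp (- (r / 2 * s)) * s ^ (j + 2)) * hankel_m \<nu> s)"
        using s by (simp add: norm_mult norm_power mult_ac)
      finally show "norm ((of_real (exp (- (y * s)) * s ^ j) * hankel_m \<nu> s - of_real (exp (- (r * s)) * s ^ j) * hankel_m \<nu> s)
          - (y - r) *\<^sub>R (- (of_real (exp (- (r * s)) * s ^ Suc j) * hankel_m \<nu> s)))
        \<le> (y - r)\<^sup>2 * norm (of_real (exp (- (r / 2 * s)) * s ^ (j + 2)) * hankel_m \<nu> s)" .
    qed
    also have "\<dots> = (y - r)\<^sup>2 * K" using Ki by (simp add: K_def)
    finally show ?thesis .
  qed
  show ?thesis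
    unfolding has_vector_derivative_def has_derivative_iff_norm
  proof (intro conjI bounded_linear_scaleR_left)
    show "((\<lambda>y. norm (hankel_L \<nu> j y - hankel_L \<nu> j r - (y - r) *\<^sub>R - hankel_L \<nu> (Suc j) r) / norm (y - r)) \<longlongrightarrow> 0) (at r)"
    proof (rule Lim_null_comparison)
      have "\<forall>\<^sub>F y in at r. dist y r < r / 2" unfolding eventually_at using assms(2) by (auto intro!: exI[of _ "r / 2"])
      then show "\<forall>\<^sub>F y in at r. norm (norm (hankel_L \<nu> j y - hankel_L \<nu> j r - (y - r) *\<^sub>R - hankel_L \<nu> (Suc j) r) / norm (y - r)) \<le> \<bar>y - r\<bar> * K"
      proof eventually_elim
        case (elim y)
        then have "norm (hankel_L \<nu> j y - hankel_L \<nu> j r - (y - r) *\<^sub>R (- hankel_L \<nu> (Suc j) r)) / \<bar>y - r\<bar> \<le> (y - r)\<^sup>2 * K / \<bar>y - r\<bar>"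
          using est[of y] by (intro divide_right_mono) (auto simp: dist_real_def)
        moreover have "(y - r)\<^sup>2 * K / \<bar>y - r\<bar> = \<bar>y - r\<bar> * K"
          by (cases "y = r") (simp_all add: power2_eq_square abs_if field_simps)
        ultimately show ?case by simp
      qed
      have "((\<lambda>y. \<bar>y - r\<bar> * K) \<longlongrightarrow> \<bar>r - r\<bar> * K) (at r)" by (intro tendsto_intros)
      then show "((\<lambda>y. \<bar>y - r\<bar> * K) \<longlongrightarrow> 0) (at r)" by simp
    qed
  qed
qed

lemma Suc_inverse_tendsto_0: "(\<lambda>n. 1 / real (Suc n)) \<longlonglongrightarrow> 0"
  by (rule LIMSEQ_Suc[OF lim_1_over_n])

lemma Suc_inverse_powr_tendsto_0:
  assumes "p > 0"
  shows "(\<lambda>n. (1 / real (Suc n)) powr p) \<longlonglongrightarrow> 0"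
  by (rule tendsto_zero_powrI[OF Suc_inverse_tendsto_0 tendsto_const]) (use assms in auto)

text \<open>Integration by parts of \<open>(d/ds) (s (1 + i s/2) m(s)) = (\<nu> + 1/2) (1 + i s) m(s)\<close>; this
  three-term relation is the differential equation of the Hankel function.\<close>

lemma hankel_L_recurrence:
  assumes \<nu>: "\<nu> > 0" and r: "r > 0"
  shows "of_real (\<nu> + 1/2) * (hankel_L \<nu> 0 r + \<i> * hankel_L \<nu> 1 r)
    = of_real r * (hankel_L \<nu> 1 r + \<i> / 2 * hankel_L \<nu> 2 r)"
proof -
  define q where "q = \<nu> + 1/2"
  have q: "q > 0" using \<nu> by (simp add: q_def)
  obtain N :: nat where N: "\<bar>\<nu> - 1/2\<bar> \<le> real N" using abs_le_nat_exists by blast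
  define E where "E j s = of_real (exp (- (r * s)) * s ^ j) * hankel_m \<nu> s" for j :: nat and s
  have Ei: "integrable half_line (E j)" for j unfolding E_def[abs_def] by (rule hankel_L_integrable[OF \<nu> r])
  have EL: "(LINT s|half_line. E j s) = hankel_L \<nu> j r" for j by (simp add: E_def hankel_L_def)
  define G where "G s = of_real s * (1 + \<i> * of_real s / 2) * hankel_m \<nu> s" for s
  define F where "F s = of_real (exp (- (r * s))) * G s" for s
  define f where "f s = of_real q * (E 0 s + \<i> * E 1 s) - of_real r * (E 1 s + \<i> / 2 * E 2 s)" for s
  have Fd: "(F has_vector_derivative f s) (at s)" if "s > 0" for s
  proof -
    have e: "((\<lambda>s. complex_of_real (exp (- (r * s)))) has_vector_derivative of_real (- r * exp (- (r * s)))) (at s)"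
      by (rule has_vector_derivative_of_real) (auto intro!: derivative_eq_intros)
    have "(F has_vector_derivative of_real (exp (- (r * s))) * (of_real (\<nu> + 1/2) * (1 + \<i> * of_real s) * hankel_m \<nu> s)
        + of_real (- r * exp (- (r * s))) * G s) (at s)"
      unfolding F_def[abs_def] using has_vector_derivative_mult[OF e hankel_m_deriv[OF that, of \<nu>]] by (simp add: G_def[abs_def])
    moreover have "of_real (exp (- (r * s))) * (of_real (\<nu> + 1/2) * (1 + \<i> * of_real s) * hankel_m \<nu> s)
        + of_real (- r * exp (- (r * s))) * G s = f s"
      unfolding f_def E_def G_def q_def by (simp add: algebra_simps power2_eq_square)
    ultimately show ?thesis by simp
  qed
  have Fle: "norm (F s) \<le> exp (- (r * s)) * s powr q * (1 + s) ^ (Suc N)" if s: "s > 0" for s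
  proof -
    have "norm (1 + \<i> * of_real s / 2) \<le> 1 + s / 2"
      using one_plus_imag_norm(2)[of "s / 2"] s by simp
    then have "norm (1 + \<i> * of_real s / 2) \<le> 1 + s" using s by linarith
    then have "norm (F s) \<le> exp (- (r * s)) * (s * (1 + s) * (s powr (\<nu> - 1/2) * (1 + s) ^ N))"
      unfolding F_def G_def norm_mult using s hankel_m_le[OF N s] by (intro mult_mono) auto
    also have "\<dots> = exp (- (r * s)) * (s powr (\<nu> - 1/2) * s) * (1 + s) ^ (Suc N)" by (simp add: mult_ac)
    also have "s powr (\<nu> - 1/2) * s = s powr q" using s powr_add[of s "\<nu> - 1/2" 1] by (simp add: q_def add.commute)
    finally show ?thesis .
  qed
  have A: "(\<lambda>n. F (1 / real (Suc n))) \<longlonglongrightarrow> 0"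
  proof (rule Lim_null_comparison)
    show "\<forall>\<^sub>F n in sequentially. norm (F (1 / real (Suc n))) \<le> 2 ^ Suc N * (1 / real (Suc n)) powr q"
    proof (intro always_eventually allI)
      fix n
      define s where "s = 1 / real (Suc n)"
      have s: "s > 0" "s \<le> 1" by (auto simp: s_def)
      have "exp (- (r * s)) * s powr q * (1 + s) ^ (Suc N) \<le> 1 * s powr q * 2 ^ Suc N"
        using s r by (intro mult_mono power_mono) auto
      then show "norm (F (1 / real (Suc n))) \<le> 2 ^ Suc N * (1 / real (Suc n)) powr q"
        using Fle[OF s(1)] unfolding s_def[symmetric] by (simp add: mult.commute)
    qed
    show "(\<lambda>n. 2 ^ Suc N * (1 / real (Suc n)) powr q) \<longlonglongrightarrow> 0"
      using tendsto_mult_left[OF Suc_inverse_powr_tendsto_0[OF q], of "2 ^ Suc N"] by simp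
  qed
  obtain C where C: "C \<ge> 0" "\<And>t. t \<ge> 1 \<Longrightarrow> exp (- (r * t)) * t powr q * (1 + t) ^ (Suc N) \<le> C * (1 / t)\<^sup>2"
    using exp_powr_decay[OF r] by blast
  have B: "(\<lambda>n. F (real (Suc n))) \<longlonglongrightarrow> 0"
  proof (rule Lim_null_comparison)
    show "\<forall>\<^sub>F n in sequentially. norm (F (real (Suc n))) \<le> C * (1 / real (Suc n))\<^sup>2"
      by (intro always_eventually allI order_trans[OF Fle C(2)]) auto
    show "(\<lambda>n. C * (1 / real (Suc n))\<^sup>2) \<longlonglongrightarrow> 0"
      using tendsto_mult_left[OF tendsto_power[OF Suc_inverse_tendsto_0, of 2], of C] by simp
  qed
  have fi: "integrable half_line f" unfolding f_def[abs_def]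
    by (intro Bochner_Integration.integrable_diff Bochner_Integration.integrable_add integrable_mult_right Ei)
  have "(LINT s|half_line. f s) = 0" using half_line_FTC[OF Fd fi A B] by simp
  moreover have "(LINT s|half_line. f s) = of_real q * (hankel_L \<nu> 0 r + \<i> * hankel_L \<nu> 1 r)
      - of_real r * (hankel_L \<nu> 1 r + \<i> / 2 * hankel_L \<nu> 2 r)"
    unfolding f_def using Ei by (simp add: EL)
  ultimately show ?thesis by (simp add: q_def)
qed

text \<open>\<open>hankel_h \<nu> r\<close> is a constant multiple of \<open>r\<^sup>1\<^sup>/\<^sup>2 H\<^sub>\<nu>(r)\<close>, with \<open>H\<^sub>\<nu>\<close> the Hankel function of the first kind,
  normalised to be asymptotic to \<open>exp(i r)\<close>.\<close>

definition hankel_h :: "real \<Rightarrow> real \<Rightarrow> complex" where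
  "hankel_h \<nu> r = of_real (1 / Gamma (\<nu> + 1/2)) * (exp (\<i> * of_real r) * (of_real (r powr (\<nu> + 1/2)) * hankel_L \<nu> 0 r))"

definition hankel_h' :: "real \<Rightarrow> real \<Rightarrow> complex" where
  "hankel_h' \<nu> r = of_real (1 / Gamma (\<nu> + 1/2)) * (exp (\<i> * of_real r) *
     (of_real (r powr (\<nu> + 1/2)) * (\<i> * hankel_L \<nu> 0 r - hankel_L \<nu> 1 r)
       + of_real ((\<nu> + 1/2) * r powr (\<nu> - 1/2)) * hankel_L \<nu> 0 r))"

lemma expi_deriv: "((\<lambda>r. exp (\<i> * of_real r)) has_vector_derivative \<i> * exp (\<i> * of_real r)) (at r)"
  by (rule has_vector_derivative_real_field) (auto intro!: derivative_eq_intros)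

lemma of_real_powr_deriv:
  "r > 0 \<Longrightarrow> ((\<lambda>r. complex_of_real (r powr p)) has_vector_derivative of_real (p * r powr (p - 1))) (at r)"
  by (intro has_vector_derivative_of_real has_real_derivative_powr)

lemma hankel_h_deriv:
  assumes "\<nu> > 0" "r > 0"
  shows "(hankel_h \<nu> has_vector_derivative hankel_h' \<nu> r) (at r)"
proof -
  have "(hankel_h \<nu> has_vector_derivative of_real (1 / Gamma (\<nu> + 1/2)) *
     (exp (\<i> * of_real r) * (of_real (r powr (\<nu> + 1/2)) * - hankel_L \<nu> (Suc 0) r + of_real ((\<nu> + 1/2) * r powr (\<nu> + 1/2 - 1)) * hankel_L \<nu> 0 r)
       + \<i> * exp (\<i> * of_real r) * (of_real (r powr (\<nu> + 1/2)) * hankel_L \<nu> 0 r))) (at r)"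
    unfolding hankel_h_def[abs_def]
    by (intro has_vector_derivative_mult_right has_vector_derivative_mult expi_deriv of_real_powr_deriv hankel_L_deriv assms)
  then show ?thesis by (simp add: hankel_h'_def algebra_simps)
qed

lemma hankel_h'_deriv:
  assumes "\<nu> > 0" "r > 0"
  shows "(hankel_h' \<nu> has_vector_derivative (of_real ((\<nu>\<^sup>2 - 1/4) / r\<^sup>2) - 1) * hankel_h \<nu> r) (at r)"
proof -
  define q where "q = \<nu> + 1/2"
  define L where "L j = hankel_L \<nu> j r" for j
  define P where "P = complex_of_real (r powr q)"
  have r0: "complex_of_real r \<noteq> 0" using assms by simp
  have p1: "complex_of_real (r powr (q - 1)) = P / of_real r" "complex_of_real (r powr (q - 1 - 1)) = P / (of_real r)\<^sup>2"
    using assms(2) by (simp_all add: P_def powr_diff power2_eq_square)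
  have "(hankel_h' \<nu> has_vector_derivative of_real (1 / Gamma (\<nu> + 1/2)) *
     (exp (\<i> * of_real r) * ((of_real (r powr q) * (\<i> * - hankel_L \<nu> (Suc 0) r - - hankel_L \<nu> (Suc 1) r)
          + of_real (q * r powr (q - 1)) * (\<i> * hankel_L \<nu> 0 r - hankel_L \<nu> 1 r))
        + (of_real q * of_real (r powr (q - 1)) * - hankel_L \<nu> (Suc 0) r
          + of_real q * of_real ((q - 1) * r powr (q - 1 - 1)) * hankel_L \<nu> 0 r))
       + \<i> * exp (\<i> * of_real r) * (of_real (r powr q) * (\<i> * hankel_L \<nu> 0 r - hankel_L \<nu> 1 r) + of_real q * of_real (r powr (q - 1)) * hankel_L \<nu> 0 r))) (at r)"
  proof -
    have "hankel_h' \<nu> = (\<lambda>r. of_real (1 / Gamma (\<nu> + 1/2)) * (exp (\<i> * of_real r) *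
     (of_real (r powr q) * (\<i> * hankel_L \<nu> 0 r - hankel_L \<nu> 1 r)
       + (of_real q * of_real (r powr (q - 1))) * hankel_L \<nu> 0 r)))"
      by (simp add: hankel_h'_def fun_eq_iff q_def)
    moreover have "((\<lambda>r. complex_of_real q * of_real (r powr (q - 1))) has_vector_derivative
        of_real q * of_real ((q - 1) * r powr (q - 1 - 1))) (at r)"
      by (intro has_vector_derivative_mult_right of_real_powr_deriv assms)
    ultimately show ?thesis
      by (simp only:) (intro has_vector_derivative_mult_right has_vector_derivative_mult has_vector_derivative_add has_vector_derivative_diff
          expi_deriv of_real_powr_deriv hankel_L_deriv assms)
  qed
  moreover have "exp (\<i> * of_real r) * ((of_real (r powr q) * (\<i> * - hankel_L \<nu> (Suc 0) r - - hankel_L \<nu> (Suc 1) r)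
          + of_real (q * r powr (q - 1)) * (\<i> * hankel_L \<nu> 0 r - hankel_L \<nu> 1 r))
        + (of_real q * of_real (r powr (q - 1)) * - hankel_L \<nu> (Suc 0) r
          + of_real q * of_real ((q - 1) * r powr (q - 1 - 1)) * hankel_L \<nu> 0 r))
       + \<i> * exp (\<i> * of_real r) * (of_real (r powr q) * (\<i> * hankel_L \<nu> 0 r - hankel_L \<nu> 1 r) + of_real q * of_real (r powr (q - 1)) * hankel_L \<nu> 0 r)
     = (of_real ((\<nu>\<^sup>2 - 1/4) / r\<^sup>2) - 1) * (exp (\<i> * of_real r) * (of_real (r powr q) * hankel_L \<nu> 0 r))"
  proof -
    have rec: "of_real q * (L 0 + \<i> * L 1) = of_real r * (L 1 + \<i> / 2 * L 2)"
      using hankel_L_recurrence[OF assms] by (simp add: q_def L_def)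
    \<comment> \<open>The defect of the differential equation is 2 i X P / R times the defect of the
      three-term recurrence, hence 0.\<close>
    have gen: "X * ((P * (\<i> * - L1 - - L2) + (Q * (P / R)) * (\<i> * L0 - L1)) + (Q * (P / R) * - L1 + Q * ((Q - 1) * (P / R\<^sup>2)) * L0))
      + \<i> * X * (P * (\<i> * L0 - L1) + Q * (P / R) * L0) = (Q * (Q - 1) / R\<^sup>2 - 1) * (X * (P * L0))"
      if rec: "Q * (L0 + \<i> * L1) = R * (L1 + \<i> / 2 * L2)" and R: "R \<noteq> 0" for X P Q R L0 L1 L2 :: complex
    proof -
      have "X * ((P * (\<i> * - L1 - - L2) + (Q * (P / R)) * (\<i> * L0 - L1)) + (Q * (P / R) * - L1 + Q * ((Q - 1) * (P / R\<^sup>2)) * L0))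
        + \<i> * X * (P * (\<i> * L0 - L1) + Q * (P / R) * L0) - (Q * (Q - 1) / R\<^sup>2 - 1) * (X * (P * L0))
        = X * P / R * (2 * \<i>) * (Q * (L0 + \<i> * L1) - R * (L1 + \<i> / 2 * L2))"
        using R by (simp add: field_simps power2_eq_square)
      then show ?thesis unfolding rec by simp
    qed
    have q2: "complex_of_real ((\<nu>\<^sup>2 - 1/4) / r\<^sup>2) = of_real q * (of_real q - 1) / (of_real r)\<^sup>2"
      by (simp add: q_def power2_eq_square algebra_simps)
    show ?thesis
      using gen[OF rec r0, of "exp (\<i> * of_real r)" P] unfolding q2 L_def
      by (simp only: of_real_mult of_real_diff of_real_1 p1 P_def[symmetric] numeral_2_eq_2 One_nat_def)
  qed
  ultimately show ?thesis unfolding hankel_h_def q_def[symmetric] by (simp only: mult.left_commute[of "of_real (1 / Gamma q)"])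
qed

section \<open>Limits of the Hankel function at infinity and at the origin\<close>

lemma powr_of_real_mult:
  fixes z :: complex
  assumes "r > 0" "z \<noteq> 0"
  shows "(of_real r * z) powr of_real a = of_real (r powr a) * z powr of_real a"
proof -
  have "(of_real r * z) powr of_real a = exp (of_real a * (of_real (ln r) + Ln z))"
    using assms by (simp add: powr_def Ln_times_of_real Ln_of_real)
  also have "\<dots> = exp (of_real (a * ln r)) * exp (of_real a * Ln z)"
    by (simp add: distrib_left exp_add)
  also have "exp (of_real (a * ln r)) = complex_of_real (r powr a)"
    using assms unfolding exp_of_real by (simp add: powr_def)
  finally show ?thesis using assms by (simp add: powr_def)
qed

text \<open>The substitution t = r s collects the dependence on r in the single factor 1 + i t / (2
  r), a form in which both limits, r to infinity and r to 0, can be taken under the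
  integral.\<close>

definition hankel_K :: "real \<Rightarrow> nat \<Rightarrow> real \<Rightarrow> complex" where
  "hankel_K \<nu> j r = (LINT t|half_line. of_real (exp (- t) * t powr (\<nu> - 1/2 + real j)) * (1 + \<i> * of_real (t / r) / 2) powr of_real (\<nu> - 1/2))"

lemma hankel_L_eq_K:
  assumes "r > 0"
  shows "of_real (r powr (\<nu> + 1/2 + real j)) * hankel_L \<nu> j r = hankel_K \<nu> j r"
proof -
  define c where "c = complex_of_real (r powr (\<nu> - 1/2 + real j))"
  have "of_real (r powr (\<nu> + 1/2 + real j)) * hankel_L \<nu> j r =
      of_real (r powr (\<nu> + 1/2 + real j)) * ((1 / r) *\<^sub>R (LINT t|half_line. of_real (exp (- (r * (t / r))) * (t / r) ^ j) * hankel_m \<nu> (t / r)))"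
    unfolding hankel_L_def by (subst half_line_scale[OF assms]) simp
  also have "\<dots> = c * (LINT t|half_line. of_real (exp (- (r * (t / r))) * (t / r) ^ j) * hankel_m \<nu> (t / r))"
  proof -
    have "r powr (\<nu> + 1/2 + real j) * (1 / r) = r powr (\<nu> - 1/2 + real j)"
      using assms powr_diff[of r "\<nu> + 1/2 + real j" 1] by (simp add: algebra_simps)
    then have "complex_of_real (r powr (\<nu> + 1/2 + real j)) * of_real (1 / r) = c"
      unfolding c_def of_real_mult[symmetric] by simp
    then show ?thesis by (simp only: scaleR_conv_of_real mult.assoc[symmetric])
  qed
  also have "\<dots> = (LINT t|half_line. c * (of_real (exp (- (r * (t / r))) * (t / r) ^ j) * hankel_m \<nu> (t / r)))"
    by simp
  also have "\<dots> = hankel_K \<nu> j r"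
    unfolding hankel_K_def
  proof (rule Bochner_Integration.integral_cong)
    fix t :: real assume "t \<in> space half_line"
    then have t: "t > 0" by simp
    have "r powr (\<nu> - 1/2 + real j) * ((t / r) ^ j * (t / r) powr (\<nu> - 1/2)) = t powr (\<nu> - 1/2 + real j)"
      using t assms by (simp add: powr_divide powr_add powr_realpow power_divide)
    then have e: "c * (of_real ((t / r) ^ j) * of_real ((t / r) powr (\<nu> - 1/2))) = of_real (t powr (\<nu> - 1/2 + real j))"
      unfolding c_def of_real_mult[symmetric] by simp
    have "c * (of_real (exp (- (r * (t / r))) * (t / r) ^ j) * hankel_m \<nu> (t / r))
      = of_real (exp (- t)) * (c * (of_real ((t / r) ^ j) * of_real ((t / r) powr (\<nu> - 1/2)))) * (1 + \<i> * of_real (t / r) / 2) powr of_real (\<nu> - 1/2)"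
      using assms by (simp add: hankel_m_def mult_ac)
    then show "c * (of_real (exp (- (r * (t / r))) * (t / r) ^ j) * hankel_m \<nu> (t / r)) =
      of_real (exp (- t) * t powr (\<nu> - 1/2 + real j)) * (1 + \<i> * of_real (t / r) / 2) powr of_real (\<nu> - 1/2)"
      unfolding e by (simp add: mult_ac)
  qed simp
  finally show ?thesis .
qed

lemma hankel_h_eq_K:
  assumes "r > 0"
  shows "hankel_h \<nu> r = of_real (1 / Gamma (\<nu> + 1/2)) * (exp (\<i> * of_real r) * hankel_K \<nu> 0 r)"
    and "hankel_h' \<nu> r = of_real (1 / Gamma (\<nu> + 1/2)) * (exp (\<i> * of_real r) *
      (\<i> * hankel_K \<nu> 0 r + (of_real (\<nu> + 1/2) * hankel_K \<nu> 0 r - hankel_K \<nu> 1 r) / of_real r))"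
proof -
  have 0: "of_real (r powr (\<nu> + 1/2)) * hankel_L \<nu> 0 r = hankel_K \<nu> 0 r"
    using hankel_L_eq_K[OF assms, of \<nu> 0] by simp
  show "hankel_h \<nu> r = of_real (1 / Gamma (\<nu> + 1/2)) * (exp (\<i> * of_real r) * hankel_K \<nu> 0 r)"
    unfolding hankel_h_def 0 ..
  have r: "complex_of_real r \<noteq> 0" using assms by simp
  have p: "r powr (\<nu> + 1/2 + real 1) = r powr (\<nu> + 1/2) * r"
    using assms unfolding powr_add[of r "\<nu> + 1/2"] by simp
  have 1: "of_real (r powr (\<nu> + 1/2)) * hankel_L \<nu> 1 r = hankel_K \<nu> 1 r / of_real r"
    using hankel_L_eq_K[OF assms, of \<nu> 1] r unfolding p by (simp add: field_simps)
  have 2: "r powr (\<nu> - 1/2) = r powr (\<nu> + 1/2) / r" using assms powr_diff[of r "\<nu> + 1/2" 1] by simp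
  have "of_real (r powr (\<nu> + 1/2)) * (\<i> * hankel_L \<nu> 0 r - hankel_L \<nu> 1 r) + of_real ((\<nu> + 1/2) * r powr (\<nu> - 1/2)) * hankel_L \<nu> 0 r
    = \<i> * (of_real (r powr (\<nu> + 1/2)) * hankel_L \<nu> 0 r) - of_real (r powr (\<nu> + 1/2)) * hankel_L \<nu> 1 r
      + of_real (\<nu> + 1/2) * (of_real (r powr (\<nu> + 1/2)) * hankel_L \<nu> 0 r) / of_real r"
    unfolding 2 by (simp add: algebra_simps)
  also have "\<dots> = \<i> * hankel_K \<nu> 0 r + (of_real (\<nu> + 1/2) * hankel_K \<nu> 0 r - hankel_K \<nu> 1 r) / of_real r"
    unfolding 0 1 by (simp add: diff_divide_distrib)
  finally show "hankel_h' \<nu> r = of_real (1 / Gamma (\<nu> + 1/2)) * (exp (\<i> * of_real r) *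
      (\<i> * hankel_K \<nu> 0 r + (of_real (\<nu> + 1/2) * hankel_K \<nu> 0 r - hankel_K \<nu> 1 r) / of_real r))"
    unfolding hankel_h'_def by simp
qed

lemma hankel_K_integrand_measurable [measurable]:
  assumes "r > 0"
  shows "(\<lambda>t. of_real (exp (- t) * t powr p) * (1 + \<i> * of_real (t / r) / 2) powr of_real a) \<in> borel_measurable half_line"
proof (rule continuous_measurable_half_line)
  show "continuous_on {0<..} (\<lambda>t. of_real (exp (- t) * t powr p) * (1 + \<i> * complex_of_real (t / r) / 2) powr of_real a)"
    by (intro continuous_intros) (use assms one_plus_imag_notin_nonpos[of "_ / r"] one_plus_imag_nonzero[of "_ / r"] in auto)
qed

lemma hankel_K_integrand_le:
  assumes "\<bar>\<nu> - 1/2\<bar> \<le> real N" "t > 0" "r \<ge> 1"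
  shows "norm (of_real (exp (- t) * t powr p) * (1 + \<i> * of_real (t / r) / 2) powr of_real (\<nu> - 1/2)) \<le> exp (- t) * t powr p * (1 + t) ^ N"
proof -
  have "t / r / 2 \<le> t" using assms by (simp add: field_simps)
  then have "norm ((1 + \<i> * of_real (t / r / 2)) powr of_real (\<nu> - 1/2)) \<le> (1 + t) ^ N"
    using assms by (intro one_plus_imag_powr_le) auto
  then have "norm ((1 + \<i> * of_real (t / r) / 2) powr of_real (\<nu> - 1/2)) \<le> (1 + t) ^ N" by simp
  then show ?thesis unfolding norm_mult norm_of_real by (intro mult_mono) auto
qed

text \<open>Uniformity in the order: t^\<nu> is dominated by t^a + t^b, and one N bounds the
  exponents of the complex factor for all orders in the interval.\<close>

lemma hankel_K_bound:
  assumes "0 < a"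
  shows "\<exists>K. \<forall>\<nu>\<in>{a..b}. \<forall>r\<ge>1. norm (hankel_K \<nu> j r) \<le> K"
proof -
  obtain N :: nat where N: "b + 1 \<le> real N" using real_arch_simple by blast
  define D where "D t = exp (- t) * t powr (a - 1/2 + real j) * (1 + t) ^ N + exp (- t) * t powr (b - 1/2 + real j) * (1 + t) ^ N" for t
  show ?thesis
  proof (intro exI ballI allI impI)
    fix \<nu> r assume \<nu>: "\<nu> \<in> {a..b}" and r: "(1::real) \<le> r"
    have i: "integrable half_line D"
      unfolding D_def[abs_def] using exp_powr_integrable[of 1 "a - 1/2 + real j" N] exp_powr_integrable[of 1 "b - 1/2 + real j" N] assms \<nu>
      by (intro Bochner_Integration.integrable_add) auto
    have le: "norm (of_real (exp (- t) * t powr (\<nu> - 1/2 + real j)) * (1 + \<i> * of_real (t / r) / 2) powr of_real (\<nu> - 1/2)) \<le> D t"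
      if t: "t > 0" for t
    proof -
      have "\<bar>\<nu> - 1/2\<bar> \<le> real N" using \<nu> N assms by auto
      from hankel_K_integrand_le[OF this t r, of "\<nu> - 1/2 + real j"]
      have 1: "norm (of_real (exp (- t) * t powr (\<nu> - 1/2 + real j)) * (1 + \<i> * of_real (t / r) / 2) powr of_real (\<nu> - 1/2))
        \<le> exp (- t) * t powr (\<nu> - 1/2 + real j) * (1 + t) ^ N" .
      have "t powr (\<nu> - 1/2 + real j) \<le> t powr (a - 1/2 + real j) + t powr (b - 1/2 + real j)"
      proof (cases "t \<le> 1")
        case True
        then have "t powr (\<nu> - 1/2 + real j) \<le> t powr (a - 1/2 + real j)" using t \<nu> by (intro powr_mono') auto
        then show ?thesis using powr_ge_zero[of t "b - 1/2 + real j"] by linarith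
      next
        case False
        then have "t powr (\<nu> - 1/2 + real j) \<le> t powr (b - 1/2 + real j)" using \<nu> by (intro powr_mono) auto
        then show ?thesis using powr_ge_zero[of t "a - 1/2 + real j"] by linarith
      qed
      then have "exp (- t) * t powr (\<nu> - 1/2 + real j) * (1 + t) ^ N \<le> exp (- t) * (t powr (a - 1/2 + real j) + t powr (b - 1/2 + real j)) * (1 + t) ^ N"
        using t by (intro mult_right_mono mult_left_mono) auto
      also have "\<dots> = D t" by (simp add: D_def algebra_simps)
      finally show ?thesis using 1 by linarith
    qed
    show "norm (hankel_K \<nu> j r) \<le> (LINT t|half_line. D t)"
      unfolding hankel_K_def
    proof (rule order_trans[OF integral_norm_bound integral_mono])
      show "integrable half_line (\<lambda>t. norm (of_real (exp (- t) * t powr (\<nu> - 1/2 + real j)) * (1 + \<i> * of_real (t / r) / 2) powr of_real (\<nu> - 1/2)))"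
      proof (rule integrable_norm, rule Bochner_Integration.integrable_bound[OF i])
        show "(\<lambda>t. of_real (exp (- t) * t powr (\<nu> - 1/2 + real j)) * (1 + \<i> * of_real (t / r) / 2) powr of_real (\<nu> - 1/2)) \<in> borel_measurable half_line"
          using r by (intro hankel_K_integrand_measurable) auto
        show "AE t in half_line. norm (of_real (exp (- t) * t powr (\<nu> - 1/2 + real j)) * (1 + \<i> * of_real (t / r) / 2) powr of_real (\<nu> - 1/2)) \<le> norm (D t)"
          using le by (intro AE_I2) (force intro: order_trans)
      qed
    qed (use le i in auto)
  qed
qed

text \<open>The third bound is the radiation condition: in the difference h' - i h the terms i
  \<open>hankel_K \<nu> 0 r\<close> cancel and a factor 1/r remains. Uniformity in the order
  prepares the limit \<mu> to \<nu>.\<close>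

lemma hankel_h_bound:
  assumes "0 < a"
  shows "\<exists>K. \<forall>\<nu>\<in>{a..b}. \<forall>r\<ge>1. norm (hankel_h \<nu> r) \<le> K \<and> norm (hankel_h' \<nu> r) \<le> K \<and>
     r * norm (hankel_h' \<nu> r - \<i> * hankel_h \<nu> r) \<le> K"
proof -
  obtain K0 K1 where K0: "\<And>\<nu> r. \<nu> \<in> {a..b} \<Longrightarrow> r \<ge> 1 \<Longrightarrow> norm (hankel_K \<nu> 0 r) \<le> K0"
    and K1: "\<And>\<nu> r. \<nu> \<in> {a..b} \<Longrightarrow> r \<ge> 1 \<Longrightarrow> norm (hankel_K \<nu> 1 r) \<le> K1"
    using hankel_K_bound[OF assms, of b 0] hankel_K_bound[OF assms, of b 1] by blast
  have pos: "Gamma (\<nu> + 1/2) > 0" if "\<nu> \<in> {a..b}" for \<nu> using that assms by (intro Gamma_real_pos) auto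
  have "continuous_on {a..b} (\<lambda>\<nu>. 1 / Gamma (\<nu> + 1/2))"
  proof (intro continuous_on_divide continuous_on_const)
    show "\<forall>x\<in>{a..b}. Gamma (x + 1/2) \<noteq> 0" using pos by (metis less_irrefl)
    have "continuous_on {0<..} (Gamma :: real \<Rightarrow> real)"
      by (rule continuous_on_Gamma) (auto elim!: nonpos_Ints_cases)
    then show "continuous_on {a..b} (\<lambda>\<nu>. Gamma (\<nu> + 1/2))"
      by (rule continuous_on_compose2) (use assms in \<open>auto intro!: continuous_intros\<close>)
  qed
  then have "bounded ((\<lambda>\<nu>. 1 / Gamma (\<nu> + 1/2)) ` {a..b})"
    by (intro compact_imp_bounded compact_continuous_image compact_Icc)
  then obtain G where G: "\<And>\<nu>. \<nu> \<in> {a..b} \<Longrightarrow> norm (1 / Gamma (\<nu> + 1/2)) \<le> G" unfolding bounded_iff by blast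
  define K where "K = G * (K0 + ((b + 1) * K0 + K1))"
  show ?thesis
  proof (intro exI[of _ K] ballI allI impI)
    fix \<nu> r assume \<nu>: "\<nu> \<in> {a..b}" and r: "(1::real) \<le> r"
    have k0: "norm (hankel_K \<nu> 0 r) \<le> K0" "K0 \<ge> 0" using K0[OF \<nu> r] norm_ge_zero order_trans by blast+
    have k1: "norm (hankel_K \<nu> 1 r) \<le> K1" "K1 \<ge> 0" using K1[OF \<nu> r] norm_ge_zero order_trans by blast+
    have g: "norm (complex_of_real (1 / Gamma (\<nu> + 1/2))) \<le> G" "G \<ge> 0"
      using G[OF \<nu>] order_trans[OF norm_ge_zero G[OF \<nu>]] by (auto simp: norm_divide)
    define Q where "Q = of_real (\<nu> + 1/2) * hankel_K \<nu> 0 r - hankel_K \<nu> 1 r"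
    have Q: "norm Q \<le> (b + 1) * K0 + K1"
    proof -
      have "norm Q \<le> norm (of_real (\<nu> + 1/2) * hankel_K \<nu> 0 r) + norm (hankel_K \<nu> 1 r)"
        unfolding Q_def by (rule norm_triangle_ineq4)
      also have "norm (of_real (\<nu> + 1/2) * hankel_K \<nu> 0 r) \<le> (b + 1) * K0"
        unfolding norm_mult norm_of_real using \<nu> assms k0 by (intro mult_mono) auto
      finally show ?thesis using k1 by linarith
    qed
    have Q0: "0 \<le> (b + 1) * K0 + K1" using Q norm_ge_zero order_trans by blast
    have h: "norm (hankel_h \<nu> r) \<le> G * K0"
    proof -
      have "r > 0" using r by simp
      have "norm (hankel_h \<nu> r) = norm (complex_of_real (1 / Gamma (\<nu> + 1/2))) * norm (hankel_K \<nu> 0 r)"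
        unfolding hankel_h_eq_K(1)[OF \<open>r > 0\<close>] norm_mult norm_exp_i_times by simp
      also have "\<dots> \<le> G * K0" using g k0 by (intro mult_mono) auto
      finally show ?thesis .
    qed
    have dif: "hankel_h' \<nu> r - \<i> * hankel_h \<nu> r = of_real (1 / Gamma (\<nu> + 1/2)) * (exp (\<i> * of_real r) * (Q / of_real r))"
      using r by (simp add: hankel_h_eq_K Q_def algebra_simps)
    have d1: "r * norm (hankel_h' \<nu> r - \<i> * hankel_h \<nu> r) \<le> G * ((b + 1) * K0 + K1)"
    proof -
      have "r * norm (hankel_h' \<nu> r - \<i> * hankel_h \<nu> r) = norm (complex_of_real (1 / Gamma (\<nu> + 1/2))) * norm Q"
        unfolding dif norm_mult norm_divide using r by simp
      also have "\<dots> \<le> G * ((b + 1) * K0 + K1)" using g Q by (intro mult_mono) auto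
      finally show ?thesis .
    qed
    have d2: "norm (hankel_h' \<nu> r - \<i> * hankel_h \<nu> r) \<le> r * norm (hankel_h' \<nu> r - \<i> * hankel_h \<nu> r)"
      using r mult_right_mono[of 1 r "norm (hankel_h' \<nu> r - \<i> * hankel_h \<nu> r)"] by simp
    have "norm (hankel_h' \<nu> r) \<le> norm (hankel_h' \<nu> r - \<i> * hankel_h \<nu> r) + norm (\<i> * hankel_h \<nu> r)"
      by (metis norm_triangle_sub add.commute)
    then have h': "norm (hankel_h' \<nu> r) \<le> G * ((b + 1) * K0 + K1) + G * K0" using h d1 d2 by (simp add: norm_mult)
    have "0 \<le> G * K0" "0 \<le> G * ((b + 1) * K0 + K1)" using g k0 Q0 by auto
    then show "norm (hankel_h \<nu> r) \<le> K \<and> norm (hankel_h' \<nu> r) \<le> K \<and> r * norm (hankel_h' \<nu> r - \<i> * hankel_h \<nu> r) \<le> K"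
      using h h' d1 unfolding K_def distrib_left[of G K0] by linarith
  qed
qed

lemma complex_Gamma_half_line:
  assumes "x > 0"
  shows "(LINT t|half_line. complex_of_real (exp (- t) * t powr (x - 1))) = of_real (Gamma x)"
  using Gamma_half_line[OF assms] by (subst integral_complex_of_real) simp

text \<open>As r grows, 1 + i t / (2 r) tends to 1 and the integral to Gamma (\<nu> + 1/2), which
  explains the normalising factor in \<open>hankel_h\<close>.\<close>

lemma hankel_h_at_infinity:
  assumes \<nu>: "\<nu> > 0"
  shows "(\<lambda>n. hankel_h \<nu> (real (Suc n)) * exp (- \<i> * of_real (real (Suc n)))) \<longlonglongrightarrow> 1"
proof -
  obtain N :: nat where N: "\<bar>\<nu> - 1/2\<bar> \<le> real N" using abs_le_nat_exists by blast
  have "(\<lambda>n. hankel_K \<nu> 0 (real (Suc n))) \<longlonglongrightarrow> (LINT t|half_line. complex_of_real (exp (- t) * t powr (\<nu> + 1/2 - 1)))"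
    unfolding hankel_K_def
  proof (rule integral_dominated_convergence[where w = "\<lambda>t. exp (- t) * t powr (\<nu> - 1/2) * (1 + t) ^ N"])
    show "integrable half_line (\<lambda>t. exp (- t) * t powr (\<nu> - 1/2) * (1 + t) ^ N)"
      using exp_powr_integrable[of 1 "\<nu> - 1/2" N] \<nu> by simp
    show "(\<lambda>t. complex_of_real (exp (- t) * t powr (\<nu> + 1/2 - 1))) \<in> borel_measurable half_line" by measurable
    show "(\<lambda>t. of_real (exp (- t) * t powr (\<nu> - 1/2 + real 0)) * (1 + \<i> * of_real (t / real (Suc n)) / 2) powr of_real (\<nu> - 1/2))
        \<in> borel_measurable half_line" for n
      by (rule hankel_K_integrand_measurable) simp
    show "AE t in half_line. norm (of_real (exp (- t) * t powr (\<nu> - 1/2 + real 0)) * (1 + \<i> * of_real (t / real (Suc n)) / 2) powr of_real (\<nu> - 1/2))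
        \<le> exp (- t) * t powr (\<nu> - 1/2) * (1 + t) ^ N" for n
      using hankel_K_integrand_le[OF N, of _ "real (Suc n)" "\<nu> - 1/2"] by (intro AE_I2) simp
    show "AE t in half_line. (\<lambda>n. of_real (exp (- t) * t powr (\<nu> - 1/2 + real 0)) * (1 + \<i> * of_real (t / real (Suc n)) / 2) powr of_real (\<nu> - 1/2))
       \<longlonglongrightarrow> complex_of_real (exp (- t) * t powr (\<nu> + 1/2 - 1))"
    proof (rule AE_I2)
      fix t :: real
      have "(\<lambda>n. t * (1 / real (Suc n))) \<longlonglongrightarrow> t * 0" by (intro tendsto_mult tendsto_const Suc_inverse_tendsto_0)
      then have "(\<lambda>n. t / real (Suc n)) \<longlonglongrightarrow> 0" by simp
      then have "(\<lambda>n. of_real (exp (- t) * t powr (\<nu> - 1/2 + real 0)) * (1 + \<i> * of_real (t / real (Suc n)) / 2) powr of_real (\<nu> - 1/2))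
       \<longlonglongrightarrow> of_real (exp (- t) * t powr (\<nu> - 1/2 + real 0)) * (1 + \<i> * of_real 0 / 2) powr of_real (\<nu> - 1/2)"
        by (intro tendsto_mult tendsto_const tendsto_powr_complex tendsto_add tendsto_divide tendsto_of_real) auto
      then show "(\<lambda>n. of_real (exp (- t) * t powr (\<nu> - 1/2 + real 0)) * (1 + \<i> * of_real (t / real (Suc n)) / 2) powr of_real (\<nu> - 1/2))
       \<longlonglongrightarrow> complex_of_real (exp (- t) * t powr (\<nu> + 1/2 - 1))" by simp
    qed
  qed
  then have K: "(\<lambda>n. hankel_K \<nu> 0 (real (Suc n))) \<longlonglongrightarrow> of_real (Gamma (\<nu> + 1/2))"
    using complex_Gamma_half_line[of "\<nu> + 1/2"] \<nu> by simp
  have G: "Gamma (\<nu> + 1/2) \<noteq> 0"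
    by (rule less_imp_neq[THEN not_sym], rule Gamma_real_pos) (use \<nu> in simp)
  have "hankel_h \<nu> (real (Suc n)) * exp (- \<i> * of_real (real (Suc n))) = of_real (1 / Gamma (\<nu> + 1/2)) * hankel_K \<nu> 0 (real (Suc n))" for n
    by (subst hankel_h_eq_K) (simp_all add: exp_minus)
  moreover have "(\<lambda>n. of_real (1 / Gamma (\<nu> + 1/2)) * hankel_K \<nu> 0 (real (Suc n))) \<longlonglongrightarrow> of_real (1 / Gamma (\<nu> + 1/2)) * of_real (Gamma (\<nu> + 1/2))"
    by (intro tendsto_mult tendsto_const K)
  ultimately show ?thesis using G by simp
qed

text \<open>The prefactor is absorbed into the complex power, r^\<gamma> (1 + i t / (2 r))^\<gamma>
  = (r + i t / 2)^\<gamma> with \<gamma> = \<nu> - 1/2, whose base tends to i t / 2. The remaining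
  power t^(2\<nu>+j-1) produces the Gamma value.\<close>

lemma hankel_K_at_0:
  assumes \<nu>: "\<nu> > 0"
  shows "(\<lambda>n. of_real ((1 / real (Suc n)) powr (\<nu> - 1/2)) * hankel_K \<nu> j (1 / real (Suc n)))
    \<longlonglongrightarrow> (\<i> / 2) powr of_real (\<nu> - 1/2) * of_real (Gamma (2 * \<nu> + real j))"
proof -
  define \<gamma> where "\<gamma> = \<nu> - 1/2"
  obtain N :: nat where N: "\<bar>\<nu> - 1/2\<bar> \<le> real N" using abs_le_nat_exists by blast
  define r where "r n = 1 / real (Suc n)" for n
  have r: "0 < r n" "r n \<le> 1" for n by (auto simp: r_def)
  have eq: "of_real (r n powr \<gamma>) * hankel_K \<nu> j (r n) =
      (LINT t|half_line. of_real (exp (- t) * t powr (\<gamma> + real j)) * (of_real (r n) + \<i> * of_real t / 2) powr of_real \<gamma>)" for n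
  proof -
    have "of_real (r n powr \<gamma>) * hankel_K \<nu> j (r n) =
      (LINT t|half_line. of_real (r n powr \<gamma>) * (of_real (exp (- t) * t powr (\<gamma> + real j)) * (1 + \<i> * of_real (t / r n) / 2) powr of_real \<gamma>))"
      unfolding hankel_K_def \<gamma>_def[symmetric] by simp
    also have "\<dots> = (LINT t|half_line. of_real (exp (- t) * t powr (\<gamma> + real j)) * (of_real (r n) + \<i> * of_real t / 2) powr of_real \<gamma>)"
    proof (rule Bochner_Integration.integral_cong)
      fix t :: real
      have "of_real (r n) + \<i> * of_real t / 2 = of_real (r n) * (1 + \<i> * of_real (t / r n) / 2)"
        using r(1)[of n] by (simp add: field_simps)
      then have "(of_real (r n) + \<i> * of_real t / 2) powr of_real \<gamma> = of_real (r n powr \<gamma>) * (1 + \<i> * of_real (t / r n) / 2) powr of_real \<gamma>"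
        using powr_of_real_mult[OF r(1)[of n] one_plus_imag_nonzero[of "t / r n"]] by simp
      then show "of_real (r n powr \<gamma>) * (of_real (exp (- t) * t powr (\<gamma> + real j)) * (1 + \<i> * of_real (t / r n) / 2) powr of_real \<gamma>)
        = of_real (exp (- t) * t powr (\<gamma> + real j)) * (of_real (r n) + \<i> * of_real t / 2) powr of_real \<gamma>"
        by (simp add: mult_ac)
    qed simp
    finally show ?thesis .
  qed
  have "(\<lambda>n. LINT t|half_line. of_real (exp (- t) * t powr (\<gamma> + real j)) * (of_real (r n) + \<i> * of_real t / 2) powr of_real \<gamma>)
    \<longlonglongrightarrow> (LINT t|half_line. (\<i> / 2) powr of_real \<gamma> * complex_of_real (exp (- t) * t powr (2 * \<nu> + real j - 1)))"
  proof (rule integral_dominated_convergence[where w = "\<lambda>t. exp (- t) * t powr (\<gamma> + real j) * (1 + t) ^ N + 2 powr (- \<gamma>) * (exp (- t) * t powr (2 * \<nu> + real j - 1))"])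
    show "integrable half_line (\<lambda>t. exp (- t) * t powr (\<gamma> + real j) * (1 + t) ^ N + 2 powr (- \<gamma>) * (exp (- t) * t powr (2 * \<nu> + real j - 1)))"
      using exp_powr_integrable[of 1 "\<gamma> + real j" N] exp_powr_integrable[of 1 "2 * \<nu> + real j - 1" 0] \<nu>
      by (intro Bochner_Integration.integrable_add integrable_mult_right) (auto simp: \<gamma>_def)
    show "(\<lambda>t. (\<i> / 2) powr of_real \<gamma> * complex_of_real (exp (- t) * t powr (2 * \<nu> + real j - 1))) \<in> borel_measurable half_line" by measurable
    have npos: "of_real (r n) + \<i> * of_real t / 2 \<notin> \<real>\<^sub>\<le>\<^sub>0" "of_real (r n) + \<i> * of_real t / 2 \<noteq> 0" for n t
      using r(1)[of n] by (auto simp: complex_nonpos_Reals_iff complex_eq_iff)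
    show "(\<lambda>t. of_real (exp (- t) * t powr (\<gamma> + real j)) * (of_real (r n) + \<i> * of_real t / 2) powr of_real \<gamma>) \<in> borel_measurable half_line" for n
      by (intro continuous_measurable_half_line continuous_intros) (use npos in auto)
    show "AE t in half_line. norm (of_real (exp (- t) * t powr (\<gamma> + real j)) * (of_real (r n) + \<i> * of_real t / 2) powr of_real \<gamma>) \<le>
       exp (- t) * t powr (\<gamma> + real j) * (1 + t) ^ N + 2 powr (- \<gamma>) * (exp (- t) * t powr (2 * \<nu> + real j - 1))" for n
    proof (rule AE_I2)
      fix t assume "t \<in> space half_line"
      then have t: "t > 0" by simp
      define w where "w = norm (of_real (r n) + \<i> * of_real t / 2)"
      have w1: "t / 2 \<le> w" using abs_Im_le_cmod[of "of_real (r n) + \<i> * of_real t / 2"] t by (simp add: w_def)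
      have w2: "w \<le> 1 + t"
        using norm_triangle_ineq[of "of_real (r n)" "\<i> * of_real t / 2"] t r[of n] by (simp add: w_def norm_mult)
      \<comment> \<open>The two terms serve the two signs of \<gamma>: w lies between t/2 and 1 +
        t.\<close>
      have "w powr \<gamma> \<le> (1 + t) ^ N + 2 powr (- \<gamma>) * t powr \<gamma>"
      proof (cases "\<gamma> \<ge> 0")
        case True
        have "w powr \<gamma> \<le> (1 + t) powr \<gamma>" using w1 w2 t True by (intro powr_mono2) auto
        also have "\<dots> \<le> (1 + t) powr real N" using t N by (intro powr_mono) (auto simp: \<gamma>_def)
        also have "\<dots> = (1 + t) ^ N" using t by (intro powr_realpow) auto
        finally show ?thesis by (simp add: add_increasing2)
      next
        case False
        have "w powr \<gamma> \<le> (t / 2) powr \<gamma>" using w1 t False by (intro powr_mono2') auto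
        also have "\<dots> = 2 powr (- \<gamma>) * t powr \<gamma>" using t by (simp add: powr_divide powr_minus_divide)
        finally show ?thesis using t by (simp add: add_increasing)
      qed
      then have "exp (- t) * t powr (\<gamma> + real j) * w powr \<gamma> \<le> exp (- t) * t powr (\<gamma> + real j) * ((1 + t) ^ N + 2 powr (- \<gamma>) * t powr \<gamma>)"
        by (intro mult_left_mono) auto
      also have "\<dots> = exp (- t) * t powr (\<gamma> + real j) * (1 + t) ^ N + 2 powr (- \<gamma>) * (exp (- t) * (t powr (\<gamma> + real j) * t powr \<gamma>))"
        by (simp add: algebra_simps)
      also have "t powr (\<gamma> + real j) * t powr \<gamma> = t powr (2 * \<nu> + real j - 1)"
        by (simp add: powr_add[symmetric] \<gamma>_def algebra_simps)
      finally show "norm (of_real (exp (- t) * t powr (\<gamma> + real j)) * (of_real (r n) + \<i> * of_real t / 2) powr of_real \<gamma>) \<le>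
       exp (- t) * t powr (\<gamma> + real j) * (1 + t) ^ N + 2 powr (- \<gamma>) * (exp (- t) * t powr (2 * \<nu> + real j - 1))"
        by (simp add: norm_mult norm_powr_real_powr' w_def)
    qed
    show "AE t in half_line. (\<lambda>n. of_real (exp (- t) * t powr (\<gamma> + real j)) * (of_real (r n) + \<i> * of_real t / 2) powr of_real \<gamma>)
      \<longlonglongrightarrow> (\<i> / 2) powr of_real \<gamma> * complex_of_real (exp (- t) * t powr (2 * \<nu> + real j - 1))"
    proof (rule AE_I2)
      fix t assume "t \<in> space half_line"
      then have t: "t > 0" by simp
      have "(\<lambda>n. of_real (exp (- t) * t powr (\<gamma> + real j)) * (of_real (r n) + \<i> * of_real t / 2) powr of_real \<gamma>)
      \<longlonglongrightarrow> of_real (exp (- t) * t powr (\<gamma> + real j)) * (of_real 0 + \<i> * of_real t / 2) powr of_real \<gamma>"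
        using t Suc_inverse_tendsto_0 unfolding r_def
        by (intro tendsto_mult tendsto_const tendsto_powr_complex tendsto_add tendsto_of_real) (auto simp: complex_nonpos_Reals_iff)
      also have "of_real 0 + \<i> * of_real t / 2 = of_real t * (\<i> / 2)" by simp
      also have "(of_real t * (\<i> / 2)) powr of_real \<gamma> = of_real (t powr \<gamma>) * (\<i> / 2) powr of_real \<gamma>"
        using t by (intro powr_of_real_mult) auto
      also have "of_real (exp (- t) * t powr (\<gamma> + real j)) * (of_real (t powr \<gamma>) * (\<i> / 2) powr of_real \<gamma>)
          = (\<i> / 2) powr of_real \<gamma> * of_real (exp (- t) * (t powr (\<gamma> + real j) * t powr \<gamma>))"
        by (simp add: mult_ac)
      also have "t powr (\<gamma> + real j) * t powr \<gamma> = t powr (2 * \<nu> + real j - 1)"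
        by (simp add: powr_add[symmetric] \<gamma>_def algebra_simps)
      finally show "(\<lambda>n. of_real (exp (- t) * t powr (\<gamma> + real j)) * (of_real (r n) + \<i> * of_real t / 2) powr of_real \<gamma>)
      \<longlonglongrightarrow> (\<i> / 2) powr of_real \<gamma> * complex_of_real (exp (- t) * t powr (2 * \<nu> + real j - 1))" .
    qed
  qed
  moreover have "(LINT t|half_line. (\<i> / 2) powr of_real \<gamma> * complex_of_real (exp (- t) * t powr (2 * \<nu> + real j - 1)))
      = (\<i> / 2) powr of_real \<gamma> * of_real (Gamma (2 * \<nu> + real j))"
    using complex_Gamma_half_line[of "2 * \<nu> + real j"] \<nu> by (subst integral_mult_right_zero) simp
  ultimately show ?thesis unfolding eq[symmetric] unfolding r_def \<gamma>_def[symmetric] by simp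
qed

section \<open>Wronskians and the asymptotics of the regular solution\<close>

lemma Gamma_duplication_real:
  assumes "\<nu> > 0"
  shows "Gamma (\<nu> + 1/2) * Gamma (\<nu> + 1) = 2 powr (- 2 * \<nu>) * sqrt pi * Gamma (2 * \<nu> + 1)"
proof -
  define z where "z = complex_of_real (\<nu> + 1/2)"
  have z: "z + 1/2 = of_real (\<nu> + 1)" "2 * z = of_real (2 * \<nu> + 1)" "1 - 2 * z = of_real (- 2 * \<nu>)"
    by (simp_all add: z_def)
  have nn: "complex_of_real x \<notin> \<int>\<^sub>\<le>\<^sub>0" if "x > 0" for x
    using that by (auto elim!: nonpos_Ints_cases simp: complex_eq_iff)
  have "Gamma z * Gamma (z + 1/2) = exp ((1 - 2 * z) * of_real (ln 2)) * of_real (sqrt pi) * Gamma (2 * z)"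
    by (rule Gamma_legendre_duplication) (unfold z(1), unfold z_def, (rule nn, use assms in simp)+)
  then have "of_real (Gamma (\<nu> + 1/2) * Gamma (\<nu> + 1)) = complex_of_real (exp (- 2 * \<nu> * ln 2) * sqrt pi * Gamma (2 * \<nu> + 1))"
    unfolding z(3) unfolding z(1,2) unfolding z_def Gamma_complex_of_real of_real_mult[symmetric] exp_of_real .
  then show ?thesis unfolding of_real_eq_iff by (simp add: powr_def)
qed

text \<open>The Wronskian of \<open>bessel_phi\<close> and \<open>hankel_h\<close>. The sines and
  cosines of \<open>pi / 2 * (\<mu> - \<nu>)\<close> that appear later are differences of its phase
  between two orders.\<close>

definition bessel_W :: "real \<Rightarrow> complex" where
  "bessel_W \<nu> = of_real (sqrt (2 / pi)) * exp (\<i> * of_real (pi / 2 * (\<nu> - 1/2)))"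

text \<open>Both functions solve the same equation, so the Wronskian is constant. Its value is found
  as r tends to 0, where only the term with \<open>hankel_K \<nu> 1\<close> survives; Legendre's
  duplication formula reduces the Gamma factors to sqrt (2 / pi).\<close>

lemma bessel_wronskian:
  assumes \<nu>: "\<nu> > 0" and r: "r > 0"
  shows "of_real (bessel_phi' \<nu> r) * hankel_h \<nu> r - of_real (bessel_phi \<nu> r) * hankel_h' \<nu> r = bessel_W \<nu>"
proof -
  define D where "D r = of_real (bessel_phi' \<nu> r) * hankel_h \<nu> r - of_real (bessel_phi \<nu> r) * hankel_h' \<nu> r" for r
  have \<nu>0: "\<nu> \<ge> 0" using \<nu> by simp
  define V where "V r = (\<nu>\<^sup>2 - 1/4) / r\<^sup>2 - 1" for r :: real
  have "(D has_vector_derivative 0) (at r)" if r: "r > 0" for r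
  proof -
    have "(D has_vector_derivative
        (of_real (bessel_phi' \<nu> r) * hankel_h' \<nu> r + of_real (V r * bessel_phi \<nu> r) * hankel_h \<nu> r)
      - (of_real (bessel_phi \<nu> r) * ((of_real ((\<nu>\<^sup>2 - 1/4) / r\<^sup>2) - 1) * hankel_h \<nu> r) + of_real (bessel_phi' \<nu> r) * hankel_h' \<nu> r)) (at r)"
      unfolding D_def[abs_def] V_def
      by (intro has_vector_derivative_diff has_vector_derivative_mult has_vector_derivative_of_real
          bessel_phi_deriv bessel_phi'_deriv hankel_h_deriv hankel_h'_deriv \<nu> \<nu>0 r)
    then show ?thesis by (simp add: V_def algebra_simps)
  qed
  then have "\<exists>c. \<forall>x\<in>{0<..}. D x = c"
    by (intro has_derivative_zero_constant) (auto simp: has_vector_derivative_def intro: has_derivative_at_withinI)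
  then obtain c where c: "\<And>r. r > 0 \<Longrightarrow> D r = c" by auto
  define \<gamma> where "\<gamma> = \<nu> - 1/2"
  define x where "x n = 1 / real (Suc n)" for n
  have x: "x n > 0" for n by (simp add: x_def)
  have x0: "x \<longlonglongrightarrow> 0" unfolding x_def[abs_def] by (rule Suc_inverse_tendsto_0)
  have D: "D r = of_real (2 powr (- \<nu>)) * of_real (1 / Gamma (\<nu> + 1/2)) * exp (\<i> * of_real r) *
     ((of_real (2 * r\<^sup>2 * bessel_S1 \<nu> (r\<^sup>2)) - \<i> * of_real (r * bessel_S \<nu> (r\<^sup>2))) * (of_real (r powr \<gamma>) * hankel_K \<nu> 0 r)
       + of_real (bessel_S \<nu> (r\<^sup>2)) * (of_real (r powr \<gamma>) * hankel_K \<nu> 1 r))" if r: "r > 0" for r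
  proof -
    have p: "r powr (\<nu> + 1/2) = r powr \<gamma> * r" "r powr (\<nu> - 1/2) = r powr \<gamma>" "r powr (\<nu> + 3/2) = r powr \<gamma> * r\<^sup>2"
      using r powr_add[of r \<gamma> 1] powr_add[of r \<gamma> 2] by (auto simp: \<gamma>_def add.commute)
    \<comment> \<open>The terms q K0, which come from differentiating the powers of r in both
      functions, cancel.\<close>
    have gen: "a * (q * P * S + 2 * (P * R\<^sup>2) * T) * (g * (X * K0)) - a * (P * R * S) * (g * (X * (\<i> * K0 + (q * K0 - K1) / R)))
      = a * g * X * ((2 * R\<^sup>2 * T - \<i> * (R * S)) * (P * K0) + S * (P * K1))"
      if "R \<noteq> 0" for a q P S R T g X K0 K1 :: complex
      using that by (simp add: field_simps power2_eq_square)
    have "complex_of_real r \<noteq> 0" using r by simp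
    from gen[OF this, of "of_real (2 powr (- \<nu>))" "of_real (\<nu> + 1/2)" "of_real (r powr \<gamma>)" "of_real (bessel_S \<nu> (r\<^sup>2))"
        "of_real (bessel_S1 \<nu> (r\<^sup>2))" "of_real (1 / Gamma (\<nu> + 1/2))" "exp (\<i> * of_real r)" "hankel_K \<nu> 0 r" "hankel_K \<nu> 1 r"]
    show ?thesis
      unfolding D_def bessel_phi_def bessel_phi'_def hankel_h_eq_K[OF r] p
      by (simp only: of_real_mult of_real_add of_real_power of_real_numeral)
  qed
  have x2: "(\<lambda>n. (x n)\<^sup>2) \<longlonglongrightarrow> 0" using tendsto_power[OF x0, of 2] by simp
  have S: "(\<lambda>n. bessel_S \<nu> ((x n)\<^sup>2)) \<longlonglongrightarrow> bessel_S \<nu> 0" "(\<lambda>n. bessel_S1 \<nu> ((x n)\<^sup>2)) \<longlonglongrightarrow> bessel_S1 \<nu> 0"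
    using isCont_tendsto_compose[OF DERIV_isCont[OF bessel_S_deriv[OF \<nu>0]] x2]
      isCont_tendsto_compose[OF DERIV_isCont[OF bessel_S1_deriv[OF \<nu>0]] x2] by simp_all
  have K: "(\<lambda>n. of_real (x n powr \<gamma>) * hankel_K \<nu> j (x n)) \<longlonglongrightarrow> (\<i> / 2) powr of_real \<gamma> * of_real (Gamma (2 * \<nu> + real j))" for j
    using hankel_K_at_0[OF \<nu>, of j] by (simp add: x_def \<gamma>_def)
  have "(\<lambda>n. D (x n)) \<longlonglongrightarrow> of_real (2 powr (- \<nu>)) * of_real (1 / Gamma (\<nu> + 1/2)) * exp (\<i> * of_real 0) *
     ((of_real (2 * 0\<^sup>2 * bessel_S1 \<nu> 0) - \<i> * of_real (0 * bessel_S \<nu> 0)) * ((\<i> / 2) powr of_real \<gamma> * of_real (Gamma (2 * \<nu> + real 0)))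
       + of_real (bessel_S \<nu> 0) * ((\<i> / 2) powr of_real \<gamma> * of_real (Gamma (2 * \<nu> + real 1))))"
    unfolding D[OF x]
    by (intro tendsto_mult tendsto_const tendsto_exp tendsto_of_real x0 tendsto_add tendsto_diff tendsto_power S K)
  moreover have "bessel_S \<nu> 0 = 1 / Gamma (\<nu> + 1)"
    unfolding bessel_S_def powser_zero by (simp add: bessel_coeff_def)
  ultimately have lim: "(\<lambda>n. D (x n)) \<longlonglongrightarrow> of_real (2 powr (- \<nu>)) * of_real (1 / Gamma (\<nu> + 1/2)) *
     (of_real (1 / Gamma (\<nu> + 1)) * ((\<i> / 2) powr of_real \<gamma> * of_real (Gamma (2 * \<nu> + 1))))" by simp
  have ip: "(\<i> / 2) powr of_real \<gamma> = of_real (2 powr (- \<gamma>)) * exp (\<i> * of_real (pi / 2 * \<gamma>))"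
  proof -
    have "(\<i> / 2) powr of_real \<gamma> = (of_real (1/2) * \<i>) powr of_real \<gamma>" by simp
    also have "\<dots> = of_real ((1/2) powr \<gamma>) * \<i> powr of_real \<gamma>" by (rule powr_of_real_mult) auto
    also have "\<i> powr of_real \<gamma> = exp (\<i> * of_real (pi / 2 * \<gamma>))" by (simp add: powr_def mult_ac)
    also have "(1/2 :: real) powr \<gamma> = 2 powr (- \<gamma>)" by (simp add: powr_divide powr_minus_divide)
    finally show ?thesis .
  qed
  have "of_real (2 powr (- \<nu>)) * of_real (1 / Gamma (\<nu> + 1/2)) *
     (of_real (1 / Gamma (\<nu> + 1)) * ((\<i> / 2) powr of_real \<gamma> * of_real (Gamma (2 * \<nu> + 1))))
    = of_real (2 powr (- \<nu>) * (1 / Gamma (\<nu> + 1/2)) * ((1 / Gamma (\<nu> + 1)) * (2 powr (- \<gamma>) * Gamma (2 * \<nu> + 1)))) * exp (\<i> * of_real (pi / 2 * \<gamma>))"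
    unfolding ip by simp
  also have "2 powr (- \<nu>) * (1 / Gamma (\<nu> + 1/2)) * ((1 / Gamma (\<nu> + 1)) * (2 powr (- \<gamma>) * Gamma (2 * \<nu> + 1))) = sqrt (2 / pi)"
  proof -
    have g: "Gamma (\<nu> + 1/2) > 0" "Gamma (\<nu> + 1) > 0" "Gamma (2 * \<nu> + 1) > 0" using \<nu> by (auto intro!: Gamma_real_pos)
    have "2 powr (- \<nu>) * (1 / Gamma (\<nu> + 1/2)) * ((1 / Gamma (\<nu> + 1)) * (2 powr (- \<gamma>) * Gamma (2 * \<nu> + 1)))
      = 2 powr (- \<nu>) * 2 powr (- \<gamma>) * Gamma (2 * \<nu> + 1) / (Gamma (\<nu> + 1/2) * Gamma (\<nu> + 1))" by simp
    also have "\<dots> = 2 powr (- \<nu>) * 2 powr (- \<gamma>) / (2 powr (- 2 * \<nu>) * sqrt pi)"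
      unfolding Gamma_duplication_real[OF \<nu>] using g by simp
    also have "2 powr (- \<nu>) * 2 powr (- \<gamma>) = 2 powr (- 2 * \<nu>) * 2 powr (1/2 :: real)"
      unfolding powr_add[symmetric] by (simp add: \<gamma>_def)
    also have "2 powr (- 2 * \<nu>) * 2 powr (1/2 :: real) / (2 powr (- 2 * \<nu>) * sqrt pi) = sqrt (2 / pi)"
      by (simp add: powr_half_sqrt real_sqrt_divide)
    finally show ?thesis .
  qed
  finally have "(\<lambda>n. D (x n)) \<longlonglongrightarrow> bessel_W \<nu>" using lim by (simp add: bessel_W_def \<gamma>_def)
  moreover have "(\<lambda>n. D (x n)) = (\<lambda>n. c)" using c[OF x] by simp
  ultimately have "c = bessel_W \<nu>" using LIMSEQ_unique[OF tendsto_const] by metis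
  then show ?thesis using c[OF r] by (simp add: D_def)
qed

lemma bessel_W_norm: "norm (bessel_W \<nu>) = sqrt (2 / pi)"
  by (simp add: bessel_W_def norm_mult)

text \<open>Constant for the same reason, but evaluated at infinity, where h' - i h tends to 0 and
  norm h to 1.\<close>

lemma hankel_wronskian:
  assumes \<nu>: "\<nu> > 0" and r: "r > 0"
  shows "hankel_h' \<nu> r * cnj (hankel_h \<nu> r) - hankel_h \<nu> r * cnj (hankel_h' \<nu> r) = 2 * \<i>"
proof -
  define D where "D r = hankel_h' \<nu> r * cnj (hankel_h \<nu> r) - hankel_h \<nu> r * cnj (hankel_h' \<nu> r)" for r
  have "(D has_vector_derivative 0) (at r)" if r: "r > 0" for r
  proof -
    have "(D has_vector_derivative
        (hankel_h' \<nu> r * cnj (hankel_h' \<nu> r) + ((of_real ((\<nu>\<^sup>2 - 1/4) / r\<^sup>2) - 1) * hankel_h \<nu> r) * cnj (hankel_h \<nu> r))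
      - (hankel_h \<nu> r * cnj ((of_real ((\<nu>\<^sup>2 - 1/4) / r\<^sup>2) - 1) * hankel_h \<nu> r) + hankel_h' \<nu> r * cnj (hankel_h' \<nu> r))) (at r)"
      unfolding D_def[abs_def]
      by (intro has_vector_derivative_diff has_vector_derivative_mult has_vector_derivative_cnj hankel_h_deriv hankel_h'_deriv \<nu> r)
    then show ?thesis by (simp add: algebra_simps)
  qed
  then have "\<exists>c. \<forall>x\<in>{0<..}. D x = c"
    by (intro has_derivative_zero_constant) (auto simp: has_vector_derivative_def intro: has_derivative_at_withinI)
  then obtain c where c: "\<And>r. r > 0 \<Longrightarrow> D r = c" by auto
  obtain K where "\<And>r. r \<ge> 1 \<Longrightarrow> norm (hankel_h \<nu> r) \<le> K \<and> norm (hankel_h' \<nu> r) \<le> K \<and>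
     r * norm (hankel_h' \<nu> r - \<i> * hankel_h \<nu> r) \<le> K"
    using hankel_h_bound[OF \<nu>, of \<nu>] by auto
  then have K: "norm (hankel_h \<nu> r) \<le> K" "norm (hankel_h' \<nu> r - \<i> * hankel_h \<nu> r) \<le> K / r" if "r \<ge> 1" for r
    using that by (auto simp: field_simps)
  define x where "x n = real (Suc n)" for n
  have x: "x n \<ge> 1" "x n > 0" for n by (auto simp: x_def)
  have hn: "(\<lambda>n. norm (hankel_h \<nu> (x n))) \<longlonglongrightarrow> 1"
    using tendsto_norm[OF hankel_h_at_infinity[OF \<nu>]] by (simp add: norm_mult x_def del: of_nat_Suc)
  define d where "d n = hankel_h' \<nu> (x n) - \<i> * hankel_h \<nu> (x n)" for n
  have dh: "(\<lambda>n. d n * cnj (hankel_h \<nu> (x n))) \<longlonglongrightarrow> 0"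
  proof (rule Lim_null_comparison)
    show "\<forall>\<^sub>F n in sequentially. norm (d n * cnj (hankel_h \<nu> (x n))) \<le> K * K * (1 / real (Suc n))"
    proof (intro always_eventually allI)
      fix n
      have "norm (d n * cnj (hankel_h \<nu> (x n))) \<le> K / x n * K"
        unfolding norm_mult d_def complex_mod_cnj using K[OF x(1)[of n]] by (intro mult_mono) (auto intro: order_trans[OF norm_ge_zero])
      then show "norm (d n * cnj (hankel_h \<nu> (x n))) \<le> K * K * (1 / real (Suc n))" by (simp add: x_def)
    qed
    show "(\<lambda>n. K * K * (1 / real (Suc n))) \<longlonglongrightarrow> 0"
      using tendsto_mult_left[OF Suc_inverse_tendsto_0, of "K * K"] by simp
  qed
  have "D (x n) = d n * cnj (hankel_h \<nu> (x n)) - cnj (d n * cnj (hankel_h \<nu> (x n))) + 2 * \<i> * of_real ((norm (hankel_h \<nu> (x n)))\<^sup>2)" for n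
    unfolding D_def d_def complex_norm_square by (simp add: algebra_simps)
  moreover have "(\<lambda>n. d n * cnj (hankel_h \<nu> (x n)) - cnj (d n * cnj (hankel_h \<nu> (x n))) + 2 * \<i> * of_real ((norm (hankel_h \<nu> (x n)))\<^sup>2))
    \<longlonglongrightarrow> 0 - cnj 0 + 2 * \<i> * of_real (1\<^sup>2)"
    by (intro tendsto_add tendsto_diff tendsto_cnj tendsto_mult tendsto_const tendsto_of_real tendsto_power dh hn)
  ultimately have "(\<lambda>n. D (x n)) \<longlonglongrightarrow> 2 * \<i>" by simp
  moreover have "(\<lambda>n. D (x n)) = (\<lambda>n. c)" using c[OF x(2)] by simp
  ultimately have "c = 2 * \<i>" using LIMSEQ_unique[OF tendsto_const] by metis
  then show ?thesis using c[OF r] by (simp add: D_def)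
qed

text \<open>Cramer's rule: the regular solution is expanded in h and its conjugate, and the
  coefficients are read off from the Wronskians.\<close>

lemma bessel_phi_eq_Im_hankel:
  assumes "\<nu> > 0" "r > 0"
  shows "of_real (bessel_phi \<nu> r) * (2 * \<i>) = cnj (bessel_W \<nu>) * hankel_h \<nu> r - bessel_W \<nu> * cnj (hankel_h \<nu> r)"
proof -
  have "bessel_W \<nu> * cnj (hankel_h \<nu> r) - cnj (bessel_W \<nu>) * hankel_h \<nu> r
    = - of_real (bessel_phi \<nu> r) * (hankel_h' \<nu> r * cnj (hankel_h \<nu> r) - hankel_h \<nu> r * cnj (hankel_h' \<nu> r))"
    unfolding bessel_wronskian[OF assms, symmetric] by (simp add: algebra_simps)
  then show ?thesis unfolding hankel_wronskian[OF assms] by (simp add: algebra_simps)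
qed

text \<open>Carries the bounds for h that are uniform in the order over to the regular solution; the
  factor sqrt (2 / pi) is below 1.\<close>

lemma bessel_phi_le_hankel:
  assumes "\<nu> > 0" "r > 0"
  shows "\<bar>bessel_phi \<nu> r\<bar> \<le> norm (hankel_h \<nu> r)"
proof -
  have "2 * \<bar>bessel_phi \<nu> r\<bar> = norm (cnj (bessel_W \<nu>) * hankel_h \<nu> r - bessel_W \<nu> * cnj (hankel_h \<nu> r))"
    unfolding bessel_phi_eq_Im_hankel[OF assms, symmetric] by (simp add: norm_mult)
  also have "\<dots> \<le> norm (cnj (bessel_W \<nu>) * hankel_h \<nu> r) + norm (bessel_W \<nu> * cnj (hankel_h \<nu> r))"
    by (rule norm_triangle_ineq4)
  also have "\<dots> = 2 * (sqrt (2 / pi) * norm (hankel_h \<nu> r))" by (simp add: norm_mult bessel_W_norm)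
  also have "\<dots> \<le> 2 * (1 * norm (hankel_h \<nu> r))"
    using pi_gt3 by (intro mult_left_mono mult_right_mono) (auto simp: field_simps)
  finally show ?thesis by simp
qed

text \<open>The Wronskian equals (\<phi>' - i \<phi>) h - \<phi> (h' - i h) with the last product of
  order 1/r, and h exp(-i r) tends to 1. The combination \<phi>' - i \<phi> isolates the incoming
  wave.\<close>

lemma bessel_phi_at_infinity:
  assumes \<nu>: "\<nu> > 0"
  shows "(\<lambda>n. (of_real (bessel_phi' \<nu> (real (Suc n))) - \<i> * of_real (bessel_phi \<nu> (real (Suc n)))) * exp (\<i> * of_real (real (Suc n)))) \<longlonglongrightarrow> bessel_W \<nu>"
proof -
  obtain K where "\<And>r. r \<ge> 1 \<Longrightarrow> norm (hankel_h \<nu> r) \<le> K \<and> norm (hankel_h' \<nu> r) \<le> K \<and>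
     r * norm (hankel_h' \<nu> r - \<i> * hankel_h \<nu> r) \<le> K"
    using hankel_h_bound[OF \<nu>, of \<nu>] by auto
  then have K: "norm (hankel_h \<nu> r) \<le> K" "norm (hankel_h' \<nu> r - \<i> * hankel_h \<nu> r) \<le> K / r" if "r \<ge> 1" for r
    using that by (auto simp: field_simps)
  define x where "x n = real (Suc n)" for n
  have x: "x n \<ge> 1" "x n > 0" for n by (auto simp: x_def)
  define p where "p n = complex_of_real (bessel_phi' \<nu> (x n)) - \<i> * of_real (bessel_phi \<nu> (x n))" for n
  define d where "d n = hankel_h' \<nu> (x n) - \<i> * hankel_h \<nu> (x n)" for n
  define e where "e n = hankel_h \<nu> (x n) * exp (- \<i> * of_real (x n))" for n
  have e1: "e \<longlonglongrightarrow> 1" using hankel_h_at_infinity[OF \<nu>] by (simp add: e_def[abs_def] x_def)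
  have dp: "(\<lambda>n. of_real (bessel_phi \<nu> (x n)) * d n) \<longlonglongrightarrow> 0"
  proof (rule Lim_null_comparison)
    show "\<forall>\<^sub>F n in sequentially. norm (of_real (bessel_phi \<nu> (x n)) * d n) \<le> K * K * (1 / real (Suc n))"
    proof (intro always_eventually allI)
      fix n
      have "\<bar>bessel_phi \<nu> (x n)\<bar> \<le> K" using bessel_phi_le_hankel[OF \<nu> x(2)] K(1)[OF x(1)] order_trans by blast
      then have "norm (of_real (bessel_phi \<nu> (x n)) * d n) \<le> K * (K / x n)"
        unfolding norm_mult d_def norm_of_real using K(2)[OF x(1)[of n]] by (intro mult_mono) (auto intro: order_trans[OF abs_ge_zero])
      then show "norm (of_real (bessel_phi \<nu> (x n)) * d n) \<le> K * K * (1 / real (Suc n))" by (simp add: x_def)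
    qed
    show "(\<lambda>n. K * K * (1 / real (Suc n))) \<longlonglongrightarrow> 0"
      using tendsto_mult_left[OF Suc_inverse_tendsto_0, of "K * K"] by simp
  qed
  have W: "p n * exp (\<i> * of_real (x n)) * e n = bessel_W \<nu> + of_real (bessel_phi \<nu> (x n)) * d n" for n
  proof -
    have "exp (\<i> * of_real (x n)) * e n = hankel_h \<nu> (x n)" by (simp add: e_def exp_minus)
    then have "p n * exp (\<i> * of_real (x n)) * e n = p n * hankel_h \<nu> (x n)" by (simp add: mult.assoc)
    then show ?thesis unfolding bessel_wronskian[OF \<nu> x(2)[of n], symmetric] p_def d_def by (simp add: algebra_simps)
  qed
  \<comment> \<open>A zero of h would make the Wronskian in \<open>hankel_wronskian\<close> vanish,
    but it equals 2 i.\<close>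
  have ne: "e n \<noteq> 0" for n
    using hankel_wronskian[OF \<nu> x(2)[of n]] by (auto simp: e_def)
  have "(\<lambda>n. (bessel_W \<nu> + of_real (bessel_phi \<nu> (x n)) * d n) / e n) \<longlonglongrightarrow> (bessel_W \<nu> + 0) / 1"
    by (intro tendsto_divide tendsto_add tendsto_const dp e1) simp
  moreover have "(bessel_W \<nu> + of_real (bessel_phi \<nu> (x n)) * d n) / e n = p n * exp (\<i> * of_real (x n))" for n
    unfolding W[symmetric] using ne[of n] by simp
  ultimately show ?thesis by (simp add: p_def x_def)
qed

section \<open>Overlap integrals of Bessel functions\<close>

text \<open>The double angle formula turns the product of cosine and sine into sin (pi d). With s =
  2 \<nu> + d and 4 (\<nu> + d) \<nu> = s^2 - d^2 a factor d^2 can then be split off the numerator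
  exactly, so that the only limit to be taken is that of (1 - sin (pi d) / (pi d)) / d^2.\<close>

lemma overlap_quotient_limit:
  fixes \<nu> :: real
  assumes \<nu>: "\<nu> > 0"
  shows "((\<lambda>d. 2 * \<nu> * ((1 / (2 * (\<nu> + d)) + 1 / (2 * \<nu>) - 2 * cos (pi / 2 * d) * (2 / pi * sin (pi / 2 * d) / ((\<nu> + d)\<^sup>2 - \<nu>\<^sup>2)))
      / (\<nu>\<^sup>2 - (\<nu> + d)\<^sup>2)\<^sup>2)) \<longlongrightarrow> pi\<^sup>2 / (12 * \<nu>\<^sup>2) + 1 / (8 * \<nu> ^ 4)) (at_right 0)"
proof (rule Lim_transform_eventually)
  have s: "((\<lambda>d. (1 - sin (pi * d) / (pi * d)) / d\<^sup>2) \<longlongrightarrow> pi\<^sup>2 / 6) (at_right 0)"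
  proof -
    have "((\<lambda>d. (1 - sin (pi * d) / (pi * d)) / d\<^sup>2) \<longlongrightarrow> pi * (pi * pi) * inverse pi / 6) (at_right 0)"
      by real_asymp
    also have "pi * (pi * pi) * inverse pi / 6 = pi\<^sup>2 / 6" by (simp add: field_simps power2_eq_square)
    finally show ?thesis .
  qed
  have "((\<lambda>d. 4 * \<nu> / (2 * \<nu> + d) ^ 3 * (1 / (4 * (\<nu> + d) * \<nu>) + (1 - sin (pi * d) / (pi * d)) / d\<^sup>2))
      \<longlongrightarrow> 4 * \<nu> / (2 * \<nu> + 0) ^ 3 * (1 / (4 * (\<nu> + 0) * \<nu>) + pi\<^sup>2 / 6)) (at_right 0)"
    by (intro tendsto_intros s) (use \<nu> in auto)
  also have "4 * \<nu> / (2 * \<nu> + 0) ^ 3 * (1 / (4 * (\<nu> + 0) * \<nu>) + pi\<^sup>2 / 6) = pi\<^sup>2 / (12 * \<nu>\<^sup>2) + 1 / (8 * \<nu> ^ 4)"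
    using \<nu> by (simp add: field_simps power2_eq_square power3_eq_cube power4_eq_xxxx)
  finally show "((\<lambda>d. 4 * \<nu> / (2 * \<nu> + d) ^ 3 * (1 / (4 * (\<nu> + d) * \<nu>) + (1 - sin (pi * d) / (pi * d)) / d\<^sup>2))
      \<longlongrightarrow> pi\<^sup>2 / (12 * \<nu>\<^sup>2) + 1 / (8 * \<nu> ^ 4)) (at_right 0)" .
  have "\<forall>\<^sub>F d in at_right (0::real). 0 < d" by (simp add: eventually_at_right_less)
  then show "\<forall>\<^sub>F d in at_right 0. 4 * \<nu> / (2 * \<nu> + d) ^ 3 * (1 / (4 * (\<nu> + d) * \<nu>) + (1 - sin (pi * d) / (pi * d)) / d\<^sup>2)
      = 2 * \<nu> * ((1 / (2 * (\<nu> + d)) + 1 / (2 * \<nu>) - 2 * cos (pi / 2 * d) * (2 / pi * sin (pi / 2 * d) / ((\<nu> + d)\<^sup>2 - \<nu>\<^sup>2)))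
      / (\<nu>\<^sup>2 - (\<nu> + d)\<^sup>2)\<^sup>2)"
  proof eventually_elim
    case (elim d)
    define s where "s = 2 * \<nu> + d"
    have s: "s > 0" using \<nu> elim by (simp add: s_def)
    have 1: "(\<nu> + d)\<^sup>2 - \<nu>\<^sup>2 = d * s" "\<nu>\<^sup>2 - (\<nu> + d)\<^sup>2 = - (d * s)" by (simp_all add: s_def power2_eq_square algebra_simps)
    have 2: "1 / (2 * (\<nu> + d)) + 1 / (2 * \<nu>) = 2 * s / (4 * (\<nu> + d) * \<nu>)"
      using \<nu> elim by (simp add: s_def field_simps)
    have 3: "4 * (\<nu> + d) * \<nu> = s\<^sup>2 - d\<^sup>2" by (simp add: s_def power2_eq_square algebra_simps)
    have p: "s\<^sup>2 - d\<^sup>2 > 0" using \<nu> elim unfolding 3[symmetric] by simp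
    have 4: "2 * cos (pi / 2 * d) * (2 / pi * sin (pi / 2 * d) / (d * s)) = 2 / s * (sin (pi * d) / (pi * d))"
      using sin_double[of "pi / 2 * d"] elim s by (simp add: field_simps)
    have gen: "4 * \<nu> / s ^ 3 * (1 / D + (1 - Z) / d\<^sup>2) = 2 * \<nu> * ((2 * s / D - 2 / s * Z) / (- (d * s))\<^sup>2)"
      if "D = s\<^sup>2 - d\<^sup>2" "D > 0" for D Z
    proof -
      have "2 * s / D - 2 / s * Z = 2 / s * (s\<^sup>2 / D - Z)"
        using s by (simp add: field_simps power2_eq_square)
      also have "s\<^sup>2 / D = 1 + d\<^sup>2 / D" using that by (simp add: field_simps)
      also have "1 + d\<^sup>2 / D - Z = d\<^sup>2 * (1 / D + (1 - Z) / d\<^sup>2)"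
        using elim by (simp add: distrib_left)
      finally have "2 * s / D - 2 / s * Z = 2 / s * (d\<^sup>2 * (1 / D + (1 - Z) / d\<^sup>2))" .
      moreover have "2 * \<nu> * (2 / s * (d\<^sup>2 * Y) / (- (d * s))\<^sup>2) = 4 * \<nu> / s ^ 3 * Y" for Y
        using s elim by (simp add: field_simps power2_eq_square power3_eq_cube)
      ultimately show ?thesis by simp
    qed
    show ?case unfolding 1 2 4 3 s_def[symmetric] by (rule gen[OF refl p])
  qed
qed

section \<open>Continuity in the order, in the norm of L2\<close>

lemma bessel_phi_measurable [measurable]: "\<nu> \<ge> 0 \<Longrightarrow> bessel_phi \<nu> \<in> borel_measurable half_line"
  by (rule continuous_measurable_half_line[OF bessel_phi_continuous])

text \<open>Near 0 the exponent belonging to \<nu>/2 leaves room for orders slightly below \<nu>;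
  beyond 1 the bound is that of \<open>hankel_h_bound\<close> on the compact interval from \<nu>/2
  to 2\<nu>. One majorant thus serves all late terms.\<close>

lemma bessel_phi_le_majorant:
  assumes \<nu>: "\<nu> > 0" and \<mu>: "\<And>n. \<mu> n > 0" "\<mu> \<longlonglongrightarrow> \<nu>"
  shows "\<exists>C. \<forall>\<^sub>F n in sequentially. \<forall>r>0. \<bar>bessel_phi (\<mu> n) r / r\<bar> \<le> C * L2_majorant (\<nu> / 2) r"
proof -
  have "0 < \<nu> / 2" using \<nu> by simp
  from hankel_h_bound[OF this, of "2 * \<nu>"]
  obtain K where K0: "\<And>m r. m \<in> {\<nu> / 2..2 * \<nu>} \<Longrightarrow> r \<ge> 1 \<Longrightarrow> norm (hankel_h m r) \<le> K" by blast
  have K: "\<bar>bessel_phi m r\<bar> \<le> K" if "m \<in> {\<nu> / 2..2 * \<nu>}" "r \<ge> 1" for m r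
  proof -
    have "m > 0" "r > 0" using that \<nu> by auto
    then show ?thesis using bessel_phi_le_hankel[of m r] K0[OF that] by linarith
  qed
  have G: "Gamma (\<nu> + 1) > 0" using \<nu> by (intro Gamma_real_pos) auto
  have nz: "\<nu> + 1 \<notin> \<int>\<^sub>\<le>\<^sub>0" using \<nu> by (auto elim!: nonpos_Ints_cases)
  have "(\<lambda>n. Gamma (\<mu> n + 1)) \<longlonglongrightarrow> Gamma (\<nu> + 1)"
    by (intro tendsto_Gamma tendsto_intros \<mu> nz)
  then have e1: "\<forall>\<^sub>F n in sequentially. Gamma (\<mu> n + 1) > Gamma (\<nu> + 1) / 2"
    by (rule order_tendstoD) (use G in simp)
  have e2: "\<forall>\<^sub>F n in sequentially. \<mu> n > \<nu> / 2" "\<forall>\<^sub>F n in sequentially. \<mu> n < 2 * \<nu>"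
    by (rule order_tendstoD[OF \<mu>(2)], use \<nu> in simp)+
  define C where "C = max (exp 1 / (Gamma (\<nu> + 1) / 2)) K"
  from e1 e2 have "\<forall>\<^sub>F n in sequentially. \<forall>r>0. \<bar>bessel_phi (\<mu> n) r / r\<bar> \<le> C * L2_majorant (\<nu> / 2) r"
  proof eventually_elim
    case (elim n)
    show ?case
    proof (intro allI impI)
      fix r :: real assume r: "r > 0"
      show "\<bar>bessel_phi (\<mu> n) r / r\<bar> \<le> C * L2_majorant (\<nu> / 2) r"
      proof (cases "r \<le> 1")
        case True
        have "\<bar>bessel_phi (\<mu> n) r\<bar> \<le> exp 1 / Gamma (\<mu> n + 1) * r powr (\<mu> n + 1/2)"
          using \<mu>(1)[of n] True r by (intro bessel_phi_bound_near_0) auto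
        also have "\<dots> \<le> C * r powr (\<nu> / 2 + 1/2)"
        proof (intro mult_mono)
          have "exp 1 / Gamma (\<mu> n + 1) \<le> exp 1 / (Gamma (\<nu> + 1) / 2)"
            using elim(1) G by (intro divide_left_mono) auto
          then show "exp 1 / Gamma (\<mu> n + 1) \<le> C" by (simp add: C_def)
          then show "0 \<le> C" using G by (simp add: C_def le_max_iff_disj)
          show "r powr (\<mu> n + 1/2) \<le> r powr (\<nu> / 2 + 1/2)" using True r elim by (intro powr_mono') auto
        qed auto
        finally have "\<bar>bessel_phi (\<mu> n) r\<bar> / r \<le> C * r powr (\<nu> / 2 + 1/2) / r" using r by (intro divide_right_mono) auto
        also have "\<dots> = C * r powr (\<nu> / 2 - 1/2)" using r powr_diff[of r "\<nu> / 2 + 1/2" 1] by simp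
        finally show ?thesis using True r by (simp add: L2_majorant_def)
      next
        case False
        have "\<bar>bessel_phi (\<mu> n) r\<bar> \<le> C" using K[of "\<mu> n" r] elim False by (auto simp: C_def)
        then show ?thesis using False r by (simp add: L2_majorant_def divide_right_mono)
      qed
    qed
  qed
  then show ?thesis by blast
qed

lemma bessel_phi_L2:
  assumes "\<nu> > 0"
  shows "(\<lambda>r. complex_of_real (bessel_phi \<nu> r / r)) \<in> L2"
proof -
  obtain C where C: "\<forall>r>0. \<bar>bessel_phi \<nu> r / r\<bar> \<le> C * L2_majorant (\<nu> / 2) r"
    using bessel_phi_le_majorant[OF assms, of "\<lambda>_. \<nu>"] assms by auto
  have [measurable]: "bessel_phi \<nu> \<in> borel_measurable half_line" using assms by (intro bessel_phi_measurable) auto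
  show ?thesis
  proof (rule L2_if_le_majorant[of "\<nu> / 2" _ C])
    show "(\<lambda>r. complex_of_real (bessel_phi \<nu> r / r)) \<in> borel_measurable half_line" by measurable
  qed (use assms C in \<open>auto simp: norm_divide\<close>)
qed

lemma bessel_phi_L2_tendsto:
  assumes \<nu>: "\<nu> > 0" and \<mu>: "\<And>n. \<mu> n > 0" "\<mu> \<longlonglongrightarrow> \<nu>"
  shows "(\<lambda>n. L2_norm (\<lambda>r. complex_of_real (bessel_phi (\<mu> n) r / r) - complex_of_real (bessel_phi \<nu> r / r))) \<longlonglongrightarrow> 0"
proof -
  obtain C where C: "\<forall>\<^sub>F n in sequentially. \<forall>r>0. \<bar>bessel_phi (\<mu> n) r / r\<bar> \<le> C * L2_majorant (\<nu> / 2) r"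
    using bessel_phi_le_majorant[OF assms] by blast
  obtain C' where C': "\<forall>r>0. \<bar>bessel_phi \<nu> r / r\<bar> \<le> C' * L2_majorant (\<nu> / 2) r"
    using bessel_phi_le_majorant[OF \<nu>, of "\<lambda>_. \<nu>"] \<nu> by auto
  from C obtain n0 where n0: "\<And>n r. n \<ge> n0 \<Longrightarrow> r > 0 \<Longrightarrow> \<bar>bessel_phi (\<mu> n) r / r\<bar> \<le> C * L2_majorant (\<nu> / 2) r"
    unfolding eventually_sequentially by blast
  have [measurable]: "bessel_phi \<nu> \<in> borel_measurable half_line" "bessel_phi (\<mu> n) \<in> borel_measurable half_line" for n
    using \<nu> \<mu>(1)[of n] by (auto intro!: bessel_phi_measurable)
  \<comment> \<open>The majorant is available only from \<open>n0\<close> on, so the sequence is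
    shifted first and the shift undone at the end.\<close>
  have "(\<lambda>n. LINT r|half_line. (norm (complex_of_real (bessel_phi (\<mu> (n + n0)) r / r) - complex_of_real (bessel_phi \<nu> r / r)))\<^sup>2)
    \<longlonglongrightarrow> (LINT r|half_line. 0)"
  proof (rule integral_dominated_convergence[where w = "\<lambda>r. ((C + C') * L2_majorant (\<nu> / 2) r)\<^sup>2"])
    show "integrable half_line (\<lambda>r. ((C + C') * L2_majorant (\<nu> / 2) r)\<^sup>2)"
      unfolding power_mult_distrib using \<nu> by (intro integrable_mult_right L2_majorant_integrable) auto
    show "AE r in half_line. (\<lambda>n. (norm (complex_of_real (bessel_phi (\<mu> (n + n0)) r / r) - complex_of_real (bessel_phi \<nu> r / r)))\<^sup>2) \<longlonglongrightarrow> 0"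
    proof (rule AE_I2)
      fix r assume "r \<in> space half_line"
      then have r: "r > 0" by simp
      have "(\<lambda>n. bessel_phi (\<mu> n) r) \<longlonglongrightarrow> bessel_phi \<nu> r"
        using \<nu> less_imp_le[OF \<mu>(1)] by (intro bessel_phi_continuous_in_order \<mu>(2) r) auto
      then have "(\<lambda>n. bessel_phi (\<mu> (n + n0)) r) \<longlonglongrightarrow> bessel_phi \<nu> r" by (rule LIMSEQ_ignore_initial_segment)
      then have "(\<lambda>n. (norm (complex_of_real (bessel_phi (\<mu> (n + n0)) r / r) - complex_of_real (bessel_phi \<nu> r / r)))\<^sup>2)
        \<longlonglongrightarrow> (norm (complex_of_real (bessel_phi \<nu> r / r) - complex_of_real (bessel_phi \<nu> r / r)))\<^sup>2"
        using r by (intro tendsto_power tendsto_norm tendsto_diff tendsto_of_real tendsto_divide tendsto_const) auto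
      then show "(\<lambda>n. (norm (complex_of_real (bessel_phi (\<mu> (n + n0)) r / r) - complex_of_real (bessel_phi \<nu> r / r)))\<^sup>2) \<longlonglongrightarrow> 0" by simp
    qed
    show "AE r in half_line. norm ((norm (complex_of_real (bessel_phi (\<mu> (n + n0)) r / r) - complex_of_real (bessel_phi \<nu> r / r)))\<^sup>2)
        \<le> ((C + C') * L2_majorant (\<nu> / 2) r)\<^sup>2" for n
    proof (rule AE_I2)
      fix r assume "r \<in> space half_line"
      then have r: "r > 0" by simp
      have "norm (complex_of_real (bessel_phi (\<mu> (n + n0)) r / r) - complex_of_real (bessel_phi \<nu> r / r))
        \<le> norm (complex_of_real (bessel_phi (\<mu> (n + n0)) r / r)) + norm (complex_of_real (bessel_phi \<nu> r / r))"
        by (rule norm_triangle_ineq4)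
      also have "\<dots> \<le> (C + C') * L2_majorant (\<nu> / 2) r"
        using n0[of "n + n0" r] C' r unfolding norm_of_real distrib_right by (intro add_mono) auto
      finally show "norm ((norm (complex_of_real (bessel_phi (\<mu> (n + n0)) r / r) - complex_of_real (bessel_phi \<nu> r / r)))\<^sup>2)
        \<le> ((C + C') * L2_majorant (\<nu> / 2) r)\<^sup>2" by (simp add: power_mono)
    qed
  qed measurable
  then have "(\<lambda>n. sqrt (LINT r|half_line. (norm (complex_of_real (bessel_phi (\<mu> (n + n0)) r / r) - complex_of_real (bessel_phi \<nu> r / r)))\<^sup>2)) \<longlonglongrightarrow> sqrt 0"
    by (intro tendsto_real_sqrt) simp
  then have "(\<lambda>n. L2_norm (\<lambda>r. complex_of_real (bessel_phi (\<mu> (n + n0)) r / r) - complex_of_real (bessel_phi \<nu> r / r))) \<longlonglongrightarrow> 0"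
    by (simp add: L2_norm_def)
  then show ?thesis by (rule LIMSEQ_offset)
qed

section \<open>Overlaps of different and of equal orders\<close>

definition bessel_overlap :: "real \<Rightarrow> real \<Rightarrow> real" where
  "bessel_overlap \<mu> \<nu> = (LINT r|half_line. (bessel_phi \<mu> r / r) * (bessel_phi \<nu> r / r))"

lemma bessel_overlap_integrable:
  assumes "\<mu> > 0" "\<nu> > 0"
  shows "integrable half_line (\<lambda>r. (bessel_phi \<mu> r / r) * (bessel_phi \<nu> r / r))"
  using L2_mult_integrable[OF bessel_phi_L2[OF assms(1)] bessel_phi_L2[OF assms(2)]]
  unfolding of_real_mult[symmetric] by (rule complex_of_real_integrable_eq[THEN iffD1])

lemma bessel_overlap_complex:
  assumes "\<mu> > 0" "\<nu> > 0"
  shows "(LINT r|half_line. complex_of_real (bessel_phi \<mu> r / r) * complex_of_real (bessel_phi \<nu> r / r)) = of_real (bessel_overlap \<mu> \<nu>)"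
  unfolding of_real_mult[symmetric] bessel_overlap_def by (rule integral_complex_of_real)

text \<open>The potentials of the two orders differ by (\<mu>^2 - \<nu>^2) / r^2, so this multiple
  of the integrand is the derivative of the Wronskian F of the two regular solutions. At 0 the
  Wronskian is of order r^(\<mu>+\<nu>), and only its limit at infinity contributes.\<close>

lemma bessel_overlap_neq:
  assumes \<mu>: "\<mu> > 0" and \<nu>: "\<nu> > 0" and ne: "\<mu> \<noteq> \<nu>"
  shows "bessel_overlap \<mu> \<nu> = 2 / pi * sin (pi / 2 * (\<mu> - \<nu>)) / (\<mu>\<^sup>2 - \<nu>\<^sup>2)"
proof -
  have 0: "\<mu> \<ge> 0" "\<nu> \<ge> 0" using \<mu> \<nu> by auto
  define F where "F r = bessel_phi' \<mu> r * bessel_phi \<nu> r - bessel_phi \<mu> r * bessel_phi' \<nu> r" for r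
  define f where "f r = (\<mu>\<^sup>2 - \<nu>\<^sup>2) * ((bessel_phi \<mu> r / r) * (bessel_phi \<nu> r / r))" for r
  have F: "(F has_vector_derivative f r) (at r)" if r: "r > 0" for r
  proof -
    have "(F has_real_derivative
       (((\<mu>\<^sup>2 - 1/4) / r\<^sup>2 - 1) * bessel_phi \<mu> r * bessel_phi \<nu> r + bessel_phi' \<nu> r * bessel_phi' \<mu> r)
       - (bessel_phi' \<mu> r * bessel_phi' \<nu> r + ((\<nu>\<^sup>2 - 1/4) / r\<^sup>2 - 1) * bessel_phi \<nu> r * bessel_phi \<mu> r)) (at r)"
      unfolding F_def[abs_def] by (intro DERIV_diff DERIV_mult bessel_phi_deriv bessel_phi'_deriv 0 r)
    moreover have "(((\<mu>\<^sup>2 - 1/4) / r\<^sup>2 - 1) * bessel_phi \<mu> r * bessel_phi \<nu> r + bessel_phi' \<nu> r * bessel_phi' \<mu> r)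
       - (bessel_phi' \<mu> r * bessel_phi' \<nu> r + ((\<nu>\<^sup>2 - 1/4) / r\<^sup>2 - 1) * bessel_phi \<nu> r * bessel_phi \<mu> r) = f r"
      using r by (simp add: f_def field_simps power2_eq_square)
    ultimately show ?thesis by (simp add: has_real_derivative_iff_has_vector_derivative)
  qed
  have fi: "integrable half_line f" unfolding f_def[abs_def] by (intro integrable_mult_right bessel_overlap_integrable \<mu> \<nu>)
  obtain C where C: "\<And>r. 0 < r \<Longrightarrow> r \<le> 1 \<Longrightarrow> \<bar>bessel_phi \<mu> r\<bar> \<le> C * r powr (\<mu> + 1/2)"
    "\<And>r. 0 < r \<Longrightarrow> r \<le> 1 \<Longrightarrow> \<bar>bessel_phi' \<mu> r\<bar> \<le> C * r powr (\<mu> - 1/2)" using bessel_phi_near_0[OF 0(1)] by blast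
  obtain C' where C': "\<And>r. 0 < r \<Longrightarrow> r \<le> 1 \<Longrightarrow> \<bar>bessel_phi \<nu> r\<bar> \<le> C' * r powr (\<nu> + 1/2)"
    "\<And>r. 0 < r \<Longrightarrow> r \<le> 1 \<Longrightarrow> \<bar>bessel_phi' \<nu> r\<bar> \<le> C' * r powr (\<nu> - 1/2)" using bessel_phi_near_0[OF 0(2)] by blast
  have A: "(\<lambda>n. F (1 / real (Suc n))) \<longlonglongrightarrow> 0"
  proof (rule Lim_null_comparison)
    show "\<forall>\<^sub>F n in sequentially. norm (F (1 / real (Suc n))) \<le> 2 * C * C' * (1 / real (Suc n)) powr (\<mu> + \<nu>)"
    proof (intro always_eventually allI)
      fix n
      define r where "r = 1 / real (Suc n)"
      have r: "r > 0" "r \<le> 1" by (auto simp: r_def)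
      have "\<bar>F r\<bar> \<le> \<bar>bessel_phi' \<mu> r\<bar> * \<bar>bessel_phi \<nu> r\<bar> + \<bar>bessel_phi \<mu> r\<bar> * \<bar>bessel_phi' \<nu> r\<bar>"
        unfolding F_def abs_mult[symmetric] by (rule abs_triangle_ineq4)
      also have "\<dots> \<le> (C * r powr (\<mu> - 1/2)) * (C' * r powr (\<nu> + 1/2)) + (C * r powr (\<mu> + 1/2)) * (C' * r powr (\<nu> - 1/2))"
        by (intro add_mono mult_mono C C' r order_trans[OF abs_ge_zero C(1)[OF r]] order_trans[OF abs_ge_zero C(2)[OF r]] abs_ge_zero)
      also have "\<dots> = C * C' * (r powr (\<mu> - 1/2) * r powr (\<nu> + 1/2)) + C * C' * (r powr (\<mu> + 1/2) * r powr (\<nu> - 1/2))"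
        by (simp add: algebra_simps)
      also have "\<dots> = 2 * C * C' * r powr (\<mu> + \<nu>)" unfolding powr_add[symmetric] by simp
      finally show "norm (F (1 / real (Suc n))) \<le> 2 * C * C' * (1 / real (Suc n)) powr (\<mu> + \<nu>)" by (simp add: r_def)
    qed
    show "(\<lambda>n. 2 * C * C' * (1 / real (Suc n)) powr (\<mu> + \<nu>)) \<longlonglongrightarrow> 0"
      using tendsto_mult_left[OF Suc_inverse_powr_tendsto_0[of "\<mu> + \<nu>"], of "2 * C * C'"] \<mu> \<nu> by simp
  qed
  define Z where "Z m n = (of_real (bessel_phi' m (real (Suc n))) - \<i> * of_real (bessel_phi m (real (Suc n)))) * exp (\<i> * of_real (real (Suc n)))" for m n
  \<comment> \<open>The factors exp(i r) cancel in the product, and (a' - i a)(b' + i b) has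
    imaginary part a' b - a b' for real values.\<close>
  have Fz: "F (real (Suc n)) = Im (Z \<mu> n * cnj (Z \<nu> n))" for n
  proof -
    have e: "exp (\<i> * of_real (real (Suc n))) * cnj (exp (\<i> * of_real (real (Suc n)))) = 1"
      by (simp add: exp_cnj exp_add[symmetric] del: of_nat_Suc)
    have zz: "Z \<mu> n * cnj (Z \<nu> n) = (of_real (bessel_phi' \<mu> (real (Suc n))) - \<i> * of_real (bessel_phi \<mu> (real (Suc n)))) *
        cnj (of_real (bessel_phi' \<nu> (real (Suc n))) - \<i> * of_real (bessel_phi \<nu> (real (Suc n)))) *
        (exp (\<i> * of_real (real (Suc n))) * cnj (exp (\<i> * of_real (real (Suc n)))))"
      unfolding Z_def complex_cnj_mult by (simp only: mult_ac)
    show ?thesis unfolding zz e by (simp add: F_def del: of_nat_Suc)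
  qed
  have "(\<lambda>n. Im (Z \<mu> n * cnj (Z \<nu> n))) \<longlonglongrightarrow> Im (bessel_W \<mu> * cnj (bessel_W \<nu>))"
    unfolding Z_def by (intro tendsto_Im tendsto_mult tendsto_cnj bessel_phi_at_infinity \<mu> \<nu>)
  then have B: "(\<lambda>n. F (real (Suc n))) \<longlonglongrightarrow> Im (bessel_W \<mu> * cnj (bessel_W \<nu>))" unfolding Fz .
  have W: "bessel_W \<mu> * cnj (bessel_W \<nu>) = of_real (2 / pi) * exp (\<i> * of_real (pi / 2 * (\<mu> - \<nu>)))"
  proof -
    have c: "cnj (exp (\<i> * of_real t)) = exp (- (\<i> * of_real t))" for t by (simp add: exp_cnj)
    have "bessel_W \<mu> * cnj (bessel_W \<nu>) = of_real (sqrt (2 / pi) * sqrt (2 / pi)) *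
        (exp (\<i> * of_real (pi / 2 * (\<mu> - 1/2))) * exp (- (\<i> * of_real (pi / 2 * (\<nu> - 1/2)))))"
      unfolding bessel_W_def complex_cnj_mult complex_cnj_complex_of_real c
      unfolding of_real_mult[of "sqrt _"] by (simp only: mult_ac)
    also have "exp (\<i> * of_real (pi / 2 * (\<mu> - 1/2))) * exp (- (\<i> * of_real (pi / 2 * (\<nu> - 1/2)))) = exp (\<i> * of_real (pi / 2 * (\<mu> - \<nu>)))"
      unfolding exp_add[symmetric] by (simp add: algebra_simps diff_divide_distrib)
    also have "sqrt (2 / pi) * sqrt (2 / pi) = 2 / pi" by simp
    finally show ?thesis .
  qed
  have "Im (bessel_W \<mu> * cnj (bessel_W \<nu>)) = 2 / pi * sin (pi / 2 * (\<mu> - \<nu>))"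
    unfolding W by (simp add: Im_exp)
  with half_line_FTC[OF F fi A B] have "(LINT r|half_line. f r) = 2 / pi * sin (pi / 2 * (\<mu> - \<nu>))" by simp
  moreover have "(LINT r|half_line. f r) = (\<mu>\<^sup>2 - \<nu>\<^sup>2) * bessel_overlap \<mu> \<nu>"
    unfolding f_def bessel_overlap_def by (rule integral_mult_right_zero)
  moreover have "\<mu>\<^sup>2 - \<nu>\<^sup>2 \<noteq> 0" using \<mu> \<nu> ne by (simp add: power2_eq_iff_nonneg)
  ultimately show ?thesis by (metis nonzero_mult_div_cancel_left)
qed

text \<open>On the diagonal the Wronskian formula reads 0/0, so the value is obtained by continuity
  in the order. It is the origin of the factor (2 \<nu>)^(1/2) in \<open>e0\<close>.\<close>

lemma bessel_overlap_eq:
  assumes \<nu>: "\<nu> > 0"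
  shows "bessel_overlap \<nu> \<nu> = 1 / (2 * \<nu>)"
proof -
  define d where "d n = 1 / real (Suc n)" for n
  have d: "d n > 0" for n by (simp add: d_def)
  have d0: "d \<longlonglongrightarrow> 0" unfolding d_def[abs_def] by (rule Suc_inverse_tendsto_0)
  have \<mu>: "\<nu> + d n > 0" "\<nu> + d n \<noteq> \<nu>" for n using d[of n] \<nu> by auto
  have "(\<lambda>n. \<nu> + d n) \<longlonglongrightarrow> \<nu>" using tendsto_add[OF tendsto_const d0, of \<nu>] by simp
  from tendsto_L2_pair[OF bessel_phi_L2[OF \<mu>(1)] bessel_phi_L2[OF \<nu>] bessel_phi_L2[OF \<nu>] bessel_phi_L2_tendsto[OF \<nu> \<mu>(1) this]]
  have "(\<lambda>n. complex_of_real (bessel_overlap (\<nu> + d n) \<nu>)) \<longlonglongrightarrow> of_real (bessel_overlap \<nu> \<nu>)"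
    unfolding bessel_overlap_complex[OF \<mu>(1) \<nu>] bessel_overlap_complex[OF \<nu> \<nu>] .
  then have 1: "(\<lambda>n. bessel_overlap (\<nu> + d n) \<nu>) \<longlonglongrightarrow> bessel_overlap \<nu> \<nu>"
    by (simp add: tendsto_of_real_iff)
  have s: "((\<lambda>x. 2 / pi * sin (pi / 2 * x) / x) \<longlongrightarrow> 1) (at_right 0)" by real_asymp
  have "filterlim d (at_right 0) sequentially"
    unfolding filterlim_at using d0 d by (auto intro!: always_eventually simp: less_imp_neq[THEN not_sym])
  from filterlim_compose[OF s this] have "(\<lambda>n. 2 / pi * sin (pi / 2 * d n) / d n) \<longlonglongrightarrow> 1" .
  then have "(\<lambda>n. 2 / pi * sin (pi / 2 * d n) / d n * (1 / (2 * \<nu> + d n))) \<longlonglongrightarrow> 1 * (1 / (2 * \<nu> + 0))"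
    by (intro tendsto_intros d0) (use \<nu> in auto)
  moreover have "bessel_overlap (\<nu> + d n) \<nu> = 2 / pi * sin (pi / 2 * d n) / d n * (1 / (2 * \<nu> + d n))" for n
  proof -
    have "(\<nu> + d n)\<^sup>2 - \<nu>\<^sup>2 = d n * (2 * \<nu> + d n)" by (simp add: power2_eq_square algebra_simps)
    then show ?thesis unfolding bessel_overlap_neq[OF \<mu>(1) \<nu> \<mu>(2)] by simp
  qed
  ultimately show ?thesis using LIMSEQ_unique[OF 1] by simp
qed

text \<open>Testing against continuous approximations of \<open>cnj D / (1 + \<bar>D\<bar>)\<close>.\<close>

lemma L2_eq_0_if_orthogonal:
  fixes D :: "real \<Rightarrow> complex"
  assumes D: "D \<in> L2"
    and orth: "\<And>\<psi> a b. continuous_on UNIV \<psi> \<Longrightarrow> 0 < a \<Longrightarrow> a < b \<Longrightarrow> (\<And>r. r \<notin> {a..b} \<Longrightarrow> \<psi> r = 0) \<Longrightarrow>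
      (LINT r|half_line. D r * (of_real r * \<psi> r)) = 0"
  shows "AE r in half_line. D r = 0"
proof -
  have Dm [measurable]: "D \<in> borel_measurable half_line" by (rule L2_measurable[OF D])
  define s where "s r = cnj (D r) / of_real (1 + norm (D r))" for r
  have "(\<lambda>r. cnj (D r)) \<in> borel_measurable half_line" by (rule L2_measurable[OF L2_cnj[OF D]])
  then have sm [measurable]: "s \<in> borel_measurable half_line" unfolding s_def[abs_def] by measurable
  then have "s measurable_on {0<..}" by (subst measurable_on_iff_borel_measurable) auto
  then obtain N g where N: "negligible N" and g: "\<And>n. continuous_on UNIV (g n)"
    and lim: "\<And>x. x \<notin> N \<Longrightarrow> (\<lambda>n. g n x) \<longlonglongrightarrow> (if x \<in> {0<..} then s x else 0)"
    unfolding measurable_on_def by blast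
  \<comment> \<open>Clipping to the unit disc bounds the approximations uniformly and keeps their
    limit, since \<open>s\<close> takes values in that disc.\<close>
  define h where "h n x = g n x / of_real (max 1 (norm (g n x)))" for n :: nat and x
  have h1: "norm (h n x) \<le> 1" for n x
    by (simp add: h_def norm_divide divide_le_eq max_def)
  have hc: "continuous_on UNIV (h n)" for n
    unfolding h_def[abs_def] by (intro continuous_intros g) auto
  have s1: "norm (s x) \<le> 1" for x
  proof -
    have "1 + norm (D x) > 0" by (simp add: add_pos_nonneg)
    then have "norm (s x) = norm (D x) / (1 + norm (D x))"
      unfolding s_def norm_divide norm_of_real complex_mod_cnj by (simp only: abs_of_pos)
    also have "\<dots> \<le> 1" using \<open>1 + norm (D x) > 0\<close> by (subst divide_le_eq_1_pos) auto
    finally show ?thesis .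
  qed
  have hlim: "(\<lambda>n. h n x) \<longlonglongrightarrow> s x" if "x \<notin> N" "x > 0" for x
  proof -
    have "(\<lambda>n. g n x) \<longlonglongrightarrow> s x" using lim[OF that(1)] that(2) by simp
    then have "(\<lambda>n. h n x) \<longlonglongrightarrow> s x / of_real (max 1 (norm (s x)))"
      unfolding h_def by (intro tendsto_intros) auto
    then show ?thesis using s1[of x] by (simp add: max_absorb1)
  qed
  have aeN: "AE x in half_line. x \<notin> N"
    using N by (auto simp: AE_restrict_space_iff negligible_iff_null_sets intro: AE_not_in[THEN AE_mp])
  \<comment> \<open>The index k + 2 ensures 1/(k+2) < k+2 already for k = 0, as the test interval
    must satisfy a < b.\<close>
  have "AE r in half_line. r \<le> 1 / real (Suc (Suc k)) \<or> real (Suc (Suc k)) \<le> r \<or> D r = 0" for k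
  proof -
    define a b where "a = 1 / real (Suc (Suc k))" and "b = real (Suc (Suc k))"
    have "a < 1" "1 < b" by (simp_all add: a_def b_def)
    then have "a < b" by linarith
    moreover have "0 < a" by (simp add: a_def)
    ultimately have ab: "0 < a" "a < b" by auto
    \<comment> \<open>A tent, positive inside the interval and 0 outside, which gives the tests
      compact support and keeps them continuous.\<close>
    define \<tau> where "\<tau> r = max 0 (min (r - a) (b - r))" for r
    have \<tau>c: "continuous_on S \<tau>" for S unfolding \<tau>_def[abs_def] by (intro continuous_intros)
    have \<tau>m [measurable]: "\<tau> \<in> borel_measurable half_line" by (rule continuous_measurable_half_line[OF \<tau>c])
    have \<tau>0: "\<tau> r \<ge> 0" "r \<notin> {a..b} \<Longrightarrow> \<tau> r = 0" for r by (auto simp: \<tau>_def)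
    have L: "(\<lambda>r. complex_of_real (r * \<tau> r)) \<in> L2"
      by (rule L2_compact_support[OF _ ab(1), of _ b]) (use \<tau>0(2) in \<open>auto intro!: continuous_intros \<tau>c\<close>)
    have dom: "integrable half_line (\<lambda>r. norm (D r * complex_of_real (r * \<tau> r)))"
      by (intro integrable_norm L2_mult_integrable D L)
    have z0: "(LINT r|half_line. D r * (of_real r * (of_real (\<tau> r) * h n r))) = 0" for n
      by (rule orth[OF _ ab]) (use \<tau>0(2) in \<open>auto intro!: continuous_intros \<tau>c hc\<close>)
    have "(\<lambda>n. LINT r|half_line. D r * (of_real r * (of_real (\<tau> r) * h n r))) \<longlonglongrightarrow>
        (LINT r|half_line. D r * (of_real r * (of_real (\<tau> r) * s r)))"
    proof (rule integral_dominated_convergence[OF _ _ dom])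
      have [measurable]: "h n \<in> borel_measurable half_line" for n
        by (rule continuous_measurable_half_line[OF continuous_on_subset[OF hc]]) simp
      show "(\<lambda>r. D r * (of_real r * (of_real (\<tau> r) * s r))) \<in> borel_measurable half_line" by measurable
      show "(\<lambda>r. D r * (of_real r * (of_real (\<tau> r) * h n r))) \<in> borel_measurable half_line" for n by measurable
      show "AE r in half_line. (\<lambda>n. D r * (of_real r * (of_real (\<tau> r) * h n r))) \<longlonglongrightarrow> D r * (of_real r * (of_real (\<tau> r) * s r))"
        using aeN AE_space by eventually_elim (auto intro!: tendsto_intros hlim)
      show "AE r in half_line. norm (D r * (of_real r * (of_real (\<tau> r) * h n r))) \<le> norm (D r * complex_of_real (r * \<tau> r))" for n
      proof (rule AE_I2)
        fix r :: real
        have "norm (D r * complex_of_real (r * \<tau> r)) * norm (h n r) \<le> norm (D r * complex_of_real (r * \<tau> r)) * 1"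
          by (intro mult_left_mono h1) auto
        then show "norm (D r * (of_real r * (of_real (\<tau> r) * h n r))) \<le> norm (D r * complex_of_real (r * \<tau> r))"
          by (simp add: norm_mult mult_ac)
      qed
    qed
    then have z: "(LINT r|half_line. D r * (of_real r * (of_real (\<tau> r) * s r))) = 0"
      unfolding z0 by (rule LIMSEQ_unique[OF tendsto_const, symmetric])
    define I where "I r = r * \<tau> r * ((norm (D r))\<^sup>2 / (1 + norm (D r)))" for r
    have eq: "D r * (of_real r * (of_real (\<tau> r) * s r)) = of_real (I r)" for r
    proof -
      have "D r * (of_real r * (of_real (\<tau> r) * s r)) = of_real (r * \<tau> r) * (D r * cnj (D r)) / of_real (1 + norm (D r))"
        by (simp add: s_def mult_ac)
      also have "D r * cnj (D r) = of_real ((norm (D r))\<^sup>2)" by (rule complex_norm_square[symmetric])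
      finally show ?thesis by (simp add: I_def)
    qed
    have "(LINT r|half_line. I r) = 0"
      using z unfolding eq integral_complex_of_real by simp
    moreover have "integrable half_line I"
    proof -
      have "integrable half_line (\<lambda>r. D r * (of_real r * (of_real (\<tau> r) * s r)))"
      proof (rule Bochner_Integration.integrable_bound[OF dom])
        show "(\<lambda>r. D r * (of_real r * (of_real (\<tau> r) * s r))) \<in> borel_measurable half_line" by measurable
        show "AE r in half_line. norm (D r * (of_real r * (of_real (\<tau> r) * s r))) \<le> norm (norm (D r * complex_of_real (r * \<tau> r)))"
        proof (rule AE_I2)
          fix r :: real
          have "norm (D r * complex_of_real (r * \<tau> r)) * norm (s r) \<le> norm (D r * complex_of_real (r * \<tau> r)) * 1"
            by (intro mult_left_mono s1) auto
          then show "norm (D r * (of_real r * (of_real (\<tau> r) * s r))) \<le> norm (norm (D r * complex_of_real (r * \<tau> r)))"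
            by (simp add: norm_mult mult_ac)
        qed
      qed
      then show ?thesis unfolding eq by (rule complex_of_real_integrable_eq[THEN iffD1])
    qed
    moreover have "AE r in half_line. 0 \<le> I r"
      by (intro AE_I2) (auto simp: I_def intro!: mult_nonneg_nonneg divide_nonneg_nonneg \<tau>0(1))
    ultimately have "AE r in half_line. I r = 0" using integral_nonneg_eq_0_iff_AE by blast
    then have "AE r in half_line. r \<le> a \<or> b \<le> r \<or> D r = 0"
      using AE_space
    proof eventually_elim
      case (elim r)
      show ?case
      proof (rule ccontr)
        assume "\<not> ?case"
        then have "r > a" "r < b" "D r \<noteq> 0" by auto
        then have "\<tau> r > 0" "norm (D r) > 0" "r > 0" using ab by (auto simp: \<tau>_def)
        then have "I r > 0" unfolding I_def by (intro mult_pos_pos divide_pos_pos) (auto intro: add_pos_pos)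
        then show False using elim(1) by simp
      qed
    qed
    then show ?thesis by (simp only: a_def b_def)
  qed
  then have "AE r in half_line. \<forall>k. r \<le> 1 / real (Suc (Suc k)) \<or> real (Suc (Suc k)) \<le> r \<or> D r = 0"
    unfolding AE_all_countable by blast
  then show ?thesis
    using AE_space
  proof eventually_elim
    case (elim r)
    then have r: "r > 0" by simp
    obtain k :: nat where k: "real k > max r (1 / r)" using reals_Archimedean2 by blast
    then have k2: "real (Suc (Suc k)) > r" "real (Suc (Suc k)) > 1 / r" by auto
    then have "1 / real (Suc (Suc k)) < r" using r by (simp add: field_simps)
    with elim(1) k2(1) show "D r = 0" by (meson not_le)
  qed
qed

section \<open>The boundary value applied to Bessel functions\<close>

lemma bounded_near_0:
  fixes f :: "real \<Rightarrow> real"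
  assumes f: "continuous_on {0<..} f" and a: "a > 0" and C: "\<And>r. 0 < r \<Longrightarrow> r \<le> a \<Longrightarrow> f r \<le> C"
  shows "\<exists>K. \<forall>r. 0 < r \<longrightarrow> r \<le> 1 \<longrightarrow> f r \<le> K"
proof -
  have "compact (f ` {a..1})"
    using a by (intro compact_continuous_image compact_Icc continuous_on_subset[OF f]) auto
  then obtain K where K: "\<And>r. r \<in> {a..1} \<Longrightarrow> norm (f r) \<le> K" using compact_imp_bounded bounded_iff by (metis image_eqI)
  have "f r \<le> max C K" if "0 < r" "r \<le> 1" for r
    using C[of r] K[of r] that by (cases "r \<le> a") auto
  then show ?thesis by blast
qed

lemma bounded_near_infinity:
  fixes f :: "real \<Rightarrow> real"
  assumes f: "continuous_on {0<..} f" and C: "\<And>r. b \<le> r \<Longrightarrow> 1 \<le> r \<Longrightarrow> f r \<le> C"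
  shows "\<exists>K. \<forall>r\<ge>1. f r \<le> K"
proof -
  have "compact (f ` {1..b})"
    by (intro compact_continuous_image compact_Icc continuous_on_subset[OF f]) auto
  then obtain K where K: "\<And>r. r \<in> {1..b} \<Longrightarrow> norm (f r) \<le> K" using compact_imp_bounded bounded_iff by (metis image_eqI)
  have "f r \<le> max C K" if "1 \<le> r" for r
    using C[of r] K[of r] that by (cases "b \<le> r") auto
  then show ?thesis by blast
qed

text \<open>The Wronskian of \<open>bessel_phi \<nu>\<close> and the outgoing (\<open>\<sigma> = 1\<close>) or incoming (\<open>\<sigma> = -1\<close>) solution.\<close>

definition radiating_W :: "real \<Rightarrow> real \<Rightarrow> complex" where
  "radiating_W \<sigma> \<nu> = of_real (sqrt (2 / pi)) * exp (\<i> * of_real (\<sigma> * (pi / 2 * (\<nu> - 1/2))))"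

lemma radiating_W_nonzero: "radiating_W \<sigma> \<nu> \<noteq> 0"
  by (simp add: radiating_W_def)

lemma radiating_W_eq: "radiating_W 1 \<nu> = bessel_W \<nu>" "radiating_W (-1) \<nu> = cnj (bessel_W \<nu>)"
  by (simp_all add: radiating_W_def bessel_W_def exp_cnj)

text \<open>The regular solution is real, so conjugation exchanges the two signs and carries the
  Wronskian along.\<close>

lemma radiating_solution_exists:
  assumes \<sigma>: "\<sigma> = 1 \<or> \<sigma> = -1" and \<nu>: "\<nu> > 0"
  shows "\<exists>H H' K. (\<forall>r>0. (H has_vector_derivative H' r) (at r)) \<and>
    (\<forall>r>0. (H' has_vector_derivative (of_real ((\<nu>\<^sup>2 - 1/4) / r\<^sup>2) - 1) * H r) (at r)) \<and>
    (\<forall>r>0. of_real (bessel_phi' \<nu> r) * H r - of_real (bessel_phi \<nu> r) * H' r = radiating_W \<sigma> \<nu>) \<and>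
    (\<forall>r\<ge>1. norm (H r) \<le> K \<and> norm (H' r) \<le> K \<and> r * norm (H' r - \<i> * of_real \<sigma> * H r) \<le> K)"
proof -
  obtain K where K: "\<And>r. r \<ge> 1 \<Longrightarrow> norm (hankel_h \<nu> r) \<le> K \<and> norm (hankel_h' \<nu> r) \<le> K \<and>
     r * norm (hankel_h' \<nu> r - \<i> * hankel_h \<nu> r) \<le> K"
    using hankel_h_bound[OF \<nu>, of \<nu>] by auto
  from \<sigma> show ?thesis
  proof
    assume "\<sigma> = 1"
    then show ?thesis using K hankel_h_deriv[OF \<nu>] hankel_h'_deriv[OF \<nu>] bessel_wronskian[OF \<nu>]
      by (rule_tac exI[of _ "hankel_h \<nu>"], rule_tac exI[of _ "hankel_h' \<nu>"], rule_tac exI[of _ K]) (auto simp: radiating_W_eq)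
  next
    assume s: "\<sigma> = -1"
    show ?thesis
    proof (rule exI[of _ "\<lambda>r. cnj (hankel_h \<nu> r)"], rule exI[of _ "\<lambda>r. cnj (hankel_h' \<nu> r)"], rule exI[of _ K], intro conjI allI impI)
      fix r :: real assume r: "r > 0"
      show "((\<lambda>r. cnj (hankel_h \<nu> r)) has_vector_derivative cnj (hankel_h' \<nu> r)) (at r)"
        by (intro has_vector_derivative_cnj hankel_h_deriv \<nu> r)
      show "((\<lambda>r. cnj (hankel_h' \<nu> r)) has_vector_derivative (of_real ((\<nu>\<^sup>2 - 1/4) / r\<^sup>2) - 1) * cnj (hankel_h \<nu> r)) (at r)"
        using has_vector_derivative_cnj[OF hankel_h'_deriv[OF \<nu> r]] by simp
      show "of_real (bessel_phi' \<nu> r) * cnj (hankel_h \<nu> r) - of_real (bessel_phi \<nu> r) * cnj (hankel_h' \<nu> r) = radiating_W \<sigma> \<nu>"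
        using arg_cong[OF bessel_wronskian[OF \<nu> r], of cnj] by (simp add: s radiating_W_eq)
    next
      fix r :: real assume r: "r \<ge> 1"
      have "cnj (hankel_h' \<nu> r) - \<i> * of_real \<sigma> * cnj (hankel_h \<nu> r) = cnj (hankel_h' \<nu> r - \<i> * hankel_h \<nu> r)"
        by (simp add: s)
      then show "r * norm (cnj (hankel_h' \<nu> r) - \<i> * of_real \<sigma> * cnj (hankel_h \<nu> r)) \<le> K"
        using K[OF r] by (simp only: complex_mod_cnj)
    qed (use K in auto)
  qed
qed

lemma bessel_phi_radiation:
  assumes \<sigma>: "\<sigma> = 1 \<or> \<sigma> = -1" and \<nu>: "\<nu> > 0"
  shows "(\<lambda>n. (of_real (bessel_phi' \<nu> (real (Suc n))) - \<i> * of_real \<sigma> * of_real (bessel_phi \<nu> (real (Suc n)))) * exp (\<i> * of_real \<sigma> * of_real (real (Suc n))))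
    \<longlonglongrightarrow> radiating_W \<sigma> \<nu>"
  using \<sigma>
proof
  assume "\<sigma> = 1"
  then show ?thesis using bessel_phi_at_infinity[OF \<nu>] by (simp add: radiating_W_eq)
next
  assume "\<sigma> = -1"
  then show ?thesis using tendsto_cnj[OF bessel_phi_at_infinity[OF \<nu>]] by (simp add: radiating_W_eq exp_cnj)
qed

lemma bessel_phi_bounded:
  assumes "\<nu> > 0"
  obtains C where "\<And>r. r \<ge> 1 \<Longrightarrow> \<bar>bessel_phi \<nu> r\<bar> \<le> C"
proof -
  obtain K where K: "\<And>r. r \<ge> 1 \<Longrightarrow> norm (hankel_h \<nu> r) \<le> K"
    using hankel_h_bound[OF assms, of \<nu>] by auto
  have "\<bar>bessel_phi \<nu> r\<bar> \<le> K" if "r \<ge> 1" for r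
  proof -
    have "r > 0" using that by simp
    then show ?thesis using bessel_phi_le_hankel[OF assms, of r] K[OF that] by linarith
  qed
  then show ?thesis using that by blast
qed

text \<open>Write w / r for the claimed value. For a compactly supported source \<psi> let v be the
  radiating solution; by \<open>boundary_value_weak\<close> the pairing of \<open>A g\<close> with r
  \<psi> is that of g with v / r. Green's identity gives the same for w / r: the boundary term at 0
  is small by the powers of r, and at infinity both w and v satisfy the same radiation condition.
  Since \<psi> is arbitrary, the two functions agree.\<close>

lemma boundary_value_bessel:
  assumes A: "is_boundary_value \<nu> \<sigma> A" and \<sigma>: "\<sigma> = 1 \<or> \<sigma> = -1" and \<nu>: "\<nu> > 0" and \<mu>: "\<mu> > 0" and ne: "\<mu> \<noteq> \<nu>"
  shows "AE r in half_line. A (\<lambda>r. of_real (bessel_phi \<mu> r / r)) r =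
    (of_real (bessel_phi \<mu> r / r) - exp (\<i> * of_real (\<sigma> * (pi / 2 * (\<mu> - \<nu>)))) * of_real (bessel_phi \<nu> r / r)) / of_real (\<nu>\<^sup>2 - \<mu>\<^sup>2)"
proof -
  define g where "g = (\<lambda>r. complex_of_real (bessel_phi \<mu> r / r))"
  define c where "c = complex_of_real (\<nu>\<^sup>2 - \<mu>\<^sup>2)"
  have c0: "c \<noteq> 0" using \<mu> \<nu> ne by (simp add: c_def power2_eq_iff_nonneg del: of_real_diff of_real_power)
  \<comment> \<open>The ratio of the limits of \<phi>' - i \<sigma> \<phi> for the two orders, so
    that subtracting \<omega> times the solution of order \<nu> removes the wave travelling in the
    wrong direction.\<close>
  define \<omega> where "\<omega> = exp (\<i> * of_real (\<sigma> * (pi / 2 * (\<mu> - \<nu>))))"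
  have \<omega>W: "radiating_W \<sigma> \<mu> = \<omega> * radiating_W \<sigma> \<nu>"
  proof -
    have "\<i> * of_real (\<sigma> * (pi / 2 * (\<mu> - 1/2))) = \<i> * of_real (\<sigma> * (pi / 2 * (\<mu> - \<nu>))) + \<i> * complex_of_real (\<sigma> * (pi / 2 * (\<nu> - 1/2)))"
      unfolding distrib_left[symmetric] of_real_add[symmetric] by (simp add: algebra_simps)
    then show ?thesis unfolding radiating_W_def \<omega>_def by (simp only: exp_add mult_ac)
  qed
  define W where "W = radiating_W \<sigma> \<nu>"
  have W0: "W \<noteq> 0" by (simp add: W_def radiating_W_nonzero)
  obtain H H' K where Hd: "\<And>r. r > 0 \<Longrightarrow> (H has_vector_derivative H' r) (at r)"
    and H'd: "\<And>r. r > 0 \<Longrightarrow> (H' has_vector_derivative (of_real ((\<nu>\<^sup>2 - 1/4) / r\<^sup>2) - 1) * H r) (at r)"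
    and HW: "\<And>r. r > 0 \<Longrightarrow> of_real (bessel_phi' \<nu> r) * H r - of_real (bessel_phi \<nu> r) * H' r = W"
    and HK: "\<And>r. r \<ge> 1 \<Longrightarrow> norm (H r) \<le> K \<and> norm (H' r) \<le> K \<and> r * norm (H' r - \<i> * of_real \<sigma> * H r) \<le> K"
    using radiating_solution_exists[OF \<sigma> \<nu>] unfolding W_def by blast
  define f f1 where "f m r = complex_of_real (bessel_phi m r)" and "f1 m r = complex_of_real (bessel_phi' m r)" for m r
  have fd: "(f m has_vector_derivative f1 m r) (at r)"
    "(f1 m has_vector_derivative (of_real ((m\<^sup>2 - 1/4) / r\<^sup>2) - 1) * f m r) (at r)" if "m > 0" "r > 0" for m r
  proof -
    show "(f m has_vector_derivative f1 m r) (at r)"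
      unfolding f_def[abs_def] f1_def using that by (intro has_vector_derivative_of_real bessel_phi_deriv) auto
    have "(f1 m has_vector_derivative of_real (((m\<^sup>2 - 1/4) / r\<^sup>2 - 1) * bessel_phi m r)) (at r)"
      unfolding f1_def[abs_def] using that by (intro has_vector_derivative_of_real bessel_phi'_deriv) auto
    then show "(f1 m has_vector_derivative (of_real ((m\<^sup>2 - 1/4) / r\<^sup>2) - 1) * f m r) (at r)"
      by (simp add: f_def)
  qed
  have vd_cont: "continuous_on {0<..} u" if "\<And>r. r > 0 \<Longrightarrow> (u has_vector_derivative u' r) (at r)" for u u' :: "real \<Rightarrow> complex"
    using that by (auto intro!: continuous_at_imp_continuous_on has_vector_derivative_continuous)
  note fc = vd_cont[OF fd(1)[OF \<nu>]] vd_cont[OF fd(2)[OF \<nu>]]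
  note Hc = vd_cont[OF Hd] vd_cont[OF H'd]
  define w w1 where "w r = (f \<mu> r - \<omega> * f \<nu> r) / c" and "w1 r = (f1 \<mu> r - \<omega> * f1 \<nu> r) / c" for r
  have wd: "(w has_vector_derivative w1 r) (at r)" if "r > 0" for r
    unfolding w_def[abs_def] w1_def
    by (intro has_vector_derivative_divide has_vector_derivative_diff has_vector_derivative_mult_right fd \<mu> \<nu> that)
  \<comment> \<open>The potentials of the two orders differ by c / r^2, and the division by c turns
    this difference into the source.\<close>
  have w1d: "(w1 has_vector_derivative (of_real ((\<nu>\<^sup>2 - 1/4) / r\<^sup>2) - 1) * w r - f \<mu> r / (of_real r)\<^sup>2) (at r)" if r: "r > 0" for r
  proof -
    have "(w1 has_vector_derivative ((of_real ((\<mu>\<^sup>2 - 1/4) / r\<^sup>2) - 1) * f \<mu> r - \<omega> * ((of_real ((\<nu>\<^sup>2 - 1/4) / r\<^sup>2) - 1) * f \<nu> r)) / c) (at r)"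
      unfolding w1_def[abs_def]
      by (intro has_vector_derivative_divide has_vector_derivative_diff has_vector_derivative_mult_right fd \<mu> \<nu> that)
    moreover have "complex_of_real ((\<mu>\<^sup>2 - 1/4) / r\<^sup>2) = of_real ((\<nu>\<^sup>2 - 1/4) / r\<^sup>2) - c / (of_real r)\<^sup>2"
      by (simp add: c_def diff_divide_distrib)
    moreover have "((V - c / R - 1) * F - \<omega> * ((V - 1) * G)) / c = (V - 1) * ((F - \<omega> * G) / c) - F / R" if "R \<noteq> 0" for V R F G :: complex
      using c0 that by (simp add: field_simps)
    ultimately show ?thesis using r by (simp add: w_def)
  qed
  have gL: "g \<in> L2" unfolding g_def by (rule bessel_phi_L2[OF \<mu>])
  have AB: "bounded_L2_operator A" using A by (simp add: is_boundary_value_def)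
  have AgL: "A g \<in> L2" by (rule bounded_L2_operator_L2[OF AB gL])
  have wL: "(\<lambda>r. w r / of_real r) \<in> L2"
  proof -
    have "(\<lambda>r. (1 / c) * (of_real (bessel_phi \<mu> r / r) + (- \<omega>) * of_real (bessel_phi \<nu> r / r))) \<in> L2"
      by (intro L2_scale L2_add bessel_phi_L2 \<mu> \<nu>)
    moreover have "(1 / c) * (of_real (bessel_phi \<mu> r / r) + (- \<omega>) * of_real (bessel_phi \<nu> r / r)) = w r / of_real r" for r
      by (simp add: w_def f_def diff_divide_distrib mult.commute)
    ultimately show ?thesis by simp
  qed
  have "AE r in half_line. A g r - w r / of_real r = 0"
  proof (rule L2_eq_0_if_orthogonal[OF L2_minus[OF AgL wL]])
    fix \<psi> :: "real \<Rightarrow> complex" and a b :: real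
    assume \<psi>: "continuous_on UNIV \<psi>" and a: "0 < a" and ab: "a < b" and out: "\<And>r. r \<notin> {a..b} \<Longrightarrow> \<psi> r = 0"
    have \<psi>c: "continuous_on {0<..} \<psi>" by (rule continuous_on_subset[OF \<psi>]) simp
    have \<psi>L: "(\<lambda>r. of_real r * \<psi> r) \<in> L2"
      by (rule L2_compact_support[OF _ a, of _ b]) (use out in \<open>auto intro!: continuous_intros \<psi>c\<close>)
    \<comment> \<open>A singularity of \<open>u\<close> at 0 does no harm because \<psi> vanishes to
      the left of a.\<close>
    have zc: "continuous_on S (\<lambda>r. u r * \<psi> r)" if "continuous_on {0<..} u" for S and u :: "real \<Rightarrow> complex"
    proof -
      have 1: "continuous_on {0<..} (\<lambda>r. u r * \<psi> r)" by (intro continuous_on_mult that \<psi>c)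
      have "0 = u r * \<psi> r" if "r \<in> {..<a}" for r using out[of r] that by auto
      then have 2: "continuous_on {..<a} (\<lambda>r. u r * \<psi> r)" by (rule continuous_on_eq[OF continuous_on_const])
      have "continuous_on ({0<..} \<union> {..<a}) (\<lambda>r. u r * \<psi> r)" by (rule continuous_on_open_Un[OF _ _ 1 2]) auto
      moreover have "{0<..} \<union> {..<a} = UNIV" using a by auto
      ultimately have "continuous_on UNIV (\<lambda>r. u r * \<psi> r)" by simp
      then show ?thesis by (rule continuous_on_subset) simp
    qed
    define P Q where "P r = integral {0..r} (\<lambda>s. f \<nu> s * \<psi> s)" and "Q r = integral {0..r} (\<lambda>s. H s * \<psi> s)" for r
    have id: "((\<lambda>r. integral {0..r} (\<lambda>s. u s * \<psi> s)) has_vector_derivative u r * \<psi> r) (at r)"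
      if "continuous_on {0<..} u" "r > 0" for r and u :: "real \<Rightarrow> complex"
    proof -
      have "((\<lambda>r. integral {0..r} (\<lambda>s. u s * \<psi> s)) has_vector_derivative u r * \<psi> r) (at r within {0..r+1})"
        by (rule integral_has_vector_derivative[OF zc[OF that(1)]]) (use that in auto)
      then show ?thesis using that(2) at_within_interior[of r "{0..r+1}"] by auto
    qed
    have Pd: "(P has_vector_derivative f \<nu> r * \<psi> r) (at r)" "(Q has_vector_derivative H r * \<psi> r) (at r)" if "r > 0" for r
    proof -
      show "(P has_vector_derivative f \<nu> r * \<psi> r) (at r)" unfolding P_def[abs_def] by (rule id[OF fc(1) that])
      show "(Q has_vector_derivative H r * \<psi> r) (at r)" unfolding Q_def[abs_def] by (rule id[OF Hc(1) that])
    qed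
    have P0: "P r = 0" "Q r = 0" if "r \<le> a" for r
    proof -
      have z: "integral {0..r} (\<lambda>s. u s * \<psi> s) = 0" for u :: "real \<Rightarrow> complex"
      proof -
        have "\<psi> s = 0" if "s \<in> {0..r} - {a}" for s using out[of s] that \<open>r \<le> a\<close> by auto
        then have "integral {0..r} (\<lambda>s. u s * \<psi> s) = integral {0..r} (\<lambda>s. 0)"
          by (intro integral_spike[of "{a}"]) auto
        then show ?thesis by simp
      qed
      show "P r = 0" "Q r = 0" unfolding P_def Q_def by (rule z)+
    qed
    have Pb: "P r = P b" "Q r = Q b" if "r \<ge> b" for r
    proof -
      have z: "integral {0..r} (\<lambda>s. u s * \<psi> s) = integral {0..b} (\<lambda>s. u s * \<psi> s)" if "continuous_on {0<..} u" for u :: "real \<Rightarrow> complex"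
      proof -
        have "integral {0..b} (\<lambda>s. u s * \<psi> s) + integral {b..r} (\<lambda>s. u s * \<psi> s) = integral {0..r} (\<lambda>s. u s * \<psi> s)"
          using a ab \<open>r \<ge> b\<close> by (intro Henstock_Kurzweil_Integration.integral_combine integrable_continuous_interval zc that) auto
        moreover have "\<psi> s = 0" if "s \<in> {b..r} - {b}" for s using out[of s] that by auto
        then have "integral {b..r} (\<lambda>s. u s * \<psi> s) = integral {b..r} (\<lambda>s. 0)"
          by (intro integral_spike[of "{b}"]) auto
        ultimately show ?thesis by simp
      qed
      show "P r = P b" unfolding P_def by (rule z[OF fc(1)])
      show "Q r = Q b" unfolding Q_def by (rule z[OF Hc(1)])
    qed
    \<comment> \<open>Variation of parameters: v is the integral of \<psi> against the Green kernel
      \<phi>(min) H(max) / W, split at r. It is a multiple of the regular solution up to a and a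
      multiple of H from b on.\<close>
    define v v1 v2 where "v r = (H r * P r + f \<nu> r * (Q b - Q r)) / W"
      and "v1 r = (H' r * P r + f1 \<nu> r * (Q b - Q r)) / W"
      and "v2 r = (of_real ((\<nu>\<^sup>2 - 1/4) / r\<^sup>2) - 1) * v r - \<psi> r" for r
    have vd: "(v has_vector_derivative v1 r) (at r)" if r: "r > 0" for r
    proof -
      have "(v has_vector_derivative ((H r * (f \<nu> r * \<psi> r) + H' r * P r) + (f \<nu> r * (0 - H r * \<psi> r) + f1 \<nu> r * (Q b - Q r))) / W) (at r)"
        unfolding v_def[abs_def]
        by (intro has_vector_derivative_divide has_vector_derivative_add has_vector_derivative_mult has_vector_derivative_diff
            has_vector_derivative_const Hd Pd fd \<nu> r)
      then show ?thesis by (simp add: v1_def algebra_simps)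
    qed
    have v1d: "(v1 has_vector_derivative v2 r) (at r)" if r: "r > 0" for r
    proof -
      define V where "V = complex_of_real ((\<nu>\<^sup>2 - 1/4) / r\<^sup>2) - 1"
      have "(v1 has_vector_derivative ((H' r * (f \<nu> r * \<psi> r) + V * H r * P r) + (f1 \<nu> r * (0 - H r * \<psi> r) + V * f \<nu> r * (Q b - Q r))) / W) (at r)"
        unfolding v1_def[abs_def] V_def
        by (intro has_vector_derivative_divide has_vector_derivative_add has_vector_derivative_mult has_vector_derivative_diff
            has_vector_derivative_const H'd Pd fd \<nu> r)
      moreover have "(H' r * (f \<nu> r * \<psi> r) + V * H r * P r) + (f1 \<nu> r * (0 - H r * \<psi> r) + V * f \<nu> r * (Q b - Q r))
        = V * (H r * P r + f \<nu> r * (Q b - Q r)) - (f1 \<nu> r * H r - f \<nu> r * H' r) * \<psi> r"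
        by (simp add: algebra_simps)
      moreover have "f1 \<nu> r * H r - f \<nu> r * H' r = W" using HW[OF r] by (simp add: f_def f1_def)
      ultimately show ?thesis using W0 by (simp add: v2_def v_def V_def diff_divide_distrib)
    qed
    note vc = vd_cont[OF vd] vd_cont[OF v1d]
    obtain C0 where C0: "\<And>r. 0 < r \<Longrightarrow> r \<le> 1 \<Longrightarrow> \<bar>bessel_phi \<nu> r\<bar> \<le> C0 * r powr (\<nu> + 1/2)"
      "\<And>r. 0 < r \<Longrightarrow> r \<le> 1 \<Longrightarrow> \<bar>bessel_phi' \<nu> r\<bar> \<le> C0 * r powr (\<nu> - 1/2)" using bessel_phi_near_0[of \<nu>] \<nu> by auto
    define q where "q = norm (Q b / W)"
    have va: "norm (v r) = \<bar>bessel_phi \<nu> r\<bar> * q" "norm (v1 r) = \<bar>bessel_phi' \<nu> r\<bar> * q" if "r \<le> a" for r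
      using P0[OF that] by (simp_all add: v_def v1_def q_def norm_mult norm_divide f_def f1_def)
    have vb: "v r = H r * (P b / W)" "v1 r = H' r * (P b / W)" if "r \<ge> b" for r
      using Pb[OF that] by (simp_all add: v_def v1_def)
    \<comment> \<open>Multiplying by r^(-p) turns the power bound into plain boundedness, which
      extends from a neighbourhood of 0 to all of (0, 1] by compactness.\<close>
    have near0: "\<exists>K. \<forall>r. 0 < r \<longrightarrow> r \<le> 1 \<longrightarrow> norm (u r) * r powr (- p) \<le> K"
      if "continuous_on {0<..} u" "\<And>r. 0 < r \<Longrightarrow> r \<le> min a 1 \<Longrightarrow> norm (u r) \<le> C0 * r powr p * q" for u :: "real \<Rightarrow> complex" and p
    proof (rule bounded_near_0[of _ "min a 1" "C0 * q"])
      show "continuous_on {0<..} (\<lambda>r. norm (u r) * r powr (- p))"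
        by (intro continuous_intros that(1)) auto
      fix r assume r: "0 < r" "r \<le> min a 1"
      have "norm (u r) * r powr (- p) \<le> C0 * r powr p * q * r powr (- p)" using that(2)[OF r] by (rule mult_right_mono) simp
      also have "\<dots> = C0 * q * (r powr p * r powr (- p))" by (simp add: mult_ac)
      also have "r powr p * r powr (- p) = 1" using r by (simp flip: powr_add)
      finally show "norm (u r) * r powr (- p) \<le> C0 * q" by simp
    qed (use a in auto)
    have "\<exists>K. \<forall>r. 0 < r \<longrightarrow> r \<le> 1 \<longrightarrow> norm (v r) * r powr (- (\<nu> + 1/2)) \<le> K"
      using C0(1) va(1) by (intro near0 vc) (auto simp: q_def intro!: mult_right_mono)
    moreover have "\<exists>K. \<forall>r. 0 < r \<longrightarrow> r \<le> 1 \<longrightarrow> norm (v1 r) * r powr (- (\<nu> - 1/2)) \<le> K"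
      using C0(2) va(2) by (intro near0 vc) (auto simp: q_def intro!: mult_right_mono)
    ultimately obtain Ka Kb where Ka: "\<And>r. 0 < r \<Longrightarrow> r \<le> 1 \<Longrightarrow> norm (v r) * r powr (- (\<nu> + 1/2)) \<le> Ka"
      and Kb: "\<And>r. 0 < r \<Longrightarrow> r \<le> 1 \<Longrightarrow> norm (v1 r) * r powr (- (\<nu> - 1/2)) \<le> Kb" by blast
    define p where "p = norm (P b / W)"
    have "\<exists>K. \<forall>r\<ge>1. norm (v r) \<le> K"
    proof (rule bounded_near_infinity[of _ b "K * p"])
      show "continuous_on {0<..} (\<lambda>r. norm (v r))" by (intro continuous_intros vc)
      show "norm (v r) \<le> K * p" if "b \<le> r" "1 \<le> r" for r
        unfolding vb(1)[OF that(1)] norm_mult p_def using HK[OF that(2)] by (intro mult_right_mono) auto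
    qed
    moreover have "\<exists>K. \<forall>r\<ge>1. norm (v1 r) \<le> K"
    proof (rule bounded_near_infinity[of _ b "K * p"])
      show "continuous_on {0<..} (\<lambda>r. norm (v1 r))" by (intro continuous_intros vc)
      show "norm (v1 r) \<le> K * p" if "b \<le> r" "1 \<le> r" for r
        unfolding vb(2)[OF that(1)] norm_mult p_def using HK[OF that(2)] by (intro mult_right_mono) auto
    qed
    moreover have "\<exists>K. \<forall>r\<ge>1. r * norm (v1 r - \<i> * of_real \<sigma> * v r) \<le> K"
    proof (rule bounded_near_infinity[of _ b "K * p"])
      show "continuous_on {0<..} (\<lambda>r. r * norm (v1 r - \<i> * of_real \<sigma> * v r))" by (intro continuous_intros vc)
      fix r assume r: "b \<le> r" "1 \<le> r"
      have "v1 r - \<i> * of_real \<sigma> * v r = (H' r - \<i> * of_real \<sigma> * H r) * (P b / W)"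
        unfolding vb[OF r(1)] by (simp add: algebra_simps diff_divide_distrib)
      then have "r * norm (v1 r - \<i> * of_real \<sigma> * v r) = r * norm (H' r - \<i> * of_real \<sigma> * H r) * p"
        by (simp only: norm_mult p_def mult.assoc)
      also have "\<dots> \<le> K * p" using HK[OF r(2)] by (intro mult_right_mono) (auto simp: p_def)
      finally show "r * norm (v1 r - \<i> * of_real \<sigma> * v r) \<le> K * p" .
    qed
    ultimately obtain Kc Kd Ke where Kc: "\<And>r. r \<ge> 1 \<Longrightarrow> norm (v r) \<le> Kc" and Kd: "\<And>r. r \<ge> 1 \<Longrightarrow> norm (v1 r) \<le> Kd"
      and Ke: "\<And>r. r \<ge> 1 \<Longrightarrow> r * norm (v1 r - \<i> * of_real \<sigma> * v r) \<le> Ke" by blast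
    define C where "C = max (max Ka Kb) (max (max Kc Kd) Ke)"
    have v0: "norm (v r) \<le> C * r powr (\<nu> + 1/2) \<and> norm (v1 r) \<le> C * r powr (\<nu> - 1/2)" if r: "0 < r" "r \<le> 1" for r
    proof -
      have "x \<le> C * r powr e" if "x * r powr (- e) \<le> C" for x e
      proof -
        have "x * r powr (- e) * r powr e \<le> C * r powr e" using that by (rule mult_right_mono) simp
        then show ?thesis using r by (simp add: mult.assoc flip: powr_add)
      qed
      moreover have "norm (v r) * r powr (- (\<nu> + 1/2)) \<le> C" "norm (v1 r) * r powr (- (\<nu> - 1/2)) \<le> C"
        using Ka[OF r] Kb[OF r] by (simp_all add: C_def le_max_iff_disj)
      ultimately show ?thesis by blast
    qed
    have vi: "norm (v r) \<le> C \<and> norm (v1 r) \<le> C \<and> r * norm (v1 r - \<i> * of_real \<sigma> * v r) \<le> C" if "1 \<le> r" for r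
      using Kc[OF that] Kd[OF that] Ke[OF that] by (auto simp: C_def le_max_iff_disj)
    have vL: "(\<lambda>r. v r / of_real r) \<in> L2"
      and main: "(LINT r|half_line. A g r * (of_real r * \<psi> r)) = (LINT r|half_line. g r * (v r / of_real r))"
      using boundary_value_weak[OF A \<sigma> \<nu> gL vd v1d v2_def \<psi>c a _ v0 vi, of b] out by auto
    \<comment> \<open>Green's identity: the derivative of this Wronskian is the difference of the
      two integrands to be compared, so the pairings agree once it vanishes at both ends.\<close>
    define F where "F r = w1 r * v r - w r * v1 r" for r
    define fF where "fF r = (w r / of_real r) * (of_real r * \<psi> r) - g r * (v r / of_real r)" for r
    have Fd: "(F has_vector_derivative fF r) (at r)" if r: "r > 0" for r
    proof -
      define V where "V = complex_of_real ((\<nu>\<^sup>2 - 1/4) / r\<^sup>2) - 1"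
      have "(F has_vector_derivative (w1 r * v1 r + (V * w r - f \<mu> r / (of_real r)\<^sup>2) * v r) - (w r * v2 r + w1 r * v1 r)) (at r)"
        unfolding F_def[abs_def] V_def
        by (intro has_vector_derivative_diff has_vector_derivative_mult wd w1d vd v1d r)
      moreover have "(w1 r * v1 r + (V * w r - f \<mu> r / (of_real r)\<^sup>2) * v r) - (w r * v2 r + w1 r * v1 r) = fF r"
        using r by (simp add: fF_def v2_def V_def g_def f_def algebra_simps power2_eq_square)
      ultimately show ?thesis by simp
    qed
    have fFi: "integrable half_line fF"
      unfolding fF_def[abs_def] by (intro Bochner_Integration.integrable_diff L2_mult_integrable wL \<psi>L gL vL)
    obtain C1 where C1: "\<And>r. 0 < r \<Longrightarrow> r \<le> 1 \<Longrightarrow> \<bar>bessel_phi \<mu> r\<bar> \<le> C1 * r powr (\<mu> + 1/2)"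
      "\<And>r. 0 < r \<Longrightarrow> r \<le> 1 \<Longrightarrow> \<bar>bessel_phi' \<mu> r\<bar> \<le> C1 * r powr (\<mu> - 1/2)" using bessel_phi_near_0[of \<mu>] \<mu> by auto
    have \<omega>1: "norm \<omega> = 1" unfolding \<omega>_def by (rule norm_exp_i_times)
    have Fa: "(\<lambda>n. F (1 / real (Suc n))) \<longlonglongrightarrow> 0"
    proof (rule Lim_null_comparison)
      show "\<forall>\<^sub>F n in sequentially. norm (F (1 / real (Suc n))) \<le>
          2 * C / norm c * (C1 * (1 / real (Suc n)) powr (\<mu> + \<nu>) + C0 * (1 / real (Suc n)) powr (2 * \<nu>))"
      proof (intro always_eventually allI)
        fix n
        define r where "r = 1 / real (Suc n)"
        have r: "r > 0" "r \<le> 1" by (auto simp: r_def)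
        have 1: "norm (w r) \<le> (C1 * r powr (\<mu> + 1/2) + C0 * r powr (\<nu> + 1/2)) / norm c"
          unfolding w_def norm_divide using norm_triangle_ineq4[of "f \<mu> r" "\<omega> * f \<nu> r"] C1(1)[OF r] C0(1)[OF r]
          by (intro divide_right_mono) (auto simp: f_def norm_mult \<omega>1)
        have 2: "norm (w1 r) \<le> (C1 * r powr (\<mu> - 1/2) + C0 * r powr (\<nu> - 1/2)) / norm c"
          unfolding w1_def norm_divide using norm_triangle_ineq4[of "f1 \<mu> r" "\<omega> * f1 \<nu> r"] C1(2)[OF r] C0(2)[OF r]
          by (intro divide_right_mono) (auto simp: f1_def norm_mult \<omega>1)
        have "norm (F r) \<le> norm (w1 r) * norm (v r) + norm (w r) * norm (v1 r)"
          unfolding F_def norm_mult[symmetric] by (rule norm_triangle_ineq4)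
        also have "\<dots> \<le> (C1 * r powr (\<mu> - 1/2) + C0 * r powr (\<nu> - 1/2)) / norm c * (C * r powr (\<nu> + 1/2))
            + (C1 * r powr (\<mu> + 1/2) + C0 * r powr (\<nu> + 1/2)) / norm c * (C * r powr (\<nu> - 1/2))"
          using v0[OF r] by (intro add_mono mult_mono 1 2 order_trans[OF norm_ge_zero 1] order_trans[OF norm_ge_zero 2]) auto
        also have "\<dots> = C / norm c * (C1 * (r powr (\<mu> - 1/2) * r powr (\<nu> + 1/2) + r powr (\<mu> + 1/2) * r powr (\<nu> - 1/2))
            + C0 * (2 * (r powr (\<nu> - 1/2) * r powr (\<nu> + 1/2))))"
          by (simp add: algebra_simps add_divide_distrib)
        also have "\<dots> = 2 * C / norm c * (C1 * r powr (\<mu> + \<nu>) + C0 * r powr (2 * \<nu>))"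
          unfolding powr_add[symmetric] by (simp add: algebra_simps)
        finally show "norm (F (1 / real (Suc n))) \<le>
          2 * C / norm c * (C1 * (1 / real (Suc n)) powr (\<mu> + \<nu>) + C0 * (1 / real (Suc n)) powr (2 * \<nu>))"
          by (simp only: r_def)
      qed
      have "(\<lambda>n. 2 * C / norm c * (C1 * (1 / real (Suc n)) powr (\<mu> + \<nu>) + C0 * (1 / real (Suc n)) powr (2 * \<nu>)))
        \<longlonglongrightarrow> 2 * C / norm c * (C1 * 0 + C0 * 0)"
        by (intro tendsto_mult tendsto_add tendsto_const Suc_inverse_powr_tendsto_0) (use \<mu> \<nu> in auto)
      then show "(\<lambda>n. 2 * C / norm c * (C1 * (1 / real (Suc n)) powr (\<mu> + \<nu>) + C0 * (1 / real (Suc n)) powr (2 * \<nu>))) \<longlonglongrightarrow> 0" by simp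
    qed
    obtain Cm where Cm: "\<And>r. r \<ge> 1 \<Longrightarrow> \<bar>bessel_phi \<mu> r\<bar> \<le> Cm" using bessel_phi_bounded[OF \<mu>] by blast
    obtain Cn where Cn: "\<And>r. r \<ge> 1 \<Longrightarrow> \<bar>bessel_phi \<nu> r\<bar> \<le> Cn" using bessel_phi_bounded[OF \<nu>] by blast
    define E where "E n = exp (\<i> * of_real \<sigma> * of_real (real (Suc n)))" for n
    have E1: "norm (E n) = 1" for n unfolding E_def by simp
    \<comment> \<open>Here the choice of \<omega> enters: the limits for the two orders
      cancel.\<close>
    have rad: "(\<lambda>n. (w1 (real (Suc n)) - \<i> * of_real \<sigma> * w (real (Suc n))) * E n) \<longlonglongrightarrow> 0"
    proof -
      have "(\<lambda>n. ((f1 \<mu> (real (Suc n)) - \<i> * of_real \<sigma> * f \<mu> (real (Suc n))) * E n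
          - \<omega> * ((f1 \<nu> (real (Suc n)) - \<i> * of_real \<sigma> * f \<nu> (real (Suc n))) * E n)) / c)
        \<longlonglongrightarrow> (radiating_W \<sigma> \<mu> - \<omega> * radiating_W \<sigma> \<nu>) / c"
        unfolding E_def f_def f1_def
        by (intro tendsto_divide tendsto_diff tendsto_mult tendsto_const bessel_phi_radiation \<sigma> \<mu> \<nu> c0)
      moreover have "((f1 \<mu> (real (Suc n)) - \<i> * of_real \<sigma> * f \<mu> (real (Suc n))) * E n
          - \<omega> * ((f1 \<nu> (real (Suc n)) - \<i> * of_real \<sigma> * f \<nu> (real (Suc n))) * E n)) / c
        = (w1 (real (Suc n)) - \<i> * of_real \<sigma> * w (real (Suc n))) * E n" for n
        using c0 by (simp add: w_def w1_def field_simps del: of_nat_Suc)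
      ultimately show ?thesis unfolding \<omega>W by simp
    qed
    define k where "k = P b / W"
    have Fb: "(\<lambda>n. F (real (Suc n))) \<longlonglongrightarrow> 0"
    proof (rule Lim_null_comparison)
      obtain n0 :: nat where n0: "b \<le> real n0" using real_arch_simple by blast
      show "\<forall>\<^sub>F n in sequentially. norm (F (real (Suc n))) \<le>
          norm k * (norm ((w1 (real (Suc n)) - \<i> * of_real \<sigma> * w (real (Suc n))) * E n) * K + (Cm + Cn) / norm c * K * (1 / real (Suc n)))"
        unfolding eventually_sequentially
      proof (intro exI[of _ n0] allI impI)
        fix n assume n: "n0 \<le> n"
        define r where "r = real (Suc n)"
        have r: "r \<ge> b" "r \<ge> 1" using n0 n by (auto simp: r_def)
        \<comment> \<open>Beyond b, v equals k H; adding and subtracting i \<sigma> w H expresses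
          the Wronskian through the radiation defects of w and H, both of which tend to 0.\<close>
        have "F r = k * ((w1 r - \<i> * of_real \<sigma> * w r) * H r - w r * (H' r - \<i> * of_real \<sigma> * H r))"
          unfolding F_def vb[OF r(1)] k_def[symmetric] by (simp add: algebra_simps)
        then have "norm (F r) \<le> norm k * (norm ((w1 r - \<i> * of_real \<sigma> * w r) * H r) + norm (w r * (H' r - \<i> * of_real \<sigma> * H r)))"
          by (simp only: norm_mult[of k]) (intro mult_left_mono norm_triangle_ineq4 norm_ge_zero)
        also have "\<dots> \<le> norm k * (norm ((w1 r - \<i> * of_real \<sigma> * w r) * E n) * K + (Cm + Cn) / norm c * K * (1 / r))"
        proof (intro mult_left_mono add_mono)
          show "norm ((w1 r - \<i> * of_real \<sigma> * w r) * H r) \<le> norm ((w1 r - \<i> * of_real \<sigma> * w r) * E n) * K"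
            unfolding norm_mult[of _ "H r"] norm_mult[of _ "E n"] E1 mult_1_right using HK[OF r(2)] by (intro mult_left_mono) auto
          have "norm (w r) \<le> (Cm + Cn) / norm c"
            unfolding w_def norm_divide using norm_triangle_ineq4[of "f \<mu> r" "\<omega> * f \<nu> r"] Cm[OF r(2)] Cn[OF r(2)]
            by (intro divide_right_mono) (auto simp: f_def norm_mult \<omega>1)
          moreover have "norm (H' r - \<i> * of_real \<sigma> * H r) \<le> K * (1 / r)"
            using HK[OF r(2)] r(2) by (simp add: field_simps)
          ultimately have "norm (w r) * norm (H' r - \<i> * of_real \<sigma> * H r) \<le> (Cm + Cn) / norm c * (K * (1 / r))"
            by (intro mult_mono) (auto intro: order_trans[OF norm_ge_zero])
          then show "norm (w r * (H' r - \<i> * of_real \<sigma> * H r)) \<le> (Cm + Cn) / norm c * K * (1 / r)"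
            by (simp only: norm_mult mult.assoc)
        qed auto
        finally show "norm (F (real (Suc n))) \<le>
          norm k * (norm ((w1 (real (Suc n)) - \<i> * of_real \<sigma> * w (real (Suc n))) * E n) * K + (Cm + Cn) / norm c * K * (1 / real (Suc n)))"
          by (simp only: r_def)
      qed
      have "(\<lambda>n. norm k * (norm ((w1 (real (Suc n)) - \<i> * of_real \<sigma> * w (real (Suc n))) * E n) * K + (Cm + Cn) / norm c * K * (1 / real (Suc n))))
        \<longlonglongrightarrow> norm k * (norm (0::complex) * K + (Cm + Cn) / norm c * K * 0)"
        by (intro tendsto_mult tendsto_add tendsto_const tendsto_norm rad Suc_inverse_tendsto_0)
      then show "(\<lambda>n. norm k * (norm ((w1 (real (Suc n)) - \<i> * of_real \<sigma> * w (real (Suc n))) * E n) * K + (Cm + Cn) / norm c * K * (1 / real (Suc n)))) \<longlonglongrightarrow> 0"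
        by simp
    qed
    have "(LINT r|half_line. fF r) = 0" using half_line_FTC[OF Fd fFi Fa Fb] by simp
    moreover have "(LINT r|half_line. fF r) = (LINT r|half_line. (w r / of_real r) * (of_real r * \<psi> r)) - (LINT r|half_line. g r * (v r / of_real r))"
      unfolding fF_def by (intro Bochner_Integration.integral_diff L2_mult_integrable wL \<psi>L gL vL)
    moreover have "(LINT r|half_line. (A g r - w r / of_real r) * (of_real r * \<psi> r)) =
        (LINT r|half_line. A g r * (of_real r * \<psi> r)) - (LINT r|half_line. (w r / of_real r) * (of_real r * \<psi> r))"
      unfolding left_diff_distrib by (intro Bochner_Integration.integral_diff L2_mult_integrable wL \<psi>L AgL)
    ultimately show "(LINT r|half_line. (A g r - w r / of_real r) * (of_real r * \<psi> r)) = 0"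
      unfolding main by simp
  qed
  then have "AE r in half_line. A g r = w r / of_real r" by eventually_elim simp
  then show ?thesis
    unfolding g_def[symmetric] \<omega>_def[symmetric] c_def[symmetric]
    by eventually_elim (simp add: w_def f_def g_def diff_divide_distrib mult.commute)
qed

text \<open>For real x, y and unimodular \<omega> the norm of x - \<omega> y depends on \<omega>
  only through its real part. The sign \<sigma> therefore drops out, and three overlap integrals
  remain.\<close>

lemma L2_norm_boundary_value_bessel:
  assumes A: "is_boundary_value \<nu> \<sigma> A" and \<sigma>: "\<sigma> = 1 \<or> \<sigma> = -1" and \<nu>: "\<nu> > 0" and \<mu>: "\<mu> > 0" and ne: "\<mu> \<noteq> \<nu>"
  shows "(L2_norm (A (\<lambda>r. of_real (bessel_phi \<mu> r / r))))\<^sup>2 =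
    (1 / (2 * \<mu>) + 1 / (2 * \<nu>) - 2 * cos (pi / 2 * (\<mu> - \<nu>)) * (2 / pi * sin (pi / 2 * (\<mu> - \<nu>)) / (\<mu>\<^sup>2 - \<nu>\<^sup>2)))
      / (\<nu>\<^sup>2 - \<mu>\<^sup>2)\<^sup>2"
proof -
  define p where "p m r = bessel_phi m r / r" for m r
  define t where "t = pi / 2 * (\<mu> - \<nu>)"
  define \<omega> where "\<omega> = exp (\<i> * of_real (\<sigma> * t))"
  have \<omega>: "Re \<omega> = cos t" "norm \<omega> = 1"
    unfolding \<omega>_def norm_exp_i_times using \<sigma> by (auto simp: Re_exp)
  define u where "u r = (of_real (p \<mu> r) - \<omega> * of_real (p \<nu> r)) / of_real (\<nu>\<^sup>2 - \<mu>\<^sup>2)" for r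
  have gL: "(\<lambda>r. complex_of_real (p m r)) \<in> L2" if "m > 0" for m
    using bessel_phi_L2[OF that] by (simp only: p_def)
  have uL: "u \<in> L2"
  proof -
    have "(\<lambda>r. (1 / of_real (\<nu>\<^sup>2 - \<mu>\<^sup>2)) * (of_real (p \<mu> r) - \<omega> * of_real (p \<nu> r))) \<in> L2"
      by (intro L2_scale L2_minus gL \<mu> \<nu>)
    then show ?thesis by (simp add: u_def[abs_def] del: of_real_diff)
  qed
  have "AE r in half_line. A (\<lambda>r. of_real (p \<mu> r)) r = u r"
    using boundary_value_bessel[OF A \<sigma> \<nu> \<mu> ne] by (simp only: u_def p_def \<omega>_def t_def)
  then have "L2_norm (A (\<lambda>r. of_real (p \<mu> r))) = L2_norm u"
    using A by (intro L2_norm_cong_AE[OF bounded_L2_operator_L2[OF _ gL[OF \<mu>]] uL]) (simp_all add: is_boundary_value_def)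
  moreover have "(L2_norm u)\<^sup>2 = (1 / (2 * \<mu>) + 1 / (2 * \<nu>) - 2 * cos t * (2 / pi * sin t / (\<mu>\<^sup>2 - \<nu>\<^sup>2))) / (\<nu>\<^sup>2 - \<mu>\<^sup>2)\<^sup>2"
  proof -
    have sq: "(norm (of_real x - \<omega> * of_real y))\<^sup>2 = x * x + y * y - 2 * cos t * (x * y)" for x y :: real
    proof -
      have i: "(Im \<omega>)\<^sup>2 = 1 - (cos t)\<^sup>2" using \<omega> cmod_power2[of \<omega>] by simp
      have "(norm (of_real x - \<omega> * of_real y))\<^sup>2 = (x - cos t * y)\<^sup>2 + (Im \<omega>)\<^sup>2 * y\<^sup>2"
        unfolding cmod_power2 using \<omega>(1) by (simp add: power_mult_distrib)
      then show ?thesis unfolding i by (simp add: power2_eq_square algebra_simps)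
    qed
    have "(norm (u r))\<^sup>2 = (p \<mu> r * p \<mu> r + p \<nu> r * p \<nu> r - 2 * cos t * (p \<mu> r * p \<nu> r)) / (\<nu>\<^sup>2 - \<mu>\<^sup>2)\<^sup>2" for r
      unfolding u_def norm_divide power_divide sq norm_of_real power2_abs ..
    then have "(L2_norm u)\<^sup>2 = (LINT r|half_line. (p \<mu> r * p \<mu> r + p \<nu> r * p \<nu> r - 2 * cos t * (p \<mu> r * p \<nu> r)) / (\<nu>\<^sup>2 - \<mu>\<^sup>2)\<^sup>2)"
      unfolding L2_norm_sq by simp
    also have "\<dots> = (bessel_overlap \<mu> \<mu> + bessel_overlap \<nu> \<nu> - 2 * cos t * bessel_overlap \<mu> \<nu>) / (\<nu>\<^sup>2 - \<mu>\<^sup>2)\<^sup>2"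
    proof -
      have i: "integrable half_line (\<lambda>r. p m r * p n r)" if "m > 0" "n > 0" for m n
        unfolding p_def by (rule bessel_overlap_integrable[OF that])
      have l: "(LINT r|half_line. p m r * p n r) = bessel_overlap m n" for m n
        by (simp only: p_def bessel_overlap_def)
      have "(LINT r|half_line. p \<mu> r * p \<mu> r + p \<nu> r * p \<nu> r - 2 * cos t * (p \<mu> r * p \<nu> r))
        = bessel_overlap \<mu> \<mu> + bessel_overlap \<nu> \<nu> - 2 * cos t * bessel_overlap \<mu> \<nu>"
        using i[OF \<mu> \<mu>] i[OF \<nu> \<nu>] i[OF \<mu> \<nu>] by (simp add: l)
      then show ?thesis by simp
    qed
    finally show ?thesis
      unfolding bessel_overlap_eq[OF \<mu>] bessel_overlap_eq[OF \<nu>] bessel_overlap_neq[OF \<mu> \<nu> ne] t_def .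
  qed
  ultimately show ?thesis by (simp only: p_def t_def)
qed

theorem theorem2p4:
  fixes \<nu> \<sigma> :: real and A :: "(real \<Rightarrow> complex) \<Rightarrow> (real \<Rightarrow> complex)"
  assumes "\<nu> > 0"
    and "\<sigma> = 1 \<or> \<sigma> = -1"
    and "is_boundary_value \<nu> \<sigma> A"
  shows "(L2_operator_norm A)\<^sup>2 \<ge> (L2_norm (A (e0 \<nu>)))\<^sup>2
       \<and> (L2_norm (A (e0 \<nu>)))\<^sup>2 = pi\<^sup>2 / (12 * \<nu>\<^sup>2) + 1 / (8 * \<nu> ^ 4)"
proof
  note \<nu> = assms(1) and \<sigma> = assms(2) and A = assms(3)
  have AB: "bounded_L2_operator A" using A by (simp add: is_boundary_value_def)
  define c where "c = (2 * \<nu>) powr (1/2)"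
  have c: "c \<ge> 0" "c\<^sup>2 = 2 * \<nu>" using \<nu> by (simp_all add: c_def powr_half_sqrt)
  have e0: "e0 \<nu> r = of_real c * of_real (bessel_phi \<nu> r / r)" if "r > 0" for r
    using bessel_J_eq(2)[of \<nu> r] \<nu> that by (simp add: c_def)
  have cL: "(\<lambda>r. of_real c * complex_of_real (bessel_phi m r / r)) \<in> L2" if "m > 0" for m
    by (intro L2_scale bessel_phi_L2 that)
  have eL: "e0 \<nu> \<in> L2" using cL[OF \<nu>] L2_cong[of "e0 \<nu>", OF e0] by simp
  have norm_e0: "L2_norm (e0 \<nu>) = 1"
  proof -
    have "(L2_norm (e0 \<nu>))\<^sup>2 = (LINT r|half_line. c\<^sup>2 * ((bessel_phi \<nu> r / r) * (bessel_phi \<nu> r / r)))"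
      unfolding L2_norm_sq
    proof (rule Bochner_Integration.integral_cong)
      fix r assume "r \<in> space half_line"
      then have "e0 \<nu> r = of_real (c * (bessel_phi \<nu> r / r))" using e0[of r] by simp
      then have "(norm (e0 \<nu> r))\<^sup>2 = (c * (bessel_phi \<nu> r / r))\<^sup>2" by (simp only: norm_of_real power2_abs)
      then show "(norm (e0 \<nu> r))\<^sup>2 = c\<^sup>2 * ((bessel_phi \<nu> r / r) * (bessel_phi \<nu> r / r))"
        by (simp only: power2_eq_square mult_ac)
    qed simp
    also have "\<dots> = c\<^sup>2 * bessel_overlap \<nu> \<nu>" unfolding bessel_overlap_def by (rule integral_mult_right_zero)
    also have "\<dots> = 1" using \<nu> by (simp add: c bessel_overlap_eq)
    finally show ?thesis using L2_norm_nonneg[of "e0 \<nu>"] by (simp add: power2_eq_1_iff)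
  qed
  obtain C where C: "\<And>f. f \<in> L2 \<Longrightarrow> L2_norm (A f) \<le> C * L2_norm f"
    using AB unfolding bounded_L2_operator_def by blast
  have "L2_norm (A (e0 \<nu>)) \<le> L2_operator_norm A"
    unfolding L2_operator_norm_def
  proof (rule cSUP_upper)
    show "e0 \<nu> \<in> {f \<in> L2. L2_norm f \<le> 1}" using eL norm_e0 by simp
    show "bdd_above ((\<lambda>f. L2_norm (A f)) ` {f \<in> L2. L2_norm f \<le> 1})"
    proof (rule bdd_aboveI2)
      fix f assume "f \<in> {f \<in> L2. L2_norm f \<le> 1}"
      then have f: "f \<in> L2" "L2_norm f \<le> 1" by auto
      have "L2_norm (A f) \<le> C * L2_norm f" by (rule C[OF f(1)])
      also have "\<dots> \<le> \<bar>C\<bar> * 1" using f(2) by (intro mult_mono) auto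
      finally show "L2_norm (A f) \<le> \<bar>C\<bar>" by simp
    qed
  qed
  then show "(L2_norm (A (e0 \<nu>)))\<^sup>2 \<le> (L2_operator_norm A)\<^sup>2"
    by (intro power_mono) auto
  define d where "d n = 1 / real (Suc n)" for n
  have d: "d n > 0" for n by (simp add: d_def)
  have d0: "d \<longlonglongrightarrow> 0" unfolding d_def[abs_def] by (rule Suc_inverse_tendsto_0)
  have dlim: "filterlim d (at_right 0) sequentially"
    unfolding filterlim_at using d0 d by (auto intro!: always_eventually simp: less_imp_neq[THEN not_sym])
  have \<mu>: "\<nu> + d n > 0" "\<nu> + d n \<noteq> \<nu>" for n using d[of n] \<nu> by auto
  have \<mu>lim: "(\<lambda>n. \<nu> + d n) \<longlonglongrightarrow> \<nu>" using tendsto_add[OF tendsto_const d0, of \<nu>] by simp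
  \<comment> \<open>The normalising constant is kept at the limiting order, which is why the factor
    2 \<nu> in \<open>overlap_quotient_limit\<close> does not involve d.\<close>
  define G where "G n = (\<lambda>r. of_real c * complex_of_real (bessel_phi (\<nu> + d n) r / r))" for n
  have GL: "G n \<in> L2" for n unfolding G_def by (rule cL[OF \<mu>(1)])
  have Glim: "(\<lambda>n. L2_norm (\<lambda>r. G n r - e0 \<nu> r)) \<longlonglongrightarrow> 0"
  proof -
    have "L2_norm (\<lambda>r. G n r - e0 \<nu> r) = norm (complex_of_real c) * L2_norm (\<lambda>r. complex_of_real (bessel_phi (\<nu> + d n) r / r) - complex_of_real (bessel_phi \<nu> r / r))" for n
    proof -
      have "L2_norm (\<lambda>r. G n r - e0 \<nu> r) = L2_norm (\<lambda>r. of_real c * (complex_of_real (bessel_phi (\<nu> + d n) r / r) - complex_of_real (bessel_phi \<nu> r / r)))"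
        by (rule L2_norm_cong_AE[OF L2_minus[OF GL eL] L2_scale[OF L2_minus[OF bessel_phi_L2[OF \<mu>(1)] bessel_phi_L2[OF \<nu>]]]])
          (rule AE_I2, simp add: G_def e0 right_diff_distrib del: of_real_divide)
      then show ?thesis by (simp only: L2_norm_scale)
    qed
    moreover have "(\<lambda>n. norm (complex_of_real c) * L2_norm (\<lambda>r. complex_of_real (bessel_phi (\<nu> + d n) r / r) - complex_of_real (bessel_phi \<nu> r / r))) \<longlonglongrightarrow> norm (complex_of_real c) * 0"
      by (intro tendsto_mult tendsto_const bessel_phi_L2_tendsto \<nu> \<mu> \<mu>lim)
    ultimately show ?thesis by simp
  qed
  \<comment> \<open>Boundedness of \<open>A\<close> transfers the convergence of \<open>G n\<close>
    to the images; this gives access to the order \<nu> itself, where the formula of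
    \<open>boundary_value_bessel\<close> has a zero denominator.\<close>
  have "(\<lambda>n. L2_norm (A (G n)) - L2_norm (A (e0 \<nu>))) \<longlonglongrightarrow> 0"
  proof (rule Lim_null_comparison)
    show "\<forall>\<^sub>F n in sequentially. norm (L2_norm (A (G n)) - L2_norm (A (e0 \<nu>))) \<le> L2_norm (\<lambda>r. A (G n) r - A (e0 \<nu>) r)"
      unfolding real_norm_def by (intro always_eventually allI L2_norm_triangle_minus bounded_L2_operator_L2[OF AB] GL eL)
  qed (rule bounded_L2_operator_tendsto[OF AB GL eL Glim])
  then have "(\<lambda>n. L2_norm (A (G n))) \<longlonglongrightarrow> L2_norm (A (e0 \<nu>))" by (simp add: LIM_zero_iff)
  then have lim1: "(\<lambda>n. (L2_norm (A (G n)))\<^sup>2) \<longlonglongrightarrow> (L2_norm (A (e0 \<nu>)))\<^sup>2" by (rule tendsto_power)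
  have eq: "(L2_norm (A (G n)))\<^sup>2 = 2 * \<nu> * ((1 / (2 * (\<nu> + d n)) + 1 / (2 * \<nu>) - 2 * cos (pi / 2 * d n) * (2 / pi * sin (pi / 2 * d n) / ((\<nu> + d n)\<^sup>2 - \<nu>\<^sup>2)))
      / (\<nu>\<^sup>2 - (\<nu> + d n)\<^sup>2)\<^sup>2)" for n
  proof -
    let ?g = "\<lambda>r. complex_of_real (bessel_phi (\<nu> + d n) r / r)"
    have "AE r in half_line. A (G n) r = of_real c * A ?g r"
      unfolding G_def by (rule bounded_L2_operator_scale[OF AB bessel_phi_L2[OF \<mu>(1)]])
    then have "L2_norm (A (G n)) = L2_norm (\<lambda>r. of_real c * A ?g r)"
      by (rule L2_norm_cong_AE[OF bounded_L2_operator_L2[OF AB GL] L2_scale[OF bounded_L2_operator_L2[OF AB bessel_phi_L2[OF \<mu>(1)]]]])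
    then have "(L2_norm (A (G n)))\<^sup>2 = c\<^sup>2 * (L2_norm (A ?g))\<^sup>2"
      by (simp only: L2_norm_scale power_mult_distrib norm_of_real power2_abs)
    then show ?thesis
      unfolding L2_norm_boundary_value_bessel[OF A \<sigma> \<nu> \<mu>(1,2)] c(2) by simp
  qed
  have "(\<lambda>n. (L2_norm (A (G n)))\<^sup>2) \<longlonglongrightarrow> pi\<^sup>2 / (12 * \<nu>\<^sup>2) + 1 / (8 * \<nu> ^ 4)"
    unfolding eq by (rule filterlim_compose[OF overlap_quotient_limit[OF \<nu>] dlim])
  with lim1 show "(L2_norm (A (e0 \<nu>)))\<^sup>2 = pi\<^sup>2 / (12 * \<nu>\<^sup>2) + 1 / (8 * \<nu> ^ 4)"
    by (rule LIMSEQ_unique)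
qed

end
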